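(* Let $\mu$ be a probability measure on $\mathbb{R}^n$ with $d\mu(x)=e^{-\Phi(x)}\,dx$, where $\Phi:\mathbb{R}^n\to\mathbb{R}$ is of class $C^2$. Assume there exist $R_1,\ldots,R_m\in\mathcal{O}_n(\mu)$ and $c_1,\ldots,c_m>0$ such that, setting $E_i:=\mathrm{Fix}(R_i)^\perp$, one has $\sum_{i=1}^m c_i P_{E_i}=\mathrm{Id}$. (1) Assume that for all $x\in\mathbb{R}^n$, $$H(x):=D^2\Phi(x)+\sum_{i=1}^m \frac{c_i}{\mathrm{c_p}(\mu_{x,E_i})}\,P_{E_i}>0 .$$ Then for every locally Lipschitz function $f:\mathbb{R}^n\to\mathbb{R}$ in $L^2(\mu)$ that is $\{R_i\}_{i\le m}$-invariant (i.e. $f\circ R_i=f$ for all $i\le m$), $$\mathrm{Var}_\mu(f)\le\int H^{-1}\nabla f\cdot\nabla f\,d\mu .$$ (2) In particular, if there exists $\rho\in\mathbb{R}$ such that $D^2\Phi\ge\rho\,\mathrm{Id}$ pointwise on $\mathbb{R}^n$ and $\mathrm{c_p}(\mu_{x,E_i})^{-1}+\rho\ge 0$ for all $x\in\mathbb{R}^n$ and $i\le m$, then for every locally Lipschitz $\{R_i\}_{i\le m}$-invariant function $f:\mathbb{R}^n\to\mathbb{R}$ in $L^2(\mu)$, $$\mathrm{Var}_\mu(f)\le\int\Big(\sum_{i=1}^m c_i\big(\mathrm{c_p}(\mu_{x,E_i})^{-1}+\rho\big)^{-1}\,\big|P_{E_i}\nabla f(x)\big|^2\Big)\,d\mu(x)\le\sup_{i,x}\big(\mathrm{c_p}(\mu_{x,E_i})^{-1}+\rho\big)^{-1}\int|\nabla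 f|^2\,d\mu .$$
   Context: $\mathbb{R}^n$ carries its standard Euclidean structure; $\mathcal{O}_n$ is the group of linear isometries. $\mathcal{O}_n(\mu)$ is the group of $R\in\mathcal{O}_n$ leaving $\mu$ invariant (push-forward of $\mu$ by $R$ equals $\mu$). $\mathrm{Fix}(R)=\{x: Rx=x\}$. $P_F$ is the orthogonal projection onto a subspace $F$. Inequalities between symmetric matrices are in the sense of quadratic forms; $>0$ means positive definite. For $g\in L^2(\nu)$, $\mathrm{Var}_\nu(g)=\int(g-\int g\,d\nu)^2\,d\nu$. The Poincar\'e constant $\mathrm{c_p}(\nu)\in(0,+\infty]$ of a Borel probability measure $\nu$ on a Euclidean space is the best constant for which $\mathrm{Var}_\nu(g)\le\mathrm{c_p}(\nu)\int|\nabla g|^2\,d\nu$ for every locally Lipschitz $g\in L^2(\nu)$. Conventions: $1/(+\infty)=0$, $1/0=+\infty$. For a subspace $E\subset\mathbb{R}^n$ and $x\in\mathbb{R}^n$, $\mu_{x,E}$ is the probability measure on $E$ obtained by conditioning $\mu$ on $P_{E^\perp}x$: $$d\mu_{x,E}(y)=e^{-\Phi(y+P_{E^\perp}x)}\frac{dy}{\int_E e^{-\Phi(z+P_{E^\perp}x)}\,dz},\qquad y\in E.$$ *)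

theory Defs
  imports "HOL-Probability.Probability"
begin

definition fixed_space :: "('a \<Rightarrow> 'a) \<Rightarrow> 'a set" where
  "fixed_space R = {x. R x = x}"

definition orth_proj :: "'a::euclidean_space set \<Rightarrow> 'a \<Rightarrow> 'a" where
  "orth_proj F x = (THE y. y \<in> F \<and> x - y \<in> F\<^sup>\<bottom>)"

definition isometries_preserving :: "'a::euclidean_space measure \<Rightarrow> ('a \<Rightarrow> 'a) set" where
  "isometries_preserving \<mu> = {R. orthogonal_transformation R \<and> distr \<mu> \<mu> R = \<mu>}"

definition locally_lipschitz_on :: "'a::metric_space set \<Rightarrow> ('a \<Rightarrow> real) \<Rightarrow> bool" where
  "locally_lipschitz_on E g \<longleftrightarrow> (\<forall>x\<in>E. \<exists>r>0. \<exists>L. L-lipschitz_on (cball x r \<inter> E) g)"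

definition L2 :: "'a measure \<Rightarrow> ('a \<Rightarrow> real) set" where
  "L2 \<nu> = {g \<in> borel_measurable \<nu>. integrable \<nu> (\<lambda>x. (g x)\<^sup>2)}"

definition Var :: "'a measure \<Rightarrow> ('a \<Rightarrow> real) \<Rightarrow> real" where
  "Var \<nu> g = (\<integral>x. (g x - (\<integral>y. g y \<partial>\<nu>))\<^sup>2 \<partial>\<nu>)"

(* Gradient, with respect to the Euclidean structure of the linear subspace E, of a function
   on E; only the values of g on E matter. A locally Lipschitz function is differentiable
   almost everywhere (Rademacher); where it is not, the value is set to 0. *)
definition gradient_on :: "'a::euclidean_space set \<Rightarrow> ('a \<Rightarrow> real) \<Rightarrow> 'a \<Rightarrow> 'a" where
  "gradient_on E g x =
     (if \<exists>v\<in>E. (g has_derivative (\<lambda>h. v \<bullet> h)) (at x within E)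
      then THE v. v \<in> E \<and> (g has_derivative (\<lambda>h. v \<bullet> h)) (at x within E)
      else 0)"

abbreviation gradient :: "('a::euclidean_space \<Rightarrow> real) \<Rightarrow> 'a \<Rightarrow> 'a" where
  "gradient \<equiv> gradient_on UNIV"

definition hessian :: "('a::euclidean_space \<Rightarrow> real) \<Rightarrow> 'a \<Rightarrow> 'a \<Rightarrow> 'a" where
  "hessian \<Phi> x = frechet_derivative (gradient \<Phi>) (at x)"

definition class_C2 :: "('a::euclidean_space \<Rightarrow> real) \<Rightarrow> bool" where
  "class_C2 \<Phi> \<longleftrightarrow>
     (\<forall>x. \<Phi> differentiable (at x)) \<and>
     (\<forall>x. gradient \<Phi> differentiable (at x)) \<and>
     (\<forall>h. continuous_on UNIV (\<lambda>x. hessian \<Phi> x h))"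

definition pos_def :: "('a::euclidean_space \<Rightarrow> 'a) \<Rightarrow> bool" where
  "pos_def A \<longleftrightarrow> (\<forall>v. v \<noteq> 0 \<longrightarrow> A v \<bullet> v > 0)"

definition orthonormal_basis_of :: "'a::euclidean_space set \<Rightarrow> 'a set \<Rightarrow> bool" where
  "orthonormal_basis_of E B \<longleftrightarrow>
     pairwise orthogonal B \<and> (\<forall>b\<in>B. norm b = 1) \<and> span B = E"

(* Lebesgue measure on the linear subspace E, as a measure with underlying space E: Lebesgue
   measure in the coordinates of an orthonormal basis. It does not depend on the basis
   chosen, because Lebesgue measure is invariant under linear isometries. For E = {0} it is
   the Dirac mass at 0. *)
definition lborel_on :: "'a::euclidean_space set \<Rightarrow> 'a measure" where
  "lborel_on E =
     (let B = (SOME B. orthonormal_basis_of E B)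
      in distr (\<Pi>\<^sub>M b\<in>B. (lborel :: real measure)) (restrict_space borel E)
           (\<lambda>u. \<Sum>b\<in>B. u b *\<^sub>R b))"

(* The measure obtained from exp (-\<Phi>) dx by conditioning on the projection of x onto the
   orthogonal complement of E. If the normalising integral is infinite, division in ennreal
   makes this the null measure. *)
definition cond_measure :: "('a::euclidean_space \<Rightarrow> real) \<Rightarrow> 'a \<Rightarrow> 'a set \<Rightarrow> 'a measure" where
  "cond_measure \<Phi> x E =
     density (lborel_on E)
       (\<lambda>y. ennreal (exp (- \<Phi> (y + orth_proj (E\<^sup>\<bottom>) x))) /
            (\<integral>\<^sup>+z. ennreal (exp (- \<Phi> (z + orth_proj (E\<^sup>\<bottom>) x))) \<partial>lborel_on E))"

(* Best Poincare constant of a measure \<nu> with underlying space the linear subspace E; it is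
   \<infinity> if there is no finite constant, or if \<nu> is not a probability measure. It is 0 when
   E = {0}. *)
definition poincare_const :: "'a::euclidean_space set \<Rightarrow> 'a measure \<Rightarrow> ereal" where
  "poincare_const E \<nu> =
     Inf {ereal C | C. 0 \<le> C \<and> prob_space \<nu> \<and>
       (\<forall>g \<in> L2 \<nu>. locally_lipschitz_on E g \<longrightarrow>
          ennreal (Var \<nu> g) \<le>
            ennreal C * (\<integral>\<^sup>+y. ennreal ((norm (gradient_on E g y))\<^sup>2) \<partial>\<nu>))}"

(* On ereal, inverse 0 = \<infinity> and inverse \<infinity> = 0. *)
abbreviation inv_cp :: "('a::euclidean_space \<Rightarrow> real) \<Rightarrow> 'a \<Rightarrow> 'a set \<Rightarrow> ereal" where
  "inv_cp \<Phi> x E \<equiv> inverse (poincare_const E (cond_measure \<Phi> x E))"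

(* For continuous \<Phi>, inv_cp is infinite only if E = {0}; the projection onto E is then 0, so that the value 0
   of real_of_ereal \<infinity> is harmless. *)
definition H_op ::
  "('a::euclidean_space \<Rightarrow> real) \<Rightarrow> nat \<Rightarrow> (nat \<Rightarrow> real) \<Rightarrow> (nat \<Rightarrow> 'a set) \<Rightarrow> 'a \<Rightarrow> 'a \<Rightarrow> 'a" where
  "H_op \<Phi> m c E x v =
     hessian \<Phi> x v +
     (\<Sum>i=1..m. (c i * real_of_ereal (inv_cp \<Phi> x (E i))) *\<^sub>R orth_proj (E i) v)"

end

theory Submission
  imports Defs
begin

text \<open>
The inequality is proved by duality. Write L = \<Delta> - \<nabla>\<Phi> \<cdot> \<nabla> for the generator of \<mu>, which satisfies
\<integral> f (L u) d\<mu> = - \<integral> \<nabla>f \<cdot> \<nabla>u d\<mu>. For a test function u and a function f of mean zero, expanding the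
square of f - L u gives

  Var f = \<integral> (f - L u)^2 d\<mu> - 2 \<integral> \<nabla>f \<cdot> \<nabla>u d\<mu> - \<integral> (L u)^2 d\<mu>,

and Bochner's formula (\<open>bochner\<close>) replaces \<integral> (L u)^2 d\<mu> by the integral of |D^2 u|^2 + D^2\<Phi> \<nabla>u \<cdot> \<nabla>u.

Symmetry enters through the Hessian term. The resolution of the identity bounds |D^2 u|^2 from below
by the sum over i of c_i times its restrictions to E_i (\<open>hessian_split\<close>). If u is invariant under R_i, then
every derivative of u in a direction of E_i has mean zero with respect to the conditional measures: the mean of \<nabla>u
over a fiber x + E_i is fixed by R_i and hence orthogonal to E_i (\<open>fiber_mean_zero\<close>). So the Poincare inequality on the
fibers applies to these derivatives with no mean to subtract and bounds the integral of |D^2 u|^2 from below by that of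
the sum of c_i |P_i \<nabla>u|^2 / c_p(\<mu>_{x,E_i}), where P_i denotes the projection onto E_i. Altogether

  Var f \<le> \<integral> (f - L u)^2 d\<mu> + \<integral> (- 2 \<nabla>f \<cdot> v - H v \<cdot> v) d\<mu>   with v = \<nabla>u,

and the second integrand is at most H^{-1}\<nabla>f \<cdot> \<nabla>f by completing the square, pointwise in x. In the second
part of the theorem the square is completed separately in every E_i.

It remains to make the first integral small (\<open>gen_dense\<close>): the functions L u, for compactly supported
invariant u, are dense in the invariant functions of mean zero in L^2(\<mu>). A function g orthogonal to all
of them is a weak solution of L g = 0; conjugation by e^{-\<Phi>/2} turns this equation into a Schroedinger
equation \<Delta>h = V h with continuous V, whose mollified solutions satisfy a Caccioppoli estimate
on large balls (\<open>mollified_energy\<close>). Hence the weak gradient of g vanishes and g is constant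
(\<open>orth_gen_const\<close>). Mollifiers and cut-offs are radial, so that the argument stays inside the invariant functions.

Two points need care. The function f is only locally Lipschitz, so integration by parts against it rests on
Rademacher's theorem (\<open>rademacher\<close>), which is derived from the one-dimensional case along lines. And the
Poincare constant of the fiber through x is not obviously a measurable function of x. It is replaced by
the ratio of the energies of the two sides of the fiber inequality for the given u (\<open>fib_ratio\<close>),
which is measurable, integrates correctly, and dominates the inverse Poincare constant wherever P_i \<nabla>u does not
vanish (\<open>fib_ratio_ge\<close>). The result is \<open>variance_le_of_pointwise\<close>, which reduces the theorem
to a pointwise inequality between quadratic forms.
\<close>

section \<open>Directional derivatives and functions of class C^k\<close>

text \<open>All calculus is done with scalar directional derivatives, so that higher derivatives are plain iterates
\<open>dd v (dd w f)\<close> and no spaces of multilinear maps occur.\<close>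
definition dd :: "'a::real_normed_vector \<Rightarrow> ('a \<Rightarrow> real) \<Rightarrow> 'a \<Rightarrow> real" where
  "dd v f x = frechet_derivative f (at x) v"

lemma dd_eqI: "(f has_derivative f') (at x) \<Longrightarrow> dd v f x = f' v"
  unfolding dd_def using frechet_derivative_at by metis

lemma has_derivative_dd: "f differentiable (at x) \<Longrightarrow> (f has_derivative (\<lambda>h. dd h f x)) (at x)"
  unfolding dd_def using frechet_derivative_works by fastforce

lemma dd_linear: "f differentiable (at x) \<Longrightarrow> linear (\<lambda>h. dd h f x)"
  using has_derivative_dd has_derivative_linear by blast

lemma dd_scale: "f differentiable (at x) \<Longrightarrow> dd (c *\<^sub>R v) f x = c * dd v f x"
  using linear_cmul[OF dd_linear, of f x c v] by simp

lemma dd_basis: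
  fixes f :: "'a::euclidean_space \<Rightarrow> real"
  assumes "f differentiable (at x)"
  shows "dd v f x = (\<Sum>b\<in>Basis. (v \<bullet> b) * dd b f x)"
proof -
  have "dd v f x = dd (\<Sum>b\<in>Basis. (v \<bullet> b) *\<^sub>R b) f x" by (simp add: euclidean_representation)
  also have "\<dots> = (\<Sum>b\<in>Basis. dd ((v \<bullet> b) *\<^sub>R b) f x)"
    by (rule linear_sum[OF dd_linear[OF assms]])
  finally show ?thesis using assms by (simp add: dd_scale)
qed

lemma dd_const [simp]: "dd v (\<lambda>x. c) = (\<lambda>x. 0)"
  unfolding dd_def by auto

lemma dd_add:
  assumes "f differentiable (at x)" "g differentiable (at x)"
  shows "dd v (\<lambda>x. f x + g x) x = dd v f x + dd v g x"
  by (rule dd_eqI) (intro derivative_intros has_derivative_dd assms)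

lemma dd_mult:
  assumes "f differentiable (at x)" "g differentiable (at x)"
  shows "dd v (\<lambda>x. f x * g x) x = dd v f x * g x + f x * dd v g x"
  by (rule dd_eqI[THEN trans])
     (auto intro!: derivative_eq_intros has_derivative_dd assms)

lemma dd_cmult:
  assumes "f differentiable (at x)"
  shows "dd v (\<lambda>x. c * f x) x = c * dd v f x"
  by (rule dd_eqI[THEN trans])
     (auto intro!: derivative_eq_intros has_derivative_dd assms)

lemma dd_sum:
  assumes "\<And>i. i \<in> I \<Longrightarrow> f i differentiable (at x)"
  shows "dd v (\<lambda>x. \<Sum>i\<in>I. f i x) x = (\<Sum>i\<in>I. dd v (f i) x)"
  by (rule dd_eqI[THEN trans])
     (auto intro!: derivative_eq_intros has_derivative_dd assms)

lemma dd_exp: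
  assumes "f differentiable (at x)"
  shows "dd v (\<lambda>x. exp (f x)) x = exp (f x) * dd v f x"
  by (rule dd_eqI[THEN trans])
     (auto intro!: derivative_eq_intros has_derivative_dd assms)

lemma dd_shift:
  assumes "f differentiable (at (x + a))"
  shows "dd v (\<lambda>x. f (x + a)) x = dd v f (x + a)"
proof (rule dd_eqI[THEN trans])
  have "((\<lambda>x. x + a) has_derivative (\<lambda>h. h)) (at x)"
    by (auto intro!: derivative_eq_intros)
  from has_derivative_compose[OF this has_derivative_dd[OF assms]]
  show "((\<lambda>x. f (x + a)) has_derivative (\<lambda>h. dd h f (x + a))) (at x)" .
qed simp

text \<open>Class C^k. Frechet differentiability, rather than mere existence of directional derivatives, is built into the recursion, so
that derivatives are linear in the direction at every level.\<close>
primrec Ck :: "nat \<Rightarrow> ('a::euclidean_space \<Rightarrow> real) \<Rightarrow> bool" where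
  "Ck 0 f \<longleftrightarrow> continuous_on UNIV f"
| "Ck (Suc k) f \<longleftrightarrow> (\<forall>x. f differentiable (at x)) \<and> (\<forall>v. Ck k (dd v f))"

lemma Ck_cont: "Ck k f \<Longrightarrow> continuous_on UNIV f"
  by (cases k) (auto simp: continuous_at_imp_continuous_on differentiable_imp_continuous_within)

lemma Ck_diff: "Ck (Suc k) f \<Longrightarrow> f differentiable (at x)"
  by simp

lemma Ck_dd: "Ck (Suc k) f \<Longrightarrow> Ck k (dd v f)"
  by simp

lemma Ck_pred: "Ck (Suc k) f \<Longrightarrow> Ck k f"
proof (induction k arbitrary: f)
  case 0 then show ?case using Ck_cont[of "Suc 0" f] by simp
next
  case (Suc k) then show ?case by (metis Ck.simps(2))
qed

lemma Ck_le: "Ck k f \<Longrightarrow> j \<le> k \<Longrightarrow> Ck j f"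
  by (induction k) (auto simp del: Ck.simps simp: le_Suc_eq dest: Ck_pred)

lemma Ck_const: "Ck k (\<lambda>x. c)"
  by (induction k arbitrary: c) auto

lemma Ck_add: "Ck k f \<Longrightarrow> Ck k g \<Longrightarrow> Ck k (\<lambda>x. f x + g x)"
proof (induction k arbitrary: f g)
  case 0 then show ?case by (auto intro!: continuous_intros)
next
  case (Suc k)
  have "dd v (\<lambda>x. f x + g x) = (\<lambda>x. dd v f x + dd v g x)" for v
    using Suc.prems by (auto intro!: dd_add)
  then show ?case using Suc by auto
qed

lemma Ck_mult: "Ck k f \<Longrightarrow> Ck k g \<Longrightarrow> Ck k (\<lambda>x. f x * g x)"
proof (induction k arbitrary: f g)
  case 0 then show ?case by (auto intro!: continuous_intros)
next
  case (Suc k)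
  have "dd v (\<lambda>x. f x * g x) = (\<lambda>x. dd v f x * g x + f x * dd v g x)" for v
    using Suc.prems by (auto intro!: dd_mult)
  then show ?case using Suc Ck_pred[OF Suc.prems(1)] Ck_pred[OF Suc.prems(2)]
    by (auto intro!: Ck_add)
qed

lemma Ck_cmult: "Ck k f \<Longrightarrow> Ck k (\<lambda>x. c * f x)"
  by (intro Ck_mult Ck_const)

lemma Ck_minus: "Ck k f \<Longrightarrow> Ck k (\<lambda>x. - f x)"
  using Ck_cmult[of k f "-1"] by simp

lemma Ck_subtract: "Ck k f \<Longrightarrow> Ck k g \<Longrightarrow> Ck k (\<lambda>x. f x - g x)"
  using Ck_add[OF _ Ck_minus, of k f g] by simp

lemma Ck_sum: "(\<And>i. i \<in> I \<Longrightarrow> Ck k (f i)) \<Longrightarrow> Ck k (\<lambda>x. \<Sum>i\<in>I. f i x)"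
  by (induction I rule: infinite_finite_induct) (auto intro: Ck_const Ck_add)

lemma Ck_inner: "Ck k (\<lambda>x. x \<bullet> a)"
proof (cases k)
  case 0 then show ?thesis by (auto intro!: continuous_intros)
next
  case (Suc j)
  have d: "((\<lambda>x. x \<bullet> a) has_derivative (\<lambda>h. h \<bullet> a)) (at x)" for x
    by (auto intro!: derivative_eq_intros)
  then have "dd v (\<lambda>x. x \<bullet> a) = (\<lambda>x. v \<bullet> a)" for v
    using dd_eqI[OF d] by auto
  then show ?thesis using Suc d Ck_const by (auto simp: differentiable_def)
qed

lemma Ck_sqnorm: "Ck k (\<lambda>x. x \<bullet> x)"
proof -
  have "(\<lambda>x::'a. x \<bullet> x) = (\<lambda>x. \<Sum>b\<in>Basis. (x \<bullet> b) * (x \<bullet> b))"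
    by (intro ext) (rule euclidean_inner)
  moreover have "Ck k (\<lambda>x::'a. \<Sum>b\<in>Basis. (x \<bullet> b) * (x \<bullet> b))"
    by (intro Ck_sum Ck_mult Ck_inner)
  ultimately show ?thesis by (simp only:)
qed

lemma Ck_exp: "Ck k f \<Longrightarrow> Ck k (\<lambda>x. exp (f x))"
proof (induction k arbitrary: f)
  case 0 then show ?case by (auto intro!: continuous_intros)
next
  case (Suc k)
  have "dd v (\<lambda>x. exp (f x)) = (\<lambda>x. exp (f x) * dd v f x)" for v
    using Suc.prems by (auto intro!: dd_exp)
  moreover have "(\<lambda>x. exp (f x)) differentiable (at x)" for x
    using has_derivative_exp[OF has_derivative_dd[OF Ck_diff[OF Suc.prems]]]
    by (auto simp: differentiable_def)
  ultimately show ?case using Suc Ck_pred[OF Suc.prems] by (auto intro!: Ck_mult)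
qed

text \<open>Away from 0 the function is locally zero or a power; at 0 its difference quotient is bounded by \<open>\<bar>t\<bar> ^ Suc k\<close>.\<close>
lemma pospart_power_deriv:
  "((\<lambda>t::real. (max 0 t) ^ Suc (Suc k)) has_real_derivative (real (Suc (Suc k)) * (max 0 t) ^ Suc k)) (at t)"
proof -
  consider "t < 0" | "t > 0" | "t = 0" by linarith
  then show ?thesis
  proof cases
    case 1
    have "((\<lambda>t::real. 0) has_real_derivative (real (Suc (Suc k)) * (max 0 t) ^ Suc k)) (at t)"
      using 1 by auto
    then show ?thesis
      by (rule has_field_derivative_transform_within_open[where S="{..<0}"]) (use 1 in auto)
  next
    case 2
    have "((\<lambda>t::real. t ^ Suc (Suc k)) has_real_derivative (real (Suc (Suc k)) * (max 0 t) ^ Suc k)) (at t)"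
      using 2 DERIV_pow[of "Suc (Suc k)" t] by (auto simp: max_def)
    then show ?thesis
      by (rule has_field_derivative_transform_within_open[where S="{0<..}"]) (use 2 in auto)
  next
    case 3
    have "((\<lambda>y::real. (max 0 y) ^ Suc (Suc k) / y) \<longlongrightarrow> 0) (at 0)"
    proof (rule Lim_null_comparison)
      show "\<forall>\<^sub>F y in at 0. norm ((max 0 y) ^ Suc (Suc k) / y) \<le> \<bar>y\<bar> ^ Suc k"
      proof (rule always_eventually, intro allI)
        fix y :: real
        show "norm ((max 0 y) ^ Suc (Suc k) / y) \<le> \<bar>y\<bar> ^ Suc k"
        proof (cases "y > 0")
          case False
          then have "max 0 y = 0" by simp
          then have "norm ((max 0 y) ^ Suc (Suc k) / y) = 0" by simp
          also have "\<dots> \<le> \<bar>y\<bar> ^ Suc k" by (intro zero_le_power) simp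
          finally show ?thesis .
        qed (simp add: max_def)
      qed
      have "((\<lambda>y::real. \<bar>y\<bar> ^ Suc k) \<longlongrightarrow> \<bar>0\<bar> ^ Suc k) (at 0)"
        by (intro tendsto_intros)
      then show "((\<lambda>y::real. \<bar>y\<bar> ^ Suc k) \<longlongrightarrow> 0) (at 0)" by simp
    qed
    then show ?thesis using 3 by (auto simp: has_field_derivative_iff)
  qed
qed

lemma Ck_pospart_power: "Ck k q \<Longrightarrow> Ck k (\<lambda>x. (max 0 (q x)) ^ Suc k)"
proof (induction k arbitrary: q)
  case 0 then show ?case by (auto intro!: continuous_intros)
next
  case (Suc k)
  have d: "((\<lambda>x. (max 0 (q x)) ^ Suc (Suc k)) has_derivative
      (\<lambda>h. real (Suc (Suc k)) * (max 0 (q x)) ^ Suc k * dd h q x)) (at x)" for x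
    using has_derivative_compose[OF has_derivative_dd[OF Ck_diff[OF Suc.prems]]
        pospart_power_deriv[unfolded has_field_derivative_def]]
    by (auto simp: mult_ac)
  then have "dd v (\<lambda>x. (max 0 (q x)) ^ Suc (Suc k)) =
      (\<lambda>x. real (Suc (Suc k)) * (max 0 (q x)) ^ Suc k * dd v q x)" for v
    using dd_eqI[OF d] by auto
  moreover have "Ck k (\<lambda>x. real (Suc (Suc k)) * (max 0 (q x)) ^ Suc k * dd v q x)" for v
    using Suc.prems by (intro Ck_mult Ck_const Suc.IH Ck_pred[OF Suc.prems]) auto
  ultimately show ?case using d by (auto simp: differentiable_def simp del: power_Suc)
qed

section \<open>Bump functions and compact support\<close>

text \<open>The fourth power of the positive part of a smooth function is C^3, which is all that Bochner's formula asks
of a test function. The bump is radial, hence invariant under every rotation.\<close>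
definition bump :: "real \<Rightarrow> 'a::euclidean_space \<Rightarrow> real" where
  "bump r x = (max 0 (r\<^sup>2 - x \<bullet> x)) ^ 4"

lemma Ck_bump: "Ck 3 (bump r)"
proof -
  have "Ck 3 (\<lambda>x. r\<^sup>2 - x \<bullet> x)" by (intro Ck_subtract Ck_const Ck_sqnorm)
  from Ck_pospart_power[OF this] show ?thesis unfolding bump_def[abs_def] by simp
qed

lemma bump_nonneg: "bump r x \<ge> 0"
  unfolding bump_def by simp

lemma bump_eq_0: "norm x \<ge> r \<Longrightarrow> r \<ge> 0 \<Longrightarrow> bump r x = 0"
  unfolding bump_def using power_mono[of r "norm x" 2]
  by (auto simp: power2_norm_eq_inner max_def)

lemma bump_pos: "norm x < r \<Longrightarrow> bump r x > 0"
  unfolding bump_def using power_strict_mono[of "norm x" r 2]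
  by (auto simp: power2_norm_eq_inner max_def)

lemma bump_le: "r \<ge> 0 \<Longrightarrow> bump r x \<le> r ^ 8"
proof -
  assume "r \<ge> 0"
  have "(max 0 (r\<^sup>2 - x \<bullet> x)) ^ 4 \<le> (r\<^sup>2) ^ 4"
    by (intro power_mono) auto
  then show ?thesis unfolding bump_def by (simp add: power_mult[symmetric])
qed

lemma dd_bump: "dd v (bump r) x = - 8 * (max 0 (r\<^sup>2 - x \<bullet> x)) ^ 3 * (x \<bullet> v)"
proof -
  have 1: "((\<lambda>x. r\<^sup>2 - x \<bullet> x) has_derivative (\<lambda>h. - (2 * (x \<bullet> h)))) (at x)"
    by (auto intro!: derivative_eq_intros simp: inner_commute)
  have "((\<lambda>x. (max 0 (r\<^sup>2 - x \<bullet> x)) ^ Suc (Suc 2)) has_derivative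
      (\<lambda>h. (real (Suc (Suc 2)) * (max 0 (r\<^sup>2 - x \<bullet> x)) ^ Suc 2) * (- (2 * (x \<bullet> h))))) (at x)"
    using has_derivative_compose[OF 1 pospart_power_deriv[unfolded has_field_derivative_def]]
    by blast
  then have "(bump r has_derivative
      (\<lambda>h. (real (Suc (Suc 2)) * (max 0 (r\<^sup>2 - x \<bullet> x)) ^ Suc 2) * (- (2 * (x \<bullet> h))))) (at x)"
    unfolding bump_def[abs_def] by (simp add: eval_nat_numeral)
  from dd_eqI[OF this, of v] show ?thesis by (simp add: eval_nat_numeral)
qed

definition csupp :: "('a::real_normed_vector \<Rightarrow> real) \<Rightarrow> bool" where
  "csupp f \<longleftrightarrow> (\<exists>r. \<forall>x. norm x > r \<longrightarrow> f x = 0)"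

lemma csupp_mult1: "csupp f \<Longrightarrow> csupp (\<lambda>x. f x * g x)"
  unfolding csupp_def by fastforce

lemma csupp_mult2: "csupp g \<Longrightarrow> csupp (\<lambda>x. f x * g x)"
  unfolding csupp_def by fastforce

lemma csupp_add: "csupp f \<Longrightarrow> csupp g \<Longrightarrow> csupp (\<lambda>x. f x + g x)"
  unfolding csupp_def
proof (elim exE)
  fix r s assume "\<forall>x. norm x > r \<longrightarrow> f x = 0" "\<forall>x. norm x > s \<longrightarrow> g x = 0"
  then show "\<exists>r. \<forall>x. norm x > r \<longrightarrow> f x + g x = 0" by (intro exI[of _ "max r s"]) auto
qed

lemma csupp_zero: "csupp (\<lambda>x. 0)" by (auto simp: csupp_def)

lemma csupp_minus: "csupp f \<Longrightarrow> csupp (\<lambda>x. - f x)"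
  unfolding csupp_def by auto

lemma csupp_sum: "(\<And>i. i \<in> I \<Longrightarrow> csupp (f i)) \<Longrightarrow> csupp (\<lambda>x. \<Sum>i\<in>I. f i x)"
  by (induction I rule: infinite_finite_induct) (auto intro: csupp_zero csupp_add)

text \<open>Outside a ball f vanishes on an open set, so its derivative vanishes as well.\<close>
lemma csupp_dd: assumes "csupp f" shows "csupp (dd v f)"
proof -
  obtain r where r: "\<And>x. norm x > r \<Longrightarrow> f x = 0" using assms by (auto simp: csupp_def)
  have "dd v f x = 0" if "norm x > r" for x
  proof -
    have "open {x::'a. norm x > r}" by (intro open_Collect_less continuous_intros)
    moreover have "((\<lambda>x. 0::real) has_derivative (\<lambda>h. 0)) (at x)" by simp
    ultimately have "(f has_derivative (\<lambda>h. 0)) (at x)"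
      using has_derivative_transform_within_open[of "\<lambda>x. 0::real" "\<lambda>h. 0" x UNIV "{x. norm x > r}" f] r that
      by auto
    then show ?thesis using dd_eqI by fastforce
  qed
  then show ?thesis unfolding csupp_def by blast
qed

lemma csupp_bump: "csupp (bump r)"
proof -
  have "bump r x = 0" if "norm x > \<bar>r\<bar>" for x :: 'a
    using bump_eq_0[of "\<bar>r\<bar>" x] that by (simp add: bump_def)
  then show ?thesis unfolding csupp_def by blast
qed

lemma csupp_bounded:
  fixes f :: "'a::euclidean_space \<Rightarrow> real"
  assumes "continuous_on UNIV f" "csupp f"
  obtains C where "C > 0" "\<And>x. \<bar>f x\<bar> \<le> C"
proof -
  obtain r where r: "\<And>x. norm x > r \<Longrightarrow> f x = 0" using assms by (auto simp: csupp_def)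
  have "compact (f ` cball 0 r)"
    by (intro compact_continuous_image continuous_on_subset[OF assms(1)]) auto
  then obtain C where C: "\<And>x. x \<in> cball 0 r \<Longrightarrow> \<bar>f x\<bar> \<le> C"
    by (force dest!: compact_imp_bounded simp: bounded_iff)
  have "\<bar>f x\<bar> \<le> max C 1" for x
    using C[of x] r[of x] by (cases "norm x > r") auto
  then show ?thesis using that[of "max C 1"] by auto
qed

lemma dd_bound:
  fixes f :: "'a::euclidean_space \<Rightarrow> real"
  assumes "Ck 1 f" "csupp f"
  obtains C where "C > 0" "\<And>x v. \<bar>dd v f x\<bar> \<le> C * norm v"
proof -
  have "\<exists>C>0. \<forall>x. \<bar>dd b f x\<bar> \<le> C" for b
    using csupp_bounded[of "dd b f"] assms csupp_dd by (metis Ck_cont Ck_dd One_nat_def)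
  then obtain C where C: "\<And>b. C b > 0" "\<And>b x. \<bar>dd b f x\<bar> \<le> C b" by metis
  have "\<bar>dd v f x\<bar> \<le> (\<Sum>b\<in>Basis. C b) * norm v" for x v
  proof -
    have "dd v f x = (\<Sum>b\<in>Basis. (v \<bullet> b) * dd b f x)"
      using assms by (intro dd_basis) auto
    then have "\<bar>dd v f x\<bar> \<le> (\<Sum>b\<in>Basis. \<bar>(v \<bullet> b) * dd b f x\<bar>)" by (simp add: sum_abs)
    also have "\<dots> \<le> (\<Sum>b\<in>Basis. norm v * C b)"
      unfolding abs_mult by (intro sum_mono mult_mono C Basis_le_norm) auto
    finally show ?thesis by (simp add: sum_distrib_left mult.commute)
  qed
  moreover have "(\<Sum>b\<in>(Basis::'a set). C b) > 0" using C by (intro sum_pos) auto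
  ultimately show ?thesis using that[of "\<Sum>b\<in>Basis. C b"] by blast
qed

lemma Ck1_lipschitz:
  fixes f :: "'a::euclidean_space \<Rightarrow> real"
  assumes "Ck 1 f" "csupp f"
  obtains L where "L-lipschitz_on UNIV f"
proof -
  obtain C where C: "C > 0" "\<And>x v. \<bar>dd v f x\<bar> \<le> C * norm v" using dd_bound[OF assms] by metis
  have "C-lipschitz_on UNIV f"
  proof (rule bounded_derivative_imp_lipschitz)
    show "(f has_derivative (\<lambda>h. dd h f x)) (at x within UNIV)" for x
      using has_derivative_dd[of f x] assms by auto
    show "onorm (\<lambda>h. dd h f x) \<le> C" for x
      using C by (intro onorm_bound) auto
  qed (use C in auto)
  then show ?thesis using that by blast
qed

section \<open>Symmetry of second derivatives, gradient and Hessian\<close>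

lemma dd_line:
  assumes "f differentiable (at (x + t *\<^sub>R v))"
  shows "((\<lambda>t. f (x + t *\<^sub>R v)) has_real_derivative dd v f (x + t *\<^sub>R v)) (at t)"
proof -
  have "((\<lambda>t. x + t *\<^sub>R v) has_derivative (\<lambda>h. h *\<^sub>R v)) (at t)"
    by (auto intro!: derivative_eq_intros)
  from has_derivative_compose[OF this has_derivative_dd[OF assms]]
  show ?thesis unfolding has_field_derivative_def
    using dd_scale[OF assms] by (simp add: mult_commute_abs)
qed

text \<open>The mean value theorem, applied first in the direction v to the difference of two translates and then in the
direction w. The left-hand side is symmetric in v and w; this is where Schwarz's theorem comes from.\<close>
lemma second_difference:
  assumes f: "Ck 2 f" and h: "h > 0"
  obtains s t where "0 < s" "s < h" "0 < t" "t < h"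
    "f (x + h *\<^sub>R v + h *\<^sub>R w) - f (x + h *\<^sub>R v) - f (x + h *\<^sub>R w) + f x = h * h * dd w (dd v f) (x + s *\<^sub>R v + t *\<^sub>R w)"
proof -
  have f1: "Ck (Suc (Suc 0)) f" using f by (simp add: numeral_2_eq_2)
  define g where "g s = f ((x + h *\<^sub>R w) + s *\<^sub>R v) - f (x + s *\<^sub>R v)" for s
  have "(g has_real_derivative (dd v f ((x + h *\<^sub>R w) + s *\<^sub>R v) - dd v f (x + s *\<^sub>R v))) (at s)" for s
    unfolding g_def by (intro DERIV_diff dd_line) (use f1 in auto)
  then obtain s where s: "0 < s" "s < h" "g h - g 0 = (h - 0) * (dd v f ((x + h *\<^sub>R w) + s *\<^sub>R v) - dd v f (x + s *\<^sub>R v))"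
    using MVT2[OF h, of g "\<lambda>s. dd v f ((x + h *\<^sub>R w) + s *\<^sub>R v) - dd v f (x + s *\<^sub>R v)"] by auto
  define k where "k t = dd v f ((x + s *\<^sub>R v) + t *\<^sub>R w)" for t
  have "(k has_real_derivative dd w (dd v f) ((x + s *\<^sub>R v) + t *\<^sub>R w)) (at t)" for t
    unfolding k_def by (intro dd_line) (use f1 in auto)
  then obtain t where t: "0 < t" "t < h" "k h - k 0 = (h - 0) * dd w (dd v f) ((x + s *\<^sub>R v) + t *\<^sub>R w)"
    using MVT2[OF h, of k "\<lambda>t. dd w (dd v f) ((x + s *\<^sub>R v) + t *\<^sub>R w)"] by auto
  have g: "g h - g 0 = f (x + h *\<^sub>R v + h *\<^sub>R w) - f (x + h *\<^sub>R v) - f (x + h *\<^sub>R w) + f x"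
  proof -
    have e: "x + h *\<^sub>R w + h *\<^sub>R v = x + h *\<^sub>R v + h *\<^sub>R w" by (simp add: add_ac)
    show ?thesis unfolding g_def e by simp
  qed
  have k: "k h - k 0 = dd v f ((x + h *\<^sub>R w) + s *\<^sub>R v) - dd v f (x + s *\<^sub>R v)"
  proof -
    have e: "x + s *\<^sub>R v + h *\<^sub>R w = x + h *\<^sub>R w + s *\<^sub>R v" by (simp add: add_ac)
    show ?thesis unfolding k_def e by simp
  qed
  have "g h - g 0 = h * h * dd w (dd v f) (x + s *\<^sub>R v + t *\<^sub>R w)"
    using s(3) t(3) k by simp
  then show ?thesis using s(1,2) t(1,2) g by (intro that[of s t]) simp_all
qed

text \<open>Schwarz's theorem: the second difference quotient is symmetric, and by \<open>second_difference\<close> and continuity it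
tends to both mixed derivatives.\<close>
lemma dd_commute:
  assumes f: "Ck 2 f"
  shows "dd w (dd v f) x = dd v (dd w f) x"
proof -
  have f1: "Ck (Suc (Suc 0)) f" using f by (simp add: numeral_2_eq_2)
  define h where "h n = 1 / real (Suc n)" for n
  have h: "h n > 0" for n by (simp add: h_def)
  have "\<exists>s t. 0 < s \<and> s < h n \<and> 0 < t \<and> t < h n \<and>
    f (x + h n *\<^sub>R v + h n *\<^sub>R w) - f (x + h n *\<^sub>R v) - f (x + h n *\<^sub>R w) + f x = h n * h n * dd w (dd v f) (x + s *\<^sub>R v + t *\<^sub>R w)" for n v w
    using second_difference[OF f h, of n x v w] by metis
  then obtain S T where ST: "\<And>n v w. 0 < S n v w \<and> S n v w < h n \<and> 0 < T n v w \<and> T n v w < h n \<and>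
    f (x + h n *\<^sub>R v + h n *\<^sub>R w) - f (x + h n *\<^sub>R v) - f (x + h n *\<^sub>R w) + f x = h n * h n * dd w (dd v f) (x + S n v w *\<^sub>R v + T n v w *\<^sub>R w)"
    by metis
  have h0: "h \<longlonglongrightarrow> 0" unfolding h_def by (rule LIMSEQ_Suc[OF lim_const_over_n])
  have lim: "(\<lambda>n. dd w (dd v f) (x + S n v w *\<^sub>R v + T n v w *\<^sub>R w)) \<longlonglongrightarrow> dd w (dd v f) x" for v w
  proof -
    have "(\<lambda>n. S n v w) \<longlonglongrightarrow> 0" "(\<lambda>n. T n v w) \<longlonglongrightarrow> 0"
      using ST[of _ v w] by (auto intro!: tendsto_sandwich[OF _ _ tendsto_const h0] always_eventually simp: less_imp_le)
    then have "(\<lambda>n. x + S n v w *\<^sub>R v + T n v w *\<^sub>R w) \<longlonglongrightarrow> x + 0 *\<^sub>R v + 0 *\<^sub>R w"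
      by (intro tendsto_intros)
    moreover have "isCont (dd w (dd v f)) x"
      using f1 continuous_on_eq_continuous_at[OF open_UNIV, of "dd w (dd v f)"] by simp
    ultimately show ?thesis using isCont_tendsto_compose[of x "dd w (dd v f)"] by simp
  qed
  have "dd w (dd v f) (x + S n v w *\<^sub>R v + T n v w *\<^sub>R w) = dd v (dd w f) (x + S n w v *\<^sub>R w + T n w v *\<^sub>R v)" for n
  proof -
    have "h n * h n * dd w (dd v f) (x + S n v w *\<^sub>R v + T n v w *\<^sub>R w) = h n * h n * dd v (dd w f) (x + S n w v *\<^sub>R w + T n w v *\<^sub>R v)"
      using ST[of n v w] ST[of n w v] by (simp add: algebra_simps)
    then show ?thesis using h[of n] by simp
  qed
  then show ?thesis using lim[of w v] lim[of v w] LIMSEQ_unique by auto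
qed

text \<open>The definite description in the definition of the gradient denotes the vector of partial derivatives,
because a derivative determines its representing vector.\<close>
lemma gradient_has_derivative:
  assumes "f differentiable (at x)"
  shows "(f has_derivative (\<lambda>h. gradient f x \<bullet> h)) (at x)"
proof -
  define v where "v = (\<Sum>b\<in>Basis. dd b f x *\<^sub>R b)"
  have "dd h f x = v \<bullet> h" for h
    using dd_basis[OF assms, of h] by (simp add: v_def inner_sum_left inner_commute[of h] mult.commute)
  then have v: "(f has_derivative (\<lambda>h. v \<bullet> h)) (at x)" using has_derivative_dd[OF assms] by simp
  have "w = v" if "(f has_derivative (\<lambda>h. w \<bullet> h)) (at x)" for w
    using has_derivative_unique[OF v that] by (metis vector_eq_rdot)
  then have "\<exists>!v. v \<in> UNIV \<and> (f has_derivative (\<lambda>h. v \<bullet> h)) (at x)"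
    using v by auto
  from theI'[OF this] show ?thesis unfolding gradient_on_def using v by auto
qed

lemma gradient_inner: "f differentiable (at x) \<Longrightarrow> gradient f x \<bullet> v = dd v f x"
  using dd_eqI[OF gradient_has_derivative] by metis

lemma dd_gradient_component:
  assumes "\<And>x. f differentiable (at x)" "gradient f differentiable (at x)"
  shows "(dd v f has_derivative (\<lambda>w. hessian f x w \<bullet> v)) (at x)"
proof -
  have "dd v f = (\<lambda>x. gradient f x \<bullet> v)"
    by (intro ext gradient_inner[symmetric] assms(1))
  moreover have "(gradient f has_derivative hessian f x) (at x)"
    using assms(2) frechet_derivative_works unfolding hessian_def by blast
  ultimately show ?thesis by (auto intro!: derivative_eq_intros)
qed

text \<open>Continuity of the Hessian operator gives continuity of all its matrix entries, which are the second directional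
derivatives.\<close>
lemma class_C2_Ck:
  assumes "class_C2 f" shows "Ck 2 f"
proof -
  have d: "(dd v f has_derivative (\<lambda>w. hessian f x w \<bullet> v)) (at x)" for v x
    using assms dd_gradient_component unfolding class_C2_def by blast
  then have "dd w (dd v f) = (\<lambda>x. hessian f x w \<bullet> v)" for v w using dd_eqI[OF d] by auto
  moreover have "continuous_on UNIV (\<lambda>x. hessian f x w \<bullet> v)" for w v
    using assms unfolding class_C2_def by (intro continuous_intros) auto
  moreover have "dd v f differentiable (at x)" for v x using d by (auto simp: differentiable_def)
  ultimately show ?thesis using assms unfolding class_C2_def
    by (simp add: numeral_2_eq_2)
qed

lemma hessian_inner:
  assumes "class_C2 f" shows "hessian f x w \<bullet> v = dd w (dd v f) x"
proof -
  have d: "(dd v f has_derivative (\<lambda>w. hessian f x w \<bullet> v)) (at x)" for v x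
    using assms dd_gradient_component unfolding class_C2_def by blast
  then show ?thesis using dd_eqI[OF d] by auto
qed

lemma hessian_linear: assumes "class_C2 f" shows "linear (hessian f x)"
  using assms linear_frechet_derivative unfolding class_C2_def hessian_def by blast

section \<open>Local integrability and integration by parts\<close>

text \<open>Locally integrable functions (\<open>lint\<close>) and bounded functions of compact support (\<open>bcs\<close>) are the two sides of the
pairing \<integral> f g: the product of one of each is integrable, and \<open>lintI\<close> says that this characterises local integrability.\<close>
definition lint :: "('a::euclidean_space \<Rightarrow> real) \<Rightarrow> bool" where
  "lint f \<longleftrightarrow> f \<in> borel_measurable borel \<and> (\<forall>r. integrable lborel (\<lambda>x. indicator (cball 0 r) x * f x))"

definition bcs :: "('a::euclidean_space \<Rightarrow> real) \<Rightarrow> bool" where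
  "bcs f \<longleftrightarrow> f \<in> borel_measurable borel \<and> csupp f \<and> (\<exists>C. \<forall>x. \<bar>f x\<bar> \<le> C)"

lemma lint_measurable: "lint f \<Longrightarrow> f \<in> borel_measurable borel"
  by (simp add: lint_def)

lemma bcs_cont: "continuous_on UNIV f \<Longrightarrow> csupp f \<Longrightarrow> bcs f"
  unfolding bcs_def using csupp_bounded[of f] borel_measurable_continuous_onI by metis

lemma bcsE:
  assumes "bcs f"
  obtains C r where "C > 0" "r > 0" "\<And>x. \<bar>f x\<bar> \<le> C" "\<And>x. norm x > r \<Longrightarrow> f x = 0" "f \<in> borel_measurable borel"
proof -
  obtain C r where Cr: "\<And>x. \<bar>f x\<bar> \<le> C" "\<And>x. norm x > r \<Longrightarrow> f x = 0" "f \<in> borel_measurable borel"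
    using assms unfolding bcs_def csupp_def by blast
  have "\<bar>f x\<bar> \<le> max C 1" "norm x > max r 1 \<Longrightarrow> f x = 0" for x
    using Cr(1)[of x] Cr(2)[of x] by auto
  then show ?thesis using Cr(3) that[of "max C 1" "max r 1"] by auto
qed

lemma lint_cont:
  assumes "continuous_on UNIV f" shows "lint f"
proof -
  have "integrable lborel (\<lambda>x. indicator (cball 0 r) x *\<^sub>R f x)" for r
    by (intro borel_integrable_compact continuous_on_subset[OF assms]) auto
  then show ?thesis unfolding lint_def using borel_measurable_continuous_onI[OF assms] by simp
qed

lemma integrable_lint_bcs:
  assumes f: "lint f" and g: "bcs g"
  shows "integrable lborel (\<lambda>x. f x * g x)"
proof -
  obtain C r where g': "C > 0" "r > 0" "\<And>x. \<bar>g x\<bar> \<le> C" "\<And>x. norm x > r \<Longrightarrow> g x = 0"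
    "g \<in> borel_measurable borel" using bcsE[OF g] by metis
  have i: "integrable lborel (\<lambda>x. C * (indicator (cball 0 r) x * f x))"
    using f unfolding lint_def by auto
  show ?thesis
  proof (rule Bochner_Integration.integrable_bound[OF i])
    show "(\<lambda>x. f x * g x) \<in> borel_measurable lborel"
      using lint_measurable[OF f] g'(5) by simp
    show "AE x in lborel. norm (f x * g x) \<le> norm (C * (indicator (cball 0 r) x * f x))"
    proof (rule AE_I2)
      fix x
      show "norm (f x * g x) \<le> norm (C * (indicator (cball 0 r) x * f x))"
      proof (cases "norm x > r")
        case True then show ?thesis using g' by simp
      next
        case False
        then have "indicator (cball 0 r) x = (1::real)" by simp
        then show ?thesis using mult_right_mono[OF g'(3)[of x], of "\<bar>f x\<bar>"] g'(1)
          by (simp add: abs_mult mult.commute)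
      qed
    qed
  qed
qed

lemma integrable_bcs: "bcs g \<Longrightarrow> integrable lborel g"
  using integrable_lint_bcs[of "\<lambda>x. 1" g] lint_cont[of "\<lambda>x. 1"] by simp

lemma bcs_indicator_cball: "bcs (indicator (cball 0 r))"
proof -
  have "indicator (cball 0 r) \<in> borel_measurable borel" by (intro borel_measurable_indicator) simp
  moreover have "\<forall>x. \<bar>indicator (cball 0 r) x\<bar> \<le> (1::real)" by (simp add: indicator_def)
  moreover have "csupp (indicator (cball 0 r))" unfolding csupp_def by (intro exI[of _ r]) simp
  ultimately show ?thesis unfolding bcs_def by blast
qed

lemma lintI:
  assumes "f \<in> borel_measurable borel" "\<And>g. bcs g \<Longrightarrow> integrable lborel (\<lambda>x. f x * g x)"
  shows "lint f"
  unfolding lint_def using assms(1) assms(2)[OF bcs_indicator_cball] by (simp add: mult.commute)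

lemma bcs_mult_cont:
  assumes "bcs f" "continuous_on UNIV g" shows "bcs (\<lambda>x. f x * g x)"
proof -
  obtain C r where f': "C > 0" "r > 0" "\<And>x. \<bar>f x\<bar> \<le> C" "\<And>x. norm x > r \<Longrightarrow> f x = 0"
    "f \<in> borel_measurable borel" using bcsE[OF assms(1)] by metis
  have "compact (g ` cball 0 r)"
    by (intro compact_continuous_image continuous_on_subset[OF assms(2)]) auto
  then obtain D where D: "\<And>x. x \<in> cball 0 r \<Longrightarrow> \<bar>g x\<bar> \<le> D"
    by (force dest!: compact_imp_bounded simp: bounded_iff)
  have "\<bar>f x * g x\<bar> \<le> C * \<bar>D\<bar>" for x
  proof (cases "norm x > r")
    case True then show ?thesis using f' by simp
  next
    case False
    then have "\<bar>g x\<bar> \<le> \<bar>D\<bar>" using D[of x] by simp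
    then show ?thesis unfolding abs_mult using f' by (intro mult_mono) auto
  qed
  moreover have "(\<lambda>x. f x * g x) \<in> borel_measurable borel"
    using f'(5) borel_measurable_continuous_onI[OF assms(2)] by simp
  moreover have "csupp (\<lambda>x. f x * g x)" using assms(1) csupp_mult1 unfolding bcs_def by blast
  ultimately show ?thesis unfolding bcs_def by blast
qed

lemma lint_mult_cont:
  assumes "lint f" "continuous_on UNIV g" shows "lint (\<lambda>x. f x * g x)"
proof (rule lintI)
  show "(\<lambda>x. f x * g x) \<in> borel_measurable borel"
    using lint_measurable[OF assms(1)] borel_measurable_continuous_onI[OF assms(2)] by simp
  fix h :: "'a \<Rightarrow> real" assume "bcs h"
  from integrable_lint_bcs[OF assms(1) bcs_mult_cont[OF this assms(2)]]
  show "integrable lborel (\<lambda>x. f x * g x * h x)" by (simp add: mult_ac)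
qed

lemma lint_abs: "lint f \<Longrightarrow> lint (\<lambda>x. \<bar>f x\<bar>)"
  unfolding lint_def
proof safe
  fix r assume "\<forall>r. integrable lborel (\<lambda>x. indicator (cball 0 r) x * f x)"
  then have "integrable lborel (\<lambda>x. \<bar>indicator (cball 0 r) x * f x\<bar>)" by auto
  then show "integrable lborel (\<lambda>x. indicator (cball 0 r) x * \<bar>f x\<bar>)" by (simp add: abs_mult)
qed auto

lemma lint_diff: "lint f \<Longrightarrow> lint g \<Longrightarrow> lint (\<lambda>x. f x - g x)"
  unfolding lint_def by (auto simp: right_diff_distrib)

lemma integrable_lint: "integrable lborel f \<Longrightarrow> lint f"
proof (rule lintI)
  assume f: "integrable lborel f"
  then show "f \<in> borel_measurable borel" by auto
  fix g :: "'a \<Rightarrow> real" assume "bcs g"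
  then obtain C r where g': "C > 0" "r > 0" "\<And>x. \<bar>g x\<bar> \<le> C" "\<And>x. norm x > r \<Longrightarrow> g x = 0"
    "g \<in> borel_measurable borel" using bcsE by metis
  show "integrable lborel (\<lambda>x. f x * g x)"
  proof (rule Bochner_Integration.integrable_bound[of _ "\<lambda>x. C * f x"])
    show "AE x in lborel. norm (f x * g x) \<le> norm (C * f x)"
      using g'(1) by (intro AE_I2) (simp add: abs_mult mult.commute[of "\<bar>f _\<bar>"] mult_right_mono[OF g'(3)])
  qed (use f g' in auto)
qed

text \<open>Pointwise, \<open>\<bar>f x\<bar> \<le> (f x)\<^sup>2 + 1\<close>.\<close>
lemma lint_square:
  assumes "f \<in> borel_measurable borel" "integrable lborel (\<lambda>x. (f x)\<^sup>2)"
  shows "lint f"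
proof (rule lintI)
  fix g :: "'a \<Rightarrow> real" assume g: "bcs g"
  then have gm: "g \<in> borel_measurable borel" by (simp add: bcs_def)
  have ig: "integrable lborel (\<lambda>x. (f x)\<^sup>2 * g x)" by (rule integrable_lint_bcs[OF integrable_lint[OF assms(2)] g])
  show "integrable lborel (\<lambda>x. f x * g x)"
  proof (rule Bochner_Integration.integrable_bound[of _ "\<lambda>x. \<bar>(f x)\<^sup>2 * g x\<bar> + \<bar>g x\<bar>"])
    show "integrable lborel (\<lambda>x. \<bar>(f x)\<^sup>2 * g x\<bar> + \<bar>g x\<bar>)"
      by (intro Bochner_Integration.integrable_add integrable_abs ig integrable_bcs g)
    show "AE x in lborel. norm (f x * g x) \<le> norm (\<bar>(f x)\<^sup>2 * g x\<bar> + \<bar>g x\<bar>)"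
    proof (rule AE_I2)
      fix x
      have "0 \<le> (\<bar>f x\<bar> - 1)\<^sup>2 + \<bar>f x\<bar>" by simp
      then have "\<bar>f x\<bar> \<le> (f x)\<^sup>2 + 1" by (simp add: power2_diff)
      then have "\<bar>f x\<bar> * \<bar>g x\<bar> \<le> ((f x)\<^sup>2 + 1) * \<bar>g x\<bar>" by (rule mult_right_mono) simp
      then show "norm (f x * g x) \<le> norm (\<bar>(f x)\<^sup>2 * g x\<bar> + \<bar>g x\<bar>)"
        by (simp add: abs_mult distrib_right)
    qed
  qed (use assms gm in auto)
qed (use assms in auto)

lemma lborel_shift:
  fixes f :: "'a::euclidean_space \<Rightarrow> real"
  assumes "f \<in> borel_measurable borel"
  shows "(\<integral>x. f (x + a) \<partial>lborel) = (\<integral>x. f x \<partial>lborel)"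
    "integrable lborel (\<lambda>x. f (x + a)) \<longleftrightarrow> integrable lborel f"
proof -
  have "(\<integral>x. f x \<partial>distr lborel borel ((+) a)) = (\<integral>x. f (a + x) \<partial>lborel)"
    by (rule integral_distr) (use assms in auto)
  then show "(\<integral>x. f (x + a) \<partial>lborel) = (\<integral>x. f x \<partial>lborel)"
    unfolding lborel_distr_plus by (simp add: add.commute)
  have "integrable (distr lborel borel ((+) a)) f \<longleftrightarrow> integrable lborel (\<lambda>x. f (a + x))"
    by (rule integrable_distr_eq) (use assms in auto)
  then show "integrable lborel (\<lambda>x. f (x + a)) \<longleftrightarrow> integrable lborel f"
    unfolding lborel_distr_plus by (simp add: add.commute)
qed

lemma lborel_distr_reflect: "distr lborel borel (\<lambda>y::'a::euclidean_space. x - y) = lborel"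
  using lborel_affine[of "-1" x] by (simp add: density_1)

lemma lborel_reflect:
  fixes f :: "'a::euclidean_space \<Rightarrow> real"
  assumes "f \<in> borel_measurable borel"
  shows "(\<integral>y. f (x - y) \<partial>lborel) = (\<integral>y. f y \<partial>lborel)"
    "integrable lborel (\<lambda>y. f (x - y)) \<longleftrightarrow> integrable lborel f"
proof -
  have "(\<integral>y. f y \<partial>distr lborel borel (\<lambda>y. x - y)) = (\<integral>y. f (x - y) \<partial>lborel)"
    by (rule integral_distr) (use assms in auto)
  then show "(\<integral>y. f (x - y) \<partial>lborel) = (\<integral>y. f y \<partial>lborel)"
    unfolding lborel_distr_reflect by simp
  have "integrable (distr lborel borel (\<lambda>y. x - y)) f \<longleftrightarrow> integrable lborel (\<lambda>y. f (x - y))"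
    by (rule integrable_distr_eq) (use assms in auto)
  then show "integrable lborel (\<lambda>y. f (x - y)) \<longleftrightarrow> integrable lborel f"
    unfolding lborel_distr_reflect by simp
qed

lemma csupp_shift: "csupp f \<Longrightarrow> csupp (\<lambda>y. f (x + y))"
proof -
  assume "csupp f"
  then obtain r where r: "\<And>y. norm y > r \<Longrightarrow> f y = 0" unfolding csupp_def by blast
  have "f (x + y) = 0" if "norm y > r + norm x" for y
    using norm_triangle_ineq4[of "x + y" x] that by (intro r) simp
  then show ?thesis unfolding csupp_def by blast
qed

lemma csupp_reflect: "csupp f \<Longrightarrow> csupp (\<lambda>y. f (x - y))"
proof -
  assume "csupp f"
  then obtain r where r: "\<And>y. norm y > r \<Longrightarrow> f y = 0" unfolding csupp_def by blast
  have "f (x - y) = 0" if "norm y > r + norm x" for y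
    using norm_triangle_ineq2[of y x] that by (intro r) (simp add: norm_minus_commute)
  then show ?thesis unfolding csupp_def by blast
qed

text \<open>By translation invariance every difference quotient of F has integral zero. The Lipschitz constant dominates
the quotients on a fixed ball, so the integral passes to the limit. The hypothesis concerns the single direction v, so
that the lemma can serve on the way to Rademacher's theorem.\<close>
lemma integral_dir_deriv_zero:
  fixes F :: "'a::euclidean_space \<Rightarrow> real"
  assumes F: "L-lipschitz_on UNIV F" "csupp F"
    and d: "d \<in> borel_measurable borel"
    and lim: "AE x in lborel. ((\<lambda>t. (F (x + t *\<^sub>R v) - F x) / t) \<longlongrightarrow> d x) (at 0)"
  shows "integrable lborel d" "(\<integral>x. d x \<partial>lborel) = 0"
proof -
  have cF: "continuous_on UNIV F" using F lipschitz_on_continuous_on by blast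
  have Fm [measurable]: "F \<in> borel_measurable borel" by (rule borel_measurable_continuous_onI[OF cF])
  obtain r where r: "\<And>x. norm x > r \<Longrightarrow> F x = 0" using F unfolding csupp_def by blast
  have L0: "L \<ge> 0" using F lipschitz_on_nonneg by blast
  define t where "t n = 1 / real (Suc n)" for n
  have t: "t n > 0" "t n \<le> 1" for n by (auto simp: t_def)
  have t0: "t \<longlonglongrightarrow> 0" unfolding t_def by (rule LIMSEQ_Suc[OF lim_const_over_n])
  have tat: "filterlim t (at 0) sequentially"
    using t0 t(1) by (auto simp: filterlim_at less_imp_neq[symmetric] intro!: always_eventually)
  define s where "s n x = (F (x + t n *\<^sub>R v) - F x) / t n" for n x
  have iF: "integrable lborel F" by (intro integrable_bcs bcs_cont cF F)
  have iFs: "integrable lborel (\<lambda>x. F (x + t n *\<^sub>R v))" for n using lborel_shift(2)[OF Fm] iF by blast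
  have s0: "(\<integral>x. s n x \<partial>lborel) = 0" for n
    unfolding s_def using iF iFs lborel_shift(1)[OF Fm] by simp
  have sm: "s n \<in> borel_measurable lborel" for n unfolding s_def by measurable
  let ?w = "\<lambda>x::'a. L * norm v * indicator (cball 0 (r + norm v)) x"
  have w: "integrable lborel ?w"
    using integrable_bcs[OF bcs_indicator_cball] by (intro integrable_mult_right) auto
  have bnd: "norm (s n x) \<le> ?w x" for n x
  proof (cases "norm x \<le> r + norm v")
    case True
    have "\<bar>F (x + t n *\<^sub>R v) - F x\<bar> \<le> L * norm (t n *\<^sub>R v)"
      using lipschitz_on_normD[OF F(1), of "x + t n *\<^sub>R v" x] by simp
    then have "\<bar>s n x\<bar> \<le> L * norm v" unfolding s_def using t(1)[of n]
      by (simp add: divide_le_eq mult_ac)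
    then show ?thesis using True by simp
  next
    case False
    have "norm (t n *\<^sub>R v) \<le> norm v" using t[of n] mult_right_mono[of "t n" 1 "norm v"] by simp
    moreover have "norm x \<le> norm (x + t n *\<^sub>R v) + norm (t n *\<^sub>R v)"
      using norm_triangle_ineq4[of "x + t n *\<^sub>R v" "t n *\<^sub>R v"] by simp
    ultimately have "norm (x + t n *\<^sub>R v) > r" "norm x > r" using False norm_ge_zero[of v] by linarith+
    then have "s n x = 0" unfolding s_def using r by simp
    then show ?thesis using L0 by simp
  qed
  have lm: "AE x in lborel. (\<lambda>n. s n x) \<longlonglongrightarrow> d x"
    using lim unfolding s_def by eventually_elim (rule filterlim_compose[OF _ tat])
  have "(\<lambda>n. integral\<^sup>L lborel (s n)) \<longlonglongrightarrow> integral\<^sup>L lborel d"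
    by (rule integral_dominated_convergence[where w="?w"]) (use d sm w lm bnd in auto)
  then show "(\<integral>x. d x \<partial>lborel) = 0" unfolding s0 using LIMSEQ_unique tendsto_const by metis
  show "integrable lborel d"
    by (rule integrable_dominated_convergence[where w="?w" and s=s]) (use d sm w lm bnd in auto)
qed

lemma dd_quotient:
  assumes "f differentiable (at x)"
  shows "((\<lambda>t. (f (x + t *\<^sub>R v) - f x) / t) \<longlongrightarrow> dd v f x) (at 0)"
  using dd_line[of f x 0 v] assms unfolding has_field_derivative_iff by simp

lemma integral_dd_zero:
  fixes F :: "'a::euclidean_space \<Rightarrow> real"
  assumes "Ck 1 F" "csupp F"
  shows "(\<integral>x. dd v F x \<partial>lborel) = 0"
proof -
  obtain L where "L-lipschitz_on UNIV F" using Ck1_lipschitz[OF assms] .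
  moreover have "dd v F \<in> borel_measurable borel"
    using assms(1) by (intro borel_measurable_continuous_onI) simp
  ultimately show ?thesis
    using assms by (intro integral_dir_deriv_zero(2)[of L F _ v]) (auto intro!: dd_quotient)
qed

lemma integral_by_parts_dd:
  fixes f :: "'a::euclidean_space \<Rightarrow> real"
  assumes f: "Ck 1 f" and g: "Ck 1 g" and s: "csupp f \<or> csupp g"
  shows "(\<integral>x. dd v f x * g x \<partial>lborel) = - (\<integral>x. f x * dd v g x \<partial>lborel)"
proof -
  have e: "dd v (\<lambda>x. f x * g x) x = dd v f x * g x + f x * dd v g x" for x
    using f g by (intro dd_mult) auto
  have z: "(\<integral>x. dd v (\<lambda>x. f x * g x) x \<partial>lborel) = 0"
    using s by (intro integral_dd_zero Ck_mult f g) (auto intro: csupp_mult1 csupp_mult2)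
  have c: "continuous_on UNIV f" "continuous_on UNIV g" "continuous_on UNIV (dd v f)" "continuous_on UNIV (dd v g)"
    using Ck_cont[OF f] Ck_cont[OF g] f g by auto
  have "integrable lborel (\<lambda>x. dd v f x * g x)" "integrable lborel (\<lambda>x. f x * dd v g x)"
    using s by (auto intro!: integrable_bcs bcs_cont continuous_intros c intro: csupp_mult1 csupp_mult2 csupp_dd)
  then show ?thesis using z unfolding e by simp
qed

section \<open>Convolution and mollification\<close>

definition conv :: "('a::euclidean_space \<Rightarrow> real) \<Rightarrow> ('a \<Rightarrow> real) \<Rightarrow> 'a \<Rightarrow> real" where
  "conv k h x = (\<integral>y. k (x - y) * h y \<partial>lborel)"

lemma conv_alt:
  assumes "k \<in> borel_measurable borel" "h \<in> borel_measurable borel"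
  shows "conv k h x = (\<integral>y. k y * h (x - y) \<partial>lborel)"
  using lborel_reflect(1)[of "\<lambda>y. k (x - y) * h y" x] assms unfolding conv_def by simp

lemma conv_commute:
  assumes "k \<in> borel_measurable borel" "h \<in> borel_measurable borel"
  shows "conv k h x = conv h k x"
  unfolding conv_alt[OF assms] by (simp add: conv_def mult.commute)

lemma bcs_reflect: "bcs f \<Longrightarrow> bcs (\<lambda>y. f (x - y))"
  unfolding bcs_def using csupp_reflect by auto

lemma conv_integrable: "bcs k \<Longrightarrow> lint h \<Longrightarrow> integrable lborel (\<lambda>y. k (x - y) * h y)"
  using integrable_lint_bcs[OF _ bcs_reflect, of h k x] by (simp add: mult.commute)

text \<open>Along a convergent, hence bounded, sequence of points the integrands are dominated on one fixed ball.\<close>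
lemma conv_continuous:
  fixes k :: "'a::euclidean_space \<Rightarrow> real"
  assumes k: "continuous_on UNIV k" "csupp k" and h: "lint h"
  shows "continuous_on UNIV (conv k h)"
proof -
  obtain C where C: "C > 0" "\<And>x. \<bar>k x\<bar> \<le> C" using csupp_bounded[OF k] by metis
  obtain r where r: "\<And>x. norm x > r \<Longrightarrow> k x = 0" using k unfolding csupp_def by blast
  have [measurable]: "k \<in> borel_measurable borel" "h \<in> borel_measurable borel"
    using k h borel_measurable_continuous_onI lint_measurable by auto
  have "isCont (conv k h) x" for x
    unfolding continuous_at_sequentially
  proof safe
    fix X :: "nat \<Rightarrow> 'a" assume X: "X \<longlonglongrightarrow> x"
    then have "bounded (range X)" by (rule convergent_imp_bounded)
    then obtain B where B: "\<And>n. norm (X n) \<le> B" unfolding bounded_iff by auto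
    have "(\<lambda>n. integral\<^sup>L lborel (\<lambda>y. k (X n - y) * h y)) \<longlonglongrightarrow> integral\<^sup>L lborel (\<lambda>y. k (x - y) * h y)"
    proof (rule integral_dominated_convergence[where w="\<lambda>y. C * \<bar>indicator (cball 0 (B + r)) y * h y\<bar>"])
      show "integrable lborel (\<lambda>y. C * \<bar>indicator (cball 0 (B + r)) y * h y\<bar>)"
        using h unfolding lint_def by auto
      show "AE y in lborel. (\<lambda>n. k (X n - y) * h y) \<longlonglongrightarrow> k (x - y) * h y"
      proof (rule AE_I2)
        fix y
        have "isCont k (x - y)" using k(1) continuous_on_eq_continuous_at[OF open_UNIV] by blast
        moreover have "(\<lambda>n. X n - y) \<longlonglongrightarrow> x - y" by (intro tendsto_intros X)
        ultimately have "(\<lambda>n. k (X n - y)) \<longlonglongrightarrow> k (x - y)" by (rule isCont_tendsto_compose)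
        then show "(\<lambda>n. k (X n - y) * h y) \<longlonglongrightarrow> k (x - y) * h y" by (intro tendsto_intros)
      qed
      fix n
      show "AE y in lborel. norm (k (X n - y) * h y) \<le> C * \<bar>indicator (cball 0 (B + r)) y * h y\<bar>"
      proof (rule AE_I2)
        fix y
        show "norm (k (X n - y) * h y) \<le> C * \<bar>indicator (cball 0 (B + r)) y * h y\<bar>"
        proof (cases "norm y \<le> B + r")
          case True
          then show ?thesis using mult_right_mono[OF C(2)[of "X n - y"], of "\<bar>h y\<bar>"]
            by (simp add: abs_mult)
        next
          case False
          have "norm (X n - y) > r" using False B[of n] norm_triangle_ineq2[of y "X n"]
            by (simp add: norm_minus_commute)
          then show ?thesis using r C by simp
        qed
      qed
    qed measurable
    then show "(conv k h \<circ> X) \<longlonglongrightarrow> conv k h x" by (simp add: conv_def o_def)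
  qed
  then show ?thesis using continuous_at_imp_continuous_on by blast
qed

text \<open>Differentiation under the integral sign. For increments in a bounded set the remainder quotient of k is bounded by the
Lipschitz constant plus the norm of the derivative and is supported in one fixed ball, which gives a dominating function
that is a multiple of \<open>\<bar>h\<bar>\<close> on that ball.\<close>
lemma conv_has_derivative:
  fixes k :: "'a::euclidean_space \<Rightarrow> real"
  assumes k: "Ck 1 k" "csupp k" and h: "lint h"
  shows "(conv k h has_derivative (\<lambda>v. conv (dd v k) h x)) (at x)"
proof -
  obtain C where C: "C > 0" "\<And>x v. \<bar>dd v k x\<bar> \<le> C * norm v" using dd_bound[OF k] by metis
  obtain L where L: "L-lipschitz_on UNIV k" using Ck1_lipschitz[OF k] .
  have L0: "L \<ge> 0" using L lipschitz_on_nonneg by blast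
  obtain r where r: "\<And>x. norm x > r \<Longrightarrow> k x = 0" using k unfolding csupp_def by blast
  have dk: "k differentiable (at x)" for x using k by simp
  have kc: "continuous_on UNIV k" "continuous_on UNIV (dd v k)" for v using k Ck_cont[OF k(1)] by auto
  have [measurable]: "k \<in> borel_measurable borel" "h \<in> borel_measurable borel" "dd v k \<in> borel_measurable borel" for v
    using kc h borel_measurable_continuous_onI lint_measurable by auto
  have i1: "integrable lborel (\<lambda>y. k (x - y) * h y)" for x
    by (intro conv_integrable h bcs_cont kc k)
  have i2: "integrable lborel (\<lambda>y. dd v k (x - y) * h y)" for x v
    by (intro conv_integrable h bcs_cont kc csupp_dd k)
  have lin: "linear (\<lambda>v. conv (dd v k) h x)"
  proof (rule linearI)
    fix v w
    have "dd (v + w) k z = dd v k z + dd w k z" for z using linear_add[OF dd_linear[OF dk]] by simp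
    then show "conv (dd (v + w) k) h x = conv (dd v k) h x + conv (dd w k) h x"
      unfolding conv_def using i2 by (simp add: distrib_right)
  next
    fix c v show "conv (dd (c *\<^sub>R v) k) h x = c *\<^sub>R conv (dd v k) h x"
      unfolding conv_def using dd_scale[OF dk] by (simp add: mult.assoc)
  qed
  show ?thesis unfolding has_derivative_at
  proof
    show "bounded_linear (\<lambda>v. conv (dd v k) h x)" using lin linear_conv_bounded_linear by blast
    show "(\<lambda>v. norm (conv k h (x + v) - conv k h x - conv (dd v k) h x) / norm v) \<midarrow>0\<rightarrow> 0"
      unfolding tendsto_at_iff_sequentially
    proof (intro allI impI)
      fix X :: "nat \<Rightarrow> 'a" assume X0: "\<forall>i. X i \<in> UNIV - {0}" and X: "X \<longlonglongrightarrow> 0"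
      define q where "q n y = (k (x + X n - y) - k (x - y) - dd (X n) k (x - y)) / norm (X n) * h y" for n y
      have qm: "q n \<in> borel_measurable borel" for n unfolding q_def[abs_def] by measurable
      have nz: "norm (X n) > 0" for n using X0 by auto
      have "bounded (range X)" using X by (rule convergent_imp_bounded)
      then obtain B where B: "\<And>n. norm (X n) \<le> B" unfolding bounded_iff by auto
      have "(\<lambda>n. integral\<^sup>L lborel (q n)) \<longlonglongrightarrow> integral\<^sup>L lborel (\<lambda>y::'a. 0)"
      proof (rule integral_dominated_convergence[where w="\<lambda>y. (L + C) * \<bar>indicator (cball 0 (norm x + B + \<bar>r\<bar> + 1)) y * h y\<bar>"])
        show "integrable lborel (\<lambda>y. (L + C) * \<bar>indicator (cball 0 (norm x + B + \<bar>r\<bar> + 1)) y * h y\<bar>)"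
          using h unfolding lint_def by auto
        show "AE y in lborel. (\<lambda>n. q n y) \<longlonglongrightarrow> 0"
        proof (rule AE_I2)
          fix y
          have "(\<lambda>v. norm (k ((x - y) + v) - k (x - y) - dd v k (x - y)) / norm v) \<midarrow>0\<rightarrow> 0"
            using has_derivative_dd[OF dk] unfolding has_derivative_at by blast
          then have "(\<lambda>n. norm (k ((x - y) + X n) - k (x - y) - dd (X n) k (x - y)) / norm (X n)) \<longlonglongrightarrow> 0"
            using X0 X unfolding tendsto_at_iff_sequentially by (auto simp: o_def)
          then have "(\<lambda>n. norm (q n y)) \<longlonglongrightarrow> 0 * \<bar>h y\<bar>"
            unfolding q_def norm_mult norm_divide by (intro tendsto_mult) (auto simp: algebra_simps)
          then show "(\<lambda>n. q n y) \<longlonglongrightarrow> 0" by (simp add: tendsto_rabs_zero_iff)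
        qed
        fix n
        show "AE y in lborel. norm (q n y) \<le> (L + C) * \<bar>indicator (cball 0 (norm x + B + \<bar>r\<bar> + 1)) y * h y\<bar>"
        proof (rule AE_I2)
          fix y
          show "norm (q n y) \<le> (L + C) * \<bar>indicator (cball 0 (norm x + B + \<bar>r\<bar> + 1)) y * h y\<bar>"
          proof (cases "norm y \<le> norm x + B + \<bar>r\<bar> + 1")
            case True
            have "\<bar>k (x + X n - y) - k (x - y)\<bar> \<le> L * norm (X n)"
              using lipschitz_on_normD[OF L, of "x + X n - y" "x - y"] by simp
            then have "\<bar>k (x + X n - y) - k (x - y) - dd (X n) k (x - y)\<bar> \<le> (L + C) * norm (X n)"
              using C(2)[of "X n" "x - y"] by (simp add: distrib_right)
            then have "\<bar>k (x + X n - y) - k (x - y) - dd (X n) k (x - y)\<bar> / norm (X n) \<le> L + C"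
              using nz[of n] by (simp add: divide_le_eq)
            from mult_right_mono[OF this, of "\<bar>h y\<bar>"] show ?thesis using True
              by (simp add: q_def abs_mult)
          next
            case False
            have "norm (x - y) > \<bar>r\<bar> + B + 1" using False norm_triangle_ineq2[of y x] B[of n] nz[of n]
              by (simp add: norm_minus_commute)
            moreover have "norm (x - y) \<le> norm (x + X n - y) + norm (X n)"
              using norm_triangle_ineq4[of "x + X n - y" "X n"] by (simp add: algebra_simps)
            ultimately have gt: "norm (x + X n - y) > r" "norm (x - y) > r" using B[of n] nz[of n] by linarith+
            have "dd (X n) k (x - y) = 0"
            proof -
              have "((\<lambda>x. 0::real) has_derivative (\<lambda>h. 0)) (at (x - y))" by simp
              then have "(k has_derivative (\<lambda>h. 0)) (at (x - y))"
              proof (rule has_derivative_transform_within_open[where s="{x. norm x > r}"])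
                show "open {x::'a. norm x > r}" by (intro open_Collect_less continuous_intros)
              qed (use gt r in auto)
              then show ?thesis using dd_eqI by fastforce
            qed
            then show ?thesis using r[OF gt(1)] r[OF gt(2)] L0 C by (simp add: q_def)
          qed
        qed
      qed (use qm in auto)
      then have l: "(\<lambda>n. norm (integral\<^sup>L lborel (q n))) \<longlonglongrightarrow> 0"
        by (intro tendsto_norm_zero) simp
      have e: "integral\<^sup>L lborel (q n) = (conv k h (x + X n) - conv k h x - conv (dd (X n) k) h x) / norm (X n)" for n
      proof -
        have "integral\<^sup>L lborel (q n) = (\<integral>y. (k (x + X n - y) * h y - k (x - y) * h y - dd (X n) k (x - y) * h y) / norm (X n) \<partial>lborel)"
          unfolding q_def by (intro Bochner_Integration.integral_cong) (auto simp: left_diff_distrib)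
        then show ?thesis unfolding conv_def using i1 i2 by simp
      qed
      show "((\<lambda>v. norm (conv k h (x + v) - conv k h x - conv (dd v k) h x) / norm v) \<circ> X) \<longlonglongrightarrow> 0"
        using l unfolding e by (simp add: o_def)
    qed
  qed
qed

lemma dd_conv: "Ck 1 k \<Longrightarrow> csupp k \<Longrightarrow> lint h \<Longrightarrow> dd v (conv k h) = conv (dd v k) h"
  using dd_eqI[OF conv_has_derivative] by blast

lemma Ck_conv: "Ck j k \<Longrightarrow> csupp k \<Longrightarrow> lint h \<Longrightarrow> Ck j (conv k h)"
proof (induction j arbitrary: k)
  case 0 then show ?case using conv_continuous by auto
next
  case (Suc j)
  have k1: "Ck 1 k" using Ck_le[OF Suc.prems(1), of 1] by simp
  have "Ck j (dd v (conv k h))" for v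
    unfolding dd_conv[OF k1 Suc.prems(2,3)] using Suc by (intro Suc.IH) (auto intro: csupp_dd)
  moreover have "conv k h differentiable (at x)" for x
    using conv_has_derivative[OF k1 Suc.prems(2,3)] unfolding differentiable_def by blast
  ultimately show ?case by simp
qed

text \<open>A derivative of a convolution may be placed on either factor.\<close>
lemma dd_conv2:
  assumes "continuous_on UNIV k" "Ck 1 h" "csupp h"
  shows "dd v (conv k h) = conv k (dd v h)"
proof -
  have m: "k \<in> borel_measurable borel" "h \<in> borel_measurable borel" "dd v h \<in> borel_measurable borel"
    using assms Ck_cont[OF assms(2)] by (auto intro!: borel_measurable_continuous_onI)
  have "conv k h = conv h k" "conv k (dd v h) = conv (dd v h) k"
    using conv_commute[OF m(1)] m by auto
  then show ?thesis using dd_conv[OF assms(2,3) lint_cont[OF assms(1)]] by simp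
qed

lemma csupp_conv:
  assumes "csupp k" "csupp h" shows "csupp (conv k h)"
proof -
  obtain r s where r: "\<And>x. norm x > r \<Longrightarrow> k x = 0" and s: "\<And>x. norm x > s \<Longrightarrow> h x = 0"
    using assms unfolding csupp_def by blast
  have "conv k h x = 0" if "norm x > r + s" for x
  proof -
    have "k (x - y) * h y = 0" for y
    proof (cases "norm y > s")
      case False
      then have "norm (x - y) > r" using that norm_triangle_ineq2[of x y] by linarith
      then show ?thesis using r by simp
    qed (use s in simp)
    then have e: "(\<lambda>y. k (x - y) * h y) = (\<lambda>y. 0)" by (rule ext)
    show ?thesis unfolding conv_def e by simp
  qed
  then show ?thesis unfolding csupp_def by blast
qed

text \<open>By Fubini, convolution with an even kernel is a symmetric operator. This is how a weak equation for h is
transferred to its mollification.\<close>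
lemma conv_adjoint:
  fixes k :: "'a::euclidean_space \<Rightarrow> real"
  assumes k: "bcs k" "\<And>x. k (- x) = k x" and h: "lint h" and g: "bcs g"
  shows "(\<integral>x. conv k h x * g x \<partial>lborel) = (\<integral>x. h x * conv k g x \<partial>lborel)"
proof -
  obtain C r where k': "C > 0" "r > 0" "\<And>x. \<bar>k x\<bar> \<le> C" "\<And>x. norm x > r \<Longrightarrow> k x = 0"
    "k \<in> borel_measurable borel" using bcsE[OF k(1)] by metis
  obtain D s where g': "D > 0" "s > 0" "\<And>x. \<bar>g x\<bar> \<le> D" "\<And>x. norm x > s \<Longrightarrow> g x = 0"
    "g \<in> borel_measurable borel" using bcsE[OF g] by metis
  have [measurable]: "k \<in> borel_measurable borel" "g \<in> borel_measurable borel" "h \<in> borel_measurable borel"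
    using k' g' lint_measurable[OF h] by auto
  let ?F = "\<lambda>x y. k (x - y) * h y * g x"
  define b :: "'a \<Rightarrow> real" where "b = (\<lambda>x. C * D * indicator (cball 0 s) x)"
  define c where "c = (\<lambda>y. \<bar>indicator (cball 0 (r + s)) y * h y\<bar>)"
  have ib: "integrable lborel b" using integrable_bcs[OF bcs_indicator_cball, of s] unfolding b_def by auto
  have ic: "integrable lborel c" using h unfolding lint_def c_def by auto
  have [measurable]: "b \<in> borel_measurable borel" "c \<in> borel_measurable borel" using ib ic by auto
  have "integrable (lborel \<Otimes>\<^sub>M lborel) (\<lambda>(x, y). b x * c y)"
    using lborel_pair.Fubini_integrable[of "\<lambda>(x, y). b x * c y"]
  proof -
    have m: "(\<lambda>(x, y). b x * c y) \<in> borel_measurable (lborel \<Otimes>\<^sub>M lborel)" by measurable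
    have "integrable lborel (\<lambda>x. \<integral>y. norm (b x * c y) \<partial>lborel)"
      using ib ic by (simp add: abs_mult)
    then show ?thesis using lborel_pair.Fubini_integrable[OF m] ic by simp
  qed
  then have iF: "integrable (lborel \<Otimes>\<^sub>M lborel) (\<lambda>(x, y). ?F x y)"
  proof (rule Bochner_Integration.integrable_bound)
    show "AE z in lborel \<Otimes>\<^sub>M lborel. norm (case z of (x, y) \<Rightarrow> ?F x y) \<le> norm (case z of (x, y) \<Rightarrow> b x * c y)"
    proof (rule AE_I2, clarify)
      fix x y :: 'a
      show "norm (?F x y) \<le> norm (b x * c y)"
      proof (cases "norm x \<le> s \<and> norm y \<le> r + s")
        case True
        have "\<bar>k (x - y)\<bar> * \<bar>g x\<bar> \<le> C * D" using k' g' by (intro mult_mono) auto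
        from mult_right_mono[OF this, of "\<bar>h y\<bar>"] show ?thesis using True k' g'
          by (simp add: abs_mult mult_ac b_def c_def)
      next
        case False
        have "?F x y = 0"
        proof (cases "norm x > s")
          case False2: False
          then have "norm (x - y) > r" using False norm_triangle_ineq2[of y x] by (simp add: norm_minus_commute)
          then show ?thesis using k' by simp
        qed (use g' in simp)
        then have "norm (?F x y) = 0" by (simp only: norm_zero)
        also have "\<dots> \<le> norm (b x * c y)" by (rule norm_ge_zero)
        finally show ?thesis .
      qed
    qed
  qed measurable
  have "(\<integral>x. conv k h x * g x \<partial>lborel) = (\<integral>x. (\<integral>y. ?F x y \<partial>lborel) \<partial>lborel)"
    unfolding conv_def by simp
  also have "\<dots> = (\<integral>y. (\<integral>x. ?F x y \<partial>lborel) \<partial>lborel)"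
    using lborel_pair.Fubini_integral[OF iF] by simp
  also have "\<dots> = (\<integral>y. h y * conv k g y \<partial>lborel)"
  proof (rule Bochner_Integration.integral_cong)
    fix y
    have "?F x y = h y * (k (y - x) * g x)" for x using k(2)[of "x - y"] by simp
    then have e: "(\<lambda>x. ?F x y) = (\<lambda>x. h y * (k (y - x) * g x))" by (rule ext)
    show "(\<integral>x. ?F x y \<partial>lborel) = h y * conv k g y" unfolding conv_def e by simp
  qed simp
  finally show ?thesis .
qed

text \<open>The mollifying kernel: the bump normalised to integral one.\<close>
definition rho :: "real \<Rightarrow> 'a::euclidean_space \<Rightarrow> real" where
  "rho e x = bump e x / (\<integral>x. bump e (x::'a) \<partial>lborel)"

lemma Ck_rho: "Ck 3 (rho e)"
  unfolding rho_def[abs_def] using Ck_cmult[OF Ck_bump, of "1 / _"] by simp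

lemma cont_rho: "continuous_on UNIV (rho e)" using Ck_cont[OF Ck_rho] .

lemma csupp_rho: "csupp (rho e)"
  unfolding rho_def[abs_def] using csupp_mult1[OF csupp_bump, of e "\<lambda>x. 1 / _"] by simp

lemma bcs_rho: "bcs (rho e)" by (intro bcs_cont cont_rho csupp_rho)

lemma rho_even: "rho e (- x) = rho e x" by (simp add: rho_def bump_def)

lemma rho_0: "e > 0 \<Longrightarrow> norm x \<ge> e \<Longrightarrow> rho e x = 0" by (simp add: rho_def bump_eq_0)

text \<open>A vanishing integral would make the ball of radius e a null set.\<close>
lemma integral_bump_pos: assumes "e > 0" shows "(\<integral>x. bump e (x::'a::euclidean_space) \<partial>lborel) > 0"
proof -
  have i: "integrable lborel (bump e :: 'a \<Rightarrow> real)"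
    by (intro integrable_bcs bcs_cont csupp_bump Ck_cont[OF Ck_bump])
  have "(\<integral>x. bump e (x::'a) \<partial>lborel) \<noteq> 0"
  proof
    assume "(\<integral>x. bump e (x::'a) \<partial>lborel) = 0"
    then have "AE x in lborel. bump e (x::'a) = 0"
      using integral_nonneg_eq_0_iff_AE[OF i] bump_nonneg by blast
    then have "AE x in lborel. x \<notin> ball (0::'a) e"
      by eventually_elim (use bump_pos in force)
    then have "emeasure lborel (ball (0::'a) e) = 0"
      by (subst (asm) AE_iff_measurable[of "ball (0::'a) e"]) auto
    then show False using content_ball_pos[OF assms, of "0::'a"]
      by (simp add: measure_def)
  qed
  moreover have "(\<integral>x. bump e (x::'a) \<partial>lborel) \<ge> 0" by (intro Bochner_Integration.integral_nonneg bump_nonneg)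
  ultimately show ?thesis by linarith
qed

lemma rho_nonneg: "rho e x \<ge> 0"
  unfolding rho_def by (intro divide_nonneg_nonneg bump_nonneg Bochner_Integration.integral_nonneg)

lemma rho_integral: "e > 0 \<Longrightarrow> (\<integral>x. rho e (x::'a::euclidean_space) \<partial>lborel) = 1"
  unfolding rho_def using integral_bump_pos[of e, where 'a='a] by simp

lemma rho_integral_shift: assumes "e > 0" shows "(\<integral>y. rho e (x - y) \<partial>lborel) = 1"
  using lborel_reflect(1)[of "rho e" x] rho_integral[OF assms, where 'a='a]
    borel_measurable_continuous_onI[OF cont_rho[of e]] by simp

text \<open>A mollified value is an average over the ball of radius e; it moves away from c by at most the
oscillation of g around c on that ball.\<close>
lemma conv_rho_close:
  fixes g :: "'a::euclidean_space \<Rightarrow> real"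
  assumes e: "e > 0" and g: "lint g" and osc: "\<And>y. norm (x - y) \<le> e \<Longrightarrow> \<bar>g y - c\<bar> \<le> d"
  shows "\<bar>conv (rho e) g x - c\<bar> \<le> d"
proof -
  have i1: "integrable lborel (\<lambda>y. rho e (x - y))" by (intro integrable_bcs bcs_reflect bcs_rho)
  have i2: "integrable lborel (\<lambda>y. rho e (x - y) * g y)" by (intro conv_integrable bcs_rho g)
  have "conv (rho e) g x - c = (\<integral>y. rho e (x - y) * g y - c * rho e (x - y) \<partial>lborel)"
    unfolding conv_def using i1 i2 rho_integral_shift[OF e, of x] by simp
  also have "\<bar>\<dots>\<bar> \<le> (\<integral>y. \<bar>rho e (x - y) * g y - c * rho e (x - y)\<bar> \<partial>lborel)"
    by (rule integral_abs_bound)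
  also have "\<dots> \<le> (\<integral>y. d * rho e (x - y) \<partial>lborel)"
  proof (rule integral_mono)
    fix y
    show "\<bar>rho e (x - y) * g y - c * rho e (x - y)\<bar> \<le> d * rho e (x - y)"
    proof (cases "norm (x - y) \<le> e")
      case True
      have "\<bar>rho e (x - y) * g y - c * rho e (x - y)\<bar> = \<bar>g y - c\<bar> * rho e (x - y)"
        using rho_nonneg[of e "x - y"] by (simp add: abs_mult left_diff_distrib[symmetric] mult.commute)
      then show ?thesis using mult_right_mono[OF osc[OF True] rho_nonneg[of e "x - y"]] by simp
    next
      case False then show ?thesis using rho_0[OF e, of "x - y"] by simp
    qed
  qed (use i1 i2 in auto)
  also have "\<dots> = d" using rho_integral_shift[OF e, of x] by simp
  finally show ?thesis .
qed

section \<open>Weak convergence of mollifications\<close>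

text \<open>A sequence of mollification scales; since it is bounded by one, mollification enlarges supports by at most one.\<close>
definition eps :: "nat \<Rightarrow> real" where "eps n = 1 / real (Suc n)"

lemma eps_pos: "eps n > 0" and eps_le: "eps n \<le> 1" by (auto simp: eps_def)

lemma eps_0: "eps \<longlonglongrightarrow> 0" unfolding eps_def by (rule LIMSEQ_Suc[OF lim_const_over_n])

lemma conv_rho_pointwise:
  fixes g :: "'a::euclidean_space \<Rightarrow> real"
  assumes "continuous_on UNIV g"
  shows "(\<lambda>n. conv (rho (eps n)) g x) \<longlonglongrightarrow> g x"
proof (rule LIMSEQ_I)
  fix r :: real assume r: "r > 0"
  have "isCont g x" using assms continuous_on_eq_continuous_at[OF open_UNIV] by blast
  then obtain d where d: "d > 0" "\<And>y. dist y x < d \<Longrightarrow> dist (g y) (g x) < r/2"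
    using r unfolding continuous_at_eps_delta by (metis half_gt_zero)
  from order_tendstoD(2)[OF eps_0 d(1)] obtain N where N: "\<And>n. n \<ge> N \<Longrightarrow> eps n < d"
    unfolding eventually_sequentially by blast
  show "\<exists>no. \<forall>n\<ge>no. norm (conv (rho (eps n)) g x - g x) < r"
  proof (intro exI[of _ N] allI impI)
    fix n assume n: "n \<ge> N"
    have "\<bar>conv (rho (eps n)) g x - g x\<bar> \<le> r/2"
    proof (rule conv_rho_close[OF eps_pos lint_cont[OF assms]])
      fix y assume "norm (x - y) \<le> eps n"
      then have "dist y x < d" using N[OF n] by (simp add: dist_norm norm_minus_commute)
      then show "\<bar>g y - g x\<bar> \<le> r/2" using d(2)[of y] by (simp add: dist_real_def)
    qed
    then show "norm (conv (rho (eps n)) g x - g x) < r" using r by simp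
  qed
qed

lemma conv_rho_supp:
  assumes "\<And>x. norm x > s \<Longrightarrow> g x = 0" "e > 0" "norm x > s + e"
  shows "conv (rho e) g x = 0"
proof -
  have "rho e (x - y) * g y = 0" for y
  proof (cases "norm y > s")
    case False
    then have "norm (x - y) \<ge> e" using assms(3) norm_triangle_ineq2[of x y] by linarith
    then have "rho e (x - y) = 0" by (rule rho_0[OF assms(2)])
    then show ?thesis by simp
  qed (use assms in simp)
  then have e: "(\<lambda>y. rho e (x - y) * g y) = (\<lambda>y. 0)" by (rule ext)
  show ?thesis unfolding conv_def e by simp
qed

lemma conv_rho_bound:
  assumes "e > 0" "lint g" "\<And>x. \<bar>g x\<bar> \<le> C"
  shows "\<bar>conv (rho e) g x\<bar> \<le> C"
  using conv_rho_close[OF assms(1,2), of x 0 C] assms(3) by simp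

text \<open>For continuous g of compact support the mollifications converge pointwise and are bounded with supports in one ball, so
they may be tested against any locally integrable h.\<close>
lemma conv_rho_weak:
  fixes g :: "'a::euclidean_space \<Rightarrow> real"
  assumes h: "lint h" and g: "continuous_on UNIV g" "csupp g"
  shows "(\<lambda>n. \<integral>x. h x * conv (rho (eps n)) g x \<partial>lborel) \<longlonglongrightarrow> (\<integral>x. h x * g x \<partial>lborel)"
proof -
  obtain C s where C: "C > 0" "s > 0" "\<And>x. \<bar>g x\<bar> \<le> C" "\<And>x. norm x > s \<Longrightarrow> g x = 0"
    using bcsE[OF bcs_cont[OF g]] by metis
  have lg: "lint g" by (rule lint_cont[OF g(1)])
  have cm: "conv (rho (eps n)) g \<in> borel_measurable borel" for n
    by (intro borel_measurable_continuous_onI conv_continuous cont_rho csupp_rho lg)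
  have hm: "h \<in> borel_measurable borel" "g \<in> borel_measurable borel" using h lg lint_measurable by auto
  show ?thesis
  proof (rule integral_dominated_convergence[where w="\<lambda>x. C * \<bar>indicator (cball 0 (s + 1)) x * h x\<bar>"])
    show "integrable lborel (\<lambda>x. C * \<bar>indicator (cball 0 (s + 1)) x * h x\<bar>)"
      using h unfolding lint_def by auto
    show "AE x in lborel. (\<lambda>n. h x * conv (rho (eps n)) g x) \<longlonglongrightarrow> h x * g x"
      by (intro AE_I2 tendsto_intros conv_rho_pointwise g)
    fix n
    show "AE x in lborel. norm (h x * conv (rho (eps n)) g x) \<le> C * \<bar>indicator (cball 0 (s + 1)) x * h x\<bar>"
    proof (rule AE_I2)
      fix x
      show "norm (h x * conv (rho (eps n)) g x) \<le> C * \<bar>indicator (cball 0 (s + 1)) x * h x\<bar>"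
      proof (cases "norm x \<le> s + 1")
        case True
        have "\<bar>conv (rho (eps n)) g x\<bar> \<le> C" by (rule conv_rho_bound[OF eps_pos lg C(3)])
        from mult_right_mono[OF this, of "\<bar>h x\<bar>"] show ?thesis using True by (simp add: abs_mult mult.commute)
      next
        case False
        then have "conv (rho (eps n)) g x = 0"
          using eps_le[of n] by (intro conv_rho_supp[OF C(4)] eps_pos) auto
        then show ?thesis using C by simp
      qed
    qed
  qed (use cm hm in auto)
qed

lemma weak_zero_cont:
  fixes g :: "'a::euclidean_space \<Rightarrow> real"
  assumes g: "lint g" and z: "\<And>\<phi>. Ck 3 \<phi> \<Longrightarrow> csupp \<phi> \<Longrightarrow> (\<integral>x. g x * \<phi> x \<partial>lborel) = 0"
    and p: "continuous_on UNIV p" "csupp p"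
  shows "(\<integral>x. g x * p x \<partial>lborel) = 0"
proof -
  have "(\<integral>x. g x * conv (rho (eps n)) p x \<partial>lborel) = 0" for n
    by (intro z Ck_conv Ck_rho csupp_rho csupp_conv lint_cont p)
  then have "(\<lambda>n::nat. 0::real) \<longlonglongrightarrow> (\<integral>x. g x * p x \<partial>lborel)" using conv_rho_weak[OF g p] by simp
  from LIMSEQ_unique[OF tendsto_const this] show ?thesis by simp
qed

text \<open>The continuous cut-offs \<open>max 0 (1 - n * infdist x K)\<close> decrease to the indicator of K.\<close>
lemma weak_zero_compact:
  fixes g :: "'a::euclidean_space \<Rightarrow> real"
  assumes g: "lint g" and z: "\<And>\<phi>. Ck 3 \<phi> \<Longrightarrow> csupp \<phi> \<Longrightarrow> (\<integral>x. g x * \<phi> x \<partial>lborel) = 0"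
    and K: "compact K"
  shows "(\<integral>x. g x * indicator K x \<partial>lborel) = 0"
proof (cases "K = {}")
  case False
  define p where "p n x = max 0 (1 - real n * infdist x K)" for n x
  have pc: "continuous_on UNIV (p n)" for n unfolding p_def by (intro continuous_intros)
  obtain s where s: "\<And>x. x \<in> K \<Longrightarrow> norm x \<le> s" using compact_imp_bounded[OF K] unfolding bounded_iff by blast
  have far: "p (Suc n) x = 0" if "norm x > s + 1" for n x
  proof -
    have "infdist x K \<ge> 1"
      unfolding infdist_notempty[OF False]
    proof (rule cINF_greatest[OF False])
      fix a assume "a \<in> K"
      then show "1 \<le> dist x a" using s[of a] that norm_triangle_ineq2[of x a] by (simp add: dist_norm)
    qed
    then have "real (Suc n) * infdist x K \<ge> 1" using mult_mono[of 1 "real (Suc n)" 1 "infdist x K"] by simp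
    then show ?thesis unfolding p_def by simp
  qed
  have pb: "\<bar>p n x\<bar> \<le> 1" for n x unfolding p_def using infdist_nonneg[of x K] by auto
  have pl: "(\<lambda>n. p (Suc n) x) \<longlonglongrightarrow> indicator K x" for x
  proof (cases "x \<in> K")
    case True
    then have "infdist x K = 0" by simp
    then show ?thesis using True by (simp add: p_def)
  next
    case nx: False
    then have i: "infdist x K > 0"
      using in_closed_iff_infdist_zero[OF compact_imp_closed[OF K] False, of x] infdist_nonneg[of x K] by linarith
    then obtain N where N: "real N * infdist x K > 1" using ex_less_of_nat_mult by blast
    have "\<forall>\<^sub>F n in sequentially. p (Suc n) x = 0"
      unfolding eventually_sequentially
    proof (intro exI[of _ N] allI impI)
      fix n assume "N \<le> n"
      then have "real (Suc n) * infdist x K \<ge> real N * infdist x K" using i by (intro mult_right_mono) auto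
      then show "p (Suc n) x = 0" using N unfolding p_def by simp
    qed
    then show ?thesis using nx tendsto_eventually by (simp add: tendsto_eventually)
  qed
  have Kb: "K \<in> sets borel" using K compact_imp_closed borel_closed by blast
  have gm: "g \<in> borel_measurable borel" by (rule lint_measurable[OF g])
  have "(\<lambda>n. \<integral>x. g x * p (Suc n) x \<partial>lborel) \<longlonglongrightarrow> (\<integral>x. g x * indicator K x \<partial>lborel)"
  proof (rule integral_dominated_convergence[where w="\<lambda>x. \<bar>indicator (cball 0 (s + 1)) x * g x\<bar>"])
    show "integrable lborel (\<lambda>x. \<bar>indicator (cball 0 (s + 1)) x * g x\<bar>)"
      using g unfolding lint_def by auto
    show "AE x in lborel. (\<lambda>n. g x * p (Suc n) x) \<longlonglongrightarrow> g x * indicator K x"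
      by (intro AE_I2 tendsto_intros pl)
    fix n
    show "AE x in lborel. norm (g x * p (Suc n) x) \<le> \<bar>indicator (cball 0 (s + 1)) x * g x\<bar>"
    proof (rule AE_I2)
      fix x
      show "norm (g x * p (Suc n) x) \<le> \<bar>indicator (cball 0 (s + 1)) x * g x\<bar>"
        using far[of x n] mult_left_mono[OF pb[of "Suc n" x], of "\<bar>g x\<bar>"]
        by (cases "norm x \<le> s + 1") (auto simp: abs_mult)
    qed
  qed (use gm Kb borel_measurable_continuous_onI[OF pc] in auto)
  moreover have "(\<integral>x. g x * p (Suc n) x \<partial>lborel) = 0" for n
    using far by (intro weak_zero_cont[OF g z] pc) (auto simp: csupp_def intro!: exI[of _ "s + 1"])
  ultimately have "(\<lambda>n::nat. 0::real) \<longlonglongrightarrow> (\<integral>x. g x * indicator K x \<partial>lborel)" by simp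
  from LIMSEQ_unique[OF tendsto_const this] show ?thesis by simp
qed simp

text \<open>On every compact subset of \<open>{x. g x > 0}\<close> a positive function has integral zero, so the subset is null; by inner
regularity the whole set is null.\<close>
lemma AE_nonpos_of_compact:
  fixes g :: "'a::euclidean_space \<Rightarrow> real"
  assumes g: "lint g" and z: "\<And>K. compact K \<Longrightarrow> (\<integral>x. g x * indicator K x \<partial>lborel) = 0"
  shows "AE x in lborel. g x \<le> 0"
proof -
  have [measurable]: "g \<in> borel_measurable borel" by (rule lint_measurable[OF g])
  define A where "A n = {x. g x > 0} \<inter> ball 0 (real n)" for n
  have Ab [measurable]: "A n \<in> sets borel" for n unfolding A_def by measurable
  have "emeasure lborel (A n) = 0" for n
  proof -
    define M where "M = density lborel (indicator (ball (0::'a) (real n)))"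
    have Ms: "sets M = sets borel" "space M = UNIV" unfolding M_def by auto
    have eM: "emeasure M X = emeasure lborel (ball 0 (real n) \<inter> X)" if "X \<in> sets borel" for X
    proof -
      have "(indicator (ball (0::'a) (real n)) :: 'a \<Rightarrow> ennreal) \<in> borel_measurable lborel"
        by (intro borel_measurable_indicator) simp
      then show ?thesis unfolding M_def using that
        by (subst emeasure_density) (auto simp: indicator_inter_arith[symmetric] nn_integral_indicator)
    qed
    have "emeasure M (space M) \<noteq> \<infinity>" using eM[of UNIV] Ms emeasure_lborel_ball_finite[of "0::'a" "real n"] by auto
    from inner_regular[OF Ms(1) this Ab[of n]]
    have "emeasure M (A n) = (SUP K \<in> {K. K \<subseteq> A n \<and> compact K}. emeasure M K)" .
    also have "\<dots> = (SUP K \<in> {K. K \<subseteq> A n \<and> compact K}. 0)"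
    proof (rule SUP_cong[OF refl])
      fix K assume "K \<in> {K. K \<subseteq> A n \<and> compact K}"
      then have K: "K \<subseteq> A n" "compact K" by auto
      have Kb: "K \<in> sets borel" using K compact_imp_closed borel_closed by blast
      obtain s where s: "\<And>x. x \<in> K \<Longrightarrow> norm x \<le> s" using compact_imp_bounded[OF K(2)] unfolding bounded_iff by blast
      have bi: "bcs (indicator K)"
      proof -
        have "csupp (indicator K)" unfolding csupp_def using s by (intro exI[of _ s] allI impI) (metis indicator_simps(2) linorder_not_le)
        moreover have "\<forall>x. \<bar>indicator K x\<bar> \<le> (1::real)" by (simp add: indicator_def)
        ultimately show ?thesis unfolding bcs_def using borel_measurable_indicator[OF Kb] by blast
      qed
      have i: "integrable lborel (\<lambda>x. g x * indicator K x)" by (rule integrable_lint_bcs[OF g bi])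
      have "AE x in lborel. g x * indicator K x = 0"
      proof -
        have "0 \<le> g x * indicator K x" for x
          using K(1) by (cases "x \<in> K") (auto simp: A_def less_imp_le)
        then have "AE x in lborel. 0 \<le> g x * indicator K x" by (intro AE_I2)
        then show ?thesis using integral_nonneg_eq_0_iff_AE[OF i] z[OF K(2)] by blast
      qed
      then have "AE x in lborel. x \<notin> K"
      proof eventually_elim
        case (elim x)
        show ?case
        proof
          assume x: "x \<in> K"
          then have "g x > 0" using K(1) by (auto simp: A_def)
          then show False using elim x by simp
        qed
      qed
      then have "emeasure lborel K = 0" using Kb by (subst (asm) AE_iff_measurable[of K]) auto
      then show "emeasure M K = 0" using eM[OF Kb] emeasure_mono[of "ball 0 (real n) \<inter> K" K lborel] Kb by simp
    qed
    also have "\<dots> = 0" by (simp add: bot_ennreal[symmetric])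
    finally show ?thesis using eM[OF Ab[of n]] by (simp add: A_def Int_ac)
  qed
  then have "AE x in lborel. \<forall>n. x \<notin> A n"
    by (intro AE_all_countable[THEN iffD2] allI AE_not_in) (auto simp: null_sets_def)
  then show ?thesis
  proof eventually_elim
    case (elim x)
    obtain n where "norm x < real n" using reals_Archimedean2 by blast
    then show ?case using elim unfolding A_def by force
  qed
qed

text \<open>Fundamental lemma of the calculus of variations. Orthogonality to C^3 test functions extends to continuous ones by
mollification, then to indicators of compact sets, and finally the two sign sets of g are null by regularity.\<close>
lemma weak_zero_AE:
  fixes g :: "'a::euclidean_space \<Rightarrow> real"
  assumes g: "lint g" and z: "\<And>\<phi>. Ck 3 \<phi> \<Longrightarrow> csupp \<phi> \<Longrightarrow> (\<integral>x. g x * \<phi> x \<partial>lborel) = 0"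
  shows "AE x in lborel. g x = 0"
proof -
  have n: "lint (\<lambda>x. - g x)" using lint_diff[OF lint_cont[of "\<lambda>x. 0"] g] by simp
  have "AE x in lborel. g x \<le> 0" by (rule AE_nonpos_of_compact[OF g weak_zero_compact[OF g z]])
  moreover have "AE x in lborel. - g x \<le> 0"
    by (rule AE_nonpos_of_compact[OF n]) (simp add: weak_zero_compact[OF g z])
  ultimately show ?thesis by eventually_elim simp
qed

text \<open>Jensen's inequality for the average with weights \<open>rho e (x - y)\<close>: the weighted variance of h around its own average c is
nonnegative.\<close>
lemma conv_square_le:
  fixes h :: "'a::euclidean_space \<Rightarrow> real"
  assumes e: "e > 0" and h: "h \<in> borel_measurable borel" "integrable lborel (\<lambda>x. (h x)\<^sup>2)"
  shows "(conv (rho e) h x)\<^sup>2 \<le> conv (rho e) (\<lambda>x. (h x)\<^sup>2) x"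
proof -
  define c where "c = conv (rho e) h x"
  have lh: "lint h" "lint (\<lambda>x. (h x)\<^sup>2)" using lint_square[OF h] integrable_lint[OF h(2)] by auto
  have i0: "integrable lborel (\<lambda>y. rho e (x - y))" by (intro integrable_bcs bcs_reflect bcs_rho)
  have i1: "integrable lborel (\<lambda>y. rho e (x - y) * h y)" by (intro conv_integrable bcs_rho lh)
  have i2: "integrable lborel (\<lambda>y. rho e (x - y) * (h y)\<^sup>2)" by (intro conv_integrable bcs_rho lh)
  have "0 \<le> (\<integral>y. rho e (x - y) * (h y - c)\<^sup>2 \<partial>lborel)"
    by (intro Bochner_Integration.integral_nonneg mult_nonneg_nonneg rho_nonneg) auto
  also have "\<dots> = (\<integral>y. rho e (x - y) * (h y)\<^sup>2 - 2 * c * (rho e (x - y) * h y) + c\<^sup>2 * rho e (x - y) \<partial>lborel)"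
    by (intro Bochner_Integration.integral_cong) (auto simp: power2_eq_square algebra_simps)
  also have "\<dots> = conv (rho e) (\<lambda>x. (h x)\<^sup>2) x - 2 * c * c + c\<^sup>2"
    using i0 i1 i2 rho_integral_shift[OF e, of x] unfolding conv_def c_def by simp
  finally show ?thesis unfolding c_def[symmetric] by (simp add: power2_eq_square)
qed

text \<open>Tonelli, integrating the kernel first.\<close>
lemma conv_rho_L1:
  fixes h :: "'a::euclidean_space \<Rightarrow> real"
  assumes e: "e > 0" and h: "integrable lborel h" "\<And>x. h x \<ge> 0"
  shows "integrable lborel (conv (rho e) h)" "(\<integral>x. conv (rho e) h x \<partial>lborel) = (\<integral>x. h x \<partial>lborel)"
proof -
  have [measurable]: "h \<in> borel_measurable borel" "rho e \<in> borel_measurable (borel :: 'a measure)"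
    using h borel_measurable_continuous_onI[OF cont_rho] by auto
  have r: "(\<integral>x. rho e (x - y) \<partial>lborel) = 1" for y :: 'a
    using lborel_shift(1)[of "rho e" "- y"] rho_integral[OF e, where 'a='a] by simp
  have ir: "integrable lborel (\<lambda>x. rho e (x - y))" for y :: 'a
    using lborel_shift(2)[of "rho e" "- y"] integrable_bcs[OF bcs_rho] by simp
  have iF: "integrable (lborel \<Otimes>\<^sub>M lborel) (\<lambda>(y, x). rho e (x - y) * h y)"
  proof (rule lborel_pair.Fubini_integrable)
    have "(\<lambda>y. \<integral>x. norm (rho e (x - y) * h y) \<partial>lborel) = h"
      using r h(2) by (simp add: abs_mult abs_of_nonneg[OF rho_nonneg])
    then show "integrable lborel (\<lambda>y. \<integral>x. norm (case (y, x) of (y, x) \<Rightarrow> rho e (x - y) * h y) \<partial>lborel)"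
      using h by simp
    show "AE y in lborel. integrable lborel (\<lambda>x. case (y, x) of (y, x) \<Rightarrow> rho e (x - y) * h y)"
      using ir by (intro AE_I2) auto
  qed measurable
  have "(\<integral>y. (\<integral>x. rho e (x - y) * h y \<partial>lborel) \<partial>lborel) = (\<integral>x. conv (rho e) h x \<partial>lborel)"
    using lborel_pair.Fubini_integral[OF iF] unfolding conv_def by simp
  then show "(\<integral>x. conv (rho e) h x \<partial>lborel) = (\<integral>x. h x \<partial>lborel)" using r by simp
  show "integrable lborel (conv (rho e) h)"
    using lborel_pair.integrable_snd[OF iF] unfolding conv_def[abs_def] .
qed

text \<open>Mollification is a contraction of L^2, by Jensen's inequality and the mass preservation of \<open>conv_rho_L1\<close>.\<close>
lemma conv_rho_L2:
  fixes h :: "'a::euclidean_space \<Rightarrow> real"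
  assumes e: "e > 0" and h: "h \<in> borel_measurable borel" "integrable lborel (\<lambda>x. (h x)\<^sup>2)"
  shows "integrable lborel (\<lambda>x. (conv (rho e) h x)\<^sup>2)"
    "(\<integral>x. (conv (rho e) h x)\<^sup>2 \<partial>lborel) \<le> (\<integral>x. (h x)\<^sup>2 \<partial>lborel)"
proof -
  have m: "conv (rho e) h \<in> borel_measurable borel"
    by (intro borel_measurable_continuous_onI conv_continuous cont_rho csupp_rho lint_square h)
  note L1 = conv_rho_L1[OF e h(2)]
  show i: "integrable lborel (\<lambda>x. (conv (rho e) h x)\<^sup>2)"
  proof (rule Bochner_Integration.integrable_bound)
    show "integrable lborel (conv (rho e) (\<lambda>x. (h x)\<^sup>2))" using L1 by simp
    show "AE x in lborel. norm ((conv (rho e) h x)\<^sup>2) \<le> norm (conv (rho e) (\<lambda>x. (h x)\<^sup>2) x)"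
      by (intro AE_I2) (use conv_square_le[OF e h] in \<open>simp add: abs_le_D1 abs_of_nonneg order.trans[OF _ abs_ge_self]\<close>)
  qed (use m in auto)
  have "(\<integral>x. (conv (rho e) h x)\<^sup>2 \<partial>lborel) \<le> (\<integral>x. conv (rho e) (\<lambda>x. (h x)\<^sup>2) x \<partial>lborel)"
    by (intro integral_mono i conv_square_le[OF e h]) (use L1 in simp)
  then show "(\<integral>x. (conv (rho e) h x)\<^sup>2 \<partial>lborel) \<le> (\<integral>x. (h x)\<^sup>2 \<partial>lborel)" using L1 by simp
qed

section \<open>Existence of directional derivatives of Lipschitz functions\<close>

definition quot :: "('a::real_normed_vector \<Rightarrow> real) \<Rightarrow> 'a \<Rightarrow> 'a \<Rightarrow> real \<Rightarrow> real" where
  "quot f v x t = (f (x + t *\<^sub>R v) - f x) / t"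

text \<open>Instead of upper and lower limits, the two sets of points where difference quotients above (below) a level q occur
at arbitrarily small scales. These sets are visibly Borel.\<close>
definition Uset :: "('a::real_normed_vector \<Rightarrow> real) \<Rightarrow> 'a \<Rightarrow> real \<Rightarrow> 'a set" where
  "Uset f v q = {x. \<forall>n. \<exists>t. t \<noteq> 0 \<and> \<bar>t\<bar> < eps n \<and> quot f v x t > q}"

definition Lset :: "('a::real_normed_vector \<Rightarrow> real) \<Rightarrow> 'a \<Rightarrow> real \<Rightarrow> 'a set" where
  "Lset f v q = {x. \<forall>n. \<exists>t. t \<noteq> 0 \<and> \<bar>t\<bar> < eps n \<and> quot f v x t < q}"

lemma quot_uminus: "quot (\<lambda>x. - f x) v x t = - quot f v x t"
  unfolding quot_def by (simp add: minus_divide_left)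

lemma Uset_uminus: "Uset f v q = Lset (\<lambda>x. - f x) v (- q)"
  unfolding Uset_def Lset_def quot_uminus by simp

text \<open>The union over uncountably many increments t is a union of open sets, hence open.\<close>
lemma Lset_borel:
  assumes "continuous_on UNIV f" shows "Lset f v q \<in> sets borel"
proof -
  have o: "open {x. quot f v x t < q}" for t
    unfolding quot_def divide_inverse
    by (intro open_Collect_less continuous_intros continuous_on_compose2[OF assms]) auto
  have "Lset f v q = (\<Inter>n. \<Union>t\<in>{t. t \<noteq> 0 \<and> \<bar>t\<bar> < eps n}. {x. quot f v x t < q})"
    unfolding Lset_def by auto
  also have "\<dots> \<in> sets borel"
    by (intro sets.countable_INT'' borel_open open_UN ballI o) auto
  finally show ?thesis .
qed

lemma Uset_borel: "continuous_on UNIV f \<Longrightarrow> Uset f v q \<in> sets borel"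
  unfolding Uset_uminus by (intro Lset_borel continuous_intros)

text \<open>The supremum s of the levels exceeded at arbitrarily small scales is the upper derivate. If no rational pair
separates the derivates, then quotients below \<open>s - r/2\<close> stop to occur at small scales, too.\<close>
lemma quot_limit:
  assumes bnd: "\<And>t. t \<noteq> 0 \<Longrightarrow> \<bar>quot f v x t\<bar> \<le> L"
    and ns: "\<And>p q. p \<in> \<rat> \<Longrightarrow> q \<in> \<rat> \<Longrightarrow> p < q \<Longrightarrow> x \<notin> Lset f v p \<inter> Uset f v q"
  shows "\<exists>d. (quot f v x \<longlongrightarrow> d) (at 0)"
proof -
  define S where "S = {q. x \<in> Uset f v q}"
  have up: "q \<le> L" if "q \<in> S" for q
    using that bnd unfolding S_def Uset_def by (force simp: abs_le_iff)
  have "- L - 1 \<in> S"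
  proof -
    have "\<exists>t. t \<noteq> 0 \<and> \<bar>t\<bar> < eps n \<and> quot f v x t > - L - 1" for n
      using eps_pos[of n] bnd[of "eps n / 2"] by (intro exI[of _ "eps n / 2"]) (auto simp: abs_le_iff)
    then show ?thesis unfolding S_def Uset_def by blast
  qed
  then have ne: "S \<noteq> {}" by blast
  have bdd: "bdd_above S" using up by (intro bdd_aboveI)
  define s where "s = Sup S"
  have "(quot f v x \<longlongrightarrow> s) (at 0)"
  proof (rule LIM_I)
    fix r :: real assume r: "r > 0"
    have "s + r/2 \<notin> S" using cSup_upper[OF _ bdd, of "s + r/2"] r unfolding s_def by auto
    then obtain n where n: "\<And>t. t \<noteq> 0 \<Longrightarrow> \<bar>t\<bar> < eps n \<Longrightarrow> quot f v x t \<le> s + r/2"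
      unfolding S_def Uset_def by (simp add: not_less) (metis linorder_not_less)
    obtain q where q: "q \<in> S" "s - r/4 < q" using less_cSup_iff[OF ne bdd, of "s - r/4"] r unfolding s_def by auto
    obtain q' where q': "q' \<in> \<rat>" "s - r/4 < q'" "q' < q" using Rats_dense_in_real[OF q(2)] by blast
    obtain p where p: "p \<in> \<rat>" "s - r/2 < p" "p < s - r/4" using Rats_dense_in_real[of "s - r/2" "s - r/4"] r by auto
    have "x \<in> Uset f v q'" using q(1) q'(3) unfolding S_def Uset_def
      by simp (meson order.strict_trans)
    then have "x \<notin> Lset f v p" using ns[OF p(1) q'(1)] p q' by auto
    then obtain m where m: "\<And>t. t \<noteq> 0 \<Longrightarrow> \<bar>t\<bar> < eps m \<Longrightarrow> quot f v x t \<ge> p"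
      unfolding Lset_def by (simp add: not_less) (metis linorder_not_less)
    show "\<exists>d>0. \<forall>t. t \<noteq> 0 \<and> norm (t - 0) < d \<longrightarrow> norm (quot f v x t - s) < r"
    proof (intro exI[of _ "min (eps n) (eps m)"] conjI allI impI)
      fix t :: real assume t: "t \<noteq> 0 \<and> norm (t - 0) < min (eps n) (eps m)"
      then have "quot f v x t \<le> s + r/2" "quot f v x t \<ge> p" using n m by auto
      then show "norm (quot f v x t - s) < r" using p r by (simp add: abs_less_iff)
    qed (use eps_pos in auto)
  qed
  then show ?thesis by blast
qed

text \<open>The Stieltjes measures of F and G add up to K times Lebesgue measure: this is clear on half-open intervals, which form
a generator stable under intersection. Everything is intersected with a bounded interval to keep the measures finite
when passing to complements.\<close>
lemma interval_measure_sum: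
  fixes F G :: "real \<Rightarrow> real"
  assumes F: "mono F" "continuous_on UNIV F" and G: "mono G" "continuous_on UNIV G"
    and s: "\<And>x. F x + G x = K * x"
    and A: "A \<in> sets borel"
  shows "emeasure (interval_measure F) (A \<inter> {-B<..B}) + emeasure (interval_measure G) (A \<inter> {-B<..B})
     = ennreal K * emeasure lborel (A \<inter> {-B<..B})"
proof -
  have K: "K \<ge> 0" using monoD[OF F(1), of 0 1] monoD[OF G(1), of 0 1] s[of 0] s[of 1] by simp
  have cF: "continuous (at_right a) F" and cG: "continuous (at_right a) G" for a
    using F(2) G(2) by (auto simp: continuous_on_eq_continuous_at continuous_at_imp_continuous_within)
  have eF: "emeasure (interval_measure F) {a<..b} = ennreal (F b - F a)" if "a \<le> b" for a b
    by (rule emeasure_interval_measure_Ioc[OF that]) (use monoD[OF F(1)] cF in auto)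
  have eG: "emeasure (interval_measure G) {a<..b} = ennreal (G b - G a)" if "a \<le> b" for a b
    by (rule emeasure_interval_measure_Ioc[OF that]) (use monoD[OF G(1)] cG in auto)
  have ioc: "emeasure (interval_measure F) {a<..b} + emeasure (interval_measure G) {a<..b}
     = ennreal K * emeasure lborel {a<..b}" for a b
  proof (cases "a \<le> b")
    case True
    have "emeasure (interval_measure F) {a<..b} + emeasure (interval_measure G) {a<..b} = ennreal ((F b - F a) + (G b - G a))"
      using eF[OF True] eG[OF True] monoD[OF F(1) True] monoD[OF G(1) True] by (simp add: ennreal_plus)
    also have "(F b - F a) + (G b - G a) = K * (b - a)" using s[of a] s[of b] by (simp add: algebra_simps)
    finally show ?thesis using True K by (simp add: ennreal_mult)
  qed simp
  have gen: "sets (borel::real measure) = sigma_sets UNIV (range (\<lambda>(a, b). {a<..b::real}))"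
    using borel_sigma_sets_Ioc by (metis (no_types) sets_measure_of top_greatest UNIV_I Pow_UNIV)
  have ist: "Int_stable (range (\<lambda>(a, b). {a<..b::real}))"
  proof (rule Int_stableI)
    fix X Y :: "real set" assume "X \<in> range (\<lambda>(a, b). {a<..b})" "Y \<in> range (\<lambda>(a, b). {a<..b})"
    then obtain a b c d where "X = {a<..b}" "Y = {c<..d}" by auto
    then have "X \<inter> Y = (\<lambda>(a, b). {a<..b}) (max a c, min b d)" by auto
    then show "X \<inter> Y \<in> range (\<lambda>(a, b). {a<..b})" by blast
  qed
  let ?I = "{-B<..B}"
  let ?m = "\<lambda>A. emeasure (interval_measure F) (A \<inter> ?I) + emeasure (interval_measure G) (A \<inter> ?I)"
  let ?l = "\<lambda>A. ennreal K * emeasure lborel (A \<inter> ?I)"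
  show "?m A = ?l A"
    using A
  proof (induction rule: sigma_sets_induct_disjoint[OF ist _ A[unfolded gen], simplified])
    case (1 A)
    then obtain a b where "A = {a<..b}" by auto
    then have "A \<inter> ?I = {max a (-B)<..min b B}" by auto
    then show ?case using ioc by simp
  next
    case 2 then show ?case by simp
  next
    case (3 A)
    then have Ab: "A \<in> sets borel" using gen by simp
    have e: "(UNIV - A) \<inter> ?I = ?I - A \<inter> ?I" by auto
    have fin: "emeasure (interval_measure F) ?I < \<infinity>" "emeasure (interval_measure G) ?I < \<infinity>" "emeasure lborel ?I < \<infinity>"
      using eF[of "-B" B] eG[of "-B" B] by (cases "-B \<le> B"; simp)+
    have fin2: "emeasure (interval_measure F) (A \<inter> ?I) \<noteq> \<infinity>" "emeasure (interval_measure G) (A \<inter> ?I) \<noteq> \<infinity>" "emeasure lborel (A \<inter> ?I) \<noteq> \<infinity>"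
      using fin emeasure_mono[of "A \<inter> ?I" ?I] by (metis inf_le2 sets_interval_measure sets_lborel greaterThanAtMost_borel leD infinity_ennreal_def)+
    have "?m (UNIV - A) + ?m A = ?l (UNIV - A) + ?l A"
    proof -
      have d: "emeasure N ((UNIV - A) \<inter> ?I) + emeasure N (A \<inter> ?I) = emeasure N ?I" if "sets N = sets borel" for N
      proof -
        have "emeasure N ((UNIV - A) \<inter> ?I) + emeasure N (A \<inter> ?I) = emeasure N (((UNIV - A) \<inter> ?I) \<union> (A \<inter> ?I))"
          using Ab that by (intro plus_emeasure) auto
        also have "((UNIV - A) \<inter> ?I) \<union> (A \<inter> ?I) = ?I" by auto
        finally show ?thesis .
      qed
      have "?m (UNIV - A) + ?m A = emeasure (interval_measure F) ?I + emeasure (interval_measure G) ?I"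
        using d[of "interval_measure F"] d[of "interval_measure G"] by (simp add: ac_simps)
      also have "\<dots> = ennreal K * emeasure lborel ?I" by (rule ioc)
      also have "\<dots> = ?l (UNIV - A) + ?l A" using d[of lborel] by (simp add: distrib_left[symmetric])
      finally show ?thesis .
    qed
    moreover have "?m A = ?l A" using 3 Ab by simp
    ultimately have "?l A + ?m (UNIV - A) = ?l A + ?l (UNIV - A)" by (metis add.commute)
    moreover have "?l A \<noteq> \<infinity>" using fin2 by (simp add: ennreal_mult_eq_top_iff)
    ultimately show ?case using ennreal_add_left_cancel by blast
  next
    case (4 A)
    then have Ab: "A i \<in> sets borel" for i using gen by auto
    have e: "(\<Union>i. A i) \<inter> ?I = (\<Union>i. A i \<inter> ?I)" by auto
    have sm: "(\<Sum>i. emeasure N (A i \<inter> ?I)) = emeasure N ((\<Union>i. A i) \<inter> ?I)" if "sets N = sets borel" for N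
      unfolding e using 4(1) Ab that
      by (intro suminf_emeasure) (auto simp: disjoint_family_on_def)
    have "?m (\<Union>i. A i) = (\<Sum>i. ?m (A i))"
      unfolding sm[of "interval_measure F", OF sets_interval_measure, symmetric] sm[of "interval_measure G", OF sets_interval_measure, symmetric]
      by (intro suminf_add) auto
    also have "\<dots> = (\<Sum>i. ?l (A i))" using 4 Ab by (intro suminf_cong) simp
    also have "\<dots> = ?l (\<Union>i. A i)" using sm[of lborel] by (simp add: ennreal_suminf_cmult)
    finally show ?case .
  qed
qed

text \<open>If F has arbitrarily short chords of slope less than p at every point of E, then a Vitali covering of E by such chords inside
a slightly larger open set shows that the Stieltjes measure of E is at most p times its length. The remainder left over
by the covering is Lebesgue null; absolute continuity makes it null for the Stieltjes measure as well.\<close>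
lemma derivate_measure_le:
  fixes F :: "real \<Rightarrow> real"
  assumes F: "mono F" "continuous_on UNIV F"
    and ac: "\<And>A. A \<in> sets borel \<Longrightarrow> A \<subseteq> {-B<..B} \<Longrightarrow> emeasure lborel A = 0 \<Longrightarrow> emeasure (interval_measure F) A = 0"
    and E: "E \<in> sets borel" "E \<subseteq> {-B<..B}" "E \<subseteq> Lset F 1 p"
  shows "emeasure (interval_measure F) E \<le> ennreal p * emeasure lborel E"
proof -
  let ?nu = "interval_measure F"
  have step: "emeasure ?nu E \<le> ennreal p * (emeasure lborel E + ennreal e)" if e: "e > 0" for e
  proof -
    obtain U where U: "open U" "E \<subseteq> U" "emeasure lborel (U - E) < e"
      using outer_regular_lborel[OF E(1) e] by metis
    define K where "K = {(a, r). r > 0 \<and> cball a r \<subseteq> U \<and> F (a + r) - F (a - r) < p * (2 * r)}"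
    have "\<exists>i\<in>K. x \<in> cball (fst i) (snd i) \<and> snd i < d" if x: "x \<in> E" and d: "d > 0" for x d
    proof -
      obtain b where b: "b > 0" "ball x b \<subseteq> U" using U x open_contains_ball by blast
      obtain n where n: "eps n < min d b" using order_tendstoD(2)[OF eps_0, of "min d b"] b d
        unfolding eventually_sequentially by auto
      obtain t where t: "t \<noteq> 0" "\<bar>t\<bar> < eps n" "quot F 1 x t < p" using E(3) x unfolding Lset_def by blast
      \<comment> \<open>the ball with diameter from x to x + t: its end points are exactly the two points of the chord, whatever the sign of t\<close>
      define a r where "a = x + t / 2" and "r = \<bar>t\<bar> / 2"
      have r: "r > 0" "r < d" using t n by (auto simp: r_def)
      have xa: "x \<in> cball a r" by (simp add: a_def r_def dist_real_def)
      have "cball a r \<subseteq> ball x b"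
      proof
        fix y assume "y \<in> cball a r"
        then have "\<bar>x + t / 2 - y\<bar> \<le> \<bar>t\<bar> / 2" by (simp add: a_def r_def dist_real_def)
        then have "\<bar>x - y\<bar> \<le> \<bar>t\<bar>" by (auto simp: abs_if split: if_splits)
        then show "y \<in> ball x b" using t n by (simp add: dist_real_def)
      qed
      moreover have "F (a + r) - F (a - r) < p * (2 * r)"
      proof (cases "t > 0")
        case True
        then have e: "a + r = x + t" "a - r = x" "2 * r = t" by (auto simp: a_def r_def)
        show ?thesis unfolding e using t(3) True unfolding quot_def by (simp add: divide_less_eq)
      next
        case False
        then have e: "a + r = x" "a - r = x + t" "2 * r = - t" by (auto simp: a_def r_def)
        show ?thesis unfolding e using t(1,3) False unfolding quot_def by (simp add: divide_less_eq)
      qed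
      ultimately have "(a, r) \<in> K" using b r unfolding K_def by auto
      then show ?thesis using xa r by (intro bexI[of _ "(a, r)"]) auto
    qed
    then have cov: "\<exists>i. i \<in> K \<and> x \<in> cball (fst i) (snd i) \<and> snd i < d" if "x \<in> E" "d > 0" for x d
      using that by blast
    have Kp: "snd i > 0" if "i \<in> K" for i using that unfolding K_def by auto
    obtain C where C: "countable C" "C \<subseteq> K"
      "pairwise (\<lambda>i j. disjnt (cball (fst i) (snd i)) (cball (fst j) (snd j))) C"
      "negligible (E - (\<Union>i\<in>C. cball (fst i) (snd i)))"
      using Vitali_covering_theorem_cballs[of K snd E fst, OF Kp cov] by blast
    define W where "W = (\<Union>i\<in>C. cball (fst i) (snd i))"
    have dj: "disjoint_family_on (\<lambda>i. cball (fst i) (snd i)) C"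
      using C(3) by (auto simp: disjoint_family_on_def pairwise_def disjnt_def)
    have Wb: "W \<in> sets borel" unfolding W_def using C(1) by (intro sets.countable_UN') auto
    have "cball (fst i) (snd i) \<subseteq> U" if "i \<in> K" for i using that unfolding K_def by auto
    then have WU: "W \<subseteq> U" unfolding W_def using C(2) by blast
    have "emeasure lborel (E - W) = 0"
      using C(4) E(1) Wb unfolding W_def[symmetric] negligible_iff_null_sets
      by (subst (asm) null_sets_completion_iff) (auto simp: null_sets_def)
    then have z: "emeasure ?nu (E - W) = 0" using E Wb by (intro ac) auto
    have "emeasure ?nu W = (\<integral>\<^sup>+i. emeasure ?nu (cball (fst i) (snd i)) \<partial>count_space C)"
      unfolding W_def by (intro emeasure_UN_countable C dj) auto
    also have "\<dots> \<le> (\<integral>\<^sup>+i. ennreal p * emeasure lborel (cball (fst i) (snd i)) \<partial>count_space C)"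
    proof (rule nn_integral_mono)
      fix i assume "i \<in> space (count_space C)"
      then have i: "i \<in> K" using C by auto
      obtain a r where ar: "i = (a, r)" by (cases i)
      have r: "r > 0" "F (a + r) - F (a - r) < p * (2 * r)" using i ar unfolding K_def by auto
      have "emeasure ?nu {a - r..a + r} = ennreal (F (a + r) - F (a - r))"
        using r(1) by (intro emeasure_interval_measure_Icc F(2)) (use monoD[OF F(1)] in auto)
      also have "\<dots> \<le> ennreal (p * (2 * r))" using r(2) by (intro ennreal_leI) simp
      also have "\<dots> = ennreal p * ennreal (2 * r)" using r(1) by (intro ennreal_mult'') simp
      also have "ennreal (2 * r) = emeasure lborel {a - r..a + r}" using r(1) by simp
      finally show "emeasure ?nu (cball (fst i) (snd i)) \<le> ennreal p * emeasure lborel (cball (fst i) (snd i))"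
        using ar by (simp add: cball_eq_atLeastAtMost)
    qed
    also have "\<dots> = ennreal p * (\<integral>\<^sup>+i. emeasure lborel (cball (fst i) (snd i)) \<partial>count_space C)"
      by (rule nn_integral_cmult) simp
    also have "(\<integral>\<^sup>+i. emeasure lborel (cball (fst i) (snd i)) \<partial>count_space C) = emeasure lborel W"
      unfolding W_def by (intro emeasure_UN_countable[symmetric] C dj) auto
    also have "ennreal p * emeasure lborel W \<le> ennreal p * (emeasure lborel E + ennreal e)"
    proof (rule mult_left_mono)
      have "emeasure lborel W \<le> emeasure lborel (E \<union> (U - E))"
        using WU U E(1) by (intro emeasure_mono) auto
      also have "\<dots> \<le> emeasure lborel E + emeasure lborel (U - E)"
        using U(1) E(1) by (intro emeasure_subadditive) auto
      also have "\<dots> \<le> emeasure lborel E + ennreal e" using U(3) by (intro add_left_mono) simp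
      finally show "emeasure lborel W \<le> emeasure lborel E + ennreal e" .
    qed simp
    finally have "emeasure ?nu W \<le> ennreal p * (emeasure lborel E + ennreal e)" .
    moreover have "emeasure ?nu E \<le> emeasure ?nu (W \<union> (E - W))" using E Wb by (intro emeasure_mono) auto
    moreover have "\<dots> \<le> emeasure ?nu W + emeasure ?nu (E - W)" using E Wb by (intro emeasure_subadditive) auto
    ultimately show ?thesis using z by (metis add.right_neutral order.trans)
  qed
  show ?thesis
  proof (rule ennreal_le_epsilon)
    fix e :: real assume e: "e > 0"
    have "emeasure ?nu E \<le> ennreal p * (emeasure lborel E + ennreal (e / (\<bar>p\<bar> + 1)))"
      using e by (intro step) simp
    also have "\<dots> = ennreal p * emeasure lborel E + ennreal p * ennreal (e / (\<bar>p\<bar> + 1))" by (rule distrib_left)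
    also have "ennreal p * ennreal (e / (\<bar>p\<bar> + 1)) = ennreal (p * (e / (\<bar>p\<bar> + 1)))"
      using e by (intro ennreal_mult''[symmetric]) simp
    also have "\<dots> \<le> ennreal e"
      using e by (intro ennreal_leI) (simp add: field_simps abs_if)
    finally show "emeasure ?nu E \<le> ennreal p * emeasure lborel E + ennreal e" by (simp add: add_left_mono)
  qed
qed

text \<open>Let E be the set where the lower derivate of f is below p and the upper one above q. For large M
the functions \<open>M * x + f x\<close> and \<open>M * x - f x\<close> are increasing, with Stieltjes measures adding up to 2 M times Lebesgue
measure. On E their lower derivates are below \<open>M + p\<close> and \<open>M - q\<close>, whence \<open>2 * M * \<bar>E\<bar> \<le> (2 * M + p - q) * \<bar>E\<bar>\<close> for the Lebesgue
measure \<open>\<bar>E\<bar>\<close> of bounded pieces of E; as p < q, this forces \<open>\<bar>E\<bar> = 0\<close>.\<close>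
lemma derivates_agree_AE:
  fixes f :: "real \<Rightarrow> real"
  assumes f: "L-lipschitz_on UNIV f" and pq: "p < q"
  shows "emeasure lborel (Lset f 1 p \<inter> Uset f 1 q) = 0"
proof -
  \<comment> \<open>large enough for both functions to be increasing and for both slopes below to be positive\<close>
  define M where "M = L + \<bar>p\<bar> + \<bar>q\<bar> + 1"
  have L0: "L \<ge> 0" using f lipschitz_on_nonneg by blast
  have M: "M + p > 0" "M - q > 0" "M > 0" "L \<le> M" using L0 by (auto simp: M_def)
  have fc: "continuous_on UNIV f" using f lipschitz_on_continuous_on by blast
  define F G where "F x = M * x + f x" and "G x = M * x - f x" for x
  have lip: "\<bar>f y - f x\<bar> \<le> M * (y - x)" if "x \<le> y" for x y
  proof -
    have "\<bar>f y - f x\<bar> \<le> L * \<bar>y - x\<bar>" using lipschitz_on_normD[OF f, of y x] by simp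
    also have "\<dots> \<le> M * \<bar>y - x\<bar>" using M(4) by (intro mult_right_mono) auto
    finally show ?thesis using that by simp
  qed
  have F: "mono F" "continuous_on UNIV F" and G: "mono G" "continuous_on UNIV G"
  proof -
    show "mono F" "mono G"
    proof (rule_tac [!] monoI)
      fix x y :: real assume "x \<le> y"
      from lip[OF this] have "f y - f x \<le> M * y - M * x" "f x - f y \<le> M * y - M * x"
        unfolding abs_le_iff right_diff_distrib by auto
      then show "F x \<le> F y" "G x \<le> G y" unfolding F_def G_def by linarith+
    qed
    show "continuous_on UNIV F" "continuous_on UNIV G"
      unfolding F_def[abs_def] G_def[abs_def] by (intro continuous_intros fc)+
  qed
  have s: "F x + G x = 2 * M * x" for x by (simp add: F_def G_def)
  define E where "E = Lset f 1 p \<inter> Uset f 1 q"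
  have Eb: "E \<in> sets borel" unfolding E_def using Lset_borel[OF fc] Uset_borel[OF fc] by auto
  have qF: "quot F 1 x t = M + quot f 1 x t" "quot G 1 x t = M - quot f 1 x t" if "t \<noteq> 0" for x t
    using that unfolding quot_def F_def G_def by (auto simp: field_simps)
  have EF: "E \<subseteq> Lset F 1 (M + p)"
  proof
    fix x assume "x \<in> E"
    then have "\<exists>t. t \<noteq> 0 \<and> \<bar>t\<bar> < eps n \<and> quot f 1 x t < p" for n unfolding E_def Lset_def by blast
    then obtain T where T: "\<And>n. T n \<noteq> 0 \<and> \<bar>T n\<bar> < eps n \<and> quot f 1 x (T n) < p" by metis
    have "T n \<noteq> 0 \<and> \<bar>T n\<bar> < eps n \<and> quot F 1 x (T n) < M + p" for n using T[of n] qF(1)[of "T n" x] by simp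
    then show "x \<in> Lset F 1 (M + p)" unfolding Lset_def by blast
  qed
  have EG: "E \<subseteq> Lset G 1 (M - q)"
  proof
    fix x assume "x \<in> E"
    then have "\<exists>t. t \<noteq> 0 \<and> \<bar>t\<bar> < eps n \<and> quot f 1 x t > q" for n unfolding E_def Uset_def by blast
    then obtain T where T: "\<And>n. T n \<noteq> 0 \<and> \<bar>T n\<bar> < eps n \<and> quot f 1 x (T n) > q" by metis
    have "T n \<noteq> 0 \<and> \<bar>T n\<bar> < eps n \<and> quot G 1 x (T n) < M - q" for n using T[of n] qF(2)[of "T n" x] by simp
    then show "x \<in> Lset G 1 (M - q)" unfolding Lset_def by blast
  qed
  have "emeasure lborel (E \<inter> {-B<..B}) = 0" for B
  proof -
    let ?E = "E \<inter> {-B<..B}"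
    note S = interval_measure_sum[OF F G s]
    have ac: "emeasure (interval_measure F) A = 0" "emeasure (interval_measure G) A = 0"
      if "A \<in> sets borel" "A \<subseteq> {-B<..B}" "emeasure lborel A = 0" for A
      using S[OF that(1), of B] that by (auto simp: Int_absorb2)
    have fin: "emeasure lborel ?E < \<infinity>"
      using emeasure_mono[of ?E "{-B<..B}" lborel] by (cases "-B \<le> B") (auto simp: top.not_eq_extremum intro: le_less_trans)
    then obtain m where m: "emeasure lborel ?E = ennreal m" "m \<ge> 0" by (cases "emeasure lborel ?E") auto
    have "ennreal (2 * M) * emeasure lborel ?E = emeasure (interval_measure F) ?E + emeasure (interval_measure G) ?E"
      using S[OF Eb, of B] by simp
    also have "\<dots> \<le> ennreal (M + p) * emeasure lborel ?E + ennreal (M - q) * emeasure lborel ?E"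
      using Eb EF EG by (intro add_mono derivate_measure_le F G ac) auto
    also have "\<dots> = ennreal ((M + p) * m + (M - q) * m)"
      using M m by (simp add: ennreal_mult[symmetric] ennreal_plus[symmetric] del: ennreal_plus)
    finally have "ennreal (2 * M * m) \<le> ennreal ((M + p) * m + (M - q) * m)"
      using M m by (simp add: ennreal_mult[symmetric])
    then have "2 * M * m \<le> (M + p) * m + (M - q) * m"
      using M m by (subst (asm) ennreal_le_iff) auto
    then have "(q - p) * m \<le> 0" by (simp add: algebra_simps)
    then have "m = 0" using pq m(2) by (simp add: mult_le_0_iff)
    then show ?thesis using m by simp
  qed
  then have "AE x in lborel. \<forall>n::nat. x \<notin> E \<inter> {-real n<..real n}"
    using Eb by (intro AE_all_countable[THEN iffD2] allI AE_not_in) (auto simp: null_sets_def)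
  then have "AE x in lborel. x \<notin> E"
  proof eventually_elim
    case (elim x)
    obtain n where "\<bar>x\<bar> < real n" using reals_Archimedean2 by blast
    then show ?case using elim[rule_format, of n] by (auto simp: abs_less_iff)
  qed
  then show ?thesis using Eb unfolding E_def[symmetric] by (subst (asm) AE_iff_measurable[of E]) auto
qed

text \<open>Average the translates of N along the segment from 0 to v and exchange the integrals: each translate has the measure of N,
while the integral along each line vanishes. No coordinates adapted to v are needed.\<close>
lemma null_of_null_slices:
  fixes N :: "'a::euclidean_space set"
  assumes N: "N \<in> sets borel" and z: "\<And>x. emeasure lborel {s::real. x + s *\<^sub>R v \<in> N} = 0"
  shows "emeasure lborel N = 0"
proof -
  have [measurable]: "(indicator N :: 'a \<Rightarrow> ennreal) \<in> borel_measurable borel" using N by simp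
  let ?F = "\<lambda>s x. indicator {0..1} s * indicator N (x + s *\<^sub>R v) :: ennreal"
  have sh: "(\<integral>\<^sup>+x. indicator N (x + s *\<^sub>R v) \<partial>lborel) = emeasure lborel N" for s
  proof -
    have "(\<integral>\<^sup>+x. indicator N x \<partial>distr lborel borel ((+) (s *\<^sub>R v))) = (\<integral>\<^sup>+x. indicator N (s *\<^sub>R v + x) \<partial>lborel)"
      by (rule nn_integral_distr) auto
    then show ?thesis unfolding lborel_distr_plus using N by (simp add: add.commute)
  qed
  have "(\<integral>\<^sup>+s. (\<integral>\<^sup>+x. ?F s x \<partial>lborel) \<partial>lborel) = (\<integral>\<^sup>+s. indicator {0..1::real} s * emeasure lborel N \<partial>lborel)"
    by (simp add: nn_integral_cmult sh)
  also have "\<dots> = emeasure lborel N" by (simp add: nn_integral_multc)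
  finally have 1: "emeasure lborel N = (\<integral>\<^sup>+s. (\<integral>\<^sup>+x. ?F s x \<partial>lborel) \<partial>lborel)" by simp
  have "(\<integral>\<^sup>+s. (\<integral>\<^sup>+x. ?F s x \<partial>lborel) \<partial>lborel) = (\<integral>\<^sup>+x. (\<integral>\<^sup>+s. ?F s x \<partial>lborel) \<partial>lborel)"
    by (rule lborel_pair.Fubini') measurable
  also have "\<dots> = 0"
  proof -
    have "(\<integral>\<^sup>+s. ?F s x \<partial>lborel) = 0" for x
    proof -
      have m: "{s::real. x + s *\<^sub>R v \<in> N} \<in> sets borel"
        using measurable_sets[of "\<lambda>s. x + s *\<^sub>R v" borel borel N] N by (simp add: vimage_def)
      have "(\<integral>\<^sup>+s. ?F s x \<partial>lborel) \<le> (\<integral>\<^sup>+s. indicator {s. x + s *\<^sub>R v \<in> N} s \<partial>lborel)"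
        by (intro nn_integral_mono) (auto simp: indicator_def)
      also have "\<dots> = 0" using m z by simp
      finally show ?thesis by simp
    qed
    then show ?thesis by simp
  qed
  finally show ?thesis using 1 by simp
qed

text \<open>On each line parallel to v the exceptional sets are those of a Lipschitz function of one variable, hence null; countably
many rational pairs suffice.\<close>
lemma lipschitz_dir_deriv_AE:
  fixes F :: "'a::euclidean_space \<Rightarrow> real"
  assumes F: "L-lipschitz_on UNIV F"
  shows "AE x in lborel. \<exists>d. (quot F v x \<longlongrightarrow> d) (at 0)"
proof -
  have Fc: "continuous_on UNIV F" using F lipschitz_on_continuous_on by blast
  have L0: "L \<ge> 0" using F lipschitz_on_nonneg by blast
  have null: "emeasure lborel (Lset F v p \<inter> Uset F v q) = 0" if "p < q" for p q
  proof (rule null_of_null_slices)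
    show "Lset F v p \<inter> Uset F v q \<in> sets borel" using Lset_borel[OF Fc] Uset_borel[OF Fc] by auto
    fix x
    define g where "g s = F (x + s *\<^sub>R v)" for s
    have gl: "(L * norm v)-lipschitz_on UNIV g"
    proof (rule lipschitz_onI)
      fix s t :: real
      have "\<bar>g s - g t\<bar> \<le> L * norm (s *\<^sub>R v - t *\<^sub>R v)"
        using lipschitz_on_normD[OF F, of "x + s *\<^sub>R v" "x + t *\<^sub>R v"] by (simp add: g_def)
      also have "\<dots> = L * norm v * \<bar>s - t\<bar>" by (simp flip: scaleR_diff_left)
      finally show "dist (g s) (g t) \<le> L * norm v * dist s t" by (simp add: dist_real_def)
    qed (use L0 in simp)
    have "quot F v (x + s *\<^sub>R v) t = quot g 1 s t" for s t
      unfolding quot_def g_def by (simp add: algebra_simps)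
    then have "{s. x + s *\<^sub>R v \<in> Lset F v p \<inter> Uset F v q} = Lset g 1 p \<inter> Uset g 1 q"
      unfolding Lset_def Uset_def by auto
    then show "emeasure lborel {s. x + s *\<^sub>R v \<in> Lset F v p \<inter> Uset F v q} = 0"
      using derivates_agree_AE[OF gl that] by simp
  qed
  have "AE x in lborel. \<forall>z\<in>{z \<in> \<rat> \<times> \<rat>. fst z < snd z}. x \<notin> Lset F v (fst z) \<inter> Uset F v (snd z)"
  proof (intro AE_ball_countable[THEN iffD2] ballI AE_not_in)
    show "countable {z \<in> \<rat> \<times> \<rat>. fst z < (snd z :: real)}"
      by (rule countable_subset[of _ "\<rat> \<times> \<rat>"]) (auto simp: countable_rat)
  qed (use null Lset_borel[OF Fc] Uset_borel[OF Fc] in \<open>auto simp: null_sets_def\<close>)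
  then show ?thesis
  proof eventually_elim
    case (elim x)
    show ?case
    proof (rule quot_limit)
      fix t :: real assume t: "t \<noteq> 0"
      have "\<bar>F (x + t *\<^sub>R v) - F x\<bar> \<le> L * norm v * \<bar>t\<bar>"
        using lipschitz_on_normD[OF F, of "x + t *\<^sub>R v" x] by (simp add: mult_ac)
      then show "\<bar>quot F v x t\<bar> \<le> L * norm v" unfolding quot_def using t by (simp add: divide_le_eq)
    next
      fix p q :: real assume "p \<in> \<rat>" "q \<in> \<rat>" "p < q"
      then show "x \<notin> Lset F v p \<inter> Uset F v q" using elim[rule_format, of "(p, q)"] by auto
    qed
  qed
qed

section \<open>Rademacher's theorem\<close>

text \<open>A partial derivative that is Borel measurable without any assumption on differentiability: the limit along the fixed
null sequence \<open>eps\<close>. Where the directional derivative exists it equals it (\<open>pd_eqI\<close>); elsewhere its value is irrelevant.\<close>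
definition pd :: "'a::euclidean_space \<Rightarrow> ('a \<Rightarrow> real) \<Rightarrow> 'a \<Rightarrow> real" where
  "pd v f x = lim (\<lambda>n. quot f v x (eps n))"

lemma eps_at_0: "filterlim eps (at 0) sequentially"
  using eps_0 eps_pos by (auto simp: filterlim_at less_imp_neq[symmetric] intro!: always_eventually)

lemma pd_eqI: "(quot f v x \<longlongrightarrow> d) (at 0) \<Longrightarrow> pd v f x = d"
  unfolding pd_def by (rule limI) (rule filterlim_compose[OF _ eps_at_0])

lemma pd_measurable:
  assumes "continuous_on UNIV f" shows "pd v f \<in> borel_measurable borel"
proof -
  have "(\<lambda>x. quot f v x (eps n)) \<in> borel_measurable borel" for n
    unfolding quot_def divide_inverse
    by (intro borel_measurable_continuous_onI continuous_intros continuous_on_compose2[OF assms]) auto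
  then show ?thesis unfolding pd_def[abs_def] by (rule borel_measurable_lim_metric)
qed

lemma quot_differentiable: "f differentiable (at x) \<Longrightarrow> (quot f v x \<longlongrightarrow> dd v f x) (at 0)"
  using dd_quotient unfolding quot_def[abs_def] .

lemma pd_differentiable: "f differentiable (at x) \<Longrightarrow> pd v f x = dd v f x"
  using quot_differentiable pd_eqI by blast

text \<open>Lipschitz on bounded sets. On Euclidean space this is the same as locally Lipschitz, by compactness of balls, but it is easier to
handle under products and cut-offs.\<close>
definition blip :: "('a::euclidean_space \<Rightarrow> real) \<Rightarrow> bool" where
  "blip f \<longleftrightarrow> (\<forall>r. \<exists>L. L-lipschitz_on (cball 0 r) f)"

lemma blip_lipschitz: "L-lipschitz_on UNIV f \<Longrightarrow> blip f"
  unfolding blip_def using lipschitz_on_subset by blast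

lemma blip_cont: assumes "blip f" shows "continuous_on UNIV f"
proof -
  have "isCont f x" for x
  proof -
    obtain L where "L-lipschitz_on (cball 0 (norm x + 1)) f" using assms unfolding blip_def by blast
    then have "continuous_on (ball 0 (norm x + 1)) f"
      by (meson ball_subset_cball continuous_on_subset lipschitz_on_continuous_on)
    moreover have "x \<in> ball 0 (norm x + 1)" by simp
    ultimately show ?thesis using continuous_on_eq_continuous_at[OF open_ball] by blast
  qed
  then show ?thesis using continuous_at_imp_continuous_on by blast
qed

lemma locally_lipschitz_blip:
  fixes f :: "'a::euclidean_space \<Rightarrow> real"
  assumes "locally_lipschitz_on UNIV f" shows "blip f"
  unfolding blip_def
proof
  fix r
  have "local_lipschitz {0::real} (cball 0 r) (\<lambda>_. f)"
  proof (rule local_lipschitzI)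
    fix t :: real and x :: 'a assume "x \<in> cball 0 r"
    obtain u L where u: "u > 0" "L-lipschitz_on (cball x u) f"
      using assms unfolding locally_lipschitz_on_def by (metis Int_UNIV_right UNIV_I)
    then have "L-lipschitz_on (cball x u \<inter> cball 0 r) f" using lipschitz_on_subset by blast
    then show "\<exists>u>0. \<exists>L. \<forall>t\<in>cball t u \<inter> {0}. L-lipschitz_on (cball x u \<inter> cball 0 r) f"
      using u by blast
  qed
  moreover have "continuous_on {0} (\<lambda>_. f x)" for x by simp
  ultimately obtain L where "\<And>t. t \<in> {0::real} \<Longrightarrow> L-lipschitz_on (cball 0 r) f"
    using local_lipschitz_compact_implies_lipschitz[of "{0::real}" "cball 0 r" "\<lambda>_. f"] by auto
  then show "\<exists>L. L-lipschitz_on (cball 0 r) f" by blast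
qed

lemma blip_mult:
  assumes "blip f" "blip g" shows "blip (\<lambda>x. f x * g x)"
  unfolding blip_def
proof
  fix r
  obtain L M where L: "L-lipschitz_on (cball 0 r) f" and M: "M-lipschitz_on (cball 0 r) g"
    using assms unfolding blip_def by metis
  have "\<exists>B. B \<ge> 0 \<and> (\<forall>x\<in>cball 0 r. \<bar>h x\<bar> \<le> B)" if "blip h" for h :: "'a \<Rightarrow> real"
  proof -
    have "compact (h ` cball 0 r)"
      by (intro compact_continuous_image continuous_on_subset[OF blip_cont[OF that]]) auto
    then obtain B where "\<And>x. x \<in> cball 0 r \<Longrightarrow> \<bar>h x\<bar> \<le> B"
      by (force dest!: compact_imp_bounded simp: bounded_iff)
    then show ?thesis by (intro exI[of _ "\<bar>B\<bar>"]) force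
  qed
  then obtain B C where B: "B \<ge> 0" "\<And>x. x \<in> cball 0 r \<Longrightarrow> \<bar>f x\<bar> \<le> B"
    and C: "C \<ge> 0" "\<And>x. x \<in> cball 0 r \<Longrightarrow> \<bar>g x\<bar> \<le> C" using assms by metis
  have "(B * M + C * L)-lipschitz_on (cball 0 r) (\<lambda>x. f x * g x)"
  proof (rule lipschitz_onI)
    fix x y :: 'a assume xy: "x \<in> cball 0 r" "y \<in> cball 0 r"
    have "f x * g x - f y * g y = f x * (g x - g y) + g y * (f x - f y)" by (simp add: algebra_simps)
    also have "\<bar>\<dots>\<bar> \<le> \<bar>f x\<bar> * \<bar>g x - g y\<bar> + \<bar>g y\<bar> * \<bar>f x - f y\<bar>"
      by (metis abs_mult abs_triangle_ineq)
    also have "\<dots> \<le> B * (M * dist x y) + C * (L * dist x y)"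
      using lipschitz_onD[OF L xy] lipschitz_onD[OF M xy] B(2)[OF xy(1)] C(2)[OF xy(2)] B(1) C(1)
      by (intro add_mono mult_mono) (auto simp: dist_real_def)
    finally show "dist (f x * g x) (f y * g y) \<le> (B * M + C * L) * dist x y"
      by (simp add: dist_real_def algebra_simps)
  qed (use B C lipschitz_on_nonneg[OF L] lipschitz_on_nonneg[OF M] in auto)
  then show "\<exists>L. L-lipschitz_on (cball 0 r) (\<lambda>x. f x * g x)" by blast
qed

text \<open>Two points of which one lies in the support are either both in the ball of radius r + 1, where L works, or at
distance at least one, where the bound B of f works as a Lipschitz constant.\<close>
lemma blip_csupp_lipschitz:
  assumes f: "blip f" "csupp f"
  obtains L where "L-lipschitz_on UNIV f"
proof -
  obtain B r where B: "B > 0" "r > 0" "\<And>x. \<bar>f x\<bar> \<le> B" "\<And>x. norm x > r \<Longrightarrow> f x = 0"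
    using bcsE[OF bcs_cont[OF blip_cont[OF f(1)] f(2)]] by metis
  obtain L where L: "L-lipschitz_on (cball 0 (r + 1)) f" using f unfolding blip_def by blast
  have L0: "L \<ge> 0" using lipschitz_on_nonneg[OF L] .
  have half: "\<bar>f x - f y\<bar> \<le> max L B * dist x y" if "norm x \<le> r" for x y
  proof (cases "norm y \<le> r + 1")
    case True
    have "\<bar>f x - f y\<bar> \<le> L * dist x y" using lipschitz_onD[OF L, of x y] that True by (simp add: dist_real_def)
    also have "\<dots> \<le> max L B * dist x y" by (intro mult_right_mono) auto
    finally show ?thesis .
  next
    case False
    have d: "1 \<le> dist x y" using that False norm_triangle_ineq2[of y x] by (simp add: dist_norm norm_minus_commute)
    have "\<bar>f x - f y\<bar> \<le> B" using B(3)[of x] B(4)[of y] False by simp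
    also have "B \<le> max L B * dist x y" using mult_mono[of B "max L B" 1 "dist x y"] B(1) d by simp
    finally show ?thesis .
  qed
  have "(max L B)-lipschitz_on UNIV f"
  proof (rule lipschitz_onI)
    fix x y
    show "dist (f x) (f y) \<le> max L B * dist x y"
    proof (cases "norm x \<le> r")
      case True then show ?thesis using half by (simp add: dist_real_def)
    next
      case nx: False
      show ?thesis
      proof (cases "norm y \<le> r")
        case True then show ?thesis using half[of y x] by (simp add: dist_real_def dist_commute abs_minus_commute)
      next
        case False
        then have "f x = 0" "f y = 0" using nx B(4) by auto
        then show ?thesis using L0 by simp
      qed
    qed
  qed (use L0 in simp)
  then show ?thesis using that by blast
qed

lemma blip_Ck1: "Ck 1 f \<Longrightarrow> csupp f \<Longrightarrow> blip f"
  using Ck1_lipschitz blip_lipschitz by metis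

lemma quot_mult:
  assumes "(quot f v x \<longlongrightarrow> a) (at 0)" "(quot g v x \<longlongrightarrow> b) (at 0)"
  shows "(quot (\<lambda>x. f x * g x) v x \<longlongrightarrow> a * g x + f x * b) (at 0)"
proof -
  have D: "((\<lambda>t. h (x + t *\<^sub>R v)) has_real_derivative c) (at 0) \<longleftrightarrow> (quot h v x \<longlongrightarrow> c) (at 0)" for h c
    unfolding has_field_derivative_iff quot_def[abs_def] by simp
  have "((\<lambda>t. f (x + t *\<^sub>R v) * g (x + t *\<^sub>R v)) has_real_derivative (a * g (x + 0 *\<^sub>R v) + b * f (x + 0 *\<^sub>R v))) (at 0)"
    using assms by (intro DERIV_mult) (auto simp: D)
  then show ?thesis using D[of "\<lambda>x. f x * g x"] by (simp add: mult.commute)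
qed

text \<open>The product with the test function is Lipschitz with compact support, so \<open>integral_dir_deriv_zero\<close> applies to it.\<close>
lemma integral_by_parts_dir:
  fixes f :: "'a::euclidean_space \<Rightarrow> real"
  assumes f: "blip f" and ae: "AE x in lborel. \<exists>d. (quot f v x \<longlongrightarrow> d) (at 0)" and p: "Ck 1 p" "csupp p"
  shows "integrable lborel (\<lambda>x. pd v f x * p x)"
    "(\<integral>x. pd v f x * p x \<partial>lborel) = - (\<integral>x. f x * dd v p x \<partial>lborel)"
proof -
  have fc: "continuous_on UNIV f" by (rule blip_cont[OF f])
  have pc: "continuous_on UNIV p" "continuous_on UNIV (dd v p)" using Ck_cont[OF p(1)] p by auto
  have cs: "csupp (\<lambda>x. f x * p x)" by (rule csupp_mult2[OF p(2)])
  obtain L where L: "L-lipschitz_on UNIV (\<lambda>x. f x * p x)"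
    using blip_csupp_lipschitz[OF blip_mult[OF f blip_Ck1[OF p]] cs] .
  define d where "d x = pd v f x * p x + f x * dd v p x" for x
  have dm: "d \<in> borel_measurable borel" unfolding d_def[abs_def]
    using pd_measurable[OF fc] borel_measurable_continuous_onI[OF pc(1)] borel_measurable_continuous_onI[OF pc(2)]
      borel_measurable_continuous_onI[OF fc] by measurable
  have lim: "AE x in lborel. ((\<lambda>t. (f (x + t *\<^sub>R v) * p (x + t *\<^sub>R v) - f x * p x) / t) \<longlongrightarrow> d x) (at 0)"
    using ae
  proof eventually_elim
    case (elim x)
    then obtain e where e: "(quot f v x \<longlongrightarrow> e) (at 0)" by blast
    have "(quot p v x \<longlongrightarrow> dd v p x) (at 0)" using p by (intro quot_differentiable) auto
    from quot_mult[OF e this] show ?case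
      unfolding d_def pd_eqI[OF e] quot_def[abs_def] .
  qed
  note Z = integral_dir_deriv_zero[OF L cs dm lim]
  have i2: "integrable lborel (\<lambda>x. f x * dd v p x)"
    by (intro integrable_lint_bcs lint_cont fc bcs_cont pc csupp_dd p)
  have "integrable lborel (\<lambda>x. d x - f x * dd v p x)" using Z(1) i2 by (rule Bochner_Integration.integrable_diff)
  then show i1: "integrable lborel (\<lambda>x. pd v f x * p x)" unfolding d_def by simp
  show "(\<integral>x. pd v f x * p x \<partial>lborel) = - (\<integral>x. f x * dd v p x \<partial>lborel)"
    using Z(2) i1 i2 unfolding d_def by simp
qed

text \<open>The derivative in a direction v exists almost everywhere and depends linearly on v almost everywhere, since by integration by
parts both sides of the linearity relation have the same integral against every test function. So outside one null set
this holds for all v in a countable dense set. By compactness of the unit sphere finitely many of these directions approximate all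
others, and the Lipschitz bound turns the convergence along them into Frechet differentiability.\<close>
lemma rademacher_csupp:
  fixes F :: "'a::euclidean_space \<Rightarrow> real"
  assumes F: "L-lipschitz_on UNIV F" "csupp F"
  shows "AE x in lborel. F differentiable (at x)"
proof -
  have Fb: "blip F" by (rule blip_lipschitz[OF F(1)])
  have Fc: "continuous_on UNIV F" by (rule blip_cont[OF Fb])
  have L0: "L \<ge> 0" using F lipschitz_on_nonneg by blast
  note ae = lipschitz_dir_deriv_AE[OF F(1)]
  have ipd: "integrable lborel (pd v F)" for v
  proof (rule integral_dir_deriv_zero(1)[OF F pd_measurable[OF Fc]])
    show "AE x in lborel. ((\<lambda>t. (F (x + t *\<^sub>R v) - F x) / t) \<longlongrightarrow> pd v F x) (at 0)"
      using ae[of v]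
    proof eventually_elim
      case (elim x)
      then obtain d where d: "(quot F v x \<longlongrightarrow> d) (at 0)" by blast
      show ?case using d unfolding pd_eqI[OF d] unfolding quot_def[abs_def] .
    qed
  qed
  have lin: "AE x in lborel. pd v F x - (\<Sum>b\<in>Basis. (v \<bullet> b) * pd b F x) = 0" for v
  proof (rule weak_zero_AE)
    show "lint (\<lambda>x. pd v F x - (\<Sum>b\<in>Basis. (v \<bullet> b) * pd b F x))"
      by (intro integrable_lint Bochner_Integration.integrable_diff Bochner_Integration.integrable_sum integrable_mult_right ipd)
    fix p :: "'a \<Rightarrow> real" assume p3: "Ck 3 p" and ps: "csupp p"
    have p: "Ck 1 p" using Ck_le[OF p3, of 1] by simp
    have pc: "continuous_on UNIV p" "continuous_on UNIV (dd v p)" for v using Ck_cont[OF p(1)] p by auto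
    note I = integral_by_parts_dir[OF Fb ae p ps]
    have i2: "integrable lborel (\<lambda>x. F x * dd v p x)" for v
      by (intro integrable_lint_bcs lint_cont Fc bcs_cont pc csupp_dd ps)
    have "(\<integral>x. (pd v F x - (\<Sum>b\<in>Basis. (v \<bullet> b) * pd b F x)) * p x \<partial>lborel)
      = (\<integral>x. pd v F x * p x - (\<Sum>b\<in>Basis. (v \<bullet> b) * (pd b F x * p x)) \<partial>lborel)"
      by (intro Bochner_Integration.integral_cong) (auto simp: left_diff_distrib sum_distrib_right mult.assoc)
    also have "\<dots> = (\<integral>x. pd v F x * p x \<partial>lborel) - (\<Sum>b\<in>Basis. (v \<bullet> b) * (\<integral>x. pd b F x * p x \<partial>lborel))"
      using I(1) by (simp add: Bochner_Integration.integral_sum)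
    also have "\<dots> = - (\<integral>x. F x * dd v p x \<partial>lborel) + (\<Sum>b\<in>Basis. (v \<bullet> b) * (\<integral>x. F x * dd b p x \<partial>lborel))"
      unfolding I(2) by (simp add: sum_negf)
    also have "(\<Sum>b\<in>Basis. (v \<bullet> b) * (\<integral>x. F x * dd b p x \<partial>lborel)) = (\<integral>x. (\<Sum>b\<in>Basis. (v \<bullet> b) * (F x * dd b p x)) \<partial>lborel)"
      using i2 by (subst Bochner_Integration.integral_sum) auto
    also have "\<dots> = (\<integral>x. F x * dd v p x \<partial>lborel)"
    proof (intro Bochner_Integration.integral_cong refl)
      fix x
      have "dd v p x = (\<Sum>b\<in>Basis. (v \<bullet> b) * dd b p x)" using p by (intro dd_basis) auto
      then show "(\<Sum>b\<in>Basis. (v \<bullet> b) * (F x * dd b p x)) = F x * dd v p x"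
        by (simp add: sum_distrib_left mult_ac)
    qed
    finally show "(\<integral>x. (pd v F x - (\<Sum>b\<in>Basis. (v \<bullet> b) * pd b F x)) * p x \<partial>lborel) = 0" by simp
  qed
  obtain D :: "'a set" where D: "countable D" "\<And>X. open X \<Longrightarrow> X \<noteq> {} \<Longrightarrow> \<exists>d\<in>D. d \<in> X"
    using countable_dense_exists by blast
  have "AE x in lborel. \<forall>v\<in>D. (\<exists>d. (quot F v x \<longlongrightarrow> d) (at 0)) \<and> pd v F x - (\<Sum>b\<in>Basis. (v \<bullet> b) * pd b F x) = 0"
    using ae lin D(1) by (auto simp: AE_ball_countable)
  then show ?thesis
  proof eventually_elim
    case (elim x)
    define g where "g = (\<Sum>b\<in>Basis. pd b F x *\<^sub>R b)"
    have q: "(quot F v x \<longlongrightarrow> g \<bullet> v) (at 0)" if "v \<in> D" for v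
    proof -
      obtain d where d: "(quot F v x \<longlongrightarrow> d) (at 0)" using elim \<open>v \<in> D\<close> by blast
      have "pd v F x = (\<Sum>b\<in>Basis. (v \<bullet> b) * pd b F x)" using elim \<open>v \<in> D\<close> by auto
      also have "\<dots> = g \<bullet> v" by (simp add: g_def inner_sum_left inner_commute[of v] mult.commute)
      finally show ?thesis using d pd_eqI[OF d] by simp
    qed
    have "(F has_derivative (\<lambda>h. g \<bullet> h)) (at x)"
      unfolding has_derivative_at_alt
    proof (intro conjI allI impI)
      show "bounded_linear (\<lambda>h. g \<bullet> h)" by (rule bounded_linear_inner_right)
      fix e :: real assume e: "e > 0"
      \<comment> \<open>the three error terms at the end add up to L + 1 + norm g times this quantity\<close>
      define e' where "e' = e / (L + 1 + norm g)"
      have den: "L + 1 + norm g > 0" using L0 norm_ge_zero[of g] by linarith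
      have e': "e' > 0" "(L + 1 + norm g) * e' = e" using e den by (auto simp: e'_def)
      have "compact (sphere (0::'a) 1)" by simp
      moreover have "sphere (0::'a) 1 \<subseteq> (\<Union>v\<in>D. ball v e')"
      proof
        fix u :: 'a assume "u \<in> sphere 0 1"
        obtain d where "d \<in> D" "d \<in> ball u e'" using D(2)[of "ball u e'"] e' by auto
        then show "u \<in> (\<Union>v\<in>D. ball v e')" by (auto simp: dist_commute)
      qed
      ultimately obtain V where V: "V \<subseteq> D" "finite V" "sphere (0::'a) 1 \<subseteq> (\<Union>v\<in>V. ball v e')"
        using compactE_image[of "sphere (0::'a) 1" D "\<lambda>v. ball v e'"] by auto
      have "\<forall>\<^sub>F t in at 0. \<forall>v\<in>V. \<bar>quot F v x t - g \<bullet> v\<bar> < e'"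
      proof (rule eventually_ball_finite[OF V(2)], rule ballI)
        fix v assume "v \<in> V"
        then have "(quot F v x \<longlongrightarrow> g \<bullet> v) (at 0)" using q V by blast
        from tendstoD[OF this e'(1)] show "\<forall>\<^sub>F t in at 0. \<bar>quot F v x t - g \<bullet> v\<bar> < e'"
          by (simp add: dist_real_def)
      qed
      then obtain d where d: "d > 0" "\<And>t v. t \<noteq> 0 \<Longrightarrow> \<bar>t\<bar> < d \<Longrightarrow> v \<in> V \<Longrightarrow> \<bar>quot F v x t - g \<bullet> v\<bar> < e'"
        unfolding eventually_at by (auto simp: dist_real_def)
      show "\<exists>d>0. \<forall>y. norm (y - x) < d \<longrightarrow> norm (F y - F x - g \<bullet> (y - x)) \<le> e * norm (y - x)"
      proof (intro exI[of _ d] conjI allI impI d(1))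
        fix y assume y: "norm (y - x) < d"
        show "norm (F y - F x - g \<bullet> (y - x)) \<le> e * norm (y - x)"
        proof (cases "y = x")
          case False
          define t where "t = norm (y - x)"
          define u where "u = (y - x) /\<^sub>R t"
          have t: "t > 0" "t < d" using False y by (auto simp: t_def)
          have u: "norm u = 1" "y - x = t *\<^sub>R u" using t by (auto simp: u_def t_def)
          then have "u \<in> sphere 0 1" by simp
          then obtain v where v: "v \<in> V" "dist v u < e'" using V by auto
          have 1: "\<bar>F y - F (x + t *\<^sub>R v)\<bar> \<le> L * (t * e')"
          proof -
            have "y - (x + t *\<^sub>R v) = t *\<^sub>R (u - v)" using u(2) by (simp add: algebra_simps)
            then have "norm (y - (x + t *\<^sub>R v)) \<le> t * e'" using t v(2) by (simp add: dist_norm norm_minus_commute)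
            then show ?thesis using lipschitz_on_normD[OF F(1), of y "x + t *\<^sub>R v"] mult_left_mono[OF _ L0] by fastforce
          qed
          have 2: "\<bar>F (x + t *\<^sub>R v) - F x - t * (g \<bullet> v)\<bar> \<le> t * e'"
          proof -
            have "\<bar>quot F v x t - g \<bullet> v\<bar> < e'" using d(2)[of t v] t v by simp
            moreover have "F (x + t *\<^sub>R v) - F x - t * (g \<bullet> v) = t * (quot F v x t - g \<bullet> v)"
              using t unfolding quot_def by (simp add: field_simps)
            ultimately show ?thesis using t by (simp add: abs_mult)
          qed
          have 3: "\<bar>t * (g \<bullet> v) - g \<bullet> (y - x)\<bar> \<le> norm g * (t * e')"
          proof -
            have "t * (g \<bullet> v) - g \<bullet> (y - x) = t * (g \<bullet> (v - u))" using u(2) by (simp add: inner_diff_right algebra_simps)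
            moreover have "\<bar>g \<bullet> (v - u)\<bar> \<le> norm g * e'"
              using Cauchy_Schwarz_ineq2[of g "v - u"] mult_left_mono[of "norm (v - u)" e' "norm g"] v(2)
              by (simp add: dist_norm)
            ultimately show ?thesis using t by (simp add: abs_mult mult.left_commute)
          qed
          have "\<bar>F y - F x - g \<bullet> (y - x)\<bar> \<le> L * (t * e') + t * e' + norm g * (t * e')" using 1 2 3 by linarith
          also have "\<dots> = (L + 1 + norm g) * e' * t" by (simp add: algebra_simps)
          finally show ?thesis unfolding e'(2) t_def by simp
        qed simp
      qed
    qed
    then show "F differentiable (at x)" unfolding differentiable_def by blast
  qed
qed

text \<open>Near a given point f is the quotient of a compactly supported Lipschitz function by a bump.\<close>
theorem rademacher:
  fixes f :: "'a::euclidean_space \<Rightarrow> real"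
  assumes f: "blip f"
  shows "AE x in lborel. f differentiable (at x)"
proof -
  have "AE x in lborel. (\<lambda>x. f x * bump (real n) x) differentiable (at x)" for n
  proof -
    have b: "Ck 1 (bump (real n) :: 'a \<Rightarrow> real)" using Ck_le[OF Ck_bump, of 1] by simp
    have cs: "csupp (\<lambda>x. f x * bump (real n) x)" by (intro csupp_mult2 csupp_bump)
    obtain L where L: "L-lipschitz_on UNIV (\<lambda>x. f x * bump (real n) x)"
      using blip_csupp_lipschitz[OF blip_mult[OF f blip_Ck1[OF b csupp_bump]] cs] .
    show ?thesis by (rule rademacher_csupp[OF L cs])
  qed
  then have "AE x in lborel. \<forall>n. (\<lambda>x. f x * bump (real n) x) differentiable (at x)"
    by (simp add: AE_all_countable)
  then show ?thesis
  proof eventually_elim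
    case (elim x)
    obtain n where n: "norm x < real n" using reals_Archimedean2 by blast
    have "bump (real n) differentiable (at x)" using Ck_diff[of 2 "bump (real n)"] Ck_bump[of "real n"] by (simp add: numeral_eq_Suc)
    then have "(\<lambda>x. f x * bump (real n) x / bump (real n) x) differentiable (at x)"
      using elim bump_pos[OF n] by (intro differentiable_divide) auto
    then obtain D where D: "((\<lambda>x. f x * bump (real n) x / bump (real n) x) has_derivative D) (at x)"
      unfolding differentiable_def by blast
    have "(f has_derivative D) (at x)"
    proof (rule has_derivative_transform_within_open[OF D open_ball[of 0 "real n"]])
      fix y :: 'a assume "y \<in> ball 0 (real n)"
      then have "bump (real n) y > 0" by (intro bump_pos) simp
      then show "f y * bump (real n) y / bump (real n) y = f y" by simp
    qed (use n in simp)
    then show ?case unfolding differentiable_def by blast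
  qed
qed

lemma integral_by_parts_blip:
  fixes f :: "'a::euclidean_space \<Rightarrow> real"
  assumes f: "blip f" and p: "Ck 1 p" "csupp p"
  shows "integrable lborel (\<lambda>x. pd v f x * p x)"
    "(\<integral>x. pd v f x * p x \<partial>lborel) = - (\<integral>x. f x * dd v p x \<partial>lborel)"
proof -
  have "AE x in lborel. \<exists>d. (quot f v x \<longlongrightarrow> d) (at 0)"
    using rademacher[OF f] by eventually_elim (use quot_differentiable in blast)
  from integral_by_parts_dir[OF f this p]
  show "integrable lborel (\<lambda>x. pd v f x * p x)"
    "(\<integral>x. pd v f x * p x \<partial>lborel) = - (\<integral>x. f x * dd v p x \<partial>lborel)" .
qed

text \<open>A Borel measurable function that agrees almost everywhere with the gradient of a locally Lipschitz function.\<close>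
definition wgrad :: "('a::euclidean_space \<Rightarrow> real) \<Rightarrow> 'a \<Rightarrow> 'a" where
  "wgrad f x = (\<Sum>b\<in>Basis. pd b f x *\<^sub>R b)"

lemma gradient_AE_wgrad:
  fixes f :: "'a::euclidean_space \<Rightarrow> real"
  assumes "blip f" shows "AE x in lborel. gradient f x = wgrad f x"
  using rademacher[OF assms]
proof eventually_elim
  case (elim x)
  show ?case unfolding wgrad_def
    by (rule euclidean_eqI) (use elim in \<open>simp add: gradient_inner pd_differentiable\<close>)
qed

lemma wgrad_measurable: "blip f \<Longrightarrow> wgrad f \<in> borel_measurable borel"
  unfolding wgrad_def[abs_def] using pd_measurable[OF blip_cont] by measurable

section \<open>The generator and Bochner's formula\<close>

text \<open>Continuous functions of compact support, the class of all integrands built from test functions.\<close>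
definition cc :: "('a::euclidean_space \<Rightarrow> real) \<Rightarrow> bool" where
  "cc f \<longleftrightarrow> continuous_on UNIV f \<and> csupp f"

lemma cc_bcs: "cc f \<Longrightarrow> bcs f" by (simp add: cc_def bcs_cont)

lemma cc_integrable: "cc f \<Longrightarrow> integrable lborel f" by (intro integrable_bcs cc_bcs)

lemma cc_mult1: "cc f \<Longrightarrow> continuous_on UNIV g \<Longrightarrow> cc (\<lambda>x. f x * g x)"
  unfolding cc_def by (auto intro: continuous_intros csupp_mult1)

lemma cc_mult2: "continuous_on UNIV f \<Longrightarrow> cc g \<Longrightarrow> cc (\<lambda>x. f x * g x)"
  unfolding cc_def by (auto intro: continuous_intros csupp_mult2)

lemma cc_add: "cc f \<Longrightarrow> cc g \<Longrightarrow> cc (\<lambda>x. f x + g x)"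
  unfolding cc_def by (auto intro: continuous_intros csupp_add)

lemma cc_diff: "cc f \<Longrightarrow> cc g \<Longrightarrow> cc (\<lambda>x. f x - g x)"
  using cc_add[of f "\<lambda>x. - g x"] unfolding cc_def by (auto intro: continuous_intros csupp_minus)

lemma cc_sum: "(\<And>i. i \<in> I \<Longrightarrow> cc (f i)) \<Longrightarrow> cc (\<lambda>x. \<Sum>i\<in>I. f i x)"
  unfolding cc_def by (auto intro: continuous_intros csupp_sum)

lemma cc_Ck: "Ck k f \<Longrightarrow> csupp f \<Longrightarrow> cc f" unfolding cc_def using Ck_cont by auto

lemma cc_dd: "Ck (Suc k) f \<Longrightarrow> csupp f \<Longrightarrow> cc (dd v f)"
  using cc_Ck[OF Ck_dd csupp_dd] .

lemma cc_dd2: "Ck (Suc (Suc k)) f \<Longrightarrow> csupp f \<Longrightarrow> cc (dd v (dd w f))"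
  by (intro cc_dd[of k] Ck_dd csupp_dd)

text \<open>The density of \<mu>. All integrals are written against Lebesgue measure with this weight, where integration by parts takes place.\<close>
definition wt :: "('a::euclidean_space \<Rightarrow> real) \<Rightarrow> 'a \<Rightarrow> real" where
  "wt \<Phi> x = exp (- \<Phi> x)"

lemma Ck_wt: "Ck k \<Phi> \<Longrightarrow> Ck k (wt \<Phi>)"
  unfolding wt_def[abs_def] by (intro Ck_exp Ck_minus)

lemma wt_pos: "wt \<Phi> x > 0" by (simp add: wt_def)

lemma dd_minus: "f differentiable (at x) \<Longrightarrow> dd v (\<lambda>x. - f x) x = - dd v f x"
  using dd_cmult[of f x v "-1"] by simp

lemma dd_wt: "Ck 1 \<Phi> \<Longrightarrow> dd v (wt \<Phi>) x = - dd v \<Phi> x * wt \<Phi> x"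
  unfolding wt_def[abs_def] by (subst dd_exp) (auto simp: dd_minus intro!: derivative_intros)

text \<open>The generator L = \<Delta> - \<nabla>\<Phi> \<cdot> \<nabla>.\<close>
definition gen :: "('a::euclidean_space \<Rightarrow> real) \<Rightarrow> ('a \<Rightarrow> real) \<Rightarrow> 'a \<Rightarrow> real" where
  "gen \<Phi> u x = (\<Sum>b\<in>Basis. dd b (dd b u) x - dd b \<Phi> x * dd b u x)"

lemma Ck_gen: "Ck (Suc k) \<Phi> \<Longrightarrow> Ck (Suc (Suc k)) u \<Longrightarrow> Ck k (gen \<Phi> u)"
  unfolding gen_def[abs_def]
  by (intro Ck_sum Ck_subtract Ck_mult Ck_dd Ck_pred[of k "dd _ u"]) (auto intro: Ck_pred)

lemma csupp_gen: "csupp u \<Longrightarrow> csupp (gen \<Phi> u)"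
  unfolding gen_def[abs_def] diff_conv_add_uminus by (intro csupp_sum csupp_add csupp_minus csupp_mult2 csupp_dd)

text \<open>The divergence form of the generator: L u = e^\<Phi> div (e^{-\<Phi>} \<nabla>u).\<close>
lemma dd_flux:
  assumes P: "Ck 1 \<Phi>" and u: "Ck 2 u"
  shows "dd b (\<lambda>x. wt \<Phi> x * dd b u x) x = wt \<Phi> x * (dd b (dd b u) x - dd b \<Phi> x * dd b u x)"
proof -
  have "Ck 1 (wt \<Phi>)" by (rule Ck_wt[OF P])
  then show ?thesis using u by (subst dd_mult) (auto simp: dd_wt[OF P] algebra_simps numeral_2_eq_2)
qed

lemma Ck_flux: "Ck (Suc k) \<Phi> \<Longrightarrow> Ck (Suc (Suc k)) u \<Longrightarrow> Ck (Suc k) (\<lambda>x. wt \<Phi> x * dd b u x)"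
  by (intro Ck_mult Ck_wt Ck_dd)

text \<open>Integration by parts against a function that is only locally Lipschitz; its partial derivatives are the measurable
representatives \<open>pd\<close>.\<close>
lemma gen_by_parts_blip:
  assumes P: "Ck 1 \<Phi>" and f: "blip f" and u: "Ck 2 u" "csupp u"
  shows "integrable lborel (\<lambda>x. (\<Sum>b\<in>Basis. pd b f x * dd b u x) * wt \<Phi> x)"
    "(\<integral>x. f x * gen \<Phi> u x * wt \<Phi> x \<partial>lborel) = - (\<integral>x. (\<Sum>b\<in>Basis. pd b f x * dd b u x) * wt \<Phi> x \<partial>lborel)"
proof -
  have fl: "Ck 1 (\<lambda>x. wt \<Phi> x * dd b u x)" "csupp (\<lambda>x. wt \<Phi> x * dd b u x)" for b
    using Ck_flux[of 0 \<Phi> u b] P u csupp_mult2[OF csupp_dd[OF u(2)]] by (auto simp: numeral_2_eq_2)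
  note I = integral_by_parts_blip[OF f fl]
  have e: "(\<Sum>b\<in>Basis. pd b f x * dd b u x) * wt \<Phi> x = (\<Sum>b\<in>Basis. pd b f x * (wt \<Phi> x * dd b u x))" for x
    by (simp add: sum_distrib_right sum_distrib_left mult_ac)
  show "integrable lborel (\<lambda>x. (\<Sum>b\<in>Basis. pd b f x * dd b u x) * wt \<Phi> x)"
    unfolding e by (intro Bochner_Integration.integrable_sum I)
  have e2: "f x * gen \<Phi> u x * wt \<Phi> x = (\<Sum>b\<in>Basis. f x * dd b (\<lambda>x. wt \<Phi> x * dd b u x) x)" for x
    unfolding dd_flux[OF P u(1)] gen_def by (simp add: sum_distrib_left sum_distrib_right mult_ac)
  have i: "integrable lborel (\<lambda>x. f x * dd b (\<lambda>x. wt \<Phi> x * dd b u x) x)" for b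
    using fl by (intro cc_integrable cc_mult2 blip_cont f cc_dd[of 0]) auto
  show "(\<integral>x. f x * gen \<Phi> u x * wt \<Phi> x \<partial>lborel) = - (\<integral>x. (\<Sum>b\<in>Basis. pd b f x * dd b u x) * wt \<Phi> x \<partial>lborel)"
    unfolding e e2 using i I by (simp add: Bochner_Integration.integral_sum sum_negf)
qed

lemma gen_by_parts:
  assumes P: "Ck 1 \<Phi>" and f: "Ck 1 f" and u: "Ck 2 u" "csupp u"
  shows "(\<integral>x. f x * gen \<Phi> u x * wt \<Phi> x \<partial>lborel) = - (\<integral>x. (\<Sum>b\<in>Basis. dd b f x * dd b u x) * wt \<Phi> x \<partial>lborel)"
proof -
  have fl: "Ck 1 (\<lambda>x. wt \<Phi> x * dd b u x)" "csupp (\<lambda>x. wt \<Phi> x * dd b u x)" for b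
    using Ck_flux[of 0 \<Phi> u b] P u csupp_mult2[OF csupp_dd[OF u(2)]] by (auto simp: numeral_2_eq_2)
  have I: "(\<integral>x. dd b f x * (wt \<Phi> x * dd b u x) \<partial>lborel) = - (\<integral>x. f x * dd b (\<lambda>x. wt \<Phi> x * dd b u x) x \<partial>lborel)" for b
    using fl(2) by (intro integral_by_parts_dd f fl) auto
  have e: "(\<Sum>b\<in>Basis. dd b f x * dd b u x) * wt \<Phi> x = (\<Sum>b\<in>Basis. dd b f x * (wt \<Phi> x * dd b u x))" for x
    by (simp add: sum_distrib_right sum_distrib_left mult_ac)
  have e2: "f x * gen \<Phi> u x * wt \<Phi> x = (\<Sum>b\<in>Basis. f x * dd b (\<lambda>x. wt \<Phi> x * dd b u x) x)" for x
    unfolding dd_flux[OF P u(1)] gen_def by (simp add: sum_distrib_left sum_distrib_right mult_ac)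
  have i: "integrable lborel (\<lambda>x. f x * dd b (\<lambda>x. wt \<Phi> x * dd b u x) x)" for b
    using fl Ck_cont[OF f] by (intro cc_integrable cc_mult2 cc_dd[of 0]) auto
  have i2: "integrable lborel (\<lambda>x. dd b f x * (wt \<Phi> x * dd b u x))" for b
    using fl f by (intro cc_integrable cc_mult2 cc_Ck[of 1]) auto
  show ?thesis
    unfolding e e2 using i i2 I by (simp add: Bochner_Integration.integral_sum sum_negf)
qed

lemma gen_mean_zero:
  assumes "Ck 1 \<Phi>" "Ck 2 u" "csupp u"
  shows "(\<integral>x. gen \<Phi> u x * wt \<Phi> x \<partial>lborel) = 0"
  using gen_by_parts[OF assms(1) Ck_const[of 1 1] assms(2,3)] by simp

text \<open>The commutator of L with a directional derivative is the corresponding row of D^2\<Phi> applied to the gradient.\<close>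
lemma dd_gen:
  assumes P: "Ck 2 \<Phi>" and u: "Ck 3 u"
  shows "dd k (gen \<Phi> u) x = gen \<Phi> (dd k u) x - (\<Sum>b\<in>Basis. dd k (dd b \<Phi>) x * dd b u x)"
proof -
  have P2: "Ck (Suc (Suc 0)) \<Phi>" and u3: "Ck (Suc (Suc (Suc 0))) u"
    using P u by (simp_all add: numeral_2_eq_2 numeral_3_eq_3)
  have u2: "Ck 2 u" using Ck_le[OF u, of 2] by simp
  have d: "dd b \<Phi> differentiable (at x)" "dd b u differentiable (at x)" "dd b (dd b u) differentiable (at x)" for b x
    using P2 u3 Ck_pred[OF u3] by auto
  have c: "dd k (dd b u) = dd b (dd k u)" for b by (rule ext) (rule dd_commute[OF u2])
  have c2: "dd k (dd b (dd b u)) x = dd b (dd b (dd k u)) x" for b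
  proof -
    have "Ck 2 (dd b u)" using u3 by (simp add: numeral_2_eq_2)
    from dd_commute[OF this, of k b x] show ?thesis unfolding c .
  qed
  have "dd k (gen \<Phi> u) x = (\<Sum>b\<in>Basis. dd k (\<lambda>x. dd b (dd b u) x + (- 1) * (dd b \<Phi> x * dd b u x)) x)"
    unfolding gen_def[abs_def] using d by (subst dd_sum) (auto intro!: derivative_intros)
  also have "\<dots> = (\<Sum>b\<in>Basis. dd k (dd b (dd b u)) x + (- 1) * (dd k (dd b \<Phi>) x * dd b u x + dd b \<Phi> x * dd k (dd b u) x))"
  proof (rule sum.cong[OF refl])
    fix b :: 'a
    have "(\<lambda>x. dd b \<Phi> x * dd b u x) differentiable (at x)" using d by (intro derivative_intros)
    then show "dd k (\<lambda>x. dd b (dd b u) x + (- 1) * (dd b \<Phi> x * dd b u x)) x =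
      dd k (dd b (dd b u)) x + (- 1) * (dd k (dd b \<Phi>) x * dd b u x + dd b \<Phi> x * dd k (dd b u) x)"
      using d by (subst dd_add) (auto simp: dd_cmult dd_mult dd_minus intro!: derivative_intros)
  qed
  also have "\<dots> = gen \<Phi> (dd k u) x - (\<Sum>b\<in>Basis. dd k (dd b \<Phi>) x * dd b u x)"
    unfolding gen_def c c2 by (simp add: sum_subtractf[symmetric] algebra_simps sum.distrib[symmetric])
  finally show ?thesis .
qed

text \<open>Integrated Bochner formula: one integration by parts moves L onto the gradient of L u, the commutator \<open>dd_gen\<close> produces
the D^2\<Phi> term, and a second integration by parts for each derivative of u produces the Hessian term.\<close>
lemma bochner:
  assumes P: "Ck 2 \<Phi>" and u: "Ck 3 u" "csupp u"
  shows "(\<integral>x. (gen \<Phi> u x)\<^sup>2 * wt \<Phi> x \<partial>lborel) =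
    (\<integral>x. (\<Sum>k\<in>Basis. \<Sum>b\<in>Basis. (dd b (dd k u) x)\<^sup>2) * wt \<Phi> x \<partial>lborel) +
    (\<integral>x. (\<Sum>k\<in>Basis. \<Sum>b\<in>Basis. dd k (dd b \<Phi>) x * dd b u x * dd k u x) * wt \<Phi> x \<partial>lborel)"
proof -
  have P2: "Ck (Suc (Suc 0)) \<Phi>" and u3: "Ck (Suc (Suc (Suc 0))) u" and P1: "Ck 1 \<Phi>"
    using P u Ck_le[OF P, of 1] by (simp_all add: numeral_2_eq_2 numeral_3_eq_3)
  have u2: "Ck 2 u" using Ck_le[OF u(1), of 2] by simp
  have k2: "Ck 2 (dd k u)" "csupp (dd k u)" for k using u3 csupp_dd[OF u(2)] by (auto simp: numeral_2_eq_2)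
  have wc: "continuous_on UNIV (wt \<Phi>)" by (intro Ck_cont[OF Ck_wt[OF P]])
  have g1: "Ck 1 (gen \<Phi> u)" using Ck_gen[of 1 \<Phi> u] P u by (simp add: numeral_2_eq_2 numeral_3_eq_3)
  have ccu: "cc (dd k u)" for k using k2 cc_Ck by blast
  have ccuu: "cc (dd b (dd k u))" for b k using cc_dd2[OF u3 u(2)] .
  have Pc: "continuous_on UNIV (dd b \<Phi>)" "continuous_on UNIV (dd k (dd b \<Phi>))" for k b
    using P2 Ck_cont[OF Ck_dd[OF P2]] by auto
  have ccgk: "cc (gen \<Phi> (dd k u))" for k
    unfolding gen_def[abs_def] using cc_dd2[of 0 "dd _ u"] k2
    by (intro cc_sum cc_diff cc_mult2 Pc ccuu) (auto simp: numeral_2_eq_2)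
  have ccA: "cc (\<lambda>x. (\<Sum>k\<in>Basis. \<Sum>b\<in>Basis. dd k (dd b \<Phi>) x * dd b u x * dd k u x) * wt \<Phi> x)"
  proof (rule cc_mult1[OF _ wc], intro cc_sum)
    fix k b :: 'a
    have "continuous_on UNIV (\<lambda>x. dd k (dd b \<Phi>) x * dd b u x)"
      using ccu by (intro continuous_intros Pc) (auto simp: cc_def)
    then show "cc (\<lambda>x. dd k (dd b \<Phi>) x * dd b u x * dd k u x)" using ccu by (rule cc_mult2)
  qed
  have ccB: "cc (\<lambda>x. dd k u x * gen \<Phi> (dd k u) x * wt \<Phi> x)" for k
    using ccgk by (intro cc_mult1 wc ccu) (auto simp: cc_def)
  have "(\<integral>x. (gen \<Phi> u x)\<^sup>2 * wt \<Phi> x \<partial>lborel) = (\<integral>x. gen \<Phi> u x * gen \<Phi> u x * wt \<Phi> x \<partial>lborel)"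
    by (simp add: power2_eq_square)
  also have "\<dots> = - (\<integral>x. (\<Sum>k\<in>Basis. dd k (gen \<Phi> u) x * dd k u x) * wt \<Phi> x \<partial>lborel)"
    by (rule gen_by_parts[OF P1 g1 u2 u(2)])
  also have "\<dots> = - (\<integral>x. (\<Sum>k\<in>Basis. dd k u x * gen \<Phi> (dd k u) x * wt \<Phi> x)
      - (\<Sum>k\<in>Basis. \<Sum>b\<in>Basis. dd k (dd b \<Phi>) x * dd b u x * dd k u x) * wt \<Phi> x \<partial>lborel)"
    unfolding dd_gen[OF P u(1)]
    by (intro arg_cong[where f=uminus] Bochner_Integration.integral_cong refl)
       (simp add: left_diff_distrib sum_subtractf sum_distrib_right sum_distrib_left right_diff_distrib mult_ac)
  also have "\<dots> = - ((\<integral>x. (\<Sum>k\<in>Basis. dd k u x * gen \<Phi> (dd k u) x * wt \<Phi> x) \<partial>lborel)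
      - (\<integral>x. (\<Sum>k\<in>Basis. \<Sum>b\<in>Basis. dd k (dd b \<Phi>) x * dd b u x * dd k u x) * wt \<Phi> x \<partial>lborel))"
    by (intro arg_cong[where f=uminus] Bochner_Integration.integral_diff cc_integrable cc_sum ccA ccB)
  also have "(\<integral>x. (\<Sum>k\<in>Basis. dd k u x * gen \<Phi> (dd k u) x * wt \<Phi> x) \<partial>lborel)
     = (\<Sum>k\<in>Basis. \<integral>x. dd k u x * gen \<Phi> (dd k u) x * wt \<Phi> x \<partial>lborel)"
    by (intro Bochner_Integration.integral_sum cc_integrable ccB)
  also have "\<dots> = (\<Sum>k\<in>Basis. - (\<integral>x. (\<Sum>b\<in>Basis. dd b (dd k u) x * dd b (dd k u) x) * wt \<Phi> x \<partial>lborel))"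
    by (intro sum.cong refl gen_by_parts P1 k2 Ck_le[OF k2(1)]) simp
  also have "\<dots> = - (\<integral>x. (\<Sum>k\<in>Basis. \<Sum>b\<in>Basis. (dd b (dd k u) x)\<^sup>2) * wt \<Phi> x \<partial>lborel)"
  proof -
    have "(\<integral>x. (\<Sum>k\<in>Basis. \<Sum>b\<in>Basis. (dd b (dd k u) x)\<^sup>2) * wt \<Phi> x \<partial>lborel)
      = (\<integral>x. (\<Sum>k\<in>Basis. (\<Sum>b\<in>Basis. dd b (dd k u) x * dd b (dd k u) x) * wt \<Phi> x) \<partial>lborel)"
      by (simp add: sum_distrib_right power2_eq_square)
    also have "\<dots> = (\<Sum>k\<in>Basis. \<integral>x. (\<Sum>b\<in>Basis. dd b (dd k u) x * dd b (dd k u) x) * wt \<Phi> x \<partial>lborel)"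
      by (intro Bochner_Integration.integral_sum cc_integrable cc_mult1 cc_sum ccuu wc) (use ccuu in \<open>auto simp: cc_def\<close>)
    finally show ?thesis by (simp add: sum_negf)
  qed
  finally show ?thesis by simp
qed

section \<open>Conjugation to a Schroedinger operator\<close>

text \<open>Conjugation by e^{\<Phi>/2} removes the first-order term: L (e^{\<Phi>/2} w) = e^{\<Phi>/2} (\<Delta>w - V w)
with V = |\<nabla>\<Phi>|^2 / 4 - \<Delta>\<Phi> / 2 (\<open>gen_ehalf\<close>). The potential V is continuous but in general not bounded below.\<close>
definition schr_pot :: "('a::euclidean_space \<Rightarrow> real) \<Rightarrow> 'a \<Rightarrow> real" where
  "schr_pot \<Phi> x = (\<Sum>b\<in>Basis. (dd b \<Phi> x)\<^sup>2 / 4 - dd b (dd b \<Phi>) x / 2)"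

lemma schr_pot_cont: "Ck 2 \<Phi> \<Longrightarrow> continuous_on UNIV (schr_pot \<Phi>)"
proof -
  assume "Ck 2 \<Phi>"
  then have P: "Ck (Suc (Suc 0)) \<Phi>" by (simp add: numeral_2_eq_2)
  have "continuous_on UNIV (dd b \<Phi>)" "continuous_on UNIV (dd b (dd b \<Phi>))" for b
    using P Ck_cont[OF Ck_dd[OF P]] by auto
  then show ?thesis unfolding schr_pot_def[abs_def] by (intro continuous_intros) auto
qed

definition ehalf :: "('a::euclidean_space \<Rightarrow> real) \<Rightarrow> 'a \<Rightarrow> real" where
  "ehalf \<Phi> x = exp (\<Phi> x / 2)"

lemma ehalf_wt: "ehalf \<Phi> x * ehalf \<Phi> x * wt \<Phi> x = 1"
  unfolding ehalf_def wt_def exp_add[symmetric] by simp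

lemma ehalf_pos: "ehalf \<Phi> x > 0" by (simp add: ehalf_def)

lemma Ck_ehalf: "Ck k \<Phi> \<Longrightarrow> Ck k (ehalf \<Phi>)"
  unfolding ehalf_def[abs_def] using Ck_exp[OF Ck_cmult[of k \<Phi> "1/2"]] by simp

lemma dd_ehalf: "Ck 1 \<Phi> \<Longrightarrow> dd v (ehalf \<Phi>) x = dd v \<Phi> x / 2 * ehalf \<Phi> x"
  unfolding ehalf_def[abs_def] using dd_cmult[of \<Phi> x v "1/2"]
  by (subst dd_exp) (auto intro!: derivative_intros)

lemma gen_ehalf:
  assumes P: "Ck 2 \<Phi>" and w: "Ck 2 w"
  shows "gen \<Phi> (\<lambda>x. w x * ehalf \<Phi> x) x =
    ((\<Sum>b\<in>Basis. dd b (dd b w) x) - schr_pot \<Phi> x * w x) * ehalf \<Phi> x"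
proof -
  have P2: "Ck (Suc (Suc 0)) \<Phi>" "Ck 1 \<Phi>" and w2: "Ck (Suc (Suc 0)) w" and P1: "Ck 1 \<Phi>"
    using P w Ck_le[OF P, of 1] by (simp_all add: numeral_2_eq_2)
  have E: "Ck (Suc (Suc 0)) (ehalf \<Phi>)" by (intro Ck_ehalf P2)
  have d: "\<And>x. \<Phi> differentiable (at x)" "\<And>x. w differentiable (at x)" "\<And>x. ehalf \<Phi> differentiable (at x)"
     "\<And>b x. dd b \<Phi> differentiable (at x)" "\<And>b x. dd b w differentiable (at x)"
    using P2 w2 E by auto
  have d1: "dd b (\<lambda>x. w x * ehalf \<Phi> x) = (\<lambda>x. (dd b w x + w x * (1/2 * dd b \<Phi> x)) * ehalf \<Phi> x)" for b
    by (rule ext) (simp add: dd_mult d dd_ehalf[OF P1] algebra_simps)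
  have d2: "dd b (dd b (\<lambda>x. w x * ehalf \<Phi> x)) x =
     (dd b (dd b w) x + (dd b w x * (1/2 * dd b \<Phi> x) + w x * (1/2 * dd b (dd b \<Phi>) x))) * ehalf \<Phi> x
      + (dd b w x + w x * (1/2 * dd b \<Phi> x)) * (dd b \<Phi> x / 2 * ehalf \<Phi> x)" for b
  proof -
    have h: "(\<lambda>x. 1/2 * dd b \<Phi> x) differentiable (at x)" using d by (intro derivative_intros)
    have wh: "(\<lambda>x. w x * (1/2 * dd b \<Phi> x)) differentiable (at x)" by (intro derivative_intros d h)
    have a: "(\<lambda>x. dd b w x + w x * (1/2 * dd b \<Phi> x)) differentiable (at x)" by (intro derivative_intros d wh)
    show ?thesis unfolding d1
      by (subst dd_mult[OF a d(3)], subst dd_add[OF d(5) wh], subst dd_mult[OF d(2) h], subst dd_cmult[OF d(4)], subst dd_ehalf[OF P1]) simp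
  qed
  show ?thesis unfolding gen_def d2 unfolding d1 schr_pot_def
    unfolding sum_distrib_right sum_subtractf[symmetric] left_diff_distrib
    by (intro sum.cong refl) (simp add: field_simps power2_eq_square)
qed

section \<open>Vanishing weak gradients\<close>

text \<open>The mollifications of g have vanishing gradient and are constants c_n. Testing against a fixed kernel shows that c_n
converges, and the limit equals g weakly, hence almost everywhere.\<close>
lemma weak_gradient_zero_const:
  fixes g :: "'a::euclidean_space \<Rightarrow> real"
  assumes g: "lint g" and z: "\<And>p b. Ck 3 p \<Longrightarrow> csupp p \<Longrightarrow> b \<in> Basis \<Longrightarrow> (\<integral>x. g x * dd b p x \<partial>lborel) = 0"
  shows "\<exists>c. AE x in lborel. g x = c"
proof -
  define G where "G n = conv (rho (eps n)) g" for n
  have r1: "Ck 1 (rho e :: 'a \<Rightarrow> real)" for e using Ck_le[OF Ck_rho, of 1] by simp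
  have G1: "Ck 1 (G n)" for n unfolding G_def by (intro Ck_conv r1 csupp_rho g)
  have db: "dd b (G n) x = 0" if b: "b \<in> Basis" for b n x
  proof -
    define p where "p y = rho (eps n) (x - y)" for y
    have pe: "p = (\<lambda>y. rho (eps n) (y + (- x)))" unfolding p_def using rho_even[of "eps n"] by (metis (no_types, opaque_lifting) minus_diff_eq uminus_add_conv_diff add.commute)
    have der: "dd v (\<lambda>y. k (y + (- x))) = (\<lambda>y. dd v k (y + (- x)))" if "Ck 1 k" for v and k :: "'a \<Rightarrow> real"
      using that by (intro ext dd_shift) auto
    have Ckp: "Ck j (\<lambda>y. k (y + (- x)))" if "Ck j k" for j and k :: "'a \<Rightarrow> real"
      using that
    proof (induction j arbitrary: k)
      case 0 then show ?case by (auto intro!: continuous_intros intro: continuous_on_compose2[of UNIV k])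
    next
      case (Suc j)
      have "(\<lambda>y. k (y + - x)) differentiable at y" for y
      proof -
        have "(\<lambda>y. y + - x) differentiable at y" by (intro derivative_intros)
        moreover have "k differentiable at (y + - x)" using Suc.prems by simp
        ultimately show ?thesis using differentiable_chain_at[of "\<lambda>y. y + - x" y k] by (simp add: o_def)
      qed
      moreover have "Ck 1 k" using Ck_le[OF Suc.prems, of 1] by simp
      moreover have "Ck j (dd v (\<lambda>y. k (y + - x)))" for v
        unfolding der[OF \<open>Ck 1 k\<close>] using Suc.prems by (intro Suc.IH) simp
      ultimately show ?case unfolding Ck.simps by blast
    qed
    have p3: "Ck 3 p" unfolding pe by (intro Ckp Ck_rho)
    have pc: "csupp p" unfolding p_def[abs_def] by (intro csupp_reflect csupp_rho)
    have dp: "dd b p y = - dd b (rho (eps n)) (x - y)" for y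
    proof -
      have "p = (\<lambda>y. rho (eps n) (- y + x))" unfolding p_def by simp
      have d: "(rho (eps n) has_derivative (\<lambda>h. dd h (rho (eps n)) (x - y))) (at (x - y))"
        using r1 by (intro has_derivative_dd) auto
      have "((\<lambda>y. x - y) has_derivative (\<lambda>h. - h)) (at y)" by (auto intro!: derivative_eq_intros)
      from has_derivative_compose[OF this d]
      have "(p has_derivative (\<lambda>h. dd (- h) (rho (eps n)) (x - y))) (at y)" unfolding p_def .
      from dd_eqI[OF this] have "dd b p y = dd (- b) (rho (eps n)) (x - y)" .
      also have "\<dots> = - dd b (rho (eps n)) (x - y)"
        using dd_scale[of "rho (eps n)" "x - y" "-1" b] r1 by simp
      finally show ?thesis .
    qed
    have "dd b (G n) x = conv (dd b (rho (eps n))) g x"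
      unfolding G_def by (simp add: dd_conv[OF r1 csupp_rho g])
    also have "\<dots> = - (\<integral>y. g y * dd b p y \<partial>lborel)" unfolding conv_def dp by (simp add: mult.commute)
    finally show ?thesis using z[OF p3 pc b] by simp
  qed
  have "\<exists>c. \<forall>x. G n x = c" for n
  proof -
    have "(G n has_derivative (\<lambda>h. 0)) (at x)" for x
    proof -
      have "dd h (G n) x = 0" for h using G1 db by (subst dd_basis) auto
      then show ?thesis using has_derivative_dd[of "G n" x] G1 by auto
    qed
    then show ?thesis using has_derivative_zero_constant[OF convex_UNIV, of "G n"] by auto
  qed
  then obtain c where c: "\<And>n x. G n x = c n" by metis
  have G: "(\<integral>x. g x * conv (rho (eps n)) p x \<partial>lborel) = c n * (\<integral>x. p x \<partial>lborel)" if "cc p" for n p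
  proof -
    have "(\<integral>x. g x * conv (rho (eps n)) p x \<partial>lborel) = (\<integral>x. G n x * p x \<partial>lborel)"
      unfolding G_def using that by (intro conv_adjoint[symmetric] bcs_rho rho_even g cc_bcs)
    then show ?thesis unfolding c by simp
  qed
  have lim: "(\<lambda>n. c n * (\<integral>x. p x \<partial>lborel)) \<longlonglongrightarrow> (\<integral>x. g x * p x \<partial>lborel)" if "cc p" for p
    using conv_rho_weak[OF g, of p] that unfolding G[OF that] by (simp add: cc_def)
  \<comment> \<open>a test function of integral one picks out the limit of the constants\<close>
  define C where "C = (\<integral>x. g x * rho 1 x \<partial>lborel)"
  have ccr: "cc (rho 1 :: 'a \<Rightarrow> real)" by (simp add: cc_def cont_rho csupp_rho)
  have cC: "c \<longlonglongrightarrow> C" using lim[OF ccr] rho_integral[of 1, where 'a='a] by (simp add: C_def)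
  have "AE x in lborel. g x - C = 0"
  proof (rule weak_zero_AE)
    show "lint (\<lambda>x. g x - C)" by (intro lint_diff g lint_cont continuous_intros)
    fix p :: "'a \<Rightarrow> real" assume p: "Ck 3 p" "csupp p"
    then have ccp: "cc p" by (rule cc_Ck)
    have "(\<lambda>n. c n * (\<integral>x. p x \<partial>lborel)) \<longlonglongrightarrow> C * (\<integral>x. p x \<partial>lborel)" by (intro tendsto_intros cC)
    then have e: "(\<integral>x. g x * p x \<partial>lborel) = C * (\<integral>x. p x \<partial>lborel)" using lim[OF ccp] LIMSEQ_unique by blast
    have "integrable lborel (\<lambda>x. g x * p x)" by (intro integrable_lint_bcs g cc_bcs ccp)
    then show "(\<integral>x. (g x - C) * p x \<partial>lborel) = 0" using e cc_integrable[OF ccp] by (simp add: left_diff_distrib)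
  qed
  then show ?thesis by (intro exI[of _ C]) (auto elim: eventually_mono)
qed

section \<open>Rotation invariance\<close>

definition rot_inv :: "('a::euclidean_space \<Rightarrow> 'a) set \<Rightarrow> ('a \<Rightarrow> 'b) \<Rightarrow> bool" where
  "rot_inv \<R> f \<longleftrightarrow> (\<forall>R\<in>\<R>. \<forall>x. f (R x) = f x)"

text \<open>The set need not be closed under composition: invariance is tested one rotation at a time.\<close>
definition rotations :: "('a::euclidean_space \<Rightarrow> 'a) set \<Rightarrow> bool" where
  "rotations \<R> \<longleftrightarrow> (\<forall>R\<in>\<R>. orthogonal_transformation R)"

lemma rotation_measurable:
  fixes R :: "'a::euclidean_space \<Rightarrow> 'a"
  shows "orthogonal_transformation R \<Longrightarrow> R \<in> borel_measurable borel"
proof -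
  assume "orthogonal_transformation R"
  then have "bounded_linear R" by (metis orthogonal_transformation_linear linear_conv_bounded_linear)
  then show ?thesis by (intro borel_measurable_continuous_onI linear_continuous_on)
qed

text \<open>For the indicator b of the unit ball, which is invariant under T, the integral of
\<open>b (T x) * g (T x + y)\<close> over x and y is computed in both orders. Translation invariance in y gives
the volume of the ball times \<integral> g; translation invariance in x, after the substitution of \<open>x - inv T y\<close>, gives the
volume times \<integral> g \<circ> T.\<close>
lemma distr_lborel_orthogonal:
  fixes T :: "'a::euclidean_space \<Rightarrow> 'a"
  assumes T: "orthogonal_transformation T"
  shows "distr lborel borel T = lborel"
proof -
  have lT: "linear T" using T orthogonal_transformation_linear by blast
  have Tm[measurable]: "T \<in> borel_measurable borel" by (rule rotation_measurable[OF T])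
  have sT: "T (inv T y) = y" for y using T by (simp add: surj_f_inv_f orthogonal_transformation_surj)
  have shift: "(\<integral>\<^sup>+x. f (a + x) \<partial>lborel) = (\<integral>\<^sup>+x. f x \<partial>lborel)" if "f \<in> borel_measurable borel" for f :: "'a \<Rightarrow> ennreal" and a
    using nn_integral_distr[of "(+) a" lborel borel f] that unfolding lborel_distr_plus by simp
  have refl: "(\<integral>\<^sup>+y. f (a - y) \<partial>lborel) = (\<integral>\<^sup>+x. f x \<partial>lborel)" if "f \<in> borel_measurable borel" for f :: "'a \<Rightarrow> ennreal" and a
    using nn_integral_distr[of "\<lambda>y. a - y" lborel borel f] that unfolding lborel_distr_reflect by simp
  define b :: "'a \<Rightarrow> ennreal" where "b = indicator (ball 0 1)"
  have bm[measurable]: "b \<in> borel_measurable borel" unfolding b_def by (intro borel_measurable_indicator) simp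
  define c where "c = (\<integral>\<^sup>+x. b x \<partial>lborel)"
  have c: "c = emeasure lborel (ball (0::'a) 1)" unfolding c_def b_def by simp
  have c0: "c \<noteq> 0" using content_ball_pos[of 1 "0::'a"] unfolding c by (auto simp: measure_def)
  have cf: "c \<noteq> \<infinity>" unfolding c using emeasure_lborel_ball_finite[of "0::'a" 1] by simp
  have bT: "b (T x) = b x" for x unfolding b_def using orthogonal_transformation_norm[OF T, of x] by (simp add: indicator_def)
  have key: "(\<integral>\<^sup>+x. g (T x) \<partial>lborel) = (\<integral>\<^sup>+x. g x \<partial>lborel)" if g[measurable]: "g \<in> borel_measurable borel" for g
  proof -
    have "c * (\<integral>\<^sup>+y. g y \<partial>lborel) = (\<integral>\<^sup>+x. b (T x) * (\<integral>\<^sup>+y. g y \<partial>lborel) \<partial>lborel)"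
      unfolding c_def bT by (intro nn_integral_multc[symmetric]) simp
    also have "\<dots> = (\<integral>\<^sup>+x. (\<integral>\<^sup>+y. b (T x) * g (T x + y) \<partial>lborel) \<partial>lborel)"
      by (intro nn_integral_cong) (simp add: nn_integral_cmult shift)
    also have "\<dots> = (\<integral>\<^sup>+y. (\<integral>\<^sup>+x. b (T x) * g (T x + y) \<partial>lborel) \<partial>lborel)"
      by (rule lborel_pair.Fubini') measurable
    also have "\<dots> = (\<integral>\<^sup>+y. (\<integral>\<^sup>+x. b (T x - y) * g (T x) \<partial>lborel) \<partial>lborel)"
    proof (rule nn_integral_cong)
      fix y
      have "T (- inv T y + x) = T x - y" for x
        using linear_add[OF lT, of "- inv T y" x] linear_neg[OF lT, of "inv T y"] sT[of y] by simp
      then show "(\<integral>\<^sup>+x. b (T x) * g (T x + y) \<partial>lborel) = (\<integral>\<^sup>+x. b (T x - y) * g (T x) \<partial>lborel)"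
        using shift[of "\<lambda>x. b (T x) * g (T x + y)" "- inv T y"] by simp
    qed
    also have "\<dots> = (\<integral>\<^sup>+x. (\<integral>\<^sup>+y. b (T x - y) * g (T x) \<partial>lborel) \<partial>lborel)"
      by (rule lborel_pair.Fubini') measurable
    also have "\<dots> = (\<integral>\<^sup>+x. c * g (T x) \<partial>lborel)"
      by (intro nn_integral_cong) (simp add: nn_integral_multc refl c_def)
    also have "\<dots> = c * (\<integral>\<^sup>+x. g (T x) \<partial>lborel)" by (rule nn_integral_cmult) simp
    finally show ?thesis using c0 cf by (simp add: ennreal_mult_cancel_left)
  qed
  show ?thesis
  proof (rule measure_eqI)
    fix A assume "A \<in> sets (distr lborel borel T)"
    then have A: "A \<in> sets borel" by simp
    have "emeasure (distr lborel borel T) A = (\<integral>\<^sup>+x. indicator A x \<partial>distr lborel borel T)" using A by simp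
    also have "\<dots> = (\<integral>\<^sup>+x. indicator A (T x) \<partial>lborel)" using A by (intro nn_integral_distr) auto
    also have "\<dots> = (\<integral>\<^sup>+x. indicator A x \<partial>lborel)" using A by (intro key) auto
    finally show "emeasure (distr lborel borel T) A = emeasure lborel A" using A by simp
  qed simp
qed

lemma radial_rot_inv: "rotations \<R> \<Longrightarrow> rot_inv \<R> (bump r)" "rotations \<R> \<Longrightarrow> rot_inv \<R> (rho r)"
proof -
  assume "rotations \<R>"
  then have "R x \<bullet> R x = x \<bullet> x" if "R \<in> \<R>" for R x
    using that unfolding rotations_def orthogonal_transformation_def by blast
  then show "rot_inv \<R> (bump r)" "rot_inv \<R> (rho r)" unfolding rot_inv_def rho_def bump_def by simp_all
qed

lemma lborel_rotate:
  fixes R :: "'a::euclidean_space \<Rightarrow> 'a" and f :: "'a::euclidean_space \<Rightarrow> real"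
  assumes R: "orthogonal_transformation R" and f: "f \<in> borel_measurable borel"
  shows "(\<integral>x. f (R x) \<partial>lborel) = (\<integral>x. f x \<partial>lborel)"
  using integral_distr[of R lborel borel f] rotation_measurable[OF R] f unfolding distr_lborel_orthogonal[OF R] by simp

text \<open>Convolution with a radial kernel commutes with rotations.\<close>
lemma conv_rot_inv:
  fixes f :: "'a::euclidean_space \<Rightarrow> real"
  assumes R: "rotations \<R>" and k: "rot_inv \<R> k" "k \<in> borel_measurable borel" and f: "rot_inv \<R> f" "f \<in> borel_measurable borel"
  shows "rot_inv \<R> (conv k f)"
  unfolding rot_inv_def
proof (intro ballI allI)
  fix R x assume "R \<in> \<R>"
  then have o: "orthogonal_transformation R" "\<And>x. k (R x) = k x" "\<And>x. f (R x) = f x"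
    using R k f unfolding rotations_def rot_inv_def by auto
  have m: "(\<lambda>y. k (R x - y) * f y) \<in> borel_measurable borel" using k(2) f(2) by measurable
  have "R x - R y = R (x - y)" for y using o(1) by (simp add: linear_diff orthogonal_transformation_linear)
  then have e: "k (R x - R y) * f (R y) = k (x - y) * f y" for y using o by simp
  have "conv k f (R x) = (\<integral>y. k (R x - R y) * f (R y) \<partial>lborel)"
    unfolding conv_def using lborel_rotate[OF o(1) m] by simp
  then show "conv k f (R x) = conv k f x" unfolding e conv_def .
qed

text \<open>Since \<Phi> is only C^2, the test functions produced by conjugation are only C^2. They are approximated by
their radial mollifications, which are C^3 and invariant and whose derivatives up to order two are the mollifications of those
of u, so that they converge weakly.\<close>
lemma test_fun_C2:
  fixes g :: "'a::euclidean_space \<Rightarrow> real"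
  assumes P: "Ck 2 \<Phi>" and R: "rotations \<R>" and g: "lint g"
    and z: "\<And>u. Ck 3 u \<Longrightarrow> csupp u \<Longrightarrow> rot_inv \<R> u \<Longrightarrow> (\<integral>x. g x * gen \<Phi> u x * wt \<Phi> x \<partial>lborel) = 0"
    and u: "Ck 2 u" "csupp u" "rot_inv \<R> u"
  shows "(\<integral>x. g x * gen \<Phi> u x * wt \<Phi> x \<partial>lborel) = 0"
proof -
  have P2: "Ck (Suc (Suc 0)) \<Phi>" and u2: "Ck (Suc (Suc 0)) u" and u1: "Ck 1 u"
    using P u Ck_le[OF u(1), of 1] by (simp_all add: numeral_2_eq_2)
  have uc: "continuous_on UNIV u" using Ck_cont[OF u1] .
  define U where "U n = conv (rho (eps n)) u" for n
  have U3: "Ck 3 (U n)" "csupp (U n)" for n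
    unfolding U_def by (intro Ck_conv csupp_conv Ck_rho csupp_rho lint_cont uc u)+
  have Ur: "rot_inv \<R> (U n)" for n
    unfolding U_def by (intro conv_rot_inv R u radial_rot_inv borel_measurable_continuous_onI uc cont_rho)
  have d1: "dd b (U n) = conv (rho (eps n)) (dd b u)" for b n
    unfolding U_def by (intro dd_conv2 cont_rho u1 u)
  have d2: "dd b (dd b (U n)) = conv (rho (eps n)) (dd b (dd b u))" for b n
    unfolding d1 using u2 by (intro dd_conv2 cont_rho csupp_dd u) auto
  have c1: "continuous_on UNIV (dd b u)" "csupp (dd b u)" "continuous_on UNIV (dd b (dd b u))" "csupp (dd b (dd b u))" for b
    using cc_dd[of 0 u b] cc_dd2[of 0 u b b] u1 u2 u(2) by (auto simp: cc_def)
  have Pc: "continuous_on UNIV (dd b \<Phi>)" for b using Ck_cont[OF Ck_dd[OF P2]] by auto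
  have wc: "continuous_on UNIV (wt \<Phi>)" by (intro Ck_cont[OF Ck_wt[OF P]])
  have l1: "lint (\<lambda>x. g x * wt \<Phi> x)" by (intro lint_mult_cont g wc)
  have l2: "lint (\<lambda>x. g x * wt \<Phi> x * dd b \<Phi> x)" for b by (intro lint_mult_cont l1 Pc)
  \<comment> \<open>the weak form of the generator as a function of second and first derivatives, which are approximated independently\<close>
  define I where "I p q = (\<Sum>b\<in>Basis. (\<integral>x. g x * wt \<Phi> x * p b x \<partial>lborel) - (\<integral>x. g x * wt \<Phi> x * dd b \<Phi> x * q b x \<partial>lborel))"
    for p q :: "'a \<Rightarrow> 'a \<Rightarrow> real"
  have I: "(\<integral>x. g x * gen \<Phi> v x * wt \<Phi> x \<partial>lborel) = I (\<lambda>b. dd b (dd b v)) (\<lambda>b. dd b v)"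
    if "Ck 2 v" "csupp v" for v
  proof -
    have v2: "Ck (Suc (Suc 0)) v" and v1: "Ck (Suc 0) v"
      using that Ck_le[OF that(1), of 1] by (simp_all add: numeral_2_eq_2)
    have i: "integrable lborel (\<lambda>x. g x * wt \<Phi> x * dd b (dd b v) x)" "integrable lborel (\<lambda>x. g x * wt \<Phi> x * dd b \<Phi> x * dd b v x)" for b
      by (intro integrable_lint_bcs l1 l2 cc_bcs cc_dd2[OF v2] cc_dd[OF v1] that)+
    have "g x * gen \<Phi> v x * wt \<Phi> x = (\<Sum>b\<in>Basis. g x * wt \<Phi> x * dd b (dd b v) x - g x * wt \<Phi> x * dd b \<Phi> x * dd b v x)" for x
      unfolding gen_def by (simp add: sum_distrib_left sum_distrib_right algebra_simps)
    then show ?thesis unfolding I_def using i by simp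
  qed
  have "(\<lambda>n. I (\<lambda>b. dd b (dd b (U n))) (\<lambda>b. dd b (U n))) \<longlonglongrightarrow> I (\<lambda>b. dd b (dd b u)) (\<lambda>b. dd b u)"
    unfolding I_def d2 unfolding d1
    by (intro tendsto_intros conv_rho_weak l1 l2 c1)
  moreover have "I (\<lambda>b. dd b (dd b (U n))) (\<lambda>b. dd b (U n)) = 0" for n
    using I[of "U n"] z[OF U3 Ur] Ck_le[OF U3(1), of 2] U3 by simp
  ultimately have "(\<lambda>n::nat. 0::real) \<longlonglongrightarrow> I (\<lambda>b. dd b (dd b u)) (\<lambda>b. dd b u)" by simp
  then have "I (\<lambda>b. dd b (dd b u)) (\<lambda>b. dd b u) = 0" using LIMSEQ_unique[OF tendsto_const] by metis
  then show ?thesis using I[OF u(1,2)] by simp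
qed

section \<open>Localised energy of weak solutions\<close>

lemma Ck3_diff: "Ck 3 f \<Longrightarrow> f differentiable (at x)"
  by (simp add: numeral_3_eq_3)

text \<open>Uniform continuity on the ball of radius r + 1, which contains all the points y that occur.\<close>
lemma cont_uniform_osc:
  fixes V :: "'a::euclidean_space \<Rightarrow> real"
  assumes V: "continuous_on UNIV V" and d: "d > 0"
  shows "\<exists>N. \<forall>n\<ge>N. \<forall>x y. norm x \<le> r \<longrightarrow> norm (x - y) \<le> eps n \<longrightarrow> \<bar>V y - V x\<bar> \<le> d"
proof -
  have "uniformly_continuous_on (cball 0 (r + 1)) V"
    by (intro compact_uniformly_continuous continuous_on_subset[OF V]) auto
  then obtain \<delta> where \<delta>: "\<delta> > 0" "\<And>x y. x \<in> cball 0 (r + 1) \<Longrightarrow> y \<in> cball 0 (r + 1) \<Longrightarrow> dist y x < \<delta> \<Longrightarrow> dist (V y) (V x) < d"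
    unfolding uniformly_continuous_on_def using d by metis
  obtain N where N: "\<And>n. n \<ge> N \<Longrightarrow> eps n < \<delta>"
    using order_tendstoD(2)[OF eps_0 \<delta>(1)] unfolding eventually_sequentially by blast
  have "\<bar>V y - V x\<bar> \<le> d" if "n \<ge> N" "norm x \<le> r" "norm (x - y) \<le> eps n" for n x y
  proof -
    have "norm y \<le> r + 1" using norm_triangle_ineq3[of y x] that eps_le[of n] by (simp add: norm_minus_commute)
    moreover have "dist y x < \<delta>" using N[OF that(1)] that(3) by (simp add: dist_norm norm_minus_commute)
    ultimately show ?thesis using \<delta>(2)[of x y] that by (simp add: dist_real_def)
  qed
  then show ?thesis by blast
qed

text \<open>The bump scaled to height one. On the ball of half the radius it is at least (3/4)^4, and its gradient is at most 8 / r.\<close>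
definition cutoff :: "real \<Rightarrow> 'a::euclidean_space \<Rightarrow> real" where
  "cutoff r x = bump r x / r ^ 8"

lemma Ck_cutoff: "Ck 3 (cutoff r)"
  unfolding cutoff_def[abs_def] using Ck_cmult[OF Ck_bump, of "1 / r ^ 8" r] by simp

lemma csupp_cutoff: "csupp (cutoff r)"
  unfolding cutoff_def[abs_def] using csupp_mult1[OF csupp_bump, of r "\<lambda>x. 1 / r ^ 8"] by simp

lemma cutoff_bounds: assumes "r > 0" shows "0 \<le> cutoff r x" "cutoff r x \<le> 1"
  unfolding cutoff_def using assms bump_nonneg[of r x] bump_le[of r x] by (auto simp: divide_le_eq)

lemma cutoff_0: "r > 0 \<Longrightarrow> norm x \<ge> r \<Longrightarrow> cutoff r x = 0"
  unfolding cutoff_def by (simp add: bump_eq_0)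

lemma cutoff_ge: assumes r: "r > 0" and x: "2 * norm x \<le> r" shows "cutoff r x \<ge> 1/4"
proof -
  have "4 * (norm x)\<^sup>2 \<le> r\<^sup>2" using power_mono[OF x, of 2] by (simp add: power_mult_distrib)
  then have "3/4 * r\<^sup>2 \<le> r\<^sup>2 - x \<bullet> x" by (simp add: power2_norm_eq_inner)
  then have "3/4 * r\<^sup>2 \<le> max 0 (r\<^sup>2 - x \<bullet> x)" by (rule max.coboundedI2)
  then have "(3/4 * r\<^sup>2) ^ 4 \<le> bump r x" unfolding bump_def by (intro power_mono) auto
  moreover have "(3/4 * r\<^sup>2) ^ 4 = (3/4)^4 * r ^ 8" by (simp only: power_mult_distrib power_mult[symmetric]) simp
  ultimately have a: "(3/4)^4 * r ^ 8 \<le> bump r x" by simp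
  have "1/4 * r ^ 8 \<le> (3/4)^4 * r ^ 8"
    using r by (intro mult_right_mono zero_le_power) (simp_all add: power4_eq_xxxx)
  then have "1/4 * r ^ 8 \<le> bump r x" using a by (rule order.trans)
  then show ?thesis unfolding cutoff_def using r by (simp add: le_divide_eq)
qed

lemma cutoff_grad: assumes r: "r > 0" shows "(\<Sum>b\<in>Basis. (dd b (cutoff r) x)\<^sup>2) \<le> 64 / r\<^sup>2"
proof -
  define m where "m = max 0 (r\<^sup>2 - x \<bullet> x)"
  have m: "0 \<le> m" "m \<le> r\<^sup>2" by (auto simp: m_def)
  have "bump r differentiable (at x)" by (rule Ck3_diff[OF Ck_bump])
  then have d: "dd b (cutoff r) x = - 8 * m ^ 3 * (x \<bullet> b) / r ^ 8" for b
    using dd_cmult[of "bump r" x b "1 / r ^ 8"] unfolding cutoff_def[abs_def] by (simp add: dd_bump m_def)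
  have "(\<Sum>b\<in>Basis. (dd b (cutoff r) x)\<^sup>2) = (\<Sum>b\<in>Basis. (64 * m ^ 6 / r ^ 16) * (x \<bullet> b)\<^sup>2)"
    unfolding d by (intro sum.cong refl) (simp add: power_mult_distrib power_divide power_mult[symmetric])
  also have "\<dots> = (64 * m ^ 6 / r ^ 16) * (x \<bullet> x)"
    by (subst euclidean_inner[of x x]) (simp add: sum_distrib_left power2_eq_square)
  also have "\<dots> \<le> (64 * (r\<^sup>2) ^ 6 / r ^ 16) * r\<^sup>2"
  proof (cases "x \<bullet> x \<le> r\<^sup>2")
    case True
    then show ?thesis using m r by (intro mult_mono divide_right_mono mult_left_mono power_mono) auto
  next
    case False
    then have "m = 0" by (simp add: m_def)
    then show ?thesis using r by simp
  qed
  also have "\<dots> = 64 / r\<^sup>2" using r by (simp add: power_mult[symmetric] field_simps power_add[symmetric])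
  finally show ?thesis .
qed

text \<open>Multiplication by a continuous function almost commutes with mollification; the error is governed by the oscillation
of V at the scale of the kernel.\<close>
lemma conv_commutator_bound:
  fixes h :: "'a::euclidean_space \<Rightarrow> real"
  assumes e: "e > 0" and h: "lint h" and V: "continuous_on UNIV V"
    and osc: "\<And>y. norm (x - y) \<le> e \<Longrightarrow> \<bar>V y - V x\<bar> \<le> d"
  shows "\<bar>V x * conv (rho e) h x - conv (rho e) (\<lambda>y. h y * V y) x\<bar> \<le> d * conv (rho e) (\<lambda>y. \<bar>h y\<bar>) x"
proof -
  have i1: "integrable lborel (\<lambda>y. rho e (x - y) * h y)" by (intro conv_integrable bcs_rho h)
  have i2: "integrable lborel (\<lambda>y. rho e (x - y) * (h y * V y))" by (intro conv_integrable bcs_rho lint_mult_cont h V)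
  have i3: "integrable lborel (\<lambda>y. rho e (x - y) * \<bar>h y\<bar>)" by (intro conv_integrable bcs_rho lint_abs h)
  have "V x * conv (rho e) h x - conv (rho e) (\<lambda>y. h y * V y) x = (\<integral>y. V x * (rho e (x - y) * h y) - rho e (x - y) * (h y * V y) \<partial>lborel)"
    unfolding conv_def using i1 i2 by simp
  also have "\<bar>\<dots>\<bar> \<le> (\<integral>y. \<bar>V x * (rho e (x - y) * h y) - rho e (x - y) * (h y * V y)\<bar> \<partial>lborel)"
    by (rule integral_abs_bound)
  also have "\<dots> \<le> (\<integral>y. d * (rho e (x - y) * \<bar>h y\<bar>) \<partial>lborel)"
  proof (rule integral_mono)
    fix y
    show "\<bar>V x * (rho e (x - y) * h y) - rho e (x - y) * (h y * V y)\<bar> \<le> d * (rho e (x - y) * \<bar>h y\<bar>)"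
    proof (cases "norm (x - y) \<le> e")
      case True
      have "V x * (rho e (x - y) * h y) - rho e (x - y) * (h y * V y) = (V x - V y) * (rho e (x - y) * h y)"
        by (simp add: algebra_simps)
      also have "\<bar>\<dots>\<bar> = \<bar>V y - V x\<bar> * (rho e (x - y) * \<bar>h y\<bar>)"
        using rho_nonneg[of e "x - y"] by (simp add: abs_mult abs_minus_commute)
      also have "\<dots> \<le> d * (rho e (x - y) * \<bar>h y\<bar>)"
        using rho_nonneg[of e "x - y"] by (intro mult_right_mono osc[OF True]) simp
      finally show ?thesis .
    next
      case False
      then have "rho e (x - y) = 0" using rho_0[OF e, of "x - y"] by simp
      then show ?thesis by simp
    qed
  qed (use i1 i2 i3 in auto)
  also have "\<dots> = d * conv (rho e) (\<lambda>y. \<bar>h y\<bar>) x" unfolding conv_def using i3 by simp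
  finally show ?thesis .
qed

text \<open>With \<eta> = c, \<nabla>\<eta> = d and \<nabla>u = a this is the pointwise inequality behind Caccioppoli's estimate: the
product \<nabla>u \<cdot> \<nabla>(\<eta>^2 u) controls \<eta>^2 |\<nabla>u|^2 up to a multiple of |u|^2 |\<nabla>\<eta>|^2; here x stands for u.\<close>
lemma cutoff_energy_pointwise:
  fixes a c d x :: real
  shows "a * (2 * c * d * x + c\<^sup>2 * a) \<ge> 1/2 * (c\<^sup>2 * a\<^sup>2) - 2 * (x\<^sup>2 * d\<^sup>2)"
proof -
  have "0 \<le> 1/2 * (c * a + 2 * d * x)\<^sup>2" by simp
  also have "\<dots> = a * (2 * c * d * x + c\<^sup>2 * a) - (1/2 * (c\<^sup>2 * a\<^sup>2) - 2 * (x\<^sup>2 * d\<^sup>2))"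
    by (simp add: power2_eq_square algebra_simps)
  finally show ?thesis by simp
qed

text \<open>Caccioppoli estimate for the mollification of a weak solution h of \<Delta>h = V h. The mollification \<open>he\<close> solves
\<Delta>he = K with K the mollification of h V, and \<open>V he - K\<close> is small by \<open>conv_commutator_bound\<close>. Testing the
equation for \<open>ge = he * e^{\<Phi>/2}\<close> with \<open>cutoff^2 * ge\<close> in the form \<open>gen_by_parts\<close> bounds its weighted energy by
this error and by the square of \<open>he\<close> times the squared gradient of the cut-off. The potential V itself
disappears from the estimate, because the quadratic form of L in \<open>gen_by_parts\<close> does not contain it. The weak equation is only assumed for invariant
test functions; the one that is used here is invariant.\<close>
lemma mollified_energy:
  fixes h :: "'a::euclidean_space \<Rightarrow> real"
  assumes P: "Ck 2 \<Phi>" and R: "rotations \<R>" and e: "e > 0" and r: "r > 0"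
    and h: "h \<in> borel_measurable borel" "integrable lborel (\<lambda>x. (h x)\<^sup>2)" "rot_inv \<R> h"
    and z: "\<And>w. Ck 3 w \<Longrightarrow> csupp w \<Longrightarrow> rot_inv \<R> w \<Longrightarrow>
        (\<integral>x. h x * (\<Sum>b\<in>Basis. dd b (dd b w) x) \<partial>lborel) = (\<integral>x. h x * schr_pot \<Phi> x * w x \<partial>lborel)"
    and osc: "\<And>x y. norm x \<le> r \<Longrightarrow> norm (x - y) \<le> e \<Longrightarrow> \<bar>schr_pot \<Phi> y - schr_pot \<Phi> x\<bar> \<le> d" and d: "d \<ge> 0"
  defines "ge \<equiv> \<lambda>x. conv (rho e) h x * ehalf \<Phi> x"
  shows "(\<integral>x. (cutoff r x)\<^sup>2 * (\<Sum>b\<in>Basis. (dd b ge x)\<^sup>2) * wt \<Phi> x \<partial>lborel)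
    \<le> (2 * d + 256 / r\<^sup>2) * (\<integral>x. (h x)\<^sup>2 \<partial>lborel)"
proof -
  define V where "V = schr_pot \<Phi>"
  define he where "he = conv (rho e) h"
  define f where "f x = (cutoff r x)\<^sup>2 * he x" for x
  define A where "A = conv (rho e) (\<lambda>y. \<bar>h y\<bar>)"
  define K where "K = conv (rho e) (\<lambda>y. h y * V y)"
  define H where "H = (\<integral>x. (h x)\<^sup>2 \<partial>lborel)"
  have P1: "Ck 1 \<Phi>" using Ck_le[OF P, of 1] by simp
  have Vc: "continuous_on UNIV V" unfolding V_def by (rule schr_pot_cont[OF P])
  have hl: "lint h" by (rule lint_square[OF h(1,2)])
  have hVl: "lint (\<lambda>y. h y * V y)" by (intro lint_mult_cont hl Vc)
  have he3: "Ck 3 he" unfolding he_def by (intro Ck_conv Ck_rho csupp_rho hl)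
  have hec: "continuous_on UNIV he" by (rule Ck_cont[OF he3])
  have ctc: "continuous_on UNIV (cutoff r :: 'a \<Rightarrow> real)" by (rule Ck_cont[OF Ck_cutoff])
  have wc: "continuous_on UNIV (wt \<Phi>)" by (intro Ck_cont[OF Ck_wt[OF P]])
  have c2: "Ck 3 (\<lambda>x::'a. (cutoff r x)\<^sup>2)" "csupp (\<lambda>x::'a. (cutoff r x)\<^sup>2)"
    unfolding power2_eq_square by (intro Ck_mult Ck_cutoff csupp_mult1 csupp_cutoff)+
  have f3: "Ck 3 f" "csupp f" unfolding f_def[abs_def] by (intro Ck_mult he3 c2 csupp_mult1)+
  have f1: "Ck 1 f" and f2: "Ck (Suc (Suc 0)) f" using Ck_le[OF f3(1), of 1] Ck_le[OF f3(1), of 2] by (simp_all add: numeral_2_eq_2)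
  have hr: "rot_inv \<R> he" unfolding he_def
    by (intro conv_rot_inv R h radial_rot_inv borel_measurable_continuous_onI cont_rho)
  have fr: "rot_inv \<R> f" using hr radial_rot_inv(1)[OF R, of r] unfolding f_def cutoff_def rot_inv_def by simp
  \<comment> \<open>mollifying the test function once more moves the mollification from w onto h, by symmetry of convolution\<close>
  define w where "w = conv (rho e) f"
  have w: "Ck 3 w" "csupp w" "rot_inv \<R> w" unfolding w_def
    by (intro Ck_conv csupp_conv conv_rot_inv R Ck_rho csupp_rho lint_cont Ck_cont[OF f1] f3 fr radial_rot_inv borel_measurable_continuous_onI cont_rho)+
  have dw: "dd b (dd b w) = conv (rho e) (dd b (dd b f))" for b
  proof -
    have "dd b w = conv (rho e) (dd b f)" unfolding w_def by (intro dd_conv2 cont_rho f1 f3)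
    then show ?thesis using f2 f3 by (simp add: dd_conv2 cont_rho csupp_dd)
  qed
  have ccff: "cc (dd b (dd b f))" for b by (rule cc_dd2[OF f2 f3(2)])
  have ccf: "cc f" by (rule cc_Ck[OF f3])
  have "(\<integral>x. h x * (\<Sum>b\<in>Basis. dd b (dd b w) x) \<partial>lborel) = (\<Sum>b\<in>Basis. \<integral>x. h x * dd b (dd b w) x \<partial>lborel)"
  proof -
    have "Ck (Suc (Suc 0)) w" using Ck_le[OF w(1), of 2] by (simp add: numeral_2_eq_2)
    then have "integrable lborel (\<lambda>x. h x * dd b (dd b w) x)" for b
      by (intro integrable_lint_bcs hl cc_bcs cc_dd2[of 0] w) auto
    then show ?thesis by (simp add: sum_distrib_left Bochner_Integration.integral_sum)
  qed
  also have "\<dots> = (\<Sum>b\<in>Basis. \<integral>x. he x * dd b (dd b f) x \<partial>lborel)"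
    unfolding dw he_def by (intro sum.cong refl conv_adjoint[symmetric] bcs_rho rho_even hl cc_bcs ccff)
  also have "\<dots> = (\<integral>x. he x * (\<Sum>b\<in>Basis. dd b (dd b f) x) \<partial>lborel)"
  proof -
    have "integrable lborel (\<lambda>x. he x * dd b (dd b f) x)" for b by (intro cc_integrable cc_mult2 hec ccff)
    then show ?thesis by (simp add: sum_distrib_left Bochner_Integration.integral_sum)
  qed
  finally have lap: "(\<integral>x. h x * (\<Sum>b\<in>Basis. dd b (dd b w) x) \<partial>lborel) = (\<integral>x. he x * (\<Sum>b\<in>Basis. dd b (dd b f) x) \<partial>lborel)" .
  have pot: "(\<integral>x. h x * V x * w x \<partial>lborel) = (\<integral>x. K x * f x \<partial>lborel)"
    unfolding w_def K_def by (intro conv_adjoint[symmetric] bcs_rho rho_even hVl cc_bcs ccf)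
  have eq: "(\<integral>x. he x * (\<Sum>b\<in>Basis. dd b (dd b f) x) \<partial>lborel) = (\<integral>x. K x * f x \<partial>lborel)"
    using z[OF w] lap pot unfolding V_def by simp
  have Kc: "continuous_on UNIV K" unfolding K_def by (intro conv_continuous cont_rho csupp_rho hVl)
  have E2: "Ck 2 (ehalf \<Phi>)" by (rule Ck_ehalf[OF P])
  have ge: "ge = (\<lambda>x. he x * ehalf \<Phi> x)" by (simp add: ge_def he_def)
  have ge2: "Ck 2 ge" unfolding ge by (intro Ck_mult E2 Ck_le[OF he3]) simp
  have ge1: "Ck 1 ge" using Ck_le[OF ge2, of 1] by simp
  define F where "F x = f x * ehalf \<Phi> x" for x
  have F2: "Ck 2 F" "csupp F" unfolding F_def[abs_def] using Ck_le[OF f3(1), of 2]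
    by (intro Ck_mult E2 csupp_mult1 f3; simp)+
  have Fge: "F = (\<lambda>x. (cutoff r x)\<^sup>2 * ge x)" unfolding F_def f_def ge by (simp add: mult_ac)
  \<comment> \<open>the two factors of e to the power \<Phi>/2 cancel the weight\<close>
  have gF: "ge x * gen \<Phi> F x * wt \<Phi> x = he x * (\<Sum>b\<in>Basis. dd b (dd b f) x) - he x * V x * f x" for x
  proof -
    have g: "gen \<Phi> F x = ((\<Sum>b\<in>Basis. dd b (dd b f) x) - V x * f x) * ehalf \<Phi> x"
      unfolding F_def[abs_def] V_def using Ck_le[OF f3(1), of 2] by (intro gen_ehalf P) simp
    have "ge x * gen \<Phi> F x * wt \<Phi> x = he x * ((\<Sum>b\<in>Basis. dd b (dd b f) x) - V x * f x) * (ehalf \<Phi> x * ehalf \<Phi> x * wt \<Phi> x)"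
      unfolding g ge by (simp only: mult_ac)
    then show ?thesis unfolding ehalf_wt by (simp add: algebra_simps)
  qed
  have i1: "integrable lborel (\<lambda>x. he x * (\<Sum>b\<in>Basis. dd b (dd b f) x))" by (intro cc_integrable cc_mult2 hec cc_sum ccff)
  have i2: "integrable lborel (\<lambda>x. he x * V x * f x)" by (intro cc_integrable cc_mult2 continuous_intros hec Vc ccf)
  have i3: "integrable lborel (\<lambda>x. K x * f x)" by (intro cc_integrable cc_mult2 Kc ccf)
  have en: "(\<integral>x. (\<Sum>b\<in>Basis. dd b ge x * dd b F x) * wt \<Phi> x \<partial>lborel) = (\<integral>x. (V x * he x - K x) * f x \<partial>lborel)"
  proof -
    have "- (\<integral>x. (\<Sum>b\<in>Basis. dd b ge x * dd b F x) * wt \<Phi> x \<partial>lborel) = (\<integral>x. ge x * gen \<Phi> F x * wt \<Phi> x \<partial>lborel)"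
      using gen_by_parts[OF P1 ge1 F2] by simp
    also have "\<dots> = (\<integral>x. K x * f x \<partial>lborel) - (\<integral>x. he x * V x * f x \<partial>lborel)"
      unfolding gF using i1 i2 eq by simp
    also have "\<dots> = - (\<integral>x. (V x * he x - K x) * f x \<partial>lborel)"
      using i2 i3 by (simp add: left_diff_distrib mult.commute[of "V _"])
    finally show ?thesis by simp
  qed
  note L2 = conv_rho_L2[OF e h(1,2)]
  have habs: "(\<lambda>x. \<bar>h x\<bar>) \<in> borel_measurable borel" "integrable lborel (\<lambda>x. \<bar>h x\<bar>\<^sup>2)" using h by auto
  have LA: "integrable lborel (\<lambda>x. (A x)\<^sup>2)" "(\<integral>x. (A x)\<^sup>2 \<partial>lborel) \<le> H"
    using conv_rho_L2[OF e habs] unfolding A_def H_def by auto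
  have Lh: "integrable lborel (\<lambda>x. (he x)\<^sup>2)" "(\<integral>x. (he x)\<^sup>2 \<partial>lborel) \<le> H"
    using L2 unfolding he_def H_def by auto
  have err: "(\<integral>x. (V x * he x - K x) * f x \<partial>lborel) \<le> d * H"
  proof -
    have "(\<integral>x. (V x * he x - K x) * f x \<partial>lborel) \<le> (\<integral>x. d * (1/2 * (A x)\<^sup>2 + 1/2 * (he x)\<^sup>2) \<partial>lborel)"
    proof (rule integral_mono)
      show "integrable lborel (\<lambda>x. (V x * he x - K x) * f x)"
        by (intro cc_integrable cc_mult2 continuous_intros hec Vc Kc ccf)
      show "integrable lborel (\<lambda>x. d * (1/2 * (A x)\<^sup>2 + 1/2 * (he x)\<^sup>2))" using LA Lh by auto
      fix x :: 'a
      show "(V x * he x - K x) * f x \<le> d * (1/2 * (A x)\<^sup>2 + 1/2 * (he x)\<^sup>2)"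
      proof (cases "norm x \<le> r")
        case True
        have c: "\<bar>V x * he x - K x\<bar> \<le> d * A x"
          unfolding he_def K_def A_def V_def
          by (rule conv_commutator_bound[OF e hl schr_pot_cont[OF P] osc[OF True]])
        have "(cutoff r x)\<^sup>2 \<le> 1" using cutoff_bounds[OF r, of x] by (simp add: power_le_one)
        then have fx: "\<bar>f x\<bar> \<le> \<bar>he x\<bar>" unfolding f_def using mult_right_mono[of "(cutoff r x)\<^sup>2" 1 "\<bar>he x\<bar>"] by (simp add: abs_mult)
        have "(V x * he x - K x) * f x \<le> \<bar>V x * he x - K x\<bar> * \<bar>f x\<bar>" by (simp flip: abs_mult)
        also have "\<dots> \<le> (d * A x) * \<bar>he x\<bar>" by (rule mult_mono[OF c fx order.trans[OF abs_ge_zero c] abs_ge_zero])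
        also have "\<dots> \<le> d * (1/2 * (A x)\<^sup>2 + 1/2 * (he x)\<^sup>2)"
        proof -
          have "0 \<le> (A x - \<bar>he x\<bar>)\<^sup>2" by simp
          then have "A x * \<bar>he x\<bar> \<le> 1/2 * (A x)\<^sup>2 + 1/2 * (he x)\<^sup>2" by (simp add: power2_diff)
          from mult_left_mono[OF this d] show ?thesis by (simp add: mult.assoc)
        qed
        finally show ?thesis .
      next
        case False
        then have "f x = 0" unfolding f_def using cutoff_0[OF r, of x] by simp
        then show ?thesis using d by simp
      qed
    qed
    also have "\<dots> = d * (1/2 * (\<integral>x. (A x)\<^sup>2 \<partial>lborel) + 1/2 * (\<integral>x. (he x)\<^sup>2 \<partial>lborel))" using LA Lh by simp
    also have "\<dots> \<le> d * H" using LA(2) Lh(2) d by (intro mult_left_mono) auto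
    finally show ?thesis .
  qed
  have ctd: "cutoff r differentiable (at x)" for x :: 'a by (rule Ck3_diff[OF Ck_cutoff])
  have ged: "ge differentiable (at x)" for x using ge1 by simp
  have dF: "dd b F x = 2 * cutoff r x * dd b (cutoff r) x * ge x + (cutoff r x)\<^sup>2 * dd b ge x" for b x
    unfolding Fge power2_eq_square using ctd ged
    by (subst dd_mult) (auto simp: dd_mult algebra_simps intro!: derivative_intros)
  let ?S = "\<lambda>x. (cutoff r x)\<^sup>2 * (\<Sum>b\<in>Basis. (dd b ge x)\<^sup>2) * wt \<Phi> x"
  have ptw: "1/2 * ?S x - 128 / r\<^sup>2 * (he x)\<^sup>2 \<le> (\<Sum>b\<in>Basis. dd b ge x * dd b F x) * wt \<Phi> x" for x
  proof -
    have "(\<Sum>b\<in>Basis. dd b ge x * dd b F x) \<ge>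
      (\<Sum>b\<in>Basis. 1/2 * ((cutoff r x)\<^sup>2 * (dd b ge x)\<^sup>2) - 2 * ((ge x)\<^sup>2 * (dd b (cutoff r) x)\<^sup>2))"
      unfolding dF by (intro sum_mono) (rule cutoff_energy_pointwise)
    also have "(\<Sum>b\<in>Basis. 1/2 * ((cutoff r x)\<^sup>2 * (dd b ge x)\<^sup>2) - 2 * ((ge x)\<^sup>2 * (dd b (cutoff r) x)\<^sup>2))
      = 1/2 * ((cutoff r x)\<^sup>2 * (\<Sum>b\<in>Basis. (dd b ge x)\<^sup>2)) - 2 * (ge x)\<^sup>2 * (\<Sum>b\<in>Basis. (dd b (cutoff r) x)\<^sup>2)"
      by (simp add: sum_subtractf sum_distrib_left mult_ac)
    finally have a: "1/2 * ((cutoff r x)\<^sup>2 * (\<Sum>b\<in>Basis. (dd b ge x)\<^sup>2)) - 2 * (ge x)\<^sup>2 * (64 / r\<^sup>2) \<le> (\<Sum>b\<in>Basis. dd b ge x * dd b F x)"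
      using mult_left_mono[OF cutoff_grad[OF r, of x], of "2 * (ge x)\<^sup>2"] by simp
    have b: "(ge x)\<^sup>2 * wt \<Phi> x = (he x)\<^sup>2"
    proof -
      have "(ge x)\<^sup>2 * wt \<Phi> x = (he x)\<^sup>2 * (ehalf \<Phi> x * ehalf \<Phi> x * wt \<Phi> x)"
        unfolding ge power2_eq_square by (simp only: mult_ac)
      then show ?thesis unfolding ehalf_wt by simp
    qed
    have "1/2 * ?S x - 128 / r\<^sup>2 * ((ge x)\<^sup>2 * wt \<Phi> x)
        = (1/2 * ((cutoff r x)\<^sup>2 * (\<Sum>b\<in>Basis. (dd b ge x)\<^sup>2)) - 2 * (ge x)\<^sup>2 * (64 / r\<^sup>2)) * wt \<Phi> x"
      using r by (simp add: field_simps)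
    also have "\<dots> \<le> (\<Sum>b\<in>Basis. dd b ge x * dd b F x) * wt \<Phi> x"
      by (rule mult_right_mono[OF a less_imp_le[OF wt_pos]])
    finally have "1/2 * ?S x - 128 / r\<^sup>2 * ((ge x)\<^sup>2 * wt \<Phi> x) \<le> (\<Sum>b\<in>Basis. dd b ge x * dd b F x) * wt \<Phi> x" .
    then show ?thesis unfolding b .
  qed
  have dgec: "continuous_on UNIV (dd b ge)" for b using ge1 by simp
  have iS: "integrable lborel ?S"
    by (intro cc_integrable cc_mult1 wc cc_Ck[OF c2] continuous_intros dgec)
  have iF: "integrable lborel (\<lambda>x. (\<Sum>b\<in>Basis. dd b ge x * dd b F x) * wt \<Phi> x)"
    using F2(2) Ck_le[OF F2(1), of 1] by (intro cc_integrable cc_mult1[OF _ wc] cc_sum cc_mult2 dgec cc_dd[of 0]) auto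
  have "1/2 * (\<integral>x. ?S x \<partial>lborel) - 128 / r\<^sup>2 * (\<integral>x. (he x)\<^sup>2 \<partial>lborel) = (\<integral>x. 1/2 * ?S x - 128 / r\<^sup>2 * (he x)\<^sup>2 \<partial>lborel)"
    using iS Lh(1) by simp
  also have "\<dots> \<le> (\<integral>x. (\<Sum>b\<in>Basis. dd b ge x * dd b F x) * wt \<Phi> x \<partial>lborel)"
    using iS Lh(1) iF by (intro integral_mono ptw) auto
  also have "\<dots> \<le> d * H" unfolding en by (rule err)
  finally have "(\<integral>x. ?S x \<partial>lborel) \<le> 2 * d * H + 256 / r\<^sup>2 * (\<integral>x. (he x)\<^sup>2 \<partial>lborel)" by simp
  also have "\<dots> \<le> 2 * d * H + 256 / r\<^sup>2 * H" using r by (intro add_left_mono mult_left_mono Lh(2)) auto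
  finally show ?thesis unfolding H_def by (simp add: distrib_right)
qed

section \<open>Functions orthogonal to the range of the generator\<close>

text \<open>The function h = g e^{-\<Phi>/2} is a weak solution of the conjugated equation. For a fixed test function p and k = 1, 2, ... the
estimate \<open>mollified_energy\<close> on a ball of radius about k, with a mollification so fine that V oscillates by at most 1 / k^2, bounds
the weighted energy of the approximations \<open>G n\<close> of g near the support of p by a multiple of 1 / k^2. Cauchy-Schwarz
in the form of Young's inequality with parameter k then bounds \<integral> g (dd b p) by a multiple of 1 / k. So the weak gradient of g vanishes.\<close>
lemma orth_gen_const:
  fixes g :: "'a::euclidean_space \<Rightarrow> real"
  assumes P: "Ck 2 \<Phi>" and R: "rotations \<R>" "rot_inv \<R> \<Phi>"
    and g: "g \<in> borel_measurable borel" "integrable lborel (\<lambda>x. (g x)\<^sup>2 * wt \<Phi> x)" "rot_inv \<R> g"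
    and z: "\<And>u. Ck 3 u \<Longrightarrow> csupp u \<Longrightarrow> rot_inv \<R> u \<Longrightarrow> (\<integral>x. g x * gen \<Phi> u x * wt \<Phi> x \<partial>lborel) = 0"
  shows "\<exists>c. AE x in lborel. g x = c"
proof -
  define E where "E = ehalf \<Phi>"
  define V where "V = schr_pot \<Phi>"
  define h where "h x = g x * (E x * wt \<Phi> x)" for x
  have P1: "Ck 1 \<Phi>" using Ck_le[OF P, of 1] by simp
  have E2: "Ck 2 E" unfolding E_def by (rule Ck_ehalf[OF P])
  have Ec: "continuous_on UNIV E" by (rule Ck_cont[OF E2])
  have wc: "continuous_on UNIV (wt \<Phi>)" by (intro Ck_cont[OF Ck_wt[OF P]])
  have Vc: "continuous_on UNIV V" unfolding V_def by (rule schr_pot_cont[OF P])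
  have EEw: "E x * E x * wt \<Phi> x = 1" for x unfolding E_def by (rule ehalf_wt)
  have h2: "(h x)\<^sup>2 = (g x)\<^sup>2 * wt \<Phi> x" for x
  proof -
    have "(h x)\<^sup>2 = (g x)\<^sup>2 * wt \<Phi> x * (E x * E x * wt \<Phi> x)" unfolding h_def power2_eq_square by (simp only: mult_ac)
    then show ?thesis unfolding EEw by simp
  qed
  have hE: "h x * E x = g x" for x
  proof -
    have "h x * E x = g x * (E x * E x * wt \<Phi> x)" unfolding h_def by (simp only: mult_ac)
    then show ?thesis unfolding EEw by simp
  qed
  have hm: "h \<in> borel_measurable borel" unfolding h_def[abs_def]
    using g(1) borel_measurable_continuous_onI[OF Ec] borel_measurable_continuous_onI[OF wc] by measurable
  have hi: "integrable lborel (\<lambda>x. (h x)\<^sup>2)" unfolding h2 by (rule g(2))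
  have hl: "lint h" by (rule lint_square[OF hm hi])
  have gl: "lint g" using lint_mult_cont[OF hl Ec] unfolding hE .
  have hr: "rot_inv \<R> h" using g(3) R(2) unfolding rot_inv_def h_def E_def ehalf_def wt_def by simp
  have zz: "(\<integral>x. h x * (\<Sum>b\<in>Basis. dd b (dd b w) x) \<partial>lborel) = (\<integral>x. h x * schr_pot \<Phi> x * w x \<partial>lborel)"
    if w: "Ck 3 w" "csupp w" "rot_inv \<R> w" for w
  proof -
    have w2: "Ck 2 w" and w2': "Ck (Suc (Suc 0)) w" using Ck_le[OF w(1), of 2] by (simp_all add: numeral_2_eq_2)
    have "(\<integral>x. g x * gen \<Phi> (\<lambda>x. w x * E x) x * wt \<Phi> x \<partial>lborel) = 0"
    proof (rule test_fun_C2[OF P R(1) gl z])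
      show "rot_inv \<R> (\<lambda>x. w x * E x)" using w(3) R(2) unfolding rot_inv_def E_def ehalf_def by simp
    qed (auto intro!: Ck_mult w2 E2 csupp_mult1 w)
    moreover have "g x * gen \<Phi> (\<lambda>x. w x * E x) x * wt \<Phi> x = h x * (\<Sum>b\<in>Basis. dd b (dd b w) x) - h x * V x * w x" for x
      unfolding E_def gen_ehalf[OF P w2] unfolding h_def V_def E_def by (simp add: algebra_simps)
    moreover have "integrable lborel (\<lambda>x. h x * (\<Sum>b\<in>Basis. dd b (dd b w) x))"
      by (intro integrable_lint_bcs hl cc_bcs cc_sum cc_dd2[OF w2'] w)
    moreover have "integrable lborel (\<lambda>x. h x * V x * w x)"
      by (intro integrable_lint_bcs lint_mult_cont hl Vc cc_bcs cc_Ck[OF w(1)] w)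
    ultimately show ?thesis unfolding V_def by simp
  qed
  define H where "H = (\<integral>x. (h x)\<^sup>2 \<partial>lborel)"
  have H0: "H \<ge> 0" unfolding H_def by (intro Bochner_Integration.integral_nonneg) simp
  define G where "G n x = conv (rho (eps n)) h x * E x" for n x
  have G2: "Ck 2 (G n)" for n unfolding G_def[abs_def]
    by (intro Ck_mult E2 Ck_conv Ck_le[OF Ck_rho] csupp_rho hl) simp
  have G1: "Ck 1 (G n)" for n using Ck_le[OF G2, of 1] by simp
  have dGc: "continuous_on UNIV (dd b (G n))" for b n using G1 by simp
  show ?thesis
  proof (rule weak_gradient_zero_const[OF gl])
    fix p :: "'a \<Rightarrow> real" and b :: 'a assume p: "Ck 3 p" "csupp p" and b: "b \<in> Basis"
    have p1: "Ck 1 p" using Ck_le[OF p(1), of 1] by simp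
    have ccp: "cc p" by (rule cc_Ck[OF p])
    have ccdp: "cc (dd b p)" using cc_dd[of 0 p b] p1 p by simp
    have pc: "continuous_on UNIV p" using ccp by (simp add: cc_def)
    obtain s where s: "s > 0" "\<And>x. norm x > s \<Longrightarrow> p x = 0" using bcsE[OF cc_bcs[OF ccp]] by metis
    define K where "K = (\<integral>x. (p x)\<^sup>2 * (E x * E x) \<partial>lborel)"
    have ccK: "cc (\<lambda>x. (p x)\<^sup>2 * (E x * E x))" unfolding power2_eq_square by (intro cc_mult1 ccp pc continuous_intros Ec)
    \<comment> \<open>on the support of p the cut-off is at least 1/4; Young's inequality with parameter t splits the product of gradient and p\<close>
    have step: "\<bar>\<integral>x. G n x * dd b p x \<partial>lborel\<bar> \<le> 8 * t * ((2 * d + 256 / r\<^sup>2) * H) + K / (2 * t)"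
      if r: "r > 0" "2 * s \<le> r" and t: "t > 0" and d: "d \<ge> 0"
        and osc: "\<And>x y. norm x \<le> r \<Longrightarrow> norm (x - y) \<le> eps n \<Longrightarrow> \<bar>V y - V x\<bar> \<le> d" for n r t d
    proof -
      let ?S = "\<lambda>x. (cutoff r x)\<^sup>2 * (\<Sum>b\<in>Basis. (dd b (G n) x)\<^sup>2) * wt \<Phi> x"
      have S: "(\<integral>x. ?S x \<partial>lborel) \<le> (2 * d + 256 / r\<^sup>2) * H"
        using mollified_energy[OF P R(1) eps_pos[of n] r(1) hm hi hr zz osc[unfolded V_def] d]
        unfolding G_def[abs_def] E_def H_def by simp
      have c2: "cc (\<lambda>x::'a. (cutoff r x)\<^sup>2)"
        unfolding power2_eq_square cc_def by (intro conjI continuous_intros csupp_mult1 csupp_cutoff Ck_cont[OF Ck_cutoff])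
      have iS: "integrable lborel ?S" by (intro cc_integrable cc_mult1 wc c2 continuous_intros dGc)
      have "(\<integral>x. G n x * dd b p x \<partial>lborel) = - (\<integral>x. dd b (G n) x * p x \<partial>lborel)"
        using integral_by_parts_dd[OF G1 p1, of n b] p(2) by simp
      then have "\<bar>\<integral>x. G n x * dd b p x \<partial>lborel\<bar> \<le> (\<integral>x. \<bar>dd b (G n) x * p x\<bar> \<partial>lborel)"
        using integral_abs_bound[of lborel "\<lambda>x. dd b (G n) x * p x"] by simp
      also have "\<dots> \<le> (\<integral>x. 8 * t * ?S x + 1 / (2 * t) * ((p x)\<^sup>2 * (E x * E x)) \<partial>lborel)"
      proof (rule integral_mono)
        show "integrable lborel (\<lambda>x. \<bar>dd b (G n) x * p x\<bar>)" by (intro integrable_abs cc_integrable cc_mult2 dGc ccp)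
        show "integrable lborel (\<lambda>x. 8 * t * ?S x + 1 / (2 * t) * ((p x)\<^sup>2 * (E x * E x)))"
          by (intro Bochner_Integration.integrable_add integrable_mult_right iS cc_integrable ccK)
        fix x :: 'a
        let ?a = "dd b (G n) x"
        have S0: "?S x \<ge> 0" using wt_pos[of \<Phi> x] by (intro mult_nonneg_nonneg sum_nonneg) auto
        show "\<bar>?a * p x\<bar> \<le> 8 * t * ?S x + 1 / (2 * t) * ((p x)\<^sup>2 * (E x * E x))"
        proof (cases "norm x > s")
          case True
          then show ?thesis using s(2)[OF True] S0 t by simp
        next
          case False
          have "1/4 \<le> cutoff r x" using False r by (intro cutoff_ge) auto
          then have "1/16 \<le> (cutoff r x)\<^sup>2" using power_mono[of "1/4" "cutoff r x" 2] by (simp add: power2_eq_square)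
          moreover have "?a\<^sup>2 \<le> (\<Sum>b\<in>Basis. (dd b (G n) x)\<^sup>2)"
            using b by (intro member_le_sum) auto
          ultimately have "1/16 * ?a\<^sup>2 * wt \<Phi> x \<le> ?S x"
            using wt_pos[of \<Phi> x] by (intro mult_right_mono mult_mono) auto
          then have 1: "t / 2 * (?a\<^sup>2 * wt \<Phi> x) \<le> 8 * t * ?S x" using t by simp
          have "0 \<le> (t * \<bar>?a\<bar> * sqrt (wt \<Phi> x) - \<bar>p x\<bar> * E x)\<^sup>2" by simp
          also have "\<dots> = t\<^sup>2 * ?a\<^sup>2 * wt \<Phi> x - 2 * t * (\<bar>?a\<bar> * \<bar>p x\<bar>) * (sqrt (wt \<Phi> x) * E x) + (p x)\<^sup>2 * (E x * E x)"
            using wt_pos[of \<Phi> x] by (simp add: power2_eq_square algebra_simps)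
          also have "sqrt (wt \<Phi> x) * E x = 1"
          proof -
            have "E x > 0" unfolding E_def by (rule ehalf_pos)
            then have "sqrt (wt \<Phi> x) * E x = sqrt (wt \<Phi> x * (E x * E x))" by (simp add: real_sqrt_mult)
            then show ?thesis using EEw[of x] by (simp add: mult_ac)
          qed
          finally have "2 * t * \<bar>?a * p x\<bar> \<le> t\<^sup>2 * ?a\<^sup>2 * wt \<Phi> x + (p x)\<^sup>2 * (E x * E x)" by (simp add: abs_mult)
          then have "\<bar>?a * p x\<bar> \<le> (t\<^sup>2 * ?a\<^sup>2 * wt \<Phi> x + (p x)\<^sup>2 * (E x * E x)) / (2 * t)"
            using t by (simp add: le_divide_eq mult.commute)
          also have "\<dots> = t / 2 * (?a\<^sup>2 * wt \<Phi> x) + 1 / (2 * t) * ((p x)\<^sup>2 * (E x * E x))"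
            using t by (simp add: field_simps power2_eq_square)
          finally show ?thesis using 1 by linarith
        qed
      qed
      also have "\<dots> = 8 * t * (\<integral>x. ?S x \<partial>lborel) + 1 / (2 * t) * K"
        unfolding K_def using iS cc_integrable[OF ccK] by simp
      also have "\<dots> \<le> 8 * t * ((2 * d + 256 / r\<^sup>2) * H) + K / (2 * t)" using S t by simp
      finally show ?thesis .
    qed
    define X where "X = (\<integral>x. g x * dd b p x \<partial>lborel)"
    have lim: "(\<lambda>n. \<integral>x. G n x * dd b p x \<partial>lborel) \<longlonglongrightarrow> X"
    proof -
      have ccE: "cc (\<lambda>x. E x * dd b p x)" by (intro cc_mult2 Ec ccdp)
      have "(\<integral>x. G n x * dd b p x \<partial>lborel) = (\<integral>x. h x * conv (rho (eps n)) (\<lambda>x. E x * dd b p x) x \<partial>lborel)" for n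
        unfolding G_def mult.assoc by (intro conv_adjoint bcs_rho rho_even hl cc_bcs ccE)
      moreover have "X = (\<integral>x. h x * (E x * dd b p x) \<partial>lborel)"
        unfolding X_def mult.assoc[symmetric] hE ..
      ultimately show ?thesis using conv_rho_weak[OF hl, of "\<lambda>x. E x * dd b p x"] ccE by (simp add: cc_def)
    qed
    have bnd: "\<bar>X\<bar> \<le> (2064 * H + K / 2) / real k" if k: "k > 0" for k :: nat
    proof -
      \<comment> \<open>with t = k the bound of step is at most 8 k (2 / k^2 + 256 / k^2) H + K / (2 k), and 8 * 258 = 2064\<close>
      define r where "r = real k * (2 * s + 1)"
      have r: "r > 0" "2 * s \<le> r" "real k \<le> r"
      proof -
        have "1 * (2 * s + 1) \<le> real k * (2 * s + 1)" using k s(1) by (intro mult_right_mono) auto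
        then have "2 * s + 1 \<le> r" unfolding r_def by simp
        then show "r > 0" "2 * s \<le> r" using s(1) by linarith+
        show "real k \<le> r" unfolding r_def using k s by simp
      qed
      define d where "d = 1 / (real k)\<^sup>2"
      have d: "d > 0" using k by (simp add: d_def)
      obtain N where N: "\<And>n x y. n \<ge> N \<Longrightarrow> norm x \<le> r \<Longrightarrow> norm (x - y) \<le> eps n \<Longrightarrow> \<bar>V y - V x\<bar> \<le> d"
        using cont_uniform_osc[OF Vc d, of r] by blast
      have "256 / r\<^sup>2 \<le> 256 / (real k)\<^sup>2" using r k by (intro divide_left_mono power_mono) auto
      then have "(2 * d + 256 / r\<^sup>2) * H \<le> (258 / (real k)\<^sup>2) * H"
        using H0 by (intro mult_right_mono) (auto simp: d_def add_divide_distrib[symmetric])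
      then have "8 * real k * ((2 * d + 256 / r\<^sup>2) * H) \<le> 8 * real k * ((258 / (real k)\<^sup>2) * H)"
        by (intro mult_left_mono) auto
      also have "\<dots> = 2064 * H / real k" using k by (simp add: power2_eq_square)
      finally have "8 * real k * ((2 * d + 256 / r\<^sup>2) * H) + K / (2 * real k) \<le> (2064 * H + K / 2) / real k"
        by (simp add: add_divide_distrib)
      moreover have "\<bar>\<integral>x. G n x * dd b p x \<partial>lborel\<bar> \<le> 8 * real k * ((2 * d + 256 / r\<^sup>2) * H) + K / (2 * real k)" if "n \<ge> N" for n
        using k d N[OF that] by (intro step r) auto
      ultimately have "\<forall>\<^sub>F n in sequentially. \<bar>\<integral>x. G n x * dd b p x \<partial>lborel\<bar> \<le> (2064 * H + K / 2) / real k"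
        unfolding eventually_sequentially by (meson order.trans)
      then show ?thesis using tendsto_rabs[OF lim] tendsto_upperbound[OF _ _ sequentially_bot] by blast
    qed
    have "(\<lambda>k. (2064 * H + K / 2) / real (Suc k)) \<longlonglongrightarrow> 0"
      using LIMSEQ_Suc[OF lim_const_over_n] .
    moreover have "\<bar>X\<bar> \<le> (2064 * H + K / 2) / real (Suc k)" for k by (rule bnd) simp
    ultimately have "\<bar>X\<bar> \<le> 0" by (intro LIMSEQ_le_const) auto
    then show "(\<integral>x. g x * dd b p x \<partial>lborel) = 0" unfolding X_def by simp
  qed
qed

text \<open>Riesz-Fischer. The limit is obtained as the pointwise limit of a subsequence, which makes it invariant under every
symmetry shared by all f n; this is why the statement exhibits it as a \<open>lim\<close>.\<close>
lemma L2_complete: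
  fixes f :: "nat \<Rightarrow> 'a \<Rightarrow> real"
  assumes f: "\<And>n. f n \<in> borel_measurable M" and fi: "\<And>n. integrable M (\<lambda>x. (f n x)\<^sup>2)"
    and cau: "\<And>e. e > 0 \<Longrightarrow> \<exists>N. \<forall>m\<ge>N. \<forall>n\<ge>N. (\<integral>x. (f m x - f n x)\<^sup>2 \<partial>M) < e"
  shows "\<exists>\<phi>. let g = (\<lambda>x. lim (\<lambda>k. f (\<phi> k) x)) in
     g \<in> borel_measurable M \<and> integrable M (\<lambda>x. (g x)\<^sup>2) \<and> (\<lambda>n. \<integral>x. (f n x - g x)\<^sup>2 \<partial>M) \<longlonglongrightarrow> 0"
proof -
  have id: "integrable M (\<lambda>x. (u x - v x)\<^sup>2)"
    if "u \<in> borel_measurable M" "integrable M (\<lambda>x. (u x)\<^sup>2)" "v \<in> borel_measurable M" "integrable M (\<lambda>x. (v x)\<^sup>2)"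
    for u v :: "'a \<Rightarrow> real"
  proof (rule Bochner_Integration.integrable_bound)
    show "integrable M (\<lambda>x. 2 * (u x)\<^sup>2 + 2 * (v x)\<^sup>2)" using that by auto
    have "(u x - v x)\<^sup>2 \<le> 2 * (u x)\<^sup>2 + 2 * (v x)\<^sup>2" for x
    proof -
      have "0 \<le> (u x + v x)\<^sup>2" by simp
      then show ?thesis by (simp add: power2_sum power2_diff)
    qed
    then show "AE x in M. norm ((u x - v x)\<^sup>2) \<le> norm (2 * (u x)\<^sup>2 + 2 * (v x)\<^sup>2)" by (intro AE_I2) simp
  qed (use that in measurable)
  \<comment> \<open>squared distances below (1/4)^k leave room for the factor 2^k, with which the squares of the increments are still summable; a pointwise bound of the increments follows from the arithmetic-geometric mean\<close>
  have "\<exists>N. \<forall>m\<ge>N. \<forall>n\<ge>N. (\<integral>x. (f m x - f n x)\<^sup>2 \<partial>M) < (1/4)^k" for k by (rule cau) simp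
  then obtain N where N: "\<And>k m n. m \<ge> N k \<Longrightarrow> n \<ge> N k \<Longrightarrow> (\<integral>x. (f m x - f n x)\<^sup>2 \<partial>M) < (1/4)^k" by metis
  define \<phi> where "\<phi> k = (\<Sum>j\<le>k. N j) + k" for k
  have \<phi>N: "\<phi> k \<ge> N k" for k unfolding \<phi>_def using member_le_sum[of k "{..k}" N] by simp
  have \<phi>k: "\<phi> k \<ge> k" for k by (simp add: \<phi>_def)
  have \<phi>S: "\<phi> (Suc k) \<ge> N k" for k unfolding \<phi>_def using member_le_sum[of k "{..Suc k}" N] by simp
  define g where "g x = lim (\<lambda>k. f (\<phi> k) x)" for x
  have gm: "g \<in> borel_measurable M" unfolding g_def[abs_def] by (rule borel_measurable_lim_metric[OF f])
  define a where "a k x = \<bar>f (\<phi> (Suc k)) x - f (\<phi> k) x\<bar>" for k x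
  have am: "a k \<in> borel_measurable M" for k unfolding a_def[abs_def] using f by measurable
  have "(\<integral>\<^sup>+x. (\<Sum>k. ennreal (2^k * (a k x)\<^sup>2)) \<partial>M) = (\<Sum>k. \<integral>\<^sup>+x. ennreal (2^k * (a k x)\<^sup>2) \<partial>M)"
    using am by (intro nn_integral_suminf) measurable
  also have "\<dots> \<le> (\<Sum>k. ennreal ((1/2)^k))"
  proof (rule suminf_le)
    fix k
    have i: "integrable M (\<lambda>x. (a k x)\<^sup>2)" unfolding a_def using id[OF f fi f fi] by simp
    have "(\<integral>\<^sup>+x. ennreal (2^k * (a k x)\<^sup>2) \<partial>M) = ennreal (\<integral>x. 2^k * (a k x)\<^sup>2 \<partial>M)"
      using i by (intro nn_integral_eq_integral) auto
    also have "(\<integral>x. 2^k * (a k x)\<^sup>2 \<partial>M) = 2^k * (\<integral>x. (f (\<phi> (Suc k)) x - f (\<phi> k) x)\<^sup>2 \<partial>M)" by (simp add: a_def)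
    also have "\<dots> \<le> 2^k * (1/4)^k" using N[OF \<phi>S \<phi>N, of k] by (intro mult_left_mono) auto
    also have "2^k * (1/4)^k = (1/2::real)^k" by (simp flip: power_mult_distrib)
    finally show "(\<integral>\<^sup>+x. ennreal (2^k * (a k x)\<^sup>2) \<partial>M) \<le> ennreal ((1/2)^k)" by (simp add: ennreal_leI)
  qed auto
  also have "\<dots> = ennreal (\<Sum>k. (1/2)^k)" by (intro suminf_ennreal2) auto
  also have "\<dots> < \<infinity>" by simp
  finally have "AE x in M. (\<Sum>k. ennreal (2^k * (a k x)\<^sup>2)) \<noteq> \<infinity>"
    using am by (intro nn_integral_PInf_AE) (measurable, auto)
  then have conv: "AE x in M. (\<lambda>k. f (\<phi> k) x) \<longlonglongrightarrow> g x"
  proof eventually_elim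
    case (elim x)
    have "summable (\<lambda>k. 2^k * (a k x)\<^sup>2)"
      using elim by (intro summable_suminf_not_top) auto
    then have s: "summable (\<lambda>k. 1/2 * (1/2)^k + 1/2 * (2^k * (a k x)\<^sup>2))"
      by (intro summable_add summable_mult) auto
    have le: "a k x \<le> 1/2 * (1/2)^k + 1/2 * (2^k * (a k x)\<^sup>2)" for k
    proof -
      have "0 \<le> (2^k * a k x - 1)\<^sup>2" by simp
      also have "\<dots> = 2^k * (2^k * (a k x)\<^sup>2) - 2 * (2^k * a k x) + 1" by (simp add: power2_eq_square algebra_simps)
      finally have "2 * (2^k * a k x) \<le> 2^k * (2^k * (a k x)\<^sup>2) + 1" by simp
      then have "(2 * (2^k * a k x)) / (2 * 2^k) \<le> (2^k * (2^k * (a k x)\<^sup>2) + 1) / (2 * 2^k)" by (intro divide_right_mono) auto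
      then show ?thesis by (simp add: add_divide_distrib power_one_over)
    qed
    have "summable (\<lambda>k. f (\<phi> (Suc k)) x - f (\<phi> k) x)"
      by (rule summable_comparison_test'[OF s, of 0]) (use le in \<open>auto simp: a_def\<close>)
    then have "(\<lambda>n. \<Sum>k<n. f (\<phi> (Suc k)) x - f (\<phi> k) x) \<longlonglongrightarrow> (\<Sum>k. f (\<phi> (Suc k)) x - f (\<phi> k) x)" by (rule summable_LIMSEQ)
    then have "(\<lambda>n. f (\<phi> n) x - f (\<phi> 0) x) \<longlonglongrightarrow> (\<Sum>k. f (\<phi> (Suc k)) x - f (\<phi> k) x)" unfolding sum_lessThan_telescope[of "\<lambda>k. f (\<phi> k) x"] .
    then have "convergent (\<lambda>n. f (\<phi> n) x - f (\<phi> 0) x)" by (rule convergentI)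
    then have "convergent (\<lambda>n. (f (\<phi> n) x - f (\<phi> 0) x) + f (\<phi> 0) x)" by (intro convergent_add convergent_const)
    then show ?case unfolding g_def by (simp add: convergent_LIMSEQ_iff)
  qed
  \<comment> \<open>Fatou's lemma turns the Cauchy condition into convergence of the whole sequence\<close>
  have fat: "(\<integral>\<^sup>+x. ennreal ((f n x - g x)\<^sup>2) \<partial>M) \<le> ennreal e" if e: "e > 0" and n: "n \<ge> N'" and N': "\<forall>m\<ge>N'. \<forall>n\<ge>N'. (\<integral>x. (f m x - f n x)\<^sup>2 \<partial>M) < e" for e n N'
  proof -
    have "(\<integral>\<^sup>+x. ennreal ((f n x - g x)\<^sup>2) \<partial>M) = (\<integral>\<^sup>+x. liminf (\<lambda>k. ennreal ((f n x - f (\<phi> k) x)\<^sup>2)) \<partial>M)"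
    proof (rule nn_integral_cong_AE)
      show "AE x in M. ennreal ((f n x - g x)\<^sup>2) = liminf (\<lambda>k. ennreal ((f n x - f (\<phi> k) x)\<^sup>2))"
        using conv
      proof eventually_elim
        case (elim x)
        have "(\<lambda>k. ennreal ((f n x - f (\<phi> k) x)\<^sup>2)) \<longlonglongrightarrow> ennreal ((f n x - g x)\<^sup>2)"
          by (intro tendsto_intros elim tendsto_ennrealI)
        from lim_imp_Liminf[OF sequentially_bot this] show ?case by simp
      qed
    qed
    also have "\<dots> \<le> liminf (\<lambda>k. \<integral>\<^sup>+x. ennreal ((f n x - f (\<phi> k) x)\<^sup>2) \<partial>M)"
      using f by (intro nn_integral_liminf) measurable
    also have "\<dots> \<le> ennreal e"
    proof (rule Liminf_le)
      show "\<forall>\<^sub>F k in sequentially. (\<integral>\<^sup>+x. ennreal ((f n x - f (\<phi> k) x)\<^sup>2) \<partial>M) \<le> ennreal e"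
        unfolding eventually_sequentially
      proof (intro exI[of _ N'] allI impI)
        fix k assume k: "N' \<le> k"
        have "(\<integral>\<^sup>+x. ennreal ((f n x - f (\<phi> k) x)\<^sup>2) \<partial>M) = ennreal (\<integral>x. (f n x - f (\<phi> k) x)\<^sup>2 \<partial>M)"
          by (intro nn_integral_eq_integral id f fi) auto
        also have "\<dots> \<le> ennreal e"
          using N' n order.trans[OF k \<phi>k[of k]] by (intro ennreal_leI) (simp add: less_imp_le)
        finally show "(\<integral>\<^sup>+x. ennreal ((f n x - f (\<phi> k) x)\<^sup>2) \<partial>M) \<le> ennreal e" .
      qed
    qed simp
    finally show ?thesis .
  qed
  have ifg: "integrable M (\<lambda>x. (f n x - g x)\<^sup>2)" if "n \<ge> N'" "\<forall>m\<ge>N'. \<forall>n\<ge>N'. (\<integral>x. (f m x - f n x)\<^sup>2 \<partial>M) < e" "e > 0" for n N' e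
    using fat[OF that(3,1,2)] f gm by (intro integrableI_bounded) (measurable, auto simp: le_less_trans)
  obtain N0 where N0: "\<forall>m\<ge>N0. \<forall>n\<ge>N0. (\<integral>x. (f m x - f n x)\<^sup>2 \<partial>M) < 1" using cau[of 1] by auto
  have gi: "integrable M (\<lambda>x. (g x)\<^sup>2)"
  proof -
    have i: "integrable M (\<lambda>x. (f N0 x - g x)\<^sup>2)" by (rule ifg[OF _ N0]) auto
    have m: "(\<lambda>x. f N0 x - g x) \<in> borel_measurable M" using f gm by measurable
    have "integrable M (\<lambda>x. (f N0 x - (f N0 x - g x))\<^sup>2)" by (rule id[OF f fi m i])
    then show ?thesis by simp
  qed
  have "(\<lambda>n. \<integral>x. (f n x - g x)\<^sup>2 \<partial>M) \<longlonglongrightarrow> 0"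
  proof (rule LIMSEQ_I)
    fix r :: real assume r: "r > 0"
    obtain N' where N': "\<forall>m\<ge>N'. \<forall>n\<ge>N'. (\<integral>x. (f m x - f n x)\<^sup>2 \<partial>M) < r/2" using cau[of "r/2"] r by auto
    have "norm ((\<integral>x. (f n x - g x)\<^sup>2 \<partial>M) - 0) < r" if n: "n \<ge> N'" for n
    proof -
      have "ennreal (\<integral>x. (f n x - g x)\<^sup>2 \<partial>M) = (\<integral>\<^sup>+x. ennreal ((f n x - g x)\<^sup>2) \<partial>M)"
        using r by (intro nn_integral_eq_integral[symmetric] ifg[OF n N']) auto
      also have "\<dots> \<le> ennreal (r/2)" using r by (intro fat[OF _ n N']) auto
      finally have "(\<integral>x. (f n x - g x)\<^sup>2 \<partial>M) \<le> r/2" using r by (subst (asm) ennreal_le_iff) auto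
      moreover have "(\<integral>x. (f n x - g x)\<^sup>2 \<partial>M) \<ge> 0" by (intro Bochner_Integration.integral_nonneg) auto
      ultimately show ?thesis using r by simp
    qed
    then show "\<exists>no. \<forall>n\<ge>no. norm ((\<integral>x. (f n x - g x)\<^sup>2 \<partial>M) - 0) < r" by blast
  qed
  then show ?thesis using gm gi unfolding Let_def g_def[abs_def] by (intro exI[of _ \<phi>]) simp
qed

section \<open>Density of the range of the generator\<close>

lemma orth_adjoint:
  fixes T :: "'a::euclidean_space \<Rightarrow> 'a"
  assumes "orthogonal_transformation T"
  shows "T x \<bullet> y = x \<bullet> inv T y" "inv T x \<bullet> inv T y = x \<bullet> y"
proof -
  have i: "orthogonal_transformation (inv T)" using assms orthogonal_transformation_inv by blast
  then show "inv T x \<bullet> inv T y = x \<bullet> y" unfolding orthogonal_transformation_def by blast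
  have "T x \<bullet> y = T x \<bullet> T (inv T y)"
    by (simp add: surj_f_inv_f orthogonal_transformation_surj[OF assms])
  then show "T x \<bullet> y = x \<bullet> inv T y" using assms unfolding orthogonal_transformation_def by simp
qed

text \<open>The images of an orthonormal basis under T form an orthonormal basis, and the trace does not depend on the basis.\<close>
lemma trace_rotate:
  fixes T :: "'a::euclidean_space \<Rightarrow> 'a" and \<beta> :: "'a \<Rightarrow> 'a \<Rightarrow> real"
  assumes T: "orthogonal_transformation T"
  shows "(\<Sum>b\<in>Basis. \<Sum>c\<in>Basis. \<Sum>d\<in>Basis. (T b \<bullet> c) * (T b \<bullet> d) * \<beta> c d) = (\<Sum>c\<in>Basis. \<beta> c c)"
proof -
  have "(\<Sum>b\<in>Basis. \<Sum>c\<in>Basis. \<Sum>d\<in>Basis. (T b \<bullet> c) * (T b \<bullet> d) * \<beta> c d)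
    = (\<Sum>c\<in>Basis. \<Sum>b\<in>Basis. \<Sum>d\<in>Basis. (T b \<bullet> c) * (T b \<bullet> d) * \<beta> c d)" by (rule sum.swap)
  also have "\<dots> = (\<Sum>c\<in>Basis. \<Sum>d\<in>Basis. \<Sum>b\<in>Basis. (T b \<bullet> c) * (T b \<bullet> d) * \<beta> c d)"
    by (intro sum.cong refl sum.swap)
  also have "\<dots> = (\<Sum>c\<in>Basis. \<Sum>d\<in>Basis. (c \<bullet> d) * \<beta> c d)"
  proof (intro sum.cong refl)
    fix c d
    have "(\<Sum>b\<in>Basis. (T b \<bullet> c) * (T b \<bullet> d)) = (\<Sum>b\<in>Basis. (inv T c \<bullet> b) * (inv T d \<bullet> b))"
      using orth_adjoint(1)[OF T] by (simp add: inner_commute)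
    also have "\<dots> = inv T c \<bullet> inv T d" by (rule euclidean_inner[symmetric])
    also have "\<dots> = c \<bullet> d" by (rule orth_adjoint(2)[OF T])
    finally show "(\<Sum>b\<in>Basis. (T b \<bullet> c) * (T b \<bullet> d) * \<beta> c d) = (c \<bullet> d) * \<beta> c d"
      by (simp flip: sum_distrib_right)
  qed
  also have "\<dots> = (\<Sum>c\<in>Basis. \<beta> c c)"
  proof (intro sum.cong refl)
    fix c :: 'a assume c: "c \<in> Basis"
    have "(\<Sum>d\<in>Basis. (c \<bullet> d) * \<beta> c d) = (\<Sum>d\<in>Basis. if d = c then \<beta> c c else 0)"
      using c by (intro sum.cong refl) (auto simp: inner_Basis)
    then show "(\<Sum>d\<in>Basis. (c \<bullet> d) * \<beta> c d) = \<beta> c c" using c by simp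
  qed
  finally show ?thesis .
qed

text \<open>The chain rule for \<open>u \<circ> T\<close>.\<close>
lemma dd_equivariant:
  fixes T :: "'a::euclidean_space \<Rightarrow> 'a"
  assumes T: "orthogonal_transformation T" and u: "\<And>x. u (T x) = v x" "\<And>x. u differentiable (at x)"
  shows "dd (T h) u (T x) = dd h v x"
proof -
  have "bounded_linear T" using T by (metis orthogonal_transformation_linear linear_conv_bounded_linear)
  then have "(T has_derivative T) (at x)" by (rule bounded_linear_imp_has_derivative)
  from has_derivative_compose[OF this has_derivative_dd[OF u(2)]]
  have "(v has_derivative (\<lambda>h. dd (T h) u (T x))) (at x)" unfolding u(1) .
  from dd_eqI[OF this] show ?thesis by simp
qed

lemma dd_dd_basis:
  assumes u: "Ck 2 u"
  shows "dd v (dd w u) y = (\<Sum>c\<in>Basis. \<Sum>d\<in>Basis. (v \<bullet> c) * (w \<bullet> d) * dd c (dd d u) y)"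
proof -
  have d: "\<And>x. u differentiable (at x)" "\<And>c x. dd c u differentiable (at x)" using u by (auto simp: numeral_2_eq_2)
  have "dd w u = (\<lambda>x. \<Sum>d\<in>Basis. (w \<bullet> d) * dd d u x)" using d by (intro ext dd_basis)
  then have "dd c (dd w u) y = (\<Sum>d\<in>Basis. (w \<bullet> d) * dd c (dd d u) y)" for c
    using d by (simp add: dd_sum dd_cmult)
  then show ?thesis using dd_basis[OF d(2), of v w y] by (simp add: sum_distrib_left mult.assoc)
qed

text \<open>Both the Laplacian and \<nabla>\<Phi> \<cdot> \<nabla>u are traces of bilinear forms that T carries from x to T x.\<close>
lemma gen_rot_inv:
  assumes R: "rotations \<R>" and P: "Ck 1 \<Phi>" "rot_inv \<R> \<Phi>" and u: "Ck 2 u" "rot_inv \<R> u"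
  shows "rot_inv \<R> (gen \<Phi> u)"
  unfolding rot_inv_def
proof (intro ballI allI)
  fix T x assume "T \<in> \<R>"
  then have T: "orthogonal_transformation T" and i: "\<And>x. \<Phi> (T x) = \<Phi> x" "\<And>x. u (T x) = u x"
    using R P u unfolding rotations_def rot_inv_def by auto
  have d: "\<And>x. u differentiable (at x)" "\<And>c x. dd c u differentiable (at x)" "\<And>x. \<Phi> differentiable (at x)"
    using u P by (auto simp: numeral_2_eq_2)
  have e1: "dd (T h) u (T x) = dd h u x" "dd (T h) \<Phi> (T x) = dd h \<Phi> x" for h x
    using dd_equivariant[OF T] i d by auto
  have e2: "dd (T h) (dd (T k) u) (T x) = dd h (dd k u) x" for h k x
    by (rule dd_equivariant[OF T e1(1) d(2)])
  let ?y = "T x"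
  have "(\<Sum>b\<in>Basis. dd b (dd b u) x) = (\<Sum>b\<in>Basis. dd (T b) (dd (T b) u) ?y)" unfolding e2 ..
  also have "\<dots> = (\<Sum>c\<in>Basis. dd c (dd c u) ?y)" unfolding dd_dd_basis[OF u(1), of "T _" "T _"] by (rule trace_rotate[OF T])
  finally have 1: "(\<Sum>b\<in>Basis. dd b (dd b u) x) = (\<Sum>c\<in>Basis. dd c (dd c u) ?y)" .
  have "(\<Sum>b\<in>Basis. dd b \<Phi> x * dd b u x) = (\<Sum>b\<in>Basis. dd (T b) \<Phi> ?y * dd (T b) u ?y)" unfolding e1 ..
  also have "\<dots> = (\<Sum>b\<in>Basis. \<Sum>c\<in>Basis. \<Sum>d\<in>Basis. (T b \<bullet> c) * (T b \<bullet> d) * (dd c \<Phi> ?y * dd d u ?y))"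
    unfolding dd_basis[OF d(1), of "T _"] dd_basis[OF d(3), of "T _"] sum_product by (simp add: mult_ac)
  also have "\<dots> = (\<Sum>c\<in>Basis. dd c \<Phi> ?y * dd c u ?y)" by (rule trace_rotate[OF T])
  finally show "gen \<Phi> u (T x) = gen \<Phi> u x" unfolding gen_def sum_subtractf 1 by simp
qed

text \<open>The first-order condition at a minimum.\<close>
lemma quadratic_forces_zero:
  fixes a q :: real
  assumes "\<And>t. 2 * t * a \<le> t\<^sup>2 * q" shows "a = 0"
proof (rule ccontr)
  assume a: "a \<noteq> 0"
  define t where "t = a / (\<bar>q\<bar> + 1)"
  have "2 * t * a \<le> t\<^sup>2 * q" by (rule assms)
  also have "\<dots> \<le> t\<^sup>2 * (\<bar>q\<bar> + 1)" by (intro mult_left_mono) auto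
  also have "\<dots> = t * a" by (simp add: t_def power2_eq_square)
  finally have "2 * (t * a) \<le> t * a" by (simp add: mult.assoc)
  then have "t * a \<le> 0" by linarith
  moreover have "t * a = a\<^sup>2 / (\<bar>q\<bar> + 1)" by (simp add: t_def power2_eq_square)
  moreover have "a\<^sup>2 / (\<bar>q\<bar> + 1) > 0" using a by (intro divide_pos_pos) auto
  ultimately show False by simp
qed

text \<open>The projection theorem for the subspace of all L u. A minimising sequence for the distance D to f has residuals that form
a Cauchy sequence by the parallelogram identity; their limit g inherits invariance, is orthogonal to all L v, and hence is
constant by \<open>orth_gen_const\<close>. Constants are orthogonal to the range, but f and all L v have mean zero, so g has, and
g = 0.\<close>
lemma gen_dense:
  fixes f :: "'a::euclidean_space \<Rightarrow> real"
  assumes P: "Ck 2 \<Phi>" and R: "rotations \<R>" "rot_inv \<R> \<Phi>" and wi: "integrable lborel (wt \<Phi>)"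
    and f: "f \<in> borel_measurable borel" "integrable lborel (\<lambda>x. (f x)\<^sup>2 * wt \<Phi> x)" "rot_inv \<R> f"
    and mean: "(\<integral>x. f x * wt \<Phi> x \<partial>lborel) = 0" and de: "de > 0"
  shows "\<exists>u. Ck 3 u \<and> csupp u \<and> rot_inv \<R> u \<and> (\<integral>x. (f x - gen \<Phi> u x)\<^sup>2 * wt \<Phi> x \<partial>lborel) < de"
proof -
  define M where "M = density lborel (\<lambda>x. ennreal (wt \<Phi> x))"
  define S where "S = {u. Ck 3 u \<and> csupp u \<and> rot_inv \<R> (u :: 'a \<Rightarrow> real)}"
  define D where "D u = (\<integral>x. (f x - gen \<Phi> u x)\<^sup>2 * wt \<Phi> x \<partial>lborel)" for u
  have P1: "Ck 1 \<Phi>" and P2: "Ck (Suc (Suc 0)) \<Phi>" using P Ck_le[OF P, of 1] by (simp_all add: numeral_2_eq_2)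
  have wc: "continuous_on UNIV (wt \<Phi>)" by (intro Ck_cont[OF Ck_wt[OF P]])
  have wm[measurable]: "wt \<Phi> \<in> borel_measurable borel" by (rule borel_measurable_continuous_onI[OF wc])
  have w0: "wt \<Phi> x \<ge> 0" for x using wt_pos[of \<Phi> x] by simp
  have ccg: "cc (gen \<Phi> u)" if "u \<in> S" for u
  proof -
    have "Ck (Suc (Suc 0)) u" "csupp u" using that Ck_le[of 3 u 2] by (simp_all add: S_def numeral_2_eq_2)
    then show ?thesis using Ck_gen[of 0 \<Phi> u] P1 csupp_gen[of u \<Phi>] by (simp add: cc_def)
  qed
  have gm: "gen \<Phi> u \<in> borel_measurable borel" if "u \<in> S" for u
    using ccg[OF that] by (simp add: cc_def borel_measurable_continuous_onI)
  have Mm: "h \<in> borel_measurable M \<longleftrightarrow> h \<in> borel_measurable borel" for h :: "'a \<Rightarrow> real" by (simp add: M_def)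
  have Mi: "integrable M h \<longleftrightarrow> integrable lborel (\<lambda>x. h x * wt \<Phi> x)" if "h \<in> borel_measurable borel" for h :: "'a \<Rightarrow> real"
    unfolding M_def using that w0 by (subst integrable_density) (auto simp: mult.commute)
  have MI: "(\<integral>x. h x \<partial>M) = (\<integral>x. h x * wt \<Phi> x \<partial>lborel)" if "h \<in> borel_measurable borel" for h :: "'a \<Rightarrow> real"
    unfolding M_def using that w0 by (subst integral_density) (auto simp: mult.commute)
  define L2' where "L2' h \<longleftrightarrow> h \<in> borel_measurable borel \<and> integrable M (\<lambda>x. (h x)\<^sup>2)" for h :: "'a \<Rightarrow> real"
  have Lmul: "integrable M (\<lambda>x. h x * k x)" if "L2' h" "L2' k" for h k
  proof (rule Bochner_Integration.integrable_bound)
    show "integrable M (\<lambda>x. (h x)\<^sup>2 + (k x)\<^sup>2)" using that by (auto simp: L2'_def)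
    have "\<bar>h x * k x\<bar> \<le> (h x)\<^sup>2 + (k x)\<^sup>2" for x
    proof -
      have "0 \<le> (\<bar>h x\<bar> - \<bar>k x\<bar>)\<^sup>2" by simp
      then have "2 * (\<bar>h x\<bar> * \<bar>k x\<bar>) \<le> (h x)\<^sup>2 + (k x)\<^sup>2" by (simp add: power2_diff)
      moreover have "0 \<le> \<bar>h x\<bar> * \<bar>k x\<bar>" by simp
      ultimately have "\<bar>h x\<bar> * \<bar>k x\<bar> \<le> (h x)\<^sup>2 + (k x)\<^sup>2" by linarith
      then show ?thesis by (simp add: abs_mult)
    qed
    then show "AE x in M. norm (h x * k x) \<le> norm ((h x)\<^sup>2 + (k x)\<^sup>2)" by (intro AE_I2) simp
  qed (use that in \<open>auto simp: L2'_def Mm\<close>)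
  have Ldiff: "L2' (\<lambda>x. h x - c * k x)" if "L2' h" "L2' k" for h k c
  proof -
    have "integrable M (\<lambda>x. (h x)\<^sup>2 - 2 * c * (h x * k x) + c\<^sup>2 * (k x)\<^sup>2)"
      using that Lmul[OF that] by (auto simp: L2'_def)
    moreover have "(h x - c * k x)\<^sup>2 = (h x)\<^sup>2 - 2 * c * (h x * k x) + c\<^sup>2 * (k x)\<^sup>2" for x
      by (simp add: power2_eq_square algebra_simps)
    ultimately show ?thesis using that unfolding L2'_def by (auto simp: Mm)
  qed
  have Lsq: "(\<integral>x. (h x - c * k x)\<^sup>2 \<partial>M) = (\<integral>x. (h x)\<^sup>2 \<partial>M) - 2 * c * (\<integral>x. h x * k x \<partial>M) + c\<^sup>2 * (\<integral>x. (k x)\<^sup>2 \<partial>M)"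
    if "L2' h" "L2' k" for h k c
  proof -
    have "(h x - c * k x)\<^sup>2 = (h x)\<^sup>2 - 2 * c * (h x * k x) + c\<^sup>2 * (k x)\<^sup>2" for x
      by (simp add: power2_eq_square algebra_simps)
    then show ?thesis using that Lmul[OF that] by (simp add: L2'_def)
  qed
  have Lnn: "(\<integral>x. (h x)\<^sup>2 \<partial>M) \<ge> 0" for h :: "'a \<Rightarrow> real" by (intro Bochner_Integration.integral_nonneg) auto
  have Lf: "L2' f" using f Mi[of "\<lambda>x. (f x)\<^sup>2"] by (simp add: L2'_def)
  have Lg: "L2' (gen \<Phi> u)" if "u \<in> S" for u
  proof -
    have "integrable lborel (\<lambda>x. (gen \<Phi> u x)\<^sup>2 * wt \<Phi> x)"
      unfolding power2_eq_square using ccg[OF that] by (intro cc_integrable cc_mult1 wc) (auto simp: cc_def)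
    then show ?thesis using gm[OF that] Mi[of "\<lambda>x. (gen \<Phi> u x)\<^sup>2"] by (simp add: L2'_def)
  qed
  have i1: "integrable lborel (\<lambda>x. 1 * wt \<Phi> x)" unfolding mult_1 by (rule wi)
  have m1: "(\<lambda>x::'a. 1::real) \<in> borel_measurable borel" by (rule borel_measurable_const)
  have L1: "L2' (\<lambda>x. 1)" unfolding L2'_def one_power2 using Mi[OF m1] i1 m1 by blast
  have Lr: "L2' (\<lambda>x. f x - gen \<Phi> u x)" if "u \<in> S" for u using Ldiff[OF Lf Lg[OF that], of 1] by simp
  have DM: "D u = (\<integral>x. (f x - gen \<Phi> u x)\<^sup>2 \<partial>M)" if "u \<in> S" for u
    unfolding D_def using MI[of "\<lambda>x. (f x - gen \<Phi> u x)\<^sup>2"] f gm[OF that] by simp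
  have comb: "(\<lambda>x. a * u x + b * v x) \<in> S" "gen \<Phi> (\<lambda>x. a * u x + b * v x) = (\<lambda>x. a * gen \<Phi> u x + b * gen \<Phi> v x)"
    if uv: "u \<in> S" "v \<in> S" for a b u v
  proof -
    have u: "Ck 3 u" "csupp u" "rot_inv \<R> u" and v: "Ck 3 v" "csupp v" "rot_inv \<R> v" using uv by (auto simp: S_def)
    then show "(\<lambda>x. a * u x + b * v x) \<in> S"
      unfolding S_def by (auto intro!: Ck_add Ck_cmult csupp_add csupp_mult2 simp: rot_inv_def)
    have d: "\<And>x. u differentiable (at x)" "\<And>x. v differentiable (at x)" "\<And>c x. dd c u differentiable (at x)" "\<And>c x. dd c v differentiable (at x)"
      using u v by (auto simp: numeral_3_eq_3)
    have 1: "dd c (\<lambda>x. a * u x + b * v x) = (\<lambda>x. a * dd c u x + b * dd c v x)" for c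
      using d by (intro ext) (simp add: dd_add dd_cmult)
    have 2: "dd c (\<lambda>x. a * dd c u x + b * dd c v x) x = a * dd c (dd c u) x + b * dd c (dd c v) x" for c x
      using d by (simp add: dd_add dd_cmult)
    show "gen \<Phi> (\<lambda>x. a * u x + b * v x) = (\<lambda>x. a * gen \<Phi> u x + b * gen \<Phi> v x)"
      unfolding gen_def[abs_def] 1 2 by (intro ext) (simp add: sum_distrib_left sum.distrib[symmetric] algebra_simps)
  qed
  have S0: "(\<lambda>x. 0) \<in> S" by (auto simp: S_def csupp_zero rot_inv_def intro: Ck_const)
  define m where "m = Inf (D ` S)"
  have bdd: "bdd_below (D ` S)"
  proof (rule bdd_belowI2[where m=0])
    fix u assume "u \<in> S" then show "0 \<le> D u" using DM Lnn[of "\<lambda>x. f x - gen \<Phi> u x"] by simp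
  qed
  have mD: "m \<le> D u" if "u \<in> S" for u unfolding m_def using that bdd by (intro cInf_lower) auto
  have "\<exists>u\<in>S. D u < m + eps k" for k
  proof -
    have "Inf (D ` S) < m + eps k" unfolding m_def using eps_pos[of k] by simp
    then show ?thesis using cInf_lessD[of "D ` S" "m + eps k"] S0 by auto
  qed
  then obtain U where U: "\<And>k. U k \<in> S" "\<And>k. D (U k) < m + eps k" by metis
  define r where "r k x = f x - gen \<Phi> (U k) x" for k x
  have rL: "L2' (r k)" for k unfolding r_def[abs_def] by (rule Lr[OF U(1)])
  have rD: "D (U k) = (\<integral>x. (r k x)\<^sup>2 \<partial>M)" for k using DM[OF U(1)] by (simp add: r_def)
  \<comment> \<open>parallelogram identity: the average of two test functions is a competitor in the minimisation\<close>
  have par: "(\<integral>x. (r j x - r k x)\<^sup>2 \<partial>M) \<le> 2 * eps j + 2 * eps k" for j k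
  proof -
    have uS: "(\<lambda>x. 1/2 * U j x + 1/2 * U k x) \<in> S" by (rule comb(1)[OF U(1) U(1)])
    have avg: "f x - gen \<Phi> (\<lambda>x. 1/2 * U j x + 1/2 * U k x) x = 1/2 * r j x + 1/2 * r k x" for x
      unfolding comb(2)[OF U(1) U(1)] r_def by (simp add: field_simps)
    have "m \<le> (\<integral>x. (1/2 * r j x + 1/2 * r k x)\<^sup>2 \<partial>M)" using mD[OF uS] DM[OF uS] unfolding avg by simp
    also have "\<dots> = 1/4 * (\<integral>x. (r j x - (-1) * r k x)\<^sup>2 \<partial>M)"
    proof -
      have e: "(1/2 * r j x + 1/2 * r k x)\<^sup>2 = 1/4 * (r j x - (-1) * r k x)\<^sup>2" for x by (simp add: power2_eq_square algebra_simps)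
      show ?thesis unfolding e by simp
    qed
    finally have "4 * m \<le> D (U j) + 2 * (\<integral>x. r j x * r k x \<partial>M) + D (U k)"
      using Lsq[OF rL[of j] rL[of k], of "-1"] rD by simp
    moreover have "(\<integral>x. (r j x - r k x)\<^sup>2 \<partial>M) = D (U j) - 2 * (\<integral>x. r j x * r k x \<partial>M) + D (U k)"
      using Lsq[OF rL[of j] rL[of k], of 1] rD by simp
    ultimately show ?thesis using U(2)[of j] U(2)[of k] by simp
  qed
  have cau: "\<exists>N. \<forall>j\<ge>N. \<forall>k\<ge>N. (\<integral>x. (r j x - r k x)\<^sup>2 \<partial>M) < e" if e: "e > 0" for e
  proof -
    obtain N where N: "\<And>n. n \<ge> N \<Longrightarrow> eps n < e/4" using order_tendstoD(2)[OF eps_0, of "e/4"] e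
      unfolding eventually_sequentially by auto
    have "(\<integral>x. (r j x - r k x)\<^sup>2 \<partial>M) < e" if "j \<ge> N" "k \<ge> N" for j k
      using par[of j k] N[OF that(1)] N[OF that(2)] by simp
    then show ?thesis by blast
  qed
  have rm: "r k \<in> borel_measurable M" "integrable M (\<lambda>x. (r k x)\<^sup>2)" for k using rL[of k] by (auto simp: L2'_def Mm)
  obtain \<phi> where \<phi>: "let g = (\<lambda>x. lim (\<lambda>k. r (\<phi> k) x)) in
     g \<in> borel_measurable M \<and> integrable M (\<lambda>x. (g x)\<^sup>2) \<and> (\<lambda>n. \<integral>x. (r n x - g x)\<^sup>2 \<partial>M) \<longlonglongrightarrow> 0"
    using L2_complete[OF rm cau] by blast
  define g where "g = (\<lambda>x. lim (\<lambda>k. r (\<phi> k) x))"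
  have gL: "L2' g" and lim: "(\<lambda>n. \<integral>x. (r n x - g x)\<^sup>2 \<partial>M) \<longlonglongrightarrow> 0"
    using \<phi> unfolding Let_def g_def[symmetric] L2'_def Mm by auto
  have genr: "rot_inv \<R> (gen \<Phi> u)" if "u \<in> S" for u
    using that Ck_le[of 3 u 2] by (intro gen_rot_inv R P1) (auto simp: S_def)
  have gr: "rot_inv \<R> g" unfolding g_def
  proof -
    have "r k (T x) = r k x" if "T \<in> \<R>" for k T x
      using that f(3) genr[OF U(1)[of k]] unfolding r_def rot_inv_def by simp
    then show "rot_inv \<R> (\<lambda>x. lim (\<lambda>k. r (\<phi> k) x))" unfolding rot_inv_def by simp
  qed
  \<comment> \<open>approximate orthogonality of the residuals to v, with a quadratic error, passes to their limit g\<close>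
  have pass: "(\<integral>x. g x * v x \<partial>M) = 0"
    if v: "L2' v" and b: "\<And>k t. 2 * t * (\<integral>x. r k x * v x \<partial>M) \<le> eps k + t\<^sup>2 * (\<integral>x. (v x)\<^sup>2 \<partial>M)" for v
  proof (rule quadratic_forces_zero)
    fix t
    let ?q = "\<integral>x. (v x)\<^sup>2 \<partial>M"
    have "2 * t * (\<integral>x. g x * v x \<partial>M) \<le> (\<integral>x. (r k x - g x)\<^sup>2 \<partial>M) + eps k + 2 * t\<^sup>2 * ?q" for k
    proof -
      have d: "L2' (\<lambda>x. r k x - g x)" using Ldiff[OF rL gL, of _ 1] by simp
      have "0 \<le> (\<integral>x. ((r k x - g x) - (- t) * v x)\<^sup>2 \<partial>M)" by (rule Lnn)
      also have "\<dots> = (\<integral>x. (r k x - g x)\<^sup>2 \<partial>M) + 2 * t * (\<integral>x. (r k x - g x) * v x \<partial>M) + t\<^sup>2 * ?q"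
        using Lsq[OF d v, of "- t"] by simp
      also have "(\<integral>x. (r k x - g x) * v x \<partial>M) = (\<integral>x. r k x * v x \<partial>M) - (\<integral>x. g x * v x \<partial>M)"
        using Lmul[OF rL v] Lmul[OF gL v] by (simp add: left_diff_distrib)
      finally show ?thesis using b[of t k] by (simp add: right_diff_distrib)
    qed
    moreover have "(\<lambda>k. (\<integral>x. (r k x - g x)\<^sup>2 \<partial>M) + eps k + 2 * t\<^sup>2 * ?q) \<longlonglongrightarrow> 0 + 0 + 2 * t\<^sup>2 * ?q"
      by (intro tendsto_intros lim eps_0)
    ultimately have "2 * t * (\<integral>x. g x * v x \<partial>M) \<le> 0 + 0 + 2 * t\<^sup>2 * ?q"
      by (intro tendsto_lowerbound[of _ _ sequentially]) auto
    then show "2 * t * (\<integral>x. g x * v x \<partial>M) \<le> t\<^sup>2 * (2 * ?q)" by simp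
  qed
  have orth: "(\<integral>x. g x * gen \<Phi> v x * wt \<Phi> x \<partial>lborel) = 0" if "Ck 3 v" "csupp v" "rot_inv \<R> v" for v
  proof -
    have v: "v \<in> S" using that by (simp add: S_def)
    have "(\<integral>x. g x * gen \<Phi> v x \<partial>M) = 0"
    proof (rule pass[OF Lg[OF v]])
      fix k t
      have uS: "(\<lambda>x. 1 * U k x + t * v x) \<in> S" by (rule comb(1)[OF U(1) v])
      have "f x - gen \<Phi> (\<lambda>x. 1 * U k x + t * v x) x = r k x - t * gen \<Phi> v x" for x
        unfolding comb(2)[OF U(1) v] r_def by simp
      then have "m \<le> (\<integral>x. (r k x - t * gen \<Phi> v x)\<^sup>2 \<partial>M)" using mD[OF uS] DM[OF uS] by simp
      then show "2 * t * (\<integral>x. r k x * gen \<Phi> v x \<partial>M) \<le> eps k + t\<^sup>2 * (\<integral>x. (gen \<Phi> v x)\<^sup>2 \<partial>M)"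
        using Lsq[OF rL[of k] Lg[OF v], of t] rD[of k] U(2)[of k] by simp
    qed
    moreover have "(\<lambda>x. g x * gen \<Phi> v x) \<in> borel_measurable borel"
      using gL gm[OF v] unfolding L2'_def by (intro borel_measurable_times) auto
    ultimately show ?thesis using MI[of "\<lambda>x. g x * gen \<Phi> v x"] by simp
  qed
  have g2: "g \<in> borel_measurable borel" "integrable lborel (\<lambda>x. (g x)\<^sup>2 * wt \<Phi> x)"
    using gL Mi[of "\<lambda>x. (g x)\<^sup>2"] by (auto simp: L2'_def)
  obtain c where c: "AE x in lborel. g x = c" using orth_gen_const[OF P R g2 gr orth] by blast
  have g0: "(\<integral>x. g x * 1 \<partial>M) = 0"
  proof (rule pass[OF L1])
    fix k t
    have "(\<integral>x. r k x * 1 \<partial>M) = (\<integral>x. f x * wt \<Phi> x - gen \<Phi> (U k) x * wt \<Phi> x \<partial>lborel)"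
      using MI[of "r k"] rL[of k] by (simp add: L2'_def r_def left_diff_distrib)
    also have "\<dots> = 0"
    proof -
      have "integrable lborel (\<lambda>x. f x * wt \<Phi> x)" using Lmul[OF Lf L1] Mi[of f] f by simp
      moreover have "integrable lborel (\<lambda>x. gen \<Phi> (U k) x * wt \<Phi> x)" by (intro cc_integrable cc_mult1 ccg U wc)
      moreover have "(\<integral>x. gen \<Phi> (U k) x * wt \<Phi> x \<partial>lborel) = 0"
        using U(1)[of k] Ck_le[of 3 "U k" 2] by (intro gen_mean_zero P1) (auto simp: S_def)
      ultimately show ?thesis using mean by simp
    qed
    finally show "2 * t * (\<integral>x. r k x * 1 \<partial>M) \<le> eps k + t\<^sup>2 * (\<integral>x. 1\<^sup>2 \<partial>M)"
      using eps_pos[of k] Lnn[of "\<lambda>x. 1"] by simp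
  qed
  have "c = 0"
  proof (rule ccontr)
    assume c0: "c \<noteq> 0"
    have "(\<integral>x. g x * 1 \<partial>M) = (\<integral>x. c * wt \<Phi> x \<partial>lborel)"
    proof -
      have "(\<integral>x. g x * wt \<Phi> x \<partial>lborel) = (\<integral>x. c * wt \<Phi> x \<partial>lborel)"
        using g2(1) c by (intro integral_cong_AE) (measurable, auto elim: eventually_mono)
      then show ?thesis using MI[OF g2(1)] by simp
    qed
    then have "(\<integral>x. wt \<Phi> x \<partial>lborel) = 0" using g0 c0 by simp
    then have "AE x in lborel. wt \<Phi> x = 0" using integral_nonneg_eq_0_iff_AE[OF wi] w0 by simp
    then have "AE x in (lborel :: 'a measure). False" by eventually_elim (use wt_pos[of \<Phi>] in \<open>simp add: less_le\<close>)
    then show False by (simp add: AE_iff_measurable[of "UNIV :: 'a set"])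
  qed
  then have "AE x in lborel. g x = 0" using c by simp
  then have "(\<integral>x. (r n x - g x)\<^sup>2 \<partial>M) = D (U n)" for n
  proof -
    have "AE x in M. g x = 0" unfolding M_def using \<open>AE x in lborel. g x = 0\<close> by (subst AE_density) auto
    then show ?thesis unfolding rD using rm(1)[of n] gL
      by (intro integral_cong_AE) (auto simp: L2'_def Mm)
  qed
  then have "(\<lambda>n. D (U n)) \<longlonglongrightarrow> 0" using lim by simp
  then have "\<forall>\<^sub>F n in sequentially. D (U n) < de" using de by (rule order_tendstoD)
  then obtain n where "D (U n) < de" unfolding eventually_sequentially by auto
  then show ?thesis using U(1)[of n] unfolding S_def D_def by blast
qed

section \<open>Orthogonal projections\<close>

lemma orth_proj_decomp:
  fixes F :: "'a::euclidean_space set"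
  assumes F: "subspace F"
  shows "orth_proj F x \<in> F" "x - orth_proj F x \<in> F\<^sup>\<bottom>"
    and orth_proj_unique: "\<And>y. y \<in> F \<Longrightarrow> x - y \<in> F\<^sup>\<bottom> \<Longrightarrow> orth_proj F x = y"
proof -
  have "x \<in> F + F\<^sup>\<bottom>" using subspace_sum_orthogonal_comp[OF F] by simp
  then obtain y z where yz: "y \<in> F" "z \<in> F\<^sup>\<bottom>" "x = y + z" by (auto elim: set_plus_elim)
  have uniq: "y = y'" if "y \<in> F" "x - y \<in> F\<^sup>\<bottom>" "y' \<in> F" "x - y' \<in> F\<^sup>\<bottom>" for y y'
  proof -
    have "y - y' \<in> F" using that subspace_diff[OF F] by blast
    moreover have "(x - y') - (x - y) \<in> F\<^sup>\<bottom>" using that subspace_diff[OF subspace_orthogonal_comp] by blast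
    ultimately have "orthogonal (y - y') (y - y')" unfolding orthogonal_comp_def by simp
    then show ?thesis by (simp add: orthogonal_self)
  qed
  have ex: "\<exists>!y. y \<in> F \<and> x - y \<in> F\<^sup>\<bottom>" using yz uniq by (intro ex1I[of _ y]) auto
  show "orth_proj F x \<in> F" "x - orth_proj F x \<in> F\<^sup>\<bottom>" unfolding orth_proj_def using theI'[OF ex] by auto
  then show "orth_proj F x = y" if "y \<in> F" "x - y \<in> F\<^sup>\<bottom>" for y using that uniq by blast
qed

lemma orth_comp_inner: "x \<in> F \<Longrightarrow> y \<in> F\<^sup>\<bottom> \<Longrightarrow> x \<bullet> y = 0"
  unfolding orthogonal_comp_def orthogonal_def by auto

lemma orth_proj_inner:
  assumes F: "subspace F"
  shows "orth_proj F x \<bullet> y = orth_proj F x \<bullet> orth_proj F y" "orth_proj F x \<bullet> y = x \<bullet> orth_proj F y"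
proof -
  have 1: "orth_proj F x \<bullet> y = orth_proj F x \<bullet> orth_proj F y" for x y
    using orth_comp_inner[OF orth_proj_decomp(1)[OF F, of x] orth_proj_decomp(2)[OF F, of y]] by (simp add: inner_diff_right)
  show "orth_proj F x \<bullet> y = orth_proj F x \<bullet> orth_proj F y" by (rule 1)
  show "orth_proj F x \<bullet> y = x \<bullet> orth_proj F y" using 1[of x y] 1[of y x] by (simp add: inner_commute)
qed

lemma orth_proj_linear: assumes F: "subspace F" shows "linear (orth_proj F)"
proof (rule linearI)
  fix x y c
  have "orth_proj F (x + y) \<bullet> z = (orth_proj F x + orth_proj F y) \<bullet> z" for z
    using orth_proj_inner(2)[OF F] by (simp add: inner_add_left)
  then show "orth_proj F (x + y) = orth_proj F x + orth_proj F y" by (metis vector_eq_rdot)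
  have "orth_proj F (c *\<^sub>R x) \<bullet> z = (c *\<^sub>R orth_proj F x) \<bullet> z" for z
    using orth_proj_inner(2)[OF F] by simp
  then show "orth_proj F (c *\<^sub>R x) = c *\<^sub>R orth_proj F x" by (metis vector_eq_rdot)
qed

lemma orth_proj_id: "subspace F \<Longrightarrow> x \<in> F \<Longrightarrow> orth_proj F x = x"
  by (intro orth_proj_unique) (auto simp: subspace_0 subspace_orthogonal_comp)

lemma orth_proj_comp_0: "subspace F \<Longrightarrow> x \<in> F\<^sup>\<bottom> \<Longrightarrow> orth_proj F x = 0"
  by (intro orth_proj_unique) (auto simp: subspace_0)

lemma orth_proj_comp: assumes F: "subspace F" shows "orth_proj (F\<^sup>\<bottom>) x = x - orth_proj F x"
  using orth_proj_decomp[OF F, of x] orthogonal_comp_subset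
  by (intro orth_proj_unique subspace_orthogonal_comp) auto

lemma orth_proj_split: "subspace F \<Longrightarrow> x = orth_proj F x + orth_proj (F\<^sup>\<bottom>) x"
  by (simp add: orth_proj_comp)

lemma orth_proj_sum:
  assumes F: "subspace F" and y: "y \<in> F" and z: "z \<in> F\<^sup>\<bottom>"
  shows "orth_proj F (y + z) = y" "orth_proj (F\<^sup>\<bottom>) (y + z) = z"
proof -
  show "orth_proj F (y + z) = y" using y z by (intro orth_proj_unique F) auto
  then show "orth_proj (F\<^sup>\<bottom>) (y + z) = z" by (simp add: orth_proj_comp[OF F])
qed

lemma orth_proj_norm_le: assumes F: "subspace F" shows "(norm (orth_proj F x))\<^sup>2 \<le> (norm x)\<^sup>2"
proof -
  have "(norm x)\<^sup>2 = (norm (orth_proj F x + (x - orth_proj F x)))\<^sup>2" by simp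
  also have "\<dots> = (norm (orth_proj F x))\<^sup>2 + (norm (x - orth_proj F x))\<^sup>2"
    using orth_comp_inner[OF orth_proj_decomp(1)[OF F, of x] orth_proj_decomp(2)[OF F, of x]]
    unfolding power2_norm_eq_inner by (simp only: inner_add_left inner_add_right inner_commute[of "x - orth_proj F x" "orth_proj F x"])
  finally show ?thesis by simp
qed

lemma orth_proj_continuous: assumes F: "subspace F" shows "continuous_on A (orth_proj F)"
  using orth_proj_linear[OF F] linear_continuous_on linear_conv_bounded_linear by blast

section \<open>Lebesgue measure on subspaces\<close>

text \<open>The very basis chosen in the definition of \<open>lborel_on\<close>.\<close>
definition onb :: "'a::euclidean_space set \<Rightarrow> 'a set" where
  "onb E = (SOME B. orthonormal_basis_of E B)"

lemma onb_works: assumes "subspace E" shows "orthonormal_basis_of E (onb E)"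
proof -
  obtain B where "B \<subseteq> E" "pairwise orthogonal B" "\<And>x. x \<in> B \<Longrightarrow> norm x = 1" "span B = E"
    using orthonormal_basis_subspace[OF assms] by metis
  then have "orthonormal_basis_of E B" unfolding orthonormal_basis_of_def by blast
  then show ?thesis unfolding onb_def by (rule someI)
qed

lemma orthonormal_facts:
  assumes "orthonormal_basis_of E B"
  shows "independent B" "finite B" "B \<subseteq> E" "\<And>a b. a \<in> B \<Longrightarrow> b \<in> B \<Longrightarrow> a \<bullet> b = (if a = b then 1 else 0)"
proof -
  have B: "pairwise orthogonal B" "\<And>b. b \<in> B \<Longrightarrow> norm b = 1" "span B = E" using assms unfolding orthonormal_basis_of_def by auto
  have "0 \<notin> B" using B(2) by force
  then show "independent B" using pairwise_orthogonal_independent B(1) by blast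
  then show "finite B" by (rule independent_imp_finite)
  show "B \<subseteq> E" using B(3) span_superset by blast
  show "a \<bullet> b = (if a = b then 1 else 0)" if "a \<in> B" "b \<in> B" for a b
    using B that unfolding pairwise_def orthogonal_def by (auto simp: dot_square_norm)
qed

text \<open>The point with coordinates u in the basis B; \<open>lborel_on\<close> is the image of product measure under this map.\<close>
definition lin :: "'a::euclidean_space set \<Rightarrow> ('a \<Rightarrow> real) \<Rightarrow> 'a" where
  "lin B u = (\<Sum>b\<in>B. u b *\<^sub>R b)"

lemma lin_inner: "orthonormal_basis_of E B \<Longrightarrow> b \<in> B \<Longrightarrow> lin B u \<bullet> b = u b"
proof -
  assume B: "orthonormal_basis_of E B" and b: "b \<in> B"
  have "lin B u \<bullet> b = (\<Sum>a\<in>B. if a = b then u b else 0)"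
    unfolding lin_def inner_sum_left using orthonormal_facts(4)[OF B] b by (intro sum.cong refl) auto
  then show ?thesis using orthonormal_facts(2)[OF B] b by simp
qed

lemma lin_in: "orthonormal_basis_of E B \<Longrightarrow> lin B u \<in> E"
  unfolding lin_def orthonormal_basis_of_def by (metis (no_types, lifting) span_base span_scale span_sum)

lemma lin_expand:
  assumes B: "orthonormal_basis_of E B" and x: "x \<in> E" shows "lin B (\<lambda>b. x \<bullet> b) = x"
proof -
  have d: "x - lin B (\<lambda>b. x \<bullet> b) \<in> span B" using x lin_in[OF B, of "\<lambda>b. x \<bullet> b"] B span_diff unfolding orthonormal_basis_of_def by metis
  have "(x - lin B (\<lambda>b. x \<bullet> b)) \<bullet> b = 0" if "b \<in> B" for b using lin_inner[OF B that] by (simp add: inner_diff_left)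
  then have "orthogonal (x - lin B (\<lambda>b. x \<bullet> b)) b" if "b \<in> B" for b using that by (simp add: orthogonal_def)
  then have "orthogonal (x - lin B (\<lambda>b. x \<bullet> b)) (x - lin B (\<lambda>b. x \<bullet> b))"
    using orthogonal_to_span[OF d] by blast
  then show ?thesis by (simp add: orthogonal_self)
qed

lemma lin_measurable [measurable]: "finite B \<Longrightarrow> lin B \<in> borel_measurable (\<Pi>\<^sub>M b\<in>B. (lborel :: real measure))"
  unfolding lin_def[abs_def] by (intro borel_measurable_sum borel_measurable_scaleR) auto

lemma lborel_on_eq: "lborel_on E = distr (\<Pi>\<^sub>M b\<in>onb E. lborel) (restrict_space borel E) (lin (onb E))"
  unfolding lborel_on_def onb_def lin_def[abs_def] by (simp add: Let_def)

lemma lin_measurable_on: "subspace E \<Longrightarrow> lin (onb E) \<in> measurable (\<Pi>\<^sub>M b\<in>onb E. lborel) (restrict_space borel E)"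
proof -
  assume "subspace E"
  then have B: "orthonormal_basis_of E (onb E)" by (rule onb_works)
  show ?thesis
    by (intro measurable_restrict_space2 lin_measurable orthonormal_facts(2)[OF B] funcsetI lin_in[OF B])
qed

lemma sets_lborel_on [simp]: "sets (lborel_on E) = sets (restrict_space borel E)"
  and space_lborel_on [simp]: "space (lborel_on E) = E"
  by (simp_all add: lborel_on_eq space_restrict_space)

lemma measurable_lborel_on: "f \<in> borel_measurable borel \<Longrightarrow> f \<in> borel_measurable (lborel_on E)"
  unfolding measurable_cong_sets[OF sets_lborel_on refl] by (rule measurable_restrict_space1)

interpretation lborel_prod: product_sigma_finite "\<lambda>_. lborel :: real measure"
  by standard

lemma nn_integral_lborel_on:
  assumes E: "subspace E" and f: "f \<in> borel_measurable borel"
  shows "(\<integral>\<^sup>+y. f y \<partial>lborel_on E) = (\<integral>\<^sup>+u. f (lin (onb E) u) \<partial>(\<Pi>\<^sub>M b\<in>onb E. lborel))"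
  unfolding lborel_on_eq using measurable_restrict_space1[OF f, of E]
  by (subst nn_integral_distr[OF lin_measurable_on[OF E]]) auto

text \<open>Matching B with the standard basis defines an orthogonal map, which preserves Lebesgue measure. Thus
the coordinates with respect to B have the same joint distribution as the standard ones, the product measure.\<close>
lemma lborel_orthonormal:
  fixes B :: "'a::euclidean_space set"
  assumes B: "orthonormal_basis_of UNIV B"
  shows "distr (\<Pi>\<^sub>M b\<in>B. lborel) borel (lin B) = lborel"
proof -
  note Bf = orthonormal_facts[OF B]
  have "card B = card (Basis :: 'a set)"
    using dim_eq_card[of B "UNIV :: 'a set"] Bf(1) B dim_UNIV[where 'a="'a"] unfolding orthonormal_basis_of_def
    by (simp add: dim_eq_card_independent[symmetric])
  then obtain \<sigma> where \<sigma>: "bij_betw \<sigma> (Basis :: 'a set) B"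
    using finite_same_card_bij[OF finite_Basis Bf(2)] by metis
  define T where "T v = (\<Sum>i\<in>Basis. (v \<bullet> i) *\<^sub>R \<sigma> i)" for v :: "'a"
  have \<sigma>B: "\<sigma> i \<in> B" if "i \<in> Basis" for i using \<sigma> that by (auto simp: bij_betw_def)
  have \<sigma>i: "\<sigma> i \<bullet> \<sigma> j = (if i = j then 1 else 0)" if "i \<in> Basis" "j \<in> Basis" for i j
    using Bf(4)[OF \<sigma>B[OF that(1)] \<sigma>B[OF that(2)]] that \<sigma> by (auto simp: bij_betw_def inj_on_def)
  have Tc: "T v \<bullet> \<sigma> j = v \<bullet> j" if "j \<in> Basis" for v j
  proof -
    have "T v \<bullet> \<sigma> j = (\<Sum>i\<in>Basis. if i = j then v \<bullet> j else 0)"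
      unfolding T_def inner_sum_left using \<sigma>i that by (intro sum.cong refl) auto
    then show ?thesis using that by simp
  qed
  have TT: "T v \<bullet> T w = v \<bullet> w" for v w
  proof -
    have "T v \<bullet> T w = (\<Sum>j\<in>Basis. (w \<bullet> j) * (T v \<bullet> \<sigma> j))" unfolding T_def[of w] by (simp add: inner_sum_right)
    also have "\<dots> = (\<Sum>j\<in>Basis. (v \<bullet> j) * (w \<bullet> j))" using Tc by (intro sum.cong refl) simp
    finally show ?thesis by (simp flip: euclidean_inner)
  qed
  have "linear T" unfolding T_def[abs_def] by (rule linearI) (simp_all add: inner_add_left scaleR_add_left sum.distrib scaleR_sum_right)
  then have To: "orthogonal_transformation T" unfolding orthogonal_transformation_def using TT by blast
  have dT: "distr lborel borel T = lborel" by (rule distr_lborel_orthogonal[OF To])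
  have Tm: "T \<in> borel_measurable borel" by (rule rotation_measurable[OF To])
  define P where "P = distr lborel (\<Pi>\<^sub>M b\<in>B. lborel) (\<lambda>x::'a. \<lambda>b\<in>B. x \<bullet> b)"
  have Pm: "(\<lambda>x::'a. \<lambda>b\<in>B. x \<bullet> b) \<in> measurable lborel (\<Pi>\<^sub>M b\<in>B. lborel)"
    by (intro measurable_restrict) simp
  have "P = (\<Pi>\<^sub>M b\<in>B. lborel)"
  proof (rule lborel_prod.PiM_eqI[OF Bf(2)])
    show "sets P = sets (\<Pi>\<^sub>M b\<in>B. lborel)" by (simp add: P_def)
    fix A :: "'a \<Rightarrow> real set" assume A: "\<And>b. b \<in> B \<Longrightarrow> A b \<in> sets lborel"
    have PA: "Pi\<^sub>E B A \<in> sets (\<Pi>\<^sub>M b\<in>B. (lborel :: real measure))" using A Bf(2) by (intro sets_PiM_I_finite) auto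
    define X where "X = {x. \<forall>b\<in>B. x \<bullet> b \<in> A b}"
    have v: "(\<lambda>x. \<lambda>b\<in>B. x \<bullet> b) -` Pi\<^sub>E B A \<inter> space lborel = X" by (auto simp: X_def)
    have Xb: "X \<in> sets borel" using measurable_sets[OF Pm PA] unfolding v by simp
    have TX: "T -` X = {y. \<forall>i\<in>Basis. y \<bullet> i \<in> A (\<sigma> i)}"
    proof -
      have "B = \<sigma> ` Basis" using \<sigma> by (simp add: bij_betw_def)
      then show ?thesis unfolding X_def using Tc by auto
    qed
    have A': "A (\<sigma> i) \<in> sets lborel" if "i \<in> Basis" for i using A \<sigma>B that by blast
    have "emeasure P (Pi\<^sub>E B A) = emeasure lborel X" unfolding P_def using emeasure_distr[OF Pm PA] v by simp
    also have "\<dots> = emeasure (distr lborel borel T) X" unfolding dT ..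
    also have "\<dots> = emeasure lborel (T -` X)" using Tm Xb by (subst emeasure_distr) auto
    also have "\<dots> = emeasure (distr (\<Pi>\<^sub>M b\<in>Basis. lborel) borel (\<lambda>f. \<Sum>b\<in>Basis. f b *\<^sub>R b)) (T -` X)"
      by (subst lborel_eq) simp
    also have "\<dots> = emeasure (\<Pi>\<^sub>M b\<in>Basis. lborel) (Pi\<^sub>E Basis (\<lambda>i. A (\<sigma> i)))"
    proof (subst emeasure_distr)
      show "T -` X \<in> sets borel" using measurable_sets[OF Tm Xb] by simp
      have "(\<lambda>f. \<Sum>b\<in>Basis. f b *\<^sub>R b) -` (T -` X) \<inter> space (\<Pi>\<^sub>M b\<in>(Basis :: 'a set). lborel) = Pi\<^sub>E Basis (\<lambda>i. A (\<sigma> i))"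
        unfolding TX by (auto simp: space_PiM PiE_def Pi_def extensional_def)
      then show "emeasure (\<Pi>\<^sub>M b\<in>Basis. lborel) ((\<lambda>f. \<Sum>b\<in>Basis. f b *\<^sub>R b) -` (T -` X) \<inter> space (\<Pi>\<^sub>M b\<in>(Basis :: 'a set). lborel)) =
        emeasure (\<Pi>\<^sub>M b\<in>Basis. lborel) (Pi\<^sub>E Basis (\<lambda>i. A (\<sigma> i)))" by simp
    qed measurable
    also have "\<dots> = (\<Prod>i\<in>Basis. emeasure lborel (A (\<sigma> i)))" by (intro lborel_prod.emeasure_PiM A') auto
    also have "\<dots> = (\<Prod>b\<in>B. emeasure lborel (A b))" by (rule prod.reindex_bij_betw[OF \<sigma>])
    finally show "emeasure P (Pi\<^sub>E B A) = (\<Prod>b\<in>B. emeasure lborel (A b))" .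
  qed
  then have "distr (\<Pi>\<^sub>M b\<in>B. lborel) borel (lin B) = distr P borel (lin B)" by simp
  also have "\<dots> = distr lborel borel (lin B \<circ> (\<lambda>x. \<lambda>b\<in>B. x \<bullet> b))"
    unfolding P_def by (intro distr_distr lin_measurable Bf(2) Pm)
  also have "lin B \<circ> (\<lambda>x. \<lambda>b\<in>B. x \<bullet> b) = (\<lambda>x. x)"
  proof
    fix x :: "'a"
    have "lin B (\<lambda>b\<in>B. x \<bullet> b) = lin B (\<lambda>b. x \<bullet> b)" unfolding lin_def by (intro sum.cong refl) simp
    then show "(lin B \<circ> (\<lambda>x. \<lambda>b\<in>B. x \<bullet> b)) x = x" using lin_expand[OF B, of x] by simp
  qed
  also have "distr lborel borel (\<lambda>x::'a. x) = lborel" by (intro distr_id2) simp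
  finally show ?thesis .
qed

text \<open>Fubini along a subspace and its orthogonal complement: orthonormal bases of the two together form an orthonormal basis of
the whole space, and the product measure over the union of index sets splits.\<close>
lemma nn_integral_fibers:
  fixes E :: "'a::euclidean_space set" and f :: "'a \<Rightarrow> ennreal"
  assumes E: "subspace E" and f[measurable]: "f \<in> borel_measurable borel"
  shows "(\<integral>\<^sup>+x. f x \<partial>lborel) = (\<integral>\<^sup>+z. (\<integral>\<^sup>+y. f (y + z) \<partial>lborel_on E) \<partial>lborel_on (E\<^sup>\<bottom>))"
    and fiber_measurable: "(\<lambda>z. \<integral>\<^sup>+y. f (y + z) \<partial>lborel_on E) \<in> borel_measurable borel"
proof -
  have E': "subspace (E\<^sup>\<bottom>)" by (rule subspace_orthogonal_comp)
  define B1 B2 where "B1 = onb E" and "B2 = onb (E\<^sup>\<bottom>)"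
  have B1: "orthonormal_basis_of E B1" and B2: "orthonormal_basis_of (E\<^sup>\<bottom>) B2"
    unfolding B1_def B2_def by (intro onb_works E E')+
  note f1 = orthonormal_facts[OF B1] and f2 = orthonormal_facts[OF B2]
  have orth: "a \<bullet> b = 0" if "a \<in> B1" "b \<in> B2" for a b using orth_comp_inner that f1(3) f2(3) by blast
  have disj: "B2 \<inter> B1 = {}"
  proof -
    have False if "b \<in> B1" "b \<in> B2" for b using orth[OF that] f1(4)[OF that(1) that(1)] by simp
    then show ?thesis by blast
  qed
  have B: "orthonormal_basis_of UNIV (B2 \<union> B1)"
    unfolding orthonormal_basis_of_def
  proof (intro conjI)
    show "pairwise orthogonal (B2 \<union> B1)"
      using B1 B2 orth unfolding orthonormal_basis_of_def pairwise_def orthogonal_def by (metis UnE inner_commute)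
    show "\<forall>b\<in>B2 \<union> B1. norm b = 1" using B1 B2 unfolding orthonormal_basis_of_def by auto
    have "x \<in> span (B2 \<union> B1)" for x
    proof -
      have "orth_proj E x \<in> span B1" "orth_proj (E\<^sup>\<bottom>) x \<in> span B2"
        using orth_proj_decomp(1)[OF E, of x] orth_proj_decomp(1)[OF E', of x] B1 B2 unfolding orthonormal_basis_of_def by auto
      then have "orth_proj E x \<in> span (B2 \<union> B1)" "orth_proj (E\<^sup>\<bottom>) x \<in> span (B2 \<union> B1)"
        using span_mono[of B1 "B2 \<union> B1"] span_mono[of B2 "B2 \<union> B1"] by auto
      then have "orth_proj E x + orth_proj (E\<^sup>\<bottom>) x \<in> span (B2 \<union> B1)" by (rule span_add)
      then show ?thesis using orth_proj_split[OF E, of x] by simp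
    qed
    then show "span (B2 \<union> B1) = UNIV" by blast
  qed
  note l1 = lin_measurable[OF f1(2)] and l2 = lin_measurable[OF f2(2)] and l3 = lin_measurable[OF orthonormal_facts(2)[OF B]]
  interpret I1: finite_product_sigma_finite "\<lambda>_. lborel :: real measure" B1 by standard (rule f1(2))
  interpret I2: finite_product_sigma_finite "\<lambda>_. lborel :: real measure" B2 by standard (rule f2(2))
  have inner: "(\<integral>\<^sup>+y. f (y + z) \<partial>lborel_on E) = (\<integral>\<^sup>+u. f (lin B1 u + z) \<partial>(\<Pi>\<^sub>M b\<in>B1. lborel))" for z
    unfolding B1_def by (intro nn_integral_lborel_on E) measurable
  show m: "(\<lambda>z. \<integral>\<^sup>+y. f (y + z) \<partial>lborel_on E) \<in> borel_measurable borel"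
    unfolding inner
  proof (rule I1.borel_measurable_nn_integral)
    have [measurable]: "lin B1 \<in> borel_measurable (\<Pi>\<^sub>M b\<in>B1. lborel)" by (rule l1)
    show "(\<lambda>(z, u). f (lin B1 u + z)) \<in> borel_measurable (borel \<Otimes>\<^sub>M (\<Pi>\<^sub>M b\<in>B1. lborel))" by measurable
  qed
  have "(\<integral>\<^sup>+x. f x \<partial>lborel) = (\<integral>\<^sup>+x. f x \<partial>distr (\<Pi>\<^sub>M b\<in>B2 \<union> B1. lborel) borel (lin (B2 \<union> B1)))"
    unfolding lborel_orthonormal[OF B] ..
  also have "\<dots> = (\<integral>\<^sup>+u. f (lin (B2 \<union> B1) u) \<partial>(\<Pi>\<^sub>M b\<in>B2 \<union> B1. lborel))"
    using f by (subst nn_integral_distr[OF l3]) auto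
  also have "\<dots> = (\<integral>\<^sup>+v. (\<integral>\<^sup>+u. f (lin (B2 \<union> B1) (merge B2 B1 (v, u))) \<partial>(\<Pi>\<^sub>M b\<in>B1. lborel)) \<partial>(\<Pi>\<^sub>M b\<in>B2. lborel))"
    by (intro lborel_prod.product_nn_integral_fold disj f1 f2 measurable_compose[OF l3 f])
  also have "\<dots> = (\<integral>\<^sup>+v. (\<integral>\<^sup>+u. f (lin B1 u + lin B2 v) \<partial>(\<Pi>\<^sub>M b\<in>B1. lborel)) \<partial>(\<Pi>\<^sub>M b\<in>B2. lborel))"
  proof -
    have "lin (B2 \<union> B1) (merge B2 B1 (v, u)) = lin B1 u + lin B2 v" for u v
    proof -
      have "lin (B2 \<union> B1) (merge B2 B1 (v, u)) = (\<Sum>b\<in>B2. merge B2 B1 (v, u) b *\<^sub>R b) + (\<Sum>b\<in>B1. merge B2 B1 (v, u) b *\<^sub>R b)"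
        unfolding lin_def using f1(2) f2(2) disj by (intro sum.union_disjoint)
      also have "\<dots> = lin B2 v + lin B1 u"
        unfolding lin_def using disj by (intro arg_cong2[of _ _ _ _ "(+)"] sum.cong refl) (auto simp: merge_def)
      finally show ?thesis by (simp add: add.commute)
    qed
    then show ?thesis by simp
  qed
  also have "\<dots> = (\<integral>\<^sup>+z. (\<integral>\<^sup>+y. f (y + z) \<partial>lborel_on E) \<partial>lborel_on (E\<^sup>\<bottom>))"
    unfolding nn_integral_lborel_on[OF E' m] B2_def[symmetric] unfolding inner ..
  finally show "(\<integral>\<^sup>+x. f x \<partial>lborel) = (\<integral>\<^sup>+z. (\<integral>\<^sup>+y. f (y + z) \<partial>lborel_on E) \<partial>lborel_on (E\<^sup>\<bottom>))" .
qed

lemma subspace_sets_borel: fixes E :: "'a::euclidean_space set" shows "subspace E \<Longrightarrow> E \<in> sets borel"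
  using closed_subspace borel_closed by blast

lemma orth_proj_measurable [measurable]: "subspace E \<Longrightarrow> orth_proj E \<in> borel_measurable borel"
  by (intro borel_measurable_continuous_onI orth_proj_continuous)

lemma nn_integral_unit_cube_on:
  assumes E: "subspace E"
  shows "(\<integral>\<^sup>+z. indicator {z. \<forall>b\<in>onb E. 0 \<le> z \<bullet> b \<and> z \<bullet> b \<le> 1} z \<partial>lborel_on E) = 1"
    and "{z. \<forall>b\<in>onb E. 0 \<le> z \<bullet> b \<and> z \<bullet> b \<le> 1} \<in> sets borel"
proof -
  have B: "orthonormal_basis_of E (onb E)" by (rule onb_works[OF E])
  note f = orthonormal_facts[OF B]
  let ?D = "{z. \<forall>b\<in>onb E. 0 \<le> z \<bullet> b \<and> z \<bullet> b \<le> 1}"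
  have "?D = (\<Inter>b\<in>onb E. {z. 0 \<le> z \<bullet> b} \<inter> {z. z \<bullet> b \<le> 1})" by auto
  moreover have "closed (\<Inter>b\<in>onb E. {z. 0 \<le> z \<bullet> b} \<inter> {z. z \<bullet> b \<le> 1})"
    by (intro closed_INT ballI closed_Int closed_Collect_le continuous_intros)
  ultimately have "closed ?D" by (simp only:)
  then show Db: "?D \<in> sets borel" by (rule borel_closed)
  have "(\<integral>\<^sup>+z. indicator ?D z \<partial>lborel_on E) = (\<integral>\<^sup>+u. indicator ?D (lin (onb E) u) \<partial>(\<Pi>\<^sub>M b\<in>onb E. lborel))"
    by (rule nn_integral_lborel_on[OF E borel_measurable_indicator[OF Db]])
  also have "\<dots> = (\<integral>\<^sup>+u. indicator (Pi\<^sub>E (onb E) (\<lambda>_. {0..1::real})) u \<partial>(\<Pi>\<^sub>M b\<in>onb E. lborel))"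
  proof (rule nn_integral_cong)
    fix u assume "u \<in> space (\<Pi>\<^sub>M b\<in>onb E. (lborel :: real measure))"
    then have "u \<in> extensional (onb E)" by (simp add: space_PiM PiE_def)
    then have "lin (onb E) u \<in> ?D \<longleftrightarrow> u \<in> Pi\<^sub>E (onb E) (\<lambda>_. {0..1::real})"
      using lin_inner[OF B] by (simp add: PiE_def Pi_def Ball_def)
    then show "(indicator ?D (lin (onb E) u) :: ennreal) = indicator (Pi\<^sub>E (onb E) (\<lambda>_. {0..1::real})) u"
      by (simp only: indicator_def)
  qed
  also have "\<dots> = emeasure (\<Pi>\<^sub>M b\<in>onb E. lborel) (Pi\<^sub>E (onb E) (\<lambda>_. {0..1::real}))"
    using f(2) by (intro nn_integral_indicator sets_PiM_I_finite) auto
  also have "\<dots> = (\<Prod>b\<in>onb E. emeasure lborel {0..1::real})" using f(2) by (intro lborel_prod.emeasure_PiM) auto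
  finally show "(\<integral>\<^sup>+z. indicator ?D z \<partial>lborel_on E) = 1" by simp
qed

text \<open>Invariance of the whole Lebesgue measure is applied to functions \<open>F (orth_proj E x) * indicator D (orth_proj (E\<^sup>\<bottom>) x)\<close>,
where D is a unit cube in the complement. As T fixes the complement, the second factor is unchanged and contributes one.\<close>
lemma lborel_on_rotate:
  fixes E :: "'a::euclidean_space set"
  assumes E: "subspace E" and T: "orthogonal_transformation T" and fxd: "\<And>z. z \<in> E\<^sup>\<bottom> \<Longrightarrow> T z = z"
  shows rotate_in: "y \<in> E \<Longrightarrow> T y \<in> E" and "distr (lborel_on E) (lborel_on E) T = lborel_on E"
proof -
  have E': "subspace (E\<^sup>\<bottom>)" by (rule subspace_orthogonal_comp)
  show inE: "T y \<in> E" if y: "y \<in> E" for y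
  proof -
    have "T y \<bullet> z = 0" if "z \<in> E\<^sup>\<bottom>" for z
    proof -
      have "T y \<bullet> z = T y \<bullet> T z" using fxd[OF that] by simp
      also have "\<dots> = y \<bullet> z" using T unfolding orthogonal_transformation_def by blast
      finally show ?thesis using orth_comp_inner[OF y that] by simp
    qed
    then have "T y \<in> E\<^sup>\<bottom>\<^sup>\<bottom>" unfolding orthogonal_comp_def orthogonal_def by (auto simp: inner_commute)
    then show ?thesis using orthogonal_comp_self[OF E] by simp
  qed
  have lT: "linear T" using T orthogonal_transformation_linear by blast
  have Tm[measurable]: "T \<in> borel_measurable borel" by (rule rotation_measurable[OF T])
  have Eb: "E \<in> sets borel" by (rule subspace_sets_borel[OF E])
  note [measurable] = orth_proj_measurable[OF E] orth_proj_measurable[OF E']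
  \<comment> \<open>unit cube in the complement, of measure one\<close>
  define D where "D = {z. \<forall>b\<in>onb (E\<^sup>\<bottom>). 0 \<le> z \<bullet> b \<and> z \<bullet> b \<le> 1}"
  have D1: "(\<integral>\<^sup>+z. indicator D z \<partial>lborel_on (E\<^sup>\<bottom>)) = 1" and [measurable]: "D \<in> sets borel"
    unfolding D_def by (rule nn_integral_unit_cube_on[OF E'])+
  have inv: "(\<integral>\<^sup>+y. F (T y) \<partial>lborel_on E) = (\<integral>\<^sup>+y. F y \<partial>lborel_on E)"
    if F[measurable]: "F \<in> borel_measurable borel" for F :: "'a \<Rightarrow> ennreal"
  proof -
    define G where "G x = F (orth_proj E x) * indicator D (orth_proj (E\<^sup>\<bottom>) x)" for x
    have Gm[measurable]: "G \<in> borel_measurable borel" unfolding G_def[abs_def] by measurable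
    have "(\<integral>\<^sup>+x. G x \<partial>distr lborel borel T) = (\<integral>\<^sup>+x. G (T x) \<partial>lborel)" by (rule nn_integral_distr) auto
    then have e: "(\<integral>\<^sup>+x. G (T x) \<partial>lborel) = (\<integral>\<^sup>+x. G x \<partial>lborel)" unfolding distr_lborel_orthogonal[OF T] by simp
    have "(\<integral>\<^sup>+x. G x \<partial>lborel) = (\<integral>\<^sup>+z. (\<integral>\<^sup>+y. G (y + z) \<partial>lborel_on E) \<partial>lborel_on (E\<^sup>\<bottom>))"
      by (rule nn_integral_fibers[OF E Gm])
    also have "\<dots> = (\<integral>\<^sup>+z. (\<integral>\<^sup>+y. F y * indicator D z \<partial>lborel_on E) \<partial>lborel_on (E\<^sup>\<bottom>))"
      unfolding G_def by (intro nn_integral_cong) (simp add: orth_proj_sum[OF E])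
    also have "\<dots> = (\<integral>\<^sup>+z. (\<integral>\<^sup>+y. F y \<partial>lborel_on E) * indicator D z \<partial>lborel_on (E\<^sup>\<bottom>))"
      by (intro nn_integral_cong nn_integral_multc measurable_lborel_on F)
    also have "\<dots> = (\<integral>\<^sup>+y. F y \<partial>lborel_on E)"
      using D1 by (subst nn_integral_cmult) (auto intro: measurable_lborel_on)
    finally have 1: "(\<integral>\<^sup>+x. G x \<partial>lborel) = (\<integral>\<^sup>+y. F y \<partial>lborel_on E)" .
    have "(\<integral>\<^sup>+x. G (T x) \<partial>lborel) = (\<integral>\<^sup>+z. (\<integral>\<^sup>+y. G (T (y + z)) \<partial>lborel_on E) \<partial>lborel_on (E\<^sup>\<bottom>))"
      by (rule nn_integral_fibers[OF E]) measurable
    also have "\<dots> = (\<integral>\<^sup>+z. (\<integral>\<^sup>+y. F (T y) * indicator D z \<partial>lborel_on E) \<partial>lborel_on (E\<^sup>\<bottom>))"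
      unfolding G_def by (intro nn_integral_cong) (simp add: linear_add[OF lT] fxd orth_proj_sum[OF E inE])
    also have "\<dots> = (\<integral>\<^sup>+z. (\<integral>\<^sup>+y. F (T y) \<partial>lborel_on E) * indicator D z \<partial>lborel_on (E\<^sup>\<bottom>))"
      by (intro nn_integral_cong nn_integral_multc measurable_lborel_on) measurable
    also have "\<dots> = (\<integral>\<^sup>+y. F (T y) \<partial>lborel_on E)"
      using D1 by (subst nn_integral_cmult) (auto intro: measurable_lborel_on)
    finally show ?thesis using e 1 by simp
  qed
  show "distr (lborel_on E) (lborel_on E) T = lborel_on E"
  proof (rule measure_eqI)
    fix A assume "A \<in> sets (distr (lborel_on E) (lborel_on E) T)"
    then have A: "A \<in> sets (lborel_on E)" by simp
    then have Ab: "A \<in> sets borel" using Eb by (auto simp: sets_restrict_space)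
    have Tmm: "T \<in> measurable (lborel_on E) (lborel_on E)"
      unfolding measurable_cong_sets[OF sets_lborel_on sets_lborel_on]
      using inE by (intro measurable_restrict_space3) auto
    have "emeasure (distr (lborel_on E) (lborel_on E) T) A = (\<integral>\<^sup>+y. indicator A y \<partial>distr (lborel_on E) (lborel_on E) T)"
      using A by simp
    also have "\<dots> = (\<integral>\<^sup>+y. indicator A (T y) \<partial>lborel_on E)"
      by (intro nn_integral_distr Tmm) (simp add: borel_measurable_indicator[OF A] measurable_cong_sets[OF sets_distr refl])
    also have "\<dots> = (\<integral>\<^sup>+y. indicator A y \<partial>lborel_on E)" using Ab by (intro inv) auto
    finally show "emeasure (distr (lborel_on E) (lborel_on E) T) A = emeasure (lborel_on E) A" using A by simp
  qed simp
qed

text \<open>If \<open>F y\<close> were positive, \<open>F \<circ> orth_proj E\<close> would be positive on a ball although its integral over the whole space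
vanishes by Fubini.\<close>
lemma lborel_on_full_support:
  fixes E :: "'a::euclidean_space set"
  assumes E: "subspace E" and F: "continuous_on UNIV F" "\<And>y. F y \<ge> 0"
    and z: "(\<integral>\<^sup>+y. ennreal (F y) \<partial>lborel_on E) = 0" and y: "y \<in> E"
  shows "F y = 0"
proof (rule ccontr)
  assume ne: "F y \<noteq> 0"
  have Fm[measurable]: "F \<in> borel_measurable borel" by (rule borel_measurable_continuous_onI[OF F(1)])
  note [measurable] = orth_proj_measurable[OF E]
  have "(\<integral>\<^sup>+x. ennreal (F (orth_proj E x)) \<partial>lborel) = (\<integral>\<^sup>+z. (\<integral>\<^sup>+y. ennreal (F (orth_proj E (y + z))) \<partial>lborel_on E) \<partial>lborel_on (E\<^sup>\<bottom>))"
    by (rule nn_integral_fibers[OF E]) measurable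
  also have "\<dots> = (\<integral>\<^sup>+z. (\<integral>\<^sup>+y. ennreal (F y) \<partial>lborel_on E) \<partial>lborel_on (E\<^sup>\<bottom>))"
    by (intro nn_integral_cong) (simp add: orth_proj_sum[OF E])
  finally have "(\<integral>\<^sup>+x. ennreal (F (orth_proj E x)) \<partial>lborel) = 0" unfolding z by simp
  then have "AE x in lborel. ennreal (F (orth_proj E x)) = 0"
    by (subst (asm) nn_integral_0_iff_AE) measurable
  then have ae: "AE x in lborel. x \<notin> {x. F (orth_proj E x) > 0}"
    by eventually_elim (metis (no_types, lifting) ennreal_eq_0_iff mem_Collect_eq not_le)
  have c: "continuous_on UNIV (\<lambda>x. F (orth_proj E x))"
    by (rule continuous_on_compose2[OF F(1) orth_proj_continuous[OF E]]) simp
  have o: "open {x. F (orth_proj E x) > 0}" by (intro open_Collect_less continuous_on_const c)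
  have "emeasure lborel {x. F (orth_proj E x) > 0} = 0"
    using ae o by (subst (asm) AE_iff_measurable[of "{x. F (orth_proj E x) > 0}"]) auto
  moreover have "y \<in> {x. F (orth_proj E x) > 0}" using ne F(2)[of y] orth_proj_id[OF E y] by simp
  then obtain e where e: "e > 0" "ball y e \<subseteq> {x. F (orth_proj E x) > 0}" using o open_contains_ball by blast
  have "emeasure lborel (ball y e) \<le> emeasure lborel {x. F (orth_proj E x) > 0}"
    using e o by (intro emeasure_mono) auto
  ultimately have "emeasure lborel (ball y e) = 0" by simp
  then show False using content_ball_pos[OF e(1), of y] by (simp add: measure_def)
qed

text \<open>In the coordinates of the basis the support lies in a cube.\<close>
lemma lborel_on_finite:
  assumes E: "subspace E" and F: "bcs F"
  shows "(\<integral>\<^sup>+y. ennreal \<bar>F y\<bar> \<partial>lborel_on E) < \<infinity>" "integrable (lborel_on E) F"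
proof -
  obtain C r where C: "C > 0" "r > 0" "\<And>x. \<bar>F x\<bar> \<le> C" "\<And>x. norm x > r \<Longrightarrow> F x = 0"
    "F \<in> borel_measurable borel" using bcsE[OF F] by metis
  have B: "orthonormal_basis_of E (onb E)" by (rule onb_works[OF E])
  note f = orthonormal_facts[OF B]
  have nb: "norm b = 1" if "b \<in> onb E" for b using B that unfolding orthonormal_basis_of_def by blast
  have "(\<integral>\<^sup>+y. ennreal \<bar>F y\<bar> \<partial>lborel_on E) = (\<integral>\<^sup>+u. ennreal \<bar>F (lin (onb E) u)\<bar> \<partial>(\<Pi>\<^sub>M b\<in>onb E. lborel))"
    using C(5) by (intro nn_integral_lborel_on E) measurable
  also have "\<dots> \<le> (\<integral>\<^sup>+u. ennreal C * indicator (Pi\<^sub>E (onb E) (\<lambda>_. {-r..r})) u \<partial>(\<Pi>\<^sub>M b\<in>onb E. lborel))"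
  proof (rule nn_integral_mono)
    fix u assume u: "u \<in> space (\<Pi>\<^sub>M b\<in>onb E. (lborel :: real measure))"
    show "ennreal \<bar>F (lin (onb E) u)\<bar> \<le> ennreal C * indicator (Pi\<^sub>E (onb E) (\<lambda>_. {-r..r})) u"
    proof (cases "norm (lin (onb E) u) > r")
      case True then show ?thesis using C(4) by simp
    next
      case False
      have "\<bar>u b\<bar> \<le> r" if "b \<in> onb E" for b
        using Cauchy_Schwarz_ineq2[of "lin (onb E) u" b] lin_inner[OF B that, of u] nb[OF that] False by simp
      then have "u \<in> Pi\<^sub>E (onb E) (\<lambda>_. {-r..r})" using u by (auto simp: space_PiM PiE_def Pi_def abs_le_iff minus_le_iff)
      then show ?thesis using C(3) by (simp add: ennreal_leI)
    qed
  qed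
  also have "\<dots> = ennreal C * emeasure (\<Pi>\<^sub>M b\<in>onb E. lborel) (Pi\<^sub>E (onb E) (\<lambda>_. {-r..r}))"
    using f(2) by (intro nn_integral_cmult_indicator sets_PiM_I_finite) auto
  also have "emeasure (\<Pi>\<^sub>M b\<in>onb E. lborel) (Pi\<^sub>E (onb E) (\<lambda>_. {-r..r})) = (\<Prod>b\<in>onb E. emeasure lborel {-r..r})"
    using f(2) by (intro lborel_prod.emeasure_PiM) auto
  also have "(\<Prod>b\<in>onb E. emeasure lborel {-r..r}) = ennreal ((2 * r) ^ card (onb E))"
    using C(2) by (simp add: ennreal_power)
  also have "ennreal C * ennreal ((2 * r) ^ card (onb E)) < \<infinity>"
    by (simp add: ennreal_mult_less_top)
  finally show fin: "(\<integral>\<^sup>+y. ennreal \<bar>F y\<bar> \<partial>lborel_on E) < \<infinity>" .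
  show "integrable (lborel_on E) F"
    using fin C(5) by (intro integrableI_bounded measurable_lborel_on) auto
qed

text \<open>The intrinsic gradient of the restriction to a fiber is the projection of the full gradient. Uniqueness of the
gradient relative to E follows by differentiating along a line in the direction of the difference of two candidates.\<close>
lemma gradient_on_restrict:
  fixes E :: "'a::euclidean_space set"
  assumes E: "subspace E" and h: "h differentiable (at (y + z))" and y: "y \<in> E"
  shows "(norm (gradient_on E (\<lambda>y. h (y + z)) y))\<^sup>2 = (\<Sum>b\<in>Basis. (dd (orth_proj E b) h (y + z))\<^sup>2)"
proof -
  let ?P = "orth_proj E"
  define g where "g y = h (y + z)" for y
  define v where "v = (\<Sum>b\<in>Basis. dd (?P b) h (y + z) *\<^sub>R b)"
  have lP: "linear ?P" by (rule orth_proj_linear[OF E])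
  have vk: "v \<bullet> k = dd (?P k) h (y + z)" for k
  proof -
    have "linear (\<lambda>k. dd (?P k) h (y + z))" using linear_compose[OF lP dd_linear[OF h]] by (simp add: o_def)
    then have "dd (?P (\<Sum>b\<in>Basis. (k \<bullet> b) *\<^sub>R b)) h (y + z) = (\<Sum>b\<in>Basis. (k \<bullet> b) * dd (?P b) h (y + z))"
      using linear_sum[of "\<lambda>k. dd (?P k) h (y + z)" "\<lambda>b. (k \<bullet> b) *\<^sub>R b" Basis] linear_cmul[of "\<lambda>k. dd (?P k) h (y + z)"]
      by simp
    then have "dd (?P k) h (y + z) = (\<Sum>b\<in>Basis. (k \<bullet> b) * dd (?P b) h (y + z))"
      unfolding euclidean_representation .
    then show ?thesis by (simp add: v_def inner_sum_left inner_commute[of k] mult.commute)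
  qed
  have vE: "v \<in> E"
  proof -
    have "v \<bullet> k = 0" if "k \<in> E\<^sup>\<bottom>" for k
      unfolding vk orth_proj_comp_0[OF E that] using linear_0[OF dd_linear[OF h]] by simp
    then have "v \<in> E\<^sup>\<bottom>\<^sup>\<bottom>" unfolding orthogonal_comp_def orthogonal_def by (auto simp: inner_commute)
    then show ?thesis using orthogonal_comp_self[OF E] by simp
  qed
  have der: "(g has_derivative (\<lambda>k. v \<bullet> k)) (at y within E)"
  proof -
    have Pd: "((\<lambda>y. ?P y + z) has_derivative ?P) (at y within E)"
    proof -
      have "(?P has_derivative ?P) (at y within E)"
        using lP by (intro bounded_linear_imp_has_derivative) (metis linear_conv_bounded_linear)
      from has_derivative_add[OF this has_derivative_const[of z]] show ?thesis by simp
    qed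
    have "?P y + z = y + z" using orth_proj_id[OF E y] by simp
    then have "(h has_derivative (\<lambda>k. dd k h (y + z))) (at (?P y + z))" using has_derivative_dd[OF h] by simp
    from has_derivative_compose[OF Pd this]
    have "((\<lambda>y. h (?P y + z)) has_derivative (\<lambda>k. v \<bullet> k)) (at y within E)" unfolding vk .
    then show ?thesis
      by (rule has_derivative_transform[OF y, rotated]) (simp add: g_def orth_proj_id[OF E])
  qed
  have uniq: "w = v" if w: "w \<in> E" "(g has_derivative (\<lambda>k. w \<bullet> k)) (at y within E)" for w
  proof -
    define d where "d = w - v"
    have dE: "d \<in> E" unfolding d_def using subspace_diff[OF E w(1) vE] .
    have line: "((\<lambda>t::real. g (y + t *\<^sub>R d)) has_derivative (\<lambda>t. q \<bullet> (t *\<^sub>R d))) (at 0)"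
      if "(g has_derivative (\<lambda>k. q \<bullet> k)) (at y within E)" for q
    proof -
      have l: "((\<lambda>t::real. y + t *\<^sub>R d) has_derivative (\<lambda>t. t *\<^sub>R d)) (at 0 within UNIV)"
        by (auto intro!: derivative_eq_intros)
      have "range (\<lambda>t. y + t *\<^sub>R d) \<subseteq> E" using y dE E by (auto intro: subspace_add subspace_scale)
      then have "(g has_derivative (\<lambda>k. q \<bullet> k)) (at (y + 0 *\<^sub>R d) within range (\<lambda>t. y + t *\<^sub>R d))"
        using that has_derivative_subset by force
      from has_derivative_in_compose[OF l this] show ?thesis by simp
    qed
    from has_derivative_unique[OF line[OF w(2)] line[OF der]]
    have "w \<bullet> (1 *\<^sub>R d) = v \<bullet> (1 *\<^sub>R d)" by metis
    then have "d \<bullet> d = 0" by (simp add: d_def inner_diff_left)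
    then show ?thesis by (simp add: d_def)
  qed
  have "gradient_on E g y = v"
  proof -
    have ex: "\<exists>!v. v \<in> E \<and> (g has_derivative (\<lambda>h. v \<bullet> h)) (at y within E)" using vE der uniq by blast
    then have "(THE v. v \<in> E \<and> (g has_derivative (\<lambda>h. v \<bullet> h)) (at y within E)) = v"
      using vE der by (intro the1_equality) auto
    then show ?thesis unfolding gradient_on_def using vE der by auto
  qed
  moreover have "(norm v)\<^sup>2 = (\<Sum>b\<in>Basis. (dd (?P b) h (y + z))\<^sup>2)"
  proof -
    have "(norm v)\<^sup>2 = (\<Sum>b\<in>Basis. (v \<bullet> b) * (v \<bullet> b))"
      unfolding power2_norm_eq_inner by (rule euclidean_inner)
    then show ?thesis by (simp only: vk power2_eq_square)
  qed
  ultimately show ?thesis unfolding g_def[abs_def] by simp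
qed

section \<open>The Poincare inequality on fibers\<close>

lemma cc_shift: assumes f: "cc f" shows "cc (\<lambda>y. f (y + z))"
proof -
  have "continuous_on UNIV (\<lambda>y. f (y + z))"
    by (rule continuous_on_compose2[of UNIV f]) (use f in \<open>auto simp: cc_def intro!: continuous_intros\<close>)
  moreover have "csupp (\<lambda>y. f (z + y))" using f csupp_shift unfolding cc_def by blast
  ultimately show ?thesis unfolding cc_def by (simp add: add.commute)
qed

text \<open>Where the symmetry is used. The integrals I a of the derivatives of u over the fiber depend linearly on the direction
a, so they are given by a vector J. Invariance of u, of the weight and of the fiber measure under T gives T J = J, while the
directions in E are orthogonal to all fixed vectors of T.\<close>
lemma fiber_mean_zero:
  fixes E :: "'a::euclidean_space set"
  assumes T: "orthogonal_transformation T" and E: "E = (fixed_space T)\<^sup>\<bottom>"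
    and P: "continuous_on UNIV \<Phi>" "\<And>x. \<Phi> (T x) = \<Phi> x" and u: "Ck 1 u" "csupp u" "\<And>x. u (T x) = u x"
    and z: "z \<in> E\<^sup>\<bottom>" and a: "a \<in> E"
  shows "(\<integral>y. dd a u (y + z) * wt \<Phi> (y + z) \<partial>lborel_on E) = 0"
proof -
  have lT: "linear T" using T orthogonal_transformation_linear by blast
  have sf: "subspace (fixed_space T)" unfolding fixed_space_def subspace_def
    by (simp add: linear_0[OF lT] linear_add[OF lT] linear_cmul[OF lT])
  have sE: "subspace E" unfolding E by (rule subspace_orthogonal_comp)
  have Ec: "E\<^sup>\<bottom> = fixed_space T" unfolding E by (rule orthogonal_comp_self[OF sf])
  have fx: "T z = z" if "z \<in> E\<^sup>\<bottom>" for z using that unfolding Ec fixed_space_def by simp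
  have rdistr: "distr (lborel_on E) (lborel_on E) T = lborel_on E" by (rule lborel_on_rotate(2)[OF sE T fx])
  have rin: "T y \<in> E" if "y \<in> E" for y by (rule lborel_on_rotate(1)[OF sE T fx that])
  have du: "u differentiable (at x)" for x using u(1) by simp
  have wc: "continuous_on UNIV (wt \<Phi>)" unfolding wt_def[abs_def] by (intro continuous_intros P)
  have cc1: "cc (\<lambda>y. dd a u (y + z) * wt \<Phi> (y + z))" for a
  proof -
    have "cc (\<lambda>x. dd a u x * wt \<Phi> x)" using cc_dd[of 0 u a] u wc by (intro cc_mult1) auto
    then show ?thesis by (rule cc_shift)
  qed
  define I where "I a = (\<integral>y. dd a u (y + z) * wt \<Phi> (y + z) \<partial>lborel_on E)" for a
  have int: "integrable (lborel_on E) (\<lambda>y. dd a u (y + z) * wt \<Phi> (y + z))" for a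
    by (intro lborel_on_finite(2) sE cc_bcs cc1)
  define J where "J = (\<Sum>b\<in>Basis. I b *\<^sub>R b)"
  have IJ: "I a = J \<bullet> a" for a
  proof -
    have "dd a u (y + z) * wt \<Phi> (y + z) = (\<Sum>b\<in>Basis. (a \<bullet> b) * (dd b u (y + z) * wt \<Phi> (y + z)))" for y
      by (subst dd_basis[OF du]) (simp add: sum_distrib_right mult.assoc)
    then have "I a = (\<Sum>b\<in>Basis. (a \<bullet> b) * I b)" unfolding I_def using int by simp
    then show ?thesis by (simp add: J_def inner_sum_left inner_commute[of a] mult.commute)
  qed
  have inv: "I (T a) = I a" for a
  proof -
    have "I (T a) = (\<integral>y. dd (T a) u (y + z) * wt \<Phi> (y + z) \<partial>distr (lborel_on E) (lborel_on E) T)"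
      unfolding I_def by (simp only: rdistr)
    also have "\<dots> = (\<integral>y. dd (T a) u (T y + z) * wt \<Phi> (T y + z) \<partial>lborel_on E)"
    proof (rule integral_distr)
      show "T \<in> measurable (lborel_on E) (lborel_on E)"
        unfolding measurable_cong_sets[OF sets_lborel_on sets_lborel_on]
        using rin rotation_measurable[OF T] by (intro measurable_restrict_space3) auto
      show "(\<lambda>y. dd (T a) u (y + z) * wt \<Phi> (y + z)) \<in> borel_measurable (lborel_on E)"
        using int[of "T a"] by (rule borel_measurable_integrable)
    qed
    also have "\<dots> = I a" unfolding I_def
    proof (intro Bochner_Integration.integral_cong refl)
      fix y
      have e: "T y + z = T (y + z)" using fx[OF z] by (simp add: linear_add[OF lT])
      have "dd (T a) u (T (y + z)) = dd a u (y + z)" by (rule dd_equivariant[OF T u(3) du])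
      then show "dd (T a) u (T y + z) * wt \<Phi> (T y + z) = dd a u (y + z) * wt \<Phi> (y + z)"
        unfolding e by (simp add: wt_def P(2))
    qed
    finally show ?thesis .
  qed
  have "T J = J"
  proof -
    have "J \<bullet> T a = J \<bullet> a" for a using inv IJ by simp
    then have "T J \<bullet> T a = J \<bullet> T a" for a using T unfolding orthogonal_transformation_def by simp
    then have "T J \<bullet> w = J \<bullet> w" for w using orthogonal_transformation_surj[OF T] by (metis surjD)
    then show ?thesis by (metis vector_eq_rdot)
  qed
  then have "J \<in> fixed_space T" by (simp add: fixed_space_def)
  then have "J \<bullet> a = 0" using a unfolding E by (rule orth_comp_inner)
  then show ?thesis using IJ unfolding I_def by simp
qed

text \<open>For a test function u, the energies on the fiber z + E of the part of its gradient along E (\<open>fib_grad\<close>) and of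
the derivative of that part along E (\<open>fib_hess\<close>).\<close>
definition fib_grad :: "('a::euclidean_space \<Rightarrow> real) \<Rightarrow> ('a \<Rightarrow> real) \<Rightarrow> 'a set \<Rightarrow> 'a \<Rightarrow> ennreal" where
  "fib_grad \<Phi> u E z = (\<integral>\<^sup>+y. ennreal ((\<Sum>k\<in>Basis. (dd (orth_proj E k) u (y + z))\<^sup>2) * wt \<Phi> (y + z)) \<partial>lborel_on E)"

definition fib_hess :: "('a::euclidean_space \<Rightarrow> real) \<Rightarrow> ('a \<Rightarrow> real) \<Rightarrow> 'a set \<Rightarrow> 'a \<Rightarrow> ennreal" where
  "fib_hess \<Phi> u E z = (\<integral>\<^sup>+y. ennreal ((\<Sum>k\<in>Basis. \<Sum>l\<in>Basis. (dd (orth_proj E l) (dd (orth_proj E k) u) (y + z))\<^sup>2) * wt \<Phi> (y + z)) \<partial>lborel_on E)"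

text \<open>A measurable substitute for the inverse Poincare constant of the fiber. Where the denominator vanishes the ratio is 0 by
division by zero; there the gradient along the whole fiber vanishes, so any value is correct.\<close>
definition fib_ratio :: "('a::euclidean_space \<Rightarrow> real) \<Rightarrow> ('a \<Rightarrow> real) \<Rightarrow> 'a set \<Rightarrow> 'a \<Rightarrow> real" where
  "fib_ratio \<Phi> u E z = enn2real (fib_hess \<Phi> u E z) / enn2real (fib_grad \<Phi> u E z)"

text \<open>The normalising integral of a conditional measure of total mass one is neither zero nor infinite.\<close>
lemma cond_measure_normalized:
  assumes E: "subspace E" and P: "continuous_on UNIV \<Phi>" and pr: "prob_space (cond_measure \<Phi> x E)"
  defines "z \<equiv> orth_proj (E\<^sup>\<bottom>) x"
  obtains \<zeta> where "\<zeta> > 0" "cond_measure \<Phi> x E = density (lborel_on E) (\<lambda>y. ennreal (wt \<Phi> (y + z) / \<zeta>))"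
proof -
  define Z where "Z = (\<integral>\<^sup>+y. ennreal (wt \<Phi> (y + z)) \<partial>lborel_on E)"
  have nu: "cond_measure \<Phi> x E = density (lborel_on E) (\<lambda>y. ennreal (wt \<Phi> (y + z)) / Z)"
    unfolding cond_measure_def wt_def Z_def z_def ..
  have wm: "(\<lambda>y. wt \<Phi> (y + z)) \<in> borel_measurable borel"
    unfolding wt_def by (intro borel_measurable_continuous_onI continuous_intros continuous_on_compose2[OF P]) auto
  have wmE[measurable]: "(\<lambda>y. wt \<Phi> (y + z)) \<in> borel_measurable (lborel_on E)" by (rule measurable_lborel_on[OF wm])
  have one: "(\<integral>\<^sup>+y. ennreal (wt \<Phi> (y + z)) / Z \<partial>lborel_on E) = 1"
  proof -
    have "emeasure (cond_measure \<Phi> x E) (space (cond_measure \<Phi> x E)) = 1" using pr by (rule prob_space.emeasure_space_1)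
    moreover have "emeasure (cond_measure \<Phi> x E) (space (cond_measure \<Phi> x E)) = (\<integral>\<^sup>+y. ennreal (wt \<Phi> (y + z)) / Z \<partial>lborel_on E)"
      unfolding nu by (subst emeasure_density) (auto intro!: nn_integral_cong simp: sets.top[of "lborel_on E", simplified])
    ultimately show ?thesis by simp
  qed
  have "Z \<noteq> 0"
  proof
    assume "Z = 0"
    then have "AE y in lborel_on E. ennreal (wt \<Phi> (y + z)) = 0"
      unfolding Z_def by (subst (asm) nn_integral_0_iff_AE) auto
    then have "AE y in lborel_on E. ennreal (wt \<Phi> (y + z)) / Z = 0"
      by eventually_elim simp
    then have "(\<integral>\<^sup>+y. ennreal (wt \<Phi> (y + z)) / Z \<partial>lborel_on E) = 0" by (subst nn_integral_0_iff_AE) auto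
    then show False using one by simp
  qed
  moreover have "Z \<noteq> \<top>" using one by auto
  ultimately obtain \<zeta> where \<zeta>: "\<zeta> > 0" "Z = ennreal \<zeta>" by (cases Z) (auto simp: less_le)
  have "ennreal (wt \<Phi> (y + z)) / Z = ennreal (wt \<Phi> (y + z) / \<zeta>)" for y
    unfolding \<zeta>(2) using \<zeta>(1) wt_pos[of \<Phi> "y + z"] by (intro divide_ennreal) auto
  then show ?thesis using that[OF \<zeta>(1)] nu by simp
qed

text \<open>The Poincare inequality of the conditional measure for the derivative of u in the direction a, which has mean zero by
\<open>fiber_mean_zero\<close>. The normalising factor appears on both sides and cancels.\<close>
lemma fiber_poincare:
  fixes E :: "'a::euclidean_space set"
  assumes T: "orthogonal_transformation T" and E: "E = (fixed_space T)\<^sup>\<bottom>"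
    and P: "continuous_on UNIV \<Phi>" "\<And>x. \<Phi> (T x) = \<Phi> x" and u: "Ck 2 u" "csupp u" "\<And>x. u (T x) = u x"
    and C: "0 \<le> C" and pr: "prob_space (cond_measure \<Phi> x E)"
    and poin: "\<forall>g \<in> L2 (cond_measure \<Phi> x E). locally_lipschitz_on E g \<longrightarrow>
          ennreal (Var (cond_measure \<Phi> x E) g) \<le> ennreal C * (\<integral>\<^sup>+y. ennreal ((norm (gradient_on E g y))\<^sup>2) \<partial>cond_measure \<Phi> x E)"
    and a: "a \<in> E"
  defines "z \<equiv> orth_proj (E\<^sup>\<bottom>) x"
  shows "(\<integral>\<^sup>+y. ennreal ((dd a u (y + z))\<^sup>2 * wt \<Phi> (y + z)) \<partial>lborel_on E)
    \<le> ennreal C * (\<integral>\<^sup>+y. ennreal ((\<Sum>l\<in>Basis. (dd (orth_proj E l) (dd a u) (y + z))\<^sup>2) * wt \<Phi> (y + z)) \<partial>lborel_on E)"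
proof -
  have sE: "subspace E" unfolding E by (rule subspace_orthogonal_comp)
  have zE: "z \<in> E\<^sup>\<bottom>" unfolding z_def by (rule orth_proj_decomp(1)[OF subspace_orthogonal_comp])
  have u2: "Ck (Suc (Suc 0)) u" and u1: "Ck 1 u" using u(1) Ck_le[OF u(1), of 1] by (simp_all add: numeral_2_eq_2)
  define h where "h = dd a u"
  have h1: "Ck 1 h" "csupp h" using u2 csupp_dd[OF u(2)] by (auto simp: h_def)
  have hd: "h differentiable (at y)" for y using h1 by simp
  have cch: "cc h" by (rule cc_Ck[OF h1])
  have hc: "continuous_on UNIV h" using cch by (simp add: cc_def)
  have wc: "continuous_on UNIV (wt \<Phi>)" unfolding wt_def[abs_def] by (intro continuous_intros P)
  define w where "w y = wt \<Phi> (y + z)" for y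
  define g where "g y = h (y + z)" for y
  obtain \<zeta> where \<zeta>: "\<zeta> > 0" "cond_measure \<Phi> x E = density (lborel_on E) (\<lambda>y. ennreal (w y / \<zeta>))"
    using cond_measure_normalized[OF sE P(1) pr] unfolding z_def[symmetric] w_def by metis
  define \<nu> where "\<nu> = density (lborel_on E) (\<lambda>y. ennreal (w y / \<zeta>))"
  have shc: "continuous_on UNIV (\<lambda>y. k (y + z))" if "continuous_on UNIV k" for k :: "'a \<Rightarrow> real"
    by (intro continuous_on_compose2[OF that] continuous_intros) auto
  have [measurable]: "w \<in> borel_measurable borel" "g \<in> borel_measurable borel"
    unfolding w_def[abs_def] g_def[abs_def] by (intro borel_measurable_continuous_onI shc wc hc)+
  have [measurable]: "w \<in> borel_measurable (lborel_on E)" "g \<in> borel_measurable (lborel_on E)"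
    by (intro measurable_lborel_on; measurable)+
  have w0: "w y / \<zeta> \<ge> 0" for y using \<zeta>(1) wt_pos[of \<Phi> "y + z"] by (simp add: w_def)
  have i1: "integrable (lborel_on E) (\<lambda>y. w y / \<zeta> * (g y)\<^sup>2)"
  proof -
    have "cc (\<lambda>x. wt \<Phi> x / \<zeta> * (h x)\<^sup>2)" unfolding power2_eq_square divide_inverse
      by (intro cc_mult2 cc_mult1 cch hc continuous_intros wc)
    from cc_shift[OF this, of z] show ?thesis unfolding w_def g_def by (intro lborel_on_finite sE cc_bcs)
  qed
  have gL: "g \<in> L2 \<nu>" unfolding L2_def \<nu>_def using w0 i1 by (simp add: integrable_density)
  have gl: "locally_lipschitz_on E g"
  proof -
    obtain L where L: "L-lipschitz_on UNIV h" using Ck1_lipschitz[OF h1] .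
    have "L-lipschitz_on (cball y 1 \<inter> E) g" for y
    proof (rule lipschitz_onI)
      fix p q show "dist (g p) (g q) \<le> L * dist p q"
        using lipschitz_onD[OF L, of "p + z" "q + z"] by (simp add: g_def)
    qed (rule lipschitz_on_nonneg[OF L])
    then show ?thesis unfolding locally_lipschitz_on_def by (meson zero_less_one)
  qed
  have mean: "(\<integral>y. g y \<partial>\<nu>) = 0"
  proof -
    have "(\<integral>y. g y \<partial>\<nu>) = (\<integral>y. w y / \<zeta> * g y \<partial>lborel_on E)"
      unfolding \<nu>_def using w0 by (subst integral_density) auto
    also have "\<dots> = (\<integral>y. (1 / \<zeta>) * (dd a u (y + z) * wt \<Phi> (y + z)) \<partial>lborel_on E)"
      unfolding w_def g_def h_def by (simp add: mult.commute)
    also have "\<dots> = 0" using fiber_mean_zero[OF T E P u1 u(2,3) zE a] by simp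
    finally show ?thesis .
  qed
  have V: "ennreal (Var \<nu> g) = ennreal (1 / \<zeta>) * (\<integral>\<^sup>+y. ennreal ((dd a u (y + z))\<^sup>2 * wt \<Phi> (y + z)) \<partial>lborel_on E)"
  proof -
    have "Var \<nu> g = (\<integral>y. w y / \<zeta> * (g y)\<^sup>2 \<partial>lborel_on E)"
      unfolding Var_def mean unfolding \<nu>_def using w0 by (subst integral_density) auto
    also have "ennreal \<dots> = (\<integral>\<^sup>+y. ennreal (w y / \<zeta> * (g y)\<^sup>2) \<partial>lborel_on E)"
      using w0 by (intro nn_integral_eq_integral[symmetric] i1 AE_I2 mult_nonneg_nonneg) auto
    also have "\<dots> = (\<integral>\<^sup>+y. ennreal (1 / \<zeta>) * ennreal ((g y)\<^sup>2 * w y) \<partial>lborel_on E)"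
      using \<zeta>(1) by (intro nn_integral_cong) (simp add: ennreal_mult''[symmetric] ennreal_mult'[symmetric] mult.commute)
    also have "\<dots> = ennreal (1 / \<zeta>) * (\<integral>\<^sup>+y. ennreal ((g y)\<^sup>2 * w y) \<partial>lborel_on E)"
      by (intro nn_integral_cmult) measurable
    finally show ?thesis unfolding g_def h_def w_def .
  qed
  define S where "S y = (\<Sum>l\<in>Basis. (dd (orth_proj E l) (dd a u) (y + z))\<^sup>2)" for y
  have Sm[measurable]: "S \<in> borel_measurable (lborel_on E)"
    unfolding S_def[abs_def] using h1(1) unfolding h_def
    by (intro measurable_lborel_on borel_measurable_continuous_onI continuous_intros shc) auto
  have S0: "S y \<ge> 0" for y unfolding S_def by (intro sum_nonneg) auto
  have G: "(\<integral>\<^sup>+y. ennreal ((norm (gradient_on E g y))\<^sup>2) \<partial>\<nu>) = ennreal (1 / \<zeta>) * (\<integral>\<^sup>+y. ennreal (S y * wt \<Phi> (y + z)) \<partial>lborel_on E)"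
  proof -
    have "(\<integral>\<^sup>+y. ennreal ((norm (gradient_on E g y))\<^sup>2) \<partial>\<nu>) = (\<integral>\<^sup>+y. ennreal (S y) \<partial>\<nu>)"
    proof (rule nn_integral_cong)
      fix y assume "y \<in> space \<nu>"
      then have "y \<in> E" by (simp add: \<nu>_def)
      from gradient_on_restrict[OF sE hd this]
      show "ennreal ((norm (gradient_on E g y))\<^sup>2) = ennreal (S y)"
        unfolding g_def[abs_def] S_def h_def by simp
    qed
    also have "\<dots> = (\<integral>\<^sup>+y. ennreal (w y / \<zeta>) * ennreal (S y) \<partial>lborel_on E)"
      unfolding \<nu>_def by (intro nn_integral_density) measurable
    also have "\<dots> = (\<integral>\<^sup>+y. ennreal (1 / \<zeta>) * ennreal (S y * w y) \<partial>lborel_on E)"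
      using \<zeta>(1) w0 S0 by (intro nn_integral_cong) (simp add: ennreal_mult''[symmetric] ennreal_mult'[symmetric] mult.commute)
    also have "\<dots> = ennreal (1 / \<zeta>) * (\<integral>\<^sup>+y. ennreal (S y * w y) \<partial>lborel_on E)"
      by (intro nn_integral_cmult) measurable
    finally show ?thesis unfolding w_def .
  qed
  have "ennreal (Var \<nu> g) \<le> ennreal C * (\<integral>\<^sup>+y. ennreal ((norm (gradient_on E g y))\<^sup>2) \<partial>\<nu>)"
    using poin gL gl unfolding \<zeta>(2) \<nu>_def by blast
  then have le: "ennreal (1 / \<zeta>) * (\<integral>\<^sup>+y. ennreal ((dd a u (y + z))\<^sup>2 * wt \<Phi> (y + z)) \<partial>lborel_on E)
     \<le> ennreal (1 / \<zeta>) * (ennreal C * (\<integral>\<^sup>+y. ennreal (S y * wt \<Phi> (y + z)) \<partial>lborel_on E))"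
    unfolding V G by (simp add: mult.left_commute)
  have cancel: "ennreal \<zeta> * (ennreal (1 / \<zeta>) * q) = q" for q
    using \<zeta>(1) by (simp add: mult.assoc[symmetric] ennreal_mult''[symmetric])
  from mult_left_mono[OF le, of "ennreal \<zeta>"] show ?thesis unfolding cancel S_def by simp
qed

lemma fib_measurable:
  assumes E: "subspace E" and P: "continuous_on UNIV \<Phi>" and u: "Ck 2 u"
  shows "fib_grad \<Phi> u E \<in> borel_measurable borel" "fib_hess \<Phi> u E \<in> borel_measurable borel"
proof -
  have u2: "Ck (Suc (Suc 0)) u" and u1: "Ck 1 u" using u Ck_le[OF u, of 1] by (simp_all add: numeral_2_eq_2)
  have c: "continuous_on UNIV (dd v u)" "continuous_on UNIV (dd w (dd v u))" for v w
    using u1 u2 by auto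
  have wc: "continuous_on UNIV (wt \<Phi>)" unfolding wt_def[abs_def] by (intro continuous_intros P)
  have "(\<lambda>x. ennreal ((\<Sum>k\<in>Basis. (dd (orth_proj E k) u x)\<^sup>2) * wt \<Phi> x)) \<in> borel_measurable borel"
    by (intro measurable_compose[OF _ measurable_ennreal] borel_measurable_continuous_onI continuous_intros c wc)
  from fiber_measurable[OF E this] show "fib_grad \<Phi> u E \<in> borel_measurable borel" unfolding fib_grad_def[abs_def] .
  have "(\<lambda>x. ennreal ((\<Sum>k\<in>Basis. \<Sum>l\<in>Basis. (dd (orth_proj E l) (dd (orth_proj E k) u) x)\<^sup>2) * wt \<Phi> x)) \<in> borel_measurable borel"
    by (intro measurable_compose[OF _ measurable_ennreal] borel_measurable_continuous_onI continuous_intros c wc)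
  from fiber_measurable[OF E this] show "fib_hess \<Phi> u E \<in> borel_measurable borel" unfolding fib_hess_def[abs_def] .
qed

lemma fib_finite:
  assumes E: "subspace E" and P: "continuous_on UNIV \<Phi>" and u: "Ck 2 u" "csupp u"
  shows "fib_grad \<Phi> u E z < \<infinity>" "fib_hess \<Phi> u E z < \<infinity>"
proof -
  have u2: "Ck (Suc (Suc 0)) u" and u1: "Ck (Suc 0) u" using u Ck_le[OF u(1), of 1] by (simp_all add: numeral_2_eq_2)
  have c: "cc (dd v u)" "cc (dd w (dd v u))" for v w using cc_dd[OF u1 u(2)] cc_dd2[OF u2 u(2)] by auto
  have c': "continuous_on UNIV (dd v u)" "continuous_on UNIV (dd w (dd v u))" for v w using c by (auto simp: cc_def)
  have wc: "continuous_on UNIV (wt \<Phi>)" unfolding wt_def[abs_def] by (intro continuous_intros P)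
  have fin: "(\<integral>\<^sup>+y. ennreal (F (y + z)) \<partial>lborel_on E) < \<infinity>" if F: "cc F" for F
  proof -
    have "(\<integral>\<^sup>+y. ennreal (F (y + z)) \<partial>lborel_on E) \<le> (\<integral>\<^sup>+y. ennreal \<bar>F (y + z)\<bar> \<partial>lborel_on E)"
      by (intro nn_integral_mono ennreal_leI) auto
    also have "\<dots> < \<infinity>" by (intro lborel_on_finite(1)[OF E] cc_bcs cc_shift F)
    finally show ?thesis .
  qed
  show "fib_grad \<Phi> u E z < \<infinity>" unfolding fib_grad_def power2_eq_square
    by (rule fin[of "\<lambda>x. (\<Sum>k\<in>Basis. dd (orth_proj E k) u x * dd (orth_proj E k) u x) * wt \<Phi> x"]) (intro cc_mult1[OF cc_sum wc] cc_mult1 c c')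
  show "fib_hess \<Phi> u E z < \<infinity>" unfolding fib_hess_def power2_eq_square
    by (rule fin[of "\<lambda>x. (\<Sum>k\<in>Basis. \<Sum>l\<in>Basis. dd (orth_proj E l) (dd (orth_proj E k) u) x * dd (orth_proj E l) (dd (orth_proj E k) u) x) * wt \<Phi> x"])
       (intro cc_mult1[OF cc_sum wc] cc_sum cc_mult1 c c')
qed

text \<open>Summing \<open>fiber_poincare\<close> over the projected basis vectors gives \<open>b \<le> C * A\<close> for every admissible constant C, with b and A
the two energies. Full support of the fiber measure makes b positive as soon as the gradient along E does not vanish at x. Without
an admissible constant the Poincare constant is infinite, and its inverse 0 is below every ratio.\<close>
lemma fib_ratio_ge:
  fixes E :: "'a::euclidean_space set"
  assumes T: "orthogonal_transformation T" and E: "E = (fixed_space T)\<^sup>\<bottom>"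
    and P: "continuous_on UNIV \<Phi>" "\<And>x. \<Phi> (T x) = \<Phi> x" and u: "Ck 2 u" "csupp u" "\<And>x. u (T x) = u x"
    and nz: "(\<Sum>k\<in>Basis. (dd (orth_proj E k) u x)\<^sup>2) \<noteq> 0"
  shows "\<exists>\<kappa>\<ge>0. inv_cp \<Phi> x E = ereal \<kappa> \<and> \<kappa> \<le> fib_ratio \<Phi> u E (orth_proj (E\<^sup>\<bottom>) x)"
proof -
  define z where "z = orth_proj (E\<^sup>\<bottom>) x"
  define b A where "b = enn2real (fib_grad \<Phi> u E z)" and "A = enn2real (fib_hess \<Phi> u E z)"
  have sE: "subspace E" unfolding E by (rule subspace_orthogonal_comp)
  have u2: "Ck (Suc (Suc 0)) u" and u1: "Ck 1 u" using u(1) Ck_le[OF u(1), of 1] by (simp_all add: numeral_2_eq_2)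
  have c: "continuous_on UNIV (dd v u)" "continuous_on UNIV (dd w (dd v u))" for v w
    using u1 u2 by auto
  have wc: "continuous_on UNIV (wt \<Phi>)" unfolding wt_def[abs_def] by (intro continuous_intros P)
  have shc: "continuous_on UNIV (\<lambda>y. k (y + z))" if "continuous_on UNIV k" for k :: "'a \<Rightarrow> real"
    by (intro continuous_on_compose2[OF that] continuous_intros) auto
  note fin = fib_finite[OF sE P(1) u(1,2), of z]
  have gb: "fib_grad \<Phi> u E z = ennreal b" and hA: "fib_hess \<Phi> u E z = ennreal A"
    using fin by (simp_all add: b_def A_def less_top)
  have b0: "b \<ge> 0" and A0: "A \<ge> 0" by (simp_all add: b_def A_def)
  have "b \<noteq> 0"
  proof
    assume "b = 0"
    define F where "F y = (\<Sum>k\<in>Basis. (dd (orth_proj E k) u (y + z))\<^sup>2) * wt \<Phi> (y + z)" for y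
    have "F (orth_proj E x) = 0"
    proof (rule lborel_on_full_support[OF sE])
      show "continuous_on UNIV F" unfolding F_def[abs_def] by (intro continuous_intros shc c wc)
      show "F y \<ge> 0" for y unfolding F_def using wt_pos[of \<Phi> "y + z"] by (intro mult_nonneg_nonneg sum_nonneg) auto
      show "(\<integral>\<^sup>+y. ennreal (F y) \<partial>lborel_on E) = 0" using gb \<open>b = 0\<close> unfolding F_def fib_grad_def by simp
      show "orth_proj E x \<in> E" by (rule orth_proj_decomp(1)[OF sE])
    qed
    moreover have "orth_proj E x + z = x" using orth_proj_split[OF sE, of x] unfolding z_def by simp
    ultimately show False using nz wt_pos[of \<Phi> x] by (simp add: F_def)
  qed
  with b0 have bp: "b > 0" by simp
  define adm where "adm = {ereal C | C. 0 \<le> C \<and> prob_space (cond_measure \<Phi> x E) \<and>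
       (\<forall>g \<in> L2 (cond_measure \<Phi> x E). locally_lipschitz_on E g \<longrightarrow>
          ennreal (Var (cond_measure \<Phi> x E) g) \<le>
            ennreal C * (\<integral>\<^sup>+y. ennreal ((norm (gradient_on E g y))\<^sup>2) \<partial>cond_measure \<Phi> x E))}"
  have cp: "poincare_const E (cond_measure \<Phi> x E) = Inf adm" unfolding poincare_const_def adm_def ..
  have ratio: "fib_ratio \<Phi> u E z = A / b" by (simp add: fib_ratio_def A_def b_def)
  have le: "b \<le> C * A" if C: "ereal C \<in> adm" for C
  proof -
    have C0: "0 \<le> C" and pr: "prob_space (cond_measure \<Phi> x E)" and poin: "\<forall>g \<in> L2 (cond_measure \<Phi> x E). locally_lipschitz_on E g \<longrightarrow>
          ennreal (Var (cond_measure \<Phi> x E) g) \<le> ennreal C * (\<integral>\<^sup>+y. ennreal ((norm (gradient_on E g y))\<^sup>2) \<partial>cond_measure \<Phi> x E)"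
      using C unfolding adm_def by auto
    have m1: "(\<lambda>y. ennreal ((dd v u (y + z))\<^sup>2 * wt \<Phi> (y + z))) \<in> borel_measurable (lborel_on E)" for v
      by (intro measurable_compose[OF _ measurable_ennreal] measurable_lborel_on borel_measurable_continuous_onI continuous_intros shc c wc)
    have m2: "(\<lambda>y. ennreal ((\<Sum>l\<in>Basis. (dd (orth_proj E l) (dd v u) (y + z))\<^sup>2) * wt \<Phi> (y + z))) \<in> borel_measurable (lborel_on E)" for v
      by (intro measurable_compose[OF _ measurable_ennreal] measurable_lborel_on borel_measurable_continuous_onI continuous_intros shc c wc)
    have "fib_grad \<Phi> u E z = (\<integral>\<^sup>+y. (\<Sum>k\<in>Basis. ennreal ((dd (orth_proj E k) u (y + z))\<^sup>2 * wt \<Phi> (y + z))) \<partial>lborel_on E)"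
      unfolding fib_grad_def sum_distrib_right using wt_pos[of \<Phi>] by (intro nn_integral_cong) (simp add: sum_ennreal less_imp_le)
    also have "\<dots> = (\<Sum>k\<in>Basis. \<integral>\<^sup>+y. ennreal ((dd (orth_proj E k) u (y + z))\<^sup>2 * wt \<Phi> (y + z)) \<partial>lborel_on E)"
      by (intro nn_integral_sum m1)
    also have "\<dots> \<le> (\<Sum>k\<in>Basis. ennreal C * (\<integral>\<^sup>+y. ennreal ((\<Sum>l\<in>Basis. (dd (orth_proj E l) (dd (orth_proj E k) u) (y + z))\<^sup>2) * wt \<Phi> (y + z)) \<partial>lborel_on E))"
      unfolding z_def by (intro sum_mono fiber_poincare[OF T E P u C0 pr poin] orth_proj_decomp(1)[OF sE])
    also have "\<dots> = ennreal C * (\<integral>\<^sup>+y. (\<Sum>k\<in>Basis. ennreal ((\<Sum>l\<in>Basis. (dd (orth_proj E l) (dd (orth_proj E k) u) (y + z))\<^sup>2) * wt \<Phi> (y + z))) \<partial>lborel_on E)"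
      by (subst nn_integral_sum) (auto simp: sum_distrib_left intro: m2)
    also have "(\<integral>\<^sup>+y. (\<Sum>k\<in>Basis. ennreal ((\<Sum>l\<in>Basis. (dd (orth_proj E l) (dd (orth_proj E k) u) (y + z))\<^sup>2) * wt \<Phi> (y + z))) \<partial>lborel_on E) = fib_hess \<Phi> u E z"
      unfolding fib_hess_def using wt_pos[of \<Phi>] by (intro nn_integral_cong) (simp add: sum_ennreal less_imp_le sum_nonneg flip: sum_distrib_right)
    finally have "ennreal b \<le> ennreal (C * A)" unfolding gb hA using C0 A0 by (simp add: ennreal_mult)
    then show ?thesis using C0 A0 by (subst (asm) ennreal_le_iff) auto
  qed
  show ?thesis
  proof (cases "adm = {}")
    case True
    then have "inv_cp \<Phi> x E = ereal 0" unfolding cp by (simp add: top_ereal_def)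
    then show ?thesis using A0 b0 ratio unfolding z_def by (intro exI[of _ 0]) simp
  next
    case False
    then obtain C0 where C0: "ereal C0 \<in> adm" unfolding adm_def by blast
    have Ap: "A > 0" using le[OF C0] bp A0 by (cases "A = 0") auto
    have "ereal (b / A) \<le> Inf adm"
    proof (rule Inf_greatest)
      fix q assume q: "q \<in> adm"
      then obtain C where C: "q = ereal C" unfolding adm_def by blast
      show "ereal (b / A) \<le> q" using le[of C] q Ap unfolding C by (simp add: divide_le_eq)
    qed
    moreover have "Inf adm \<le> ereal C0" using C0 by (rule Inf_lower)
    ultimately obtain q where q: "Inf adm = ereal q" "b / A \<le> q" by (cases "Inf adm") auto
    have "b / A > 0" using bp Ap by simp
    then have "q > 0" using q(2) by linarith
    have "inverse q \<le> inverse (b / A)" using q(2) \<open>b / A > 0\<close> by (rule le_imp_inverse_le)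
    then have "inverse q \<le> A / b" by simp
    then show ?thesis using q(1) \<open>q > 0\<close> ratio unfolding cp z_def by (intro exI[of _ "inverse q"]) auto
  qed
qed

text \<open>The ratio is constant on each fiber, where it turns the gradient energy into the Hessian energy; Fubini then
integrates this identity over the fibers. It is only an inequality, because the ratio is 0 where the gradient
energy is.\<close>
lemma fib_ratio_integral:
  fixes E :: "'a::euclidean_space set"
  assumes E: "subspace E" and P: "continuous_on UNIV \<Phi>" and u: "Ck 2 u" "csupp u"
  defines "S \<equiv> \<lambda>x. \<Sum>k\<in>Basis. (dd (orth_proj E k) u x)\<^sup>2"
    and "D \<equiv> \<lambda>x. \<Sum>k\<in>Basis. \<Sum>l\<in>Basis. (dd (orth_proj E l) (dd (orth_proj E k) u) x)\<^sup>2"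
  shows "integrable lborel (\<lambda>x. fib_ratio \<Phi> u E (orth_proj (E\<^sup>\<bottom>) x) * S x * wt \<Phi> x)"
    "integrable lborel (\<lambda>x. D x * wt \<Phi> x)"
    "(\<integral>x. fib_ratio \<Phi> u E (orth_proj (E\<^sup>\<bottom>) x) * S x * wt \<Phi> x \<partial>lborel) \<le> (\<integral>x. D x * wt \<Phi> x \<partial>lborel)"
proof -
  have E': "subspace (E\<^sup>\<bottom>)" by (rule subspace_orthogonal_comp)
  have u2: "Ck (Suc (Suc 0)) u" and u1: "Ck (Suc 0) u" using u Ck_le[OF u(1), of 1] by (simp_all add: numeral_2_eq_2)
  have c: "cc (dd v u)" "cc (dd w (dd v u))" for v w using cc_dd[OF u1 u(2)] cc_dd2[OF u2 u(2)] by auto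
  have c': "continuous_on UNIV (dd v u)" "continuous_on UNIV (dd w (dd v u))" for v w using c by (auto simp: cc_def)
  have wc: "continuous_on UNIV (wt \<Phi>)" unfolding wt_def[abs_def] by (intro continuous_intros P)
  have wm[measurable]: "wt \<Phi> \<in> borel_measurable borel" by (rule borel_measurable_continuous_onI[OF wc])
  have w0: "wt \<Phi> x \<ge> 0" for x using wt_pos[of \<Phi> x] by simp
  have Sc: "continuous_on UNIV S" and Dc: "continuous_on UNIV D" unfolding S_def D_def by (intro continuous_intros c')+
  have Sm[measurable]: "S \<in> borel_measurable borel" "D \<in> borel_measurable borel" using Sc Dc borel_measurable_continuous_onI by auto
  have S0: "S x \<ge> 0" and D0: "D x \<ge> 0" for x unfolding S_def D_def by (intro sum_nonneg zero_le_power2)+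
  note [measurable] = orth_proj_measurable[OF E'] fib_measurable[OF E P u(1)]
  have rm[measurable]: "fib_ratio \<Phi> u E \<in> borel_measurable borel" unfolding fib_ratio_def[abs_def] by measurable
  have r0: "fib_ratio \<Phi> u E z \<ge> 0" for z unfolding fib_ratio_def by simp
  let ?f = "\<lambda>x. fib_ratio \<Phi> u E (orth_proj (E\<^sup>\<bottom>) x) * S x * wt \<Phi> x"
  have f0: "?f x \<ge> 0" for x using r0 S0 w0 by simp
  have ccD: "cc (\<lambda>x. D x * wt \<Phi> x)" unfolding D_def power2_eq_square by (intro cc_mult1[OF cc_sum wc] cc_sum cc_mult1 c c')
  show iD: "integrable lborel (\<lambda>x. D x * wt \<Phi> x)" by (rule cc_integrable[OF ccD])
  have key: "(\<integral>\<^sup>+x. ennreal (?f x) \<partial>lborel) \<le> ennreal (\<integral>x. D x * wt \<Phi> x \<partial>lborel)"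
  proof -
    have "(\<integral>\<^sup>+x. ennreal (?f x) \<partial>lborel) = (\<integral>\<^sup>+z. (\<integral>\<^sup>+y. ennreal (?f (y + z)) \<partial>lborel_on E) \<partial>lborel_on (E\<^sup>\<bottom>))"
      by (rule nn_integral_fibers[OF E]) measurable
    also have "\<dots> \<le> (\<integral>\<^sup>+z. (\<integral>\<^sup>+y. ennreal (D (y + z) * wt \<Phi> (y + z)) \<partial>lborel_on E) \<partial>lborel_on (E\<^sup>\<bottom>))"
    proof (rule nn_integral_mono)
      fix z assume "z \<in> space (lborel_on (E\<^sup>\<bottom>))"
      then have z: "z \<in> E\<^sup>\<bottom>" by simp
      define b A where "b = enn2real (fib_grad \<Phi> u E z)" and "A = enn2real (fib_hess \<Phi> u E z)"
      have gb: "fib_grad \<Phi> u E z = ennreal b" and hA: "fib_hess \<Phi> u E z = ennreal A"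
        using fib_finite[OF E P u, of z] by (simp_all add: b_def A_def less_top)
      have fg: "fib_grad \<Phi> u E z = (\<integral>\<^sup>+y. ennreal (S (y + z) * wt \<Phi> (y + z)) \<partial>lborel_on E)"
        unfolding fib_grad_def S_def ..
      have "(\<integral>\<^sup>+y. ennreal (?f (y + z)) \<partial>lborel_on E) = (\<integral>\<^sup>+y. ennreal (fib_ratio \<Phi> u E z) * ennreal (S (y + z) * wt \<Phi> (y + z)) \<partial>lborel_on E)"
      proof (rule nn_integral_cong)
        fix y assume "y \<in> space (lborel_on E)"
        then have "y \<in> E" by simp
        then have "orth_proj (E\<^sup>\<bottom>) (y + z) = z" by (rule orth_proj_sum(2)[OF E _ z])
        then show "ennreal (?f (y + z)) = ennreal (fib_ratio \<Phi> u E z) * ennreal (S (y + z) * wt \<Phi> (y + z))"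
          using r0 S0 w0 by (simp add: ennreal_mult[symmetric] mult.assoc)
      qed
      also have "\<dots> = ennreal (fib_ratio \<Phi> u E z) * fib_grad \<Phi> u E z"
        unfolding fg
        by (intro nn_integral_cmult measurable_lborel_on) measurable
      also have "\<dots> \<le> fib_hess \<Phi> u E z"
      proof (cases "b = 0")
        case True then show ?thesis unfolding gb by simp
      next
        case False
        have "ennreal (fib_ratio \<Phi> u E z) * ennreal b = ennreal (A / b * b)"
          unfolding fib_ratio_def b_def[symmetric] A_def[symmetric] by (intro ennreal_mult[symmetric]) (auto simp: b_def A_def)
        then show ?thesis unfolding gb hA using False by simp
      qed
      also have "\<dots> = (\<integral>\<^sup>+y. ennreal (D (y + z) * wt \<Phi> (y + z)) \<partial>lborel_on E)" unfolding fib_hess_def D_def ..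
      finally show "(\<integral>\<^sup>+y. ennreal (?f (y + z)) \<partial>lborel_on E) \<le> (\<integral>\<^sup>+y. ennreal (D (y + z) * wt \<Phi> (y + z)) \<partial>lborel_on E)" .
    qed
    also have "\<dots> = (\<integral>\<^sup>+x. ennreal (D x * wt \<Phi> x) \<partial>lborel)"
      by (rule nn_integral_fibers(1)[OF E, symmetric]) measurable
    also have "\<dots> = ennreal (\<integral>x. D x * wt \<Phi> x \<partial>lborel)"
      using D0 w0 by (intro nn_integral_eq_integral iD) auto
    finally show ?thesis .
  qed
  show i: "integrable lborel ?f"
  proof (rule integrableI_nonneg)
    show "(\<integral>\<^sup>+x. ennreal (?f x) \<partial>lborel) < \<infinity>" using key by (rule le_less_trans) simp
  qed (use f0 in auto)
  have "ennreal (\<integral>x. ?f x \<partial>lborel) = (\<integral>\<^sup>+x. ennreal (?f x) \<partial>lborel)"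
    using f0 by (intro nn_integral_eq_integral[symmetric] i) auto
  then have "ennreal (\<integral>x. ?f x \<partial>lborel) \<le> ennreal (\<integral>x. D x * wt \<Phi> x \<partial>lborel)" using key by simp
  moreover have "0 \<le> (\<integral>x. D x * wt \<Phi> x \<partial>lborel)" using D0 w0 by (intro Bochner_Integration.integral_nonneg) simp
  ultimately show "(\<integral>x. ?f x \<partial>lborel) \<le> (\<integral>x. D x * wt \<Phi> x \<partial>lborel)" by (subst (asm) ennreal_le_iff)
qed

section \<open>The duality estimate\<close>

text \<open>The set where two continuous functions differ is open, and nonempty open sets have positive measure.\<close>
lemma AE_eq_continuous:
  fixes f g :: "'a::euclidean_space \<Rightarrow> real"
  assumes "continuous_on UNIV f" "continuous_on UNIV g" and ae: "AE x in lborel. f x = g x"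
  shows "f x = g x"
proof (rule ccontr)
  assume "f x \<noteq> g x"
  have o: "open {x. f x \<noteq> g x}"
  proof -
    have "closed {x. f x = g x}" by (intro closed_Collect_eq assms)
    then have "open (- {x. f x = g x})" by (rule open_Compl)
    moreover have "- {x. f x = g x} = {x. f x \<noteq> g x}" by auto
    ultimately show ?thesis by simp
  qed
  obtain e where e: "e > 0" "ball x e \<subseteq> {x. f x \<noteq> g x}"
    using o \<open>f x \<noteq> g x\<close> open_contains_ball by blast
  have "AE y in lborel. y \<notin> ball x e" using ae by eventually_elim (use e in blast)
  then have "emeasure lborel (ball x e) = 0" by (subst (asm) AE_iff_measurable[of "ball x e"]) auto
  then show False using content_ball_pos[OF e(1), of x] by (simp add: measure_def)
qed

text \<open>Lebesgue measure being invariant as well, the two densities agree almost everywhere, and by continuity everywhere.\<close>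
lemma potential_invariant:
  fixes \<Phi> :: "'a::euclidean_space \<Rightarrow> real"
  assumes P: "continuous_on UNIV \<Phi>" and mu: "\<mu> = density lborel (\<lambda>x. ennreal (exp (- \<Phi> x)))"
    and T: "T \<in> isometries_preserving \<mu>"
  shows "\<Phi> (T x) = \<Phi> x"
proof -
  have oT: "orthogonal_transformation T" and d: "distr \<mu> \<mu> T = \<mu>" using T unfolding isometries_preserving_def by auto
  have oi: "orthogonal_transformation (inv T)" using oT orthogonal_transformation_inv by blast
  have Tm[measurable]: "T \<in> borel_measurable borel" "inv T \<in> borel_measurable borel"
    by (rule rotation_measurable[OF oT], rule rotation_measurable[OF oi])
  have iT: "inv T (T x) = x" for x using oT by (simp add: inv_f_f orthogonal_transformation_inj)
  have Pm[measurable]: "\<Phi> \<in> borel_measurable borel" by (rule borel_measurable_continuous_onI[OF P])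
  define f where "f x = ennreal (exp (- \<Phi> x))" for x
  define F where "F x = f (inv T x)" for x
  have fm[measurable]: "f \<in> borel_measurable borel" unfolding f_def[abs_def] by measurable
  have Fm[measurable]: "F \<in> borel_measurable borel" unfolding F_def[abs_def] by measurable
  have muf: "\<mu> = density lborel f" unfolding mu f_def[abs_def] ..
  have "density lborel F = density (distr lborel borel T) F" unfolding distr_lborel_orthogonal[OF oT] ..
  also have "\<dots> = distr (density lborel (\<lambda>x. F (T x))) borel T" by (rule density_distr) auto
  also have "(\<lambda>x. F (T x)) = f" unfolding F_def iT ..
  also have "distr (density lborel f) borel T = distr \<mu> \<mu> T" unfolding muf by (rule distr_cong) auto
  finally have "density lborel F = density lborel f" using d muf by simp
  then have "AE x in lborel. F x = f x" by (rule sigma_finite_measure.density_unique[OF sigma_finite_lborel, rotated 2]) auto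
  then have "AE x in lborel. \<Phi> (inv T x) = \<Phi> x" unfolding F_def f_def by eventually_elim simp
  then have "\<Phi> (inv T y) = \<Phi> y" for y
  proof (rule AE_eq_continuous[rotated 2])
    have "continuous_on UNIV (inv T)" using oi
      by (metis linear_continuous_on linear_conv_bounded_linear orthogonal_transformation_linear)
    then show "continuous_on UNIV (\<lambda>x. \<Phi> (inv T x))" by (rule continuous_on_compose2[OF P]) simp
  qed (rule P)
  from this[of "T x"] show ?thesis unfolding iT by simp
qed

text \<open>The Hilbert-Schmidt norm of a linear functional composed with the projection, in terms of the representing vector.\<close>
lemma norm_functional:
  fixes \<phi> :: "'a::euclidean_space \<Rightarrow> real"
  assumes E: "subspace E" and lin: "\<And>v. \<phi> v = \<gamma> \<bullet> v"
  shows "(\<Sum>b\<in>Basis. (\<phi> (orth_proj E b))\<^sup>2) = (norm (orth_proj E \<gamma>))\<^sup>2"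
proof -
  have "(norm (orth_proj E \<gamma>))\<^sup>2 = (\<Sum>b\<in>Basis. (orth_proj E \<gamma> \<bullet> b) * (orth_proj E \<gamma> \<bullet> b))"
    unfolding power2_norm_eq_inner by (rule euclidean_inner)
  then show ?thesis by (simp add: lin power2_eq_square orth_proj_inner(2)[OF E])
qed

lemma decomp_norm:
  fixes v :: "'a::euclidean_space"
  assumes sE: "\<And>i. i \<in> I \<Longrightarrow> subspace (E i)" and d: "\<And>v. (\<Sum>i\<in>I. c i *\<^sub>R orth_proj (E i) v) = v"
  shows "v \<bullet> w = (\<Sum>i\<in>I. c i * (orth_proj (E i) v \<bullet> orth_proj (E i) w))"
    "(norm v)\<^sup>2 = (\<Sum>i\<in>I. c i * (norm (orth_proj (E i) v))\<^sup>2)"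
proof -
  show *: "v \<bullet> w = (\<Sum>i\<in>I. c i * (orth_proj (E i) v \<bullet> orth_proj (E i) w))" for v w
  proof -
    have "v \<bullet> w = (\<Sum>i\<in>I. c i *\<^sub>R orth_proj (E i) v) \<bullet> w" unfolding d ..
    also have "\<dots> = (\<Sum>i\<in>I. c i * (orth_proj (E i) v \<bullet> w))" by (simp add: inner_sum_left)
    also have "\<dots> = (\<Sum>i\<in>I. c i * (orth_proj (E i) v \<bullet> orth_proj (E i) w))"
      by (intro sum.cong refl arg_cong[where f="(*) _"] orth_proj_inner(1)) (rule sE)
    finally show ?thesis .
  qed
  show "(norm v)\<^sup>2 = (\<Sum>i\<in>I. c i * (norm (orth_proj (E i) v))\<^sup>2)"
    unfolding power2_norm_eq_inner by (rule *)
qed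

text \<open>The Hessian norm on E_i is that of P_i D^2u P_i. Dropping the left projection increases it, and the sum over i of the
weighted norms of D^2u P_i recovers the full norm by the resolution of the identity.\<close>
lemma hessian_split:
  fixes u :: "'a::euclidean_space \<Rightarrow> real"
  assumes u: "Ck 2 u" and c: "\<And>i. i \<in> I \<Longrightarrow> c i > 0"
    and sE: "\<And>i. i \<in> I \<Longrightarrow> subspace (E i)" and d: "\<And>v. (\<Sum>i\<in>I. c i *\<^sub>R orth_proj (E i) v) = v"
  shows "(\<Sum>i\<in>I. c i * (\<Sum>k\<in>Basis. \<Sum>l\<in>Basis. (dd (orth_proj (E i) l) (dd (orth_proj (E i) k) u) x)\<^sup>2))
    \<le> (\<Sum>k\<in>Basis. \<Sum>b\<in>Basis. (dd b (dd k u) x)\<^sup>2)"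
proof -
  define \<beta> where "\<beta> v w = dd v (dd w u) x" for v w
  have B: "\<beta> v w = (\<Sum>c\<in>Basis. \<Sum>d\<in>Basis. (v \<bullet> c) * (w \<bullet> d) * \<beta> c d)" for v w
    unfolding \<beta>_def by (rule dd_dd_basis[OF u])
  have 1: "\<beta> v w = (\<Sum>b\<in>Basis. \<beta> b w *\<^sub>R b) \<bullet> v" for v w
  proof -
    have "dd w u differentiable (at x)" using u by (simp add: numeral_2_eq_2)
    from dd_basis[OF this, of v] show ?thesis
      unfolding \<beta>_def by (simp add: inner_sum_left inner_commute[of v] mult.commute)
  qed
  have 2: "\<beta> v w = (\<Sum>b\<in>Basis. \<beta> v b *\<^sub>R b) \<bullet> w" for v w
  proof -
    have "\<beta> v w = \<beta> w v" unfolding \<beta>_def by (rule dd_commute[OF u])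
    also have "\<dots> = (\<Sum>b\<in>Basis. \<beta> b v *\<^sub>R b) \<bullet> w" by (rule 1)
    also have "(\<Sum>b\<in>Basis. \<beta> b v *\<^sub>R b) = (\<Sum>b\<in>Basis. \<beta> v b *\<^sub>R b)"
      by (intro sum.cong refl arg_cong2[where f="(*\<^sub>R)"]) (simp add: \<beta>_def dd_commute[OF u])
    finally show ?thesis .
  qed
  have full: "(\<Sum>b\<in>Basis. (\<gamma> \<bullet> b)\<^sup>2) = (norm \<gamma>)\<^sup>2" for \<gamma> :: 'a
    unfolding power2_norm_eq_inner by (subst euclidean_inner[of \<gamma> \<gamma>]) (simp add: power2_eq_square)
  define \<eta> where "\<eta> l = (\<Sum>b\<in>Basis. \<beta> l b *\<^sub>R b)" for l
  have "(\<Sum>i\<in>I. c i * (\<Sum>k\<in>Basis. \<Sum>l\<in>Basis. (\<beta> (orth_proj (E i) l) (orth_proj (E i) k))\<^sup>2))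
    \<le> (\<Sum>i\<in>I. c i * (\<Sum>k\<in>Basis. \<Sum>l\<in>Basis. (\<beta> l (orth_proj (E i) k))\<^sup>2))"
  proof (rule sum_mono)
    fix i assume i: "i \<in> I"
    have "(\<Sum>l\<in>Basis. (\<beta> (orth_proj (E i) l) (orth_proj (E i) k))\<^sup>2) \<le> (\<Sum>l\<in>Basis. (\<beta> l (orth_proj (E i) k))\<^sup>2)" for k
    proof -
      let ?w = "orth_proj (E i) k"
      let ?\<gamma> = "\<Sum>b\<in>Basis. \<beta> b ?w *\<^sub>R b"
      have "(\<Sum>l\<in>Basis. (\<beta> (orth_proj (E i) l) ?w)\<^sup>2) = (norm (orth_proj (E i) ?\<gamma>))\<^sup>2"
        by (rule norm_functional[OF sE[OF i], of "\<lambda>v. \<beta> v ?w"]) (rule 1)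
      also have "\<dots> \<le> (norm ?\<gamma>)\<^sup>2" by (rule orth_proj_norm_le[OF sE[OF i]])
      also have "\<dots> = (\<Sum>l\<in>Basis. (\<beta> l ?w)\<^sup>2)" unfolding full[symmetric] 1[symmetric] ..
      finally show ?thesis .
    qed
    then show "c i * (\<Sum>k\<in>Basis. \<Sum>l\<in>Basis. (\<beta> (orth_proj (E i) l) (orth_proj (E i) k))\<^sup>2)
      \<le> c i * (\<Sum>k\<in>Basis. \<Sum>l\<in>Basis. (\<beta> l (orth_proj (E i) k))\<^sup>2)"
      using c[OF i] by (meson less_imp_le mult_left_mono sum_mono)
  qed
  also have "\<dots> = (\<Sum>i\<in>I. \<Sum>l\<in>Basis. c i * (norm (orth_proj (E i) (\<eta> l)))\<^sup>2)"
  proof (rule sum.cong[OF refl])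
    fix i assume i: "i \<in> I"
    have "(\<Sum>k\<in>Basis. \<Sum>l\<in>Basis. (\<beta> l (orth_proj (E i) k))\<^sup>2) = (\<Sum>l\<in>Basis. \<Sum>k\<in>Basis. (\<beta> l (orth_proj (E i) k))\<^sup>2)"
      by (rule sum.swap)
    also have "\<dots> = (\<Sum>l\<in>Basis. (norm (orth_proj (E i) (\<eta> l)))\<^sup>2)"
      unfolding \<eta>_def by (intro sum.cong refl norm_functional[OF sE[OF i]] 2)
    finally show "c i * (\<Sum>k\<in>Basis. \<Sum>l\<in>Basis. (\<beta> l (orth_proj (E i) k))\<^sup>2) = (\<Sum>l\<in>Basis. c i * (norm (orth_proj (E i) (\<eta> l)))\<^sup>2)"
      by (simp add: sum_distrib_left)
  qed
  also have "\<dots> = (\<Sum>l\<in>Basis. \<Sum>i\<in>I. c i * (norm (orth_proj (E i) (\<eta> l)))\<^sup>2)" by (rule sum.swap)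
  also have "\<dots> = (\<Sum>l\<in>Basis. (norm (\<eta> l))\<^sup>2)" by (intro sum.cong refl decomp_norm(2)[OF sE d, symmetric])
  also have "\<dots> = (\<Sum>l\<in>Basis. \<Sum>b\<in>Basis. (\<beta> l b)\<^sup>2)" unfolding full[symmetric] \<eta>_def 2[symmetric] ..
  also have "\<dots> = (\<Sum>k\<in>Basis. \<Sum>b\<in>Basis. (\<beta> b k)\<^sup>2)" by (rule sum.swap)
  finally show ?thesis unfolding \<beta>_def .
qed

text \<open>The duality argument. The hypothesis on N is the pointwise inequality that is left once the integrals are dealt with: v plays the
role of the gradient of the test function at x, and \<open>lam i\<close> that of an upper bound for the inverse Poincare constant
of the fiber, which matters only for components of v that do not vanish.\<close>
theorem variance_le_of_pointwise:
  fixes \<mu> :: "'a::euclidean_space measure" and \<Phi> :: "'a \<Rightarrow> real"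
  assumes prob: "prob_space \<mu>"
    and dens: "\<mu> = density lborel (\<lambda>x. ennreal (exp (- \<Phi> x)))"
    and C2: "class_C2 \<Phi>"
    and R: "\<forall>i\<in>{1..m}. R i \<in> isometries_preserving \<mu>"
    and c: "\<forall>i\<in>{1..m::nat}. c i > 0"
    and E: "\<forall>i\<in>{1..m}. E i = (fixed_space (R i))\<^sup>\<bottom>"
    and decomp: "\<forall>v. (\<Sum>i=1..m. c i *\<^sub>R orth_proj (E i) v) = v"
    and f: "locally_lipschitz_on UNIV f" "f \<in> L2 \<mu>" "\<forall>i\<in>{1..m}. f \<circ> R i = f"
    and N: "\<And>x v lam. (\<And>i. i \<in> {1..m} \<Longrightarrow> orth_proj (E i) v \<noteq> 0 \<Longrightarrow> \<exists>\<kappa>\<ge>0. inv_cp \<Phi> x (E i) = ereal \<kappa> \<and> \<kappa> \<le> lam i)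
      \<Longrightarrow> ennreal (- 2 * (gradient f x \<bullet> v) - hessian \<Phi> x v \<bullet> v - (\<Sum>i=1..m. c i * lam i * (norm (orth_proj (E i) v))\<^sup>2)) \<le> N x"
  shows "ennreal (Var \<mu> f) \<le> (\<integral>\<^sup>+x. N x \<partial>\<mu>)"
proof -
  have P: "Ck 2 \<Phi>" by (rule class_C2_Ck[OF C2])
  have P1: "Ck 1 \<Phi>" and P2: "Ck (Suc (Suc 0)) \<Phi>" using P Ck_le[OF P, of 1] by (simp_all add: numeral_2_eq_2)
  have Pc: "continuous_on UNIV \<Phi>" by (rule Ck_cont[OF P])
  have wc: "continuous_on UNIV (wt \<Phi>)" by (intro Ck_cont[OF Ck_wt[OF P]])
  have wm[measurable]: "wt \<Phi> \<in> borel_measurable borel" by (rule borel_measurable_continuous_onI[OF wc])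
  have w0: "wt \<Phi> x \<ge> 0" for x using wt_pos[of \<Phi> x] by simp
  have mu: "\<mu> = density lborel (\<lambda>x. ennreal (wt \<Phi> x))" unfolding dens wt_def ..
  have sm: "sets \<mu> = sets borel" by (simp add: mu)
  have Mm: "h \<in> borel_measurable \<mu> \<longleftrightarrow> h \<in> borel_measurable borel" for h :: "'a \<Rightarrow> real" by (simp add: mu)
  have Mi: "integrable \<mu> h \<longleftrightarrow> integrable lborel (\<lambda>x. h x * wt \<Phi> x)" if "h \<in> borel_measurable borel" for h :: "'a \<Rightarrow> real"
    unfolding mu using that w0 by (subst integrable_density) (auto simp: mult.commute)
  have MI: "(\<integral>x. h x \<partial>\<mu>) = (\<integral>x. h x * wt \<Phi> x \<partial>lborel)" if "h \<in> borel_measurable borel" for h :: "'a \<Rightarrow> real"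
    unfolding mu using that w0 by (subst integral_density) (auto simp: mult.commute)
  interpret \<mu>: prob_space \<mu> by (rule prob)
  have wi: "integrable lborel (wt \<Phi>)" and w1: "(\<integral>x. wt \<Phi> x \<partial>lborel) = 1"
    using Mi[of "\<lambda>x. 1"] MI[of "\<lambda>x. 1"] \<mu>.prob_space by simp_all
  have fb: "blip f" by (rule locally_lipschitz_blip[OF f(1)])
  have fc: "continuous_on UNIV f" by (rule blip_cont[OF fb])
  have fm[measurable]: "f \<in> borel_measurable borel" by (rule borel_measurable_continuous_onI[OF fc])
  have f2: "integrable \<mu> (\<lambda>x. (f x)\<^sup>2)" using f(2) by (simp add: L2_def)
  have fmu: "f \<in> borel_measurable \<mu>" by (simp add: Mm)
  have f1: "integrable \<mu> f" by (rule \<mu>.square_integrable_imp_integrable[OF fmu f2])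
  define a where "a = (\<integral>x. f x \<partial>\<mu>)"
  define f0 where "f0 x = f x - a" for x
  have f0m[measurable]: "f0 \<in> borel_measurable borel" unfolding f0_def[abs_def] by measurable
  have f0i: "integrable \<mu> (\<lambda>x. (f0 x)\<^sup>2)"
  proof -
    have "integrable \<mu> (\<lambda>x. (f x)\<^sup>2 - 2 * a * f x + a\<^sup>2)" using f1 f2 by simp
    moreover have "(f0 x)\<^sup>2 = (f x)\<^sup>2 - 2 * a * f x + a\<^sup>2" for x
      unfolding f0_def by (simp add: power2_eq_square algebra_simps)
    ultimately show ?thesis by simp
  qed
  have f0w: "integrable lborel (\<lambda>x. (f0 x)\<^sup>2 * wt \<Phi> x)" using Mi[of "\<lambda>x. (f0 x)\<^sup>2"] f0i by simp
  have f0mean: "(\<integral>x. f0 x * wt \<Phi> x \<partial>lborel) = 0"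
  proof -
    have "(\<integral>x. f0 x \<partial>\<mu>) = 0" unfolding f0_def using f1 by (simp add: a_def \<mu>.prob_space)
    then show ?thesis using MI[of f0] by simp
  qed
  have Var: "Var \<mu> f = (\<integral>x. (f0 x)\<^sup>2 * wt \<Phi> x \<partial>lborel)"
    unfolding Var_def a_def[symmetric] f0_def[symmetric] by (rule MI) measurable
  define \<R> where "\<R> = R ` {1..m}"
  have oR: "orthogonal_transformation (R i)" if "i \<in> {1..m}" for i using R that unfolding isometries_preserving_def by auto
  have PR: "\<Phi> (R i x) = \<Phi> x" if "i \<in> {1..m}" for i x using potential_invariant[OF Pc dens] R that by blast
  have rots: "rotations \<R>" unfolding rotations_def \<R>_def using oR by blast
  have Pr: "rot_inv \<R> \<Phi>" unfolding rot_inv_def \<R>_def using PR by blast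
  have f0r: "rot_inv \<R> f0" unfolding rot_inv_def \<R>_def f0_def using f(3) by (auto simp: fun_eq_iff)
  have sE: "subspace (E i)" if "i \<in> {1..m}" for i using E that subspace_orthogonal_comp by metis
  have bound: "ennreal (Var \<mu> f) \<le> (\<integral>\<^sup>+x. N x \<partial>\<mu>) + ennreal \<delta>" if \<delta>: "\<delta> > 0" for \<delta>
  proof -
    obtain u where u3: "Ck 3 u" and us: "csupp u" and ur: "rot_inv \<R> u"
      and ud: "(\<integral>x. (f0 x - gen \<Phi> u x)\<^sup>2 * wt \<Phi> x \<partial>lborel) < \<delta>"
      using gen_dense[OF P rots Pr wi f0m f0w f0r f0mean \<delta>] by blast
    have u2: "Ck 2 u" "Ck (Suc (Suc 0)) u" and u1: "Ck (Suc 0) u" using Ck_le[OF u3, of 2] Ck_le[OF u3, of 1] by (simp_all add: numeral_2_eq_2)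
    have du: "u differentiable (at x)" for x using u1 by simp
    have uR: "u (R i x) = u x" if "i \<in> {1..m}" for i x using ur that unfolding rot_inv_def \<R>_def by blast
    define L where "L = gen \<Phi> u"
    have ccu: "cc (dd v u)" "cc (dd w (dd v u))" for v w using cc_dd[OF u1 us] cc_dd2[OF u2(2) us] by auto
    have cu: "continuous_on UNIV (dd v u)" "continuous_on UNIV (dd w (dd v u))" for v w using ccu by (auto simp: cc_def)
    have ccL: "cc L" unfolding L_def cc_def using Ck_gen[of 0 \<Phi> u] P1 u2 csupp_gen[OF us] by simp
    have Lc: "continuous_on UNIV L" using ccL by (simp add: cc_def)
    have Lm[measurable]: "L \<in> borel_measurable borel" by (rule borel_measurable_continuous_onI[OF Lc])
    define S where "S i x = (\<Sum>k\<in>Basis. (dd (orth_proj (E i) k) u x)\<^sup>2)" for i x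
    define lam where "lam i x = fib_ratio \<Phi> u (E i) (orth_proj ((E i)\<^sup>\<bottom>) x)" for i x
    define D where "D i x = (\<Sum>k\<in>Basis. \<Sum>l\<in>Basis. (dd (orth_proj (E i) l) (dd (orth_proj (E i) k) u) x)\<^sup>2)" for i x
    define Hs where "Hs x = (\<Sum>k\<in>Basis. \<Sum>b\<in>Basis. dd k (dd b \<Phi>) x * dd b u x * dd k u x)" for x
    define G where "G x = (\<Sum>b\<in>Basis. pd b f x * dd b u x)" for x
    have ratio: "integrable lborel (\<lambda>x. lam i x * S i x * wt \<Phi> x)" "integrable lborel (\<lambda>x. D i x * wt \<Phi> x)"
      "(\<integral>x. lam i x * S i x * wt \<Phi> x \<partial>lborel) \<le> (\<integral>x. D i x * wt \<Phi> x \<partial>lborel)" if "i \<in> {1..m}" for i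
      unfolding lam_def S_def D_def by (rule fib_ratio_integral[OF sE[OF that] Pc u2(1) us])+
    have Pdc: "continuous_on UNIV (dd k (dd b \<Phi>))" for k b using P2 by simp
    have ccH: "cc Hs" unfolding Hs_def[abs_def]
    proof (intro cc_sum)
      fix k b :: 'a
      have "continuous_on UNIV (\<lambda>x. dd k (dd b \<Phi>) x * dd b u x)" by (intro continuous_intros Pdc cu)
      then show "cc (\<lambda>x. dd k (dd b \<Phi>) x * dd b u x * dd k u x)" using ccu(1) by (rule cc_mult2)
    qed
    have iH: "integrable lborel (\<lambda>x. Hs x * wt \<Phi> x)" by (intro cc_integrable cc_mult1 ccH wc)
    have iG: "integrable lborel (\<lambda>x. G x * wt \<Phi> x)"
      and gG: "(\<integral>x. f x * L x * wt \<Phi> x \<partial>lborel) = - (\<integral>x. G x * wt \<Phi> x \<partial>lborel)"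
      unfolding G_def L_def by (rule gen_by_parts_blip[OF P1 fb u2(1) us])+
    define h where "h x = - 2 * G x * wt \<Phi> x - Hs x * wt \<Phi> x - (\<Sum>i=1..m. c i * (lam i x * S i x * wt \<Phi> x))" for x
    have isum: "integrable lborel (\<lambda>x. \<Sum>i=1..m. c i * (lam i x * S i x * wt \<Phi> x))"
      by (intro Bochner_Integration.integrable_sum integrable_mult_right ratio(1)) simp
    have ih: "integrable lborel h" unfolding h_def[abs_def]
      using isum iH iG by (intro Bochner_Integration.integrable_diff) (auto simp: mult.assoc)
    have Ih: "(\<integral>x. h x \<partial>lborel) = - 2 * (\<integral>x. G x * wt \<Phi> x \<partial>lborel) - (\<integral>x. Hs x * wt \<Phi> x \<partial>lborel)
      - (\<Sum>i=1..m. c i * (\<integral>x. lam i x * S i x * wt \<Phi> x \<partial>lborel))"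
    proof -
      have "(\<integral>x. (\<Sum>i=1..m. c i * (lam i x * S i x * wt \<Phi> x)) \<partial>lborel) = (\<Sum>i=1..m. c i * (\<integral>x. lam i x * S i x * wt \<Phi> x \<partial>lborel))"
        using ratio(1) by (subst Bochner_Integration.integral_sum) auto
      then show ?thesis unfolding h_def using isum iH iG by (simp add: mult.assoc)
    qed
    \<comment> \<open>Bochner's formula together with the fiber inequalities bounds the square of the generator from below\<close>
    have low: "(\<integral>x. h x \<partial>lborel) \<ge> 2 * (\<integral>x. f0 x * L x * wt \<Phi> x \<partial>lborel) - (\<integral>x. (L x)\<^sup>2 * wt \<Phi> x \<partial>lborel)"
    proof -
      have "(\<Sum>i=1..m. c i * (\<integral>x. lam i x * S i x * wt \<Phi> x \<partial>lborel)) \<le> (\<Sum>i=1..m. c i * (\<integral>x. D i x * wt \<Phi> x \<partial>lborel))"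
        using c by (intro sum_mono mult_left_mono ratio(3)) (auto simp: less_imp_le)
      also have "\<dots> = (\<integral>x. (\<Sum>i=1..m. c i * (D i x * wt \<Phi> x)) \<partial>lborel)"
        using ratio(2) by (subst Bochner_Integration.integral_sum) auto
      also have "\<dots> \<le> (\<integral>x. (\<Sum>k\<in>Basis. \<Sum>b\<in>Basis. (dd b (dd k u) x)\<^sup>2) * wt \<Phi> x \<partial>lborel)"
      proof (rule integral_mono)
        show "integrable lborel (\<lambda>x. \<Sum>i=1..m. c i * (D i x * wt \<Phi> x))"
          by (intro Bochner_Integration.integrable_sum integrable_mult_right ratio(2)) simp
        show "integrable lborel (\<lambda>x. (\<Sum>k\<in>Basis. \<Sum>b\<in>Basis. (dd b (dd k u) x)\<^sup>2) * wt \<Phi> x)"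
          unfolding power2_eq_square by (intro cc_integrable cc_mult1[OF cc_sum wc] cc_sum cc_mult1 ccu cu)
        fix x
        have "(\<Sum>i=1..m. c i * D i x) \<le> (\<Sum>k\<in>Basis. \<Sum>b\<in>Basis. (dd b (dd k u) x)\<^sup>2)"
          unfolding D_def using c decomp by (intro hessian_split u2 sE) auto
        from mult_right_mono[OF this w0[of x]]
        show "(\<Sum>i=1..m. c i * (D i x * wt \<Phi> x)) \<le> (\<Sum>k\<in>Basis. \<Sum>b\<in>Basis. (dd b (dd k u) x)\<^sup>2) * wt \<Phi> x"
          by (simp add: sum_distrib_right mult.assoc)
      qed
      finally have 1: "(\<Sum>i=1..m. c i * (\<integral>x. lam i x * S i x * wt \<Phi> x \<partial>lborel)) + (\<integral>x. Hs x * wt \<Phi> x \<partial>lborel) \<le> (\<integral>x. (L x)\<^sup>2 * wt \<Phi> x \<partial>lborel)"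
        unfolding L_def bochner[OF P u3 us] Hs_def by simp
      have "(\<integral>x. f0 x * L x * wt \<Phi> x \<partial>lborel) = (\<integral>x. f x * L x * wt \<Phi> x - a * (L x * wt \<Phi> x) \<partial>lborel)"
        unfolding f0_def by (simp add: algebra_simps)
      also have "\<dots> = (\<integral>x. f x * L x * wt \<Phi> x \<partial>lborel) - a * (\<integral>x. L x * wt \<Phi> x \<partial>lborel)"
      proof -
        have "integrable lborel (\<lambda>x. f x * L x * wt \<Phi> x)" "integrable lborel (\<lambda>x. L x * wt \<Phi> x)"
          by (intro cc_integrable cc_mult1 cc_mult2 fc ccL wc)+
        then show ?thesis by simp
      qed
      also have "(\<integral>x. L x * wt \<Phi> x \<partial>lborel) = 0" unfolding L_def by (rule gen_mean_zero[OF P1 u2(1) us])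
      finally have "(\<integral>x. f0 x * L x * wt \<Phi> x \<partial>lborel) = - (\<integral>x. G x * wt \<Phi> x \<partial>lborel)" using gG by simp
      then show ?thesis unfolding Ih using 1 by simp
    qed
    have sq: "(\<integral>x. (f0 x - L x)\<^sup>2 * wt \<Phi> x \<partial>lborel) = (\<integral>x. (f0 x)\<^sup>2 * wt \<Phi> x \<partial>lborel) - 2 * (\<integral>x. f0 x * L x * wt \<Phi> x \<partial>lborel) + (\<integral>x. (L x)\<^sup>2 * wt \<Phi> x \<partial>lborel)"
    proof -
      have f0c: "continuous_on UNIV f0" unfolding f0_def[abs_def] by (intro continuous_intros fc)
      have i1: "integrable lborel (\<lambda>x. f0 x * L x * wt \<Phi> x)" by (intro cc_integrable cc_mult1 cc_mult2 f0c ccL wc)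
      have i2: "integrable lborel (\<lambda>x. (L x)\<^sup>2 * wt \<Phi> x)" unfolding power2_eq_square by (intro cc_integrable cc_mult1 ccL Lc wc)
      have "(f0 x - L x)\<^sup>2 * wt \<Phi> x = (f0 x)\<^sup>2 * wt \<Phi> x - 2 * (f0 x * L x * wt \<Phi> x) + (L x)\<^sup>2 * wt \<Phi> x" for x
        by (simp add: power2_eq_square algebra_simps)
      then show ?thesis using i1 i2 f0w by simp
    qed
    have Vh: "Var \<mu> f \<le> (\<integral>x. h x \<partial>lborel) + \<delta>" using low sq ud unfolding Var L_def by simp
    have "ennreal (\<integral>x. h x \<partial>lborel) \<le> (\<integral>\<^sup>+x. N x \<partial>\<mu>)"
    proof -
      have "(\<integral>x. h x \<partial>lborel) \<le> (\<integral>x. max 0 (h x) \<partial>lborel)" using ih by (intro integral_mono) auto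
      then have "ennreal (\<integral>x. h x \<partial>lborel) \<le> ennreal (\<integral>x. max 0 (h x) \<partial>lborel)" by (rule ennreal_leI)
      also have "\<dots> = (\<integral>\<^sup>+x. ennreal (max 0 (h x)) \<partial>lborel)" using ih by (intro nn_integral_eq_integral[symmetric]) auto
      also have "\<dots> = (\<integral>\<^sup>+x. ennreal (wt \<Phi> x) * ennreal (h x / wt \<Phi> x) \<partial>lborel)"
      proof (rule nn_integral_cong)
        fix x
        have "h x = wt \<Phi> x * (h x / wt \<Phi> x)" using wt_pos[of \<Phi> x] by simp
        then show "ennreal (max 0 (h x)) = ennreal (wt \<Phi> x) * ennreal (h x / wt \<Phi> x)"
          using w0[of x] by (metis ennreal_mult' ennreal_max_0)
      qed
      also have "\<dots> = (\<integral>\<^sup>+x. ennreal (h x / wt \<Phi> x) \<partial>\<mu>)"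
        unfolding mu using ih by (intro nn_integral_density[symmetric]) auto
      also have "\<dots> \<le> (\<integral>\<^sup>+x. N x \<partial>\<mu>)"
      proof (rule nn_integral_mono_AE)
        have "AE x in lborel. ennreal (h x / wt \<Phi> x) \<le> N x"
          using rademacher[OF fb]
        proof eventually_elim
          case (elim x)
          define v where "v = gradient u x"
          have vd: "v \<bullet> w = dd w u x" for w unfolding v_def by (rule gradient_inner[OF du])
          have Sx: "S i x = (norm (orth_proj (E i) v))\<^sup>2" if "i \<in> {1..m}" for i
            unfolding S_def by (rule norm_functional[OF sE[OF that]]) (simp add: vd)
          have Gx: "G x = gradient f x \<bullet> v"
          proof -
            have "gradient f x \<bullet> v = (\<Sum>b\<in>Basis. (gradient f x \<bullet> b) * (v \<bullet> b))" by (rule euclidean_inner)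
            then show ?thesis unfolding G_def vd using elim by (simp add: gradient_inner pd_differentiable)
          qed
          have Hx: "Hs x = hessian \<Phi> x v \<bullet> v"
          proof -
            have "hessian \<Phi> x v \<bullet> v = (\<Sum>k\<in>Basis. \<Sum>b\<in>Basis. (v \<bullet> k) * (v \<bullet> b) * dd k (dd b \<Phi>) x)"
              unfolding hessian_inner[OF C2] by (rule dd_dd_basis[OF P])
            then show ?thesis unfolding Hs_def vd by (simp add: mult_ac)
          qed
          have hx: "h x / wt \<Phi> x = - 2 * (gradient f x \<bullet> v) - hessian \<Phi> x v \<bullet> v - (\<Sum>i=1..m. c i * lam i x * (norm (orth_proj (E i) v))\<^sup>2)"
          proof -
            have "h x = (- 2 * G x - Hs x - (\<Sum>i=1..m. c i * lam i x * S i x)) * wt \<Phi> x"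
              unfolding h_def by (simp add: left_diff_distrib sum_distrib_right mult.assoc)
            then have "h x / wt \<Phi> x = - 2 * G x - Hs x - (\<Sum>i=1..m. c i * lam i x * S i x)" using wt_pos[of \<Phi> x] by simp
            then show ?thesis unfolding Gx Hx using Sx by simp
          qed
          show ?case unfolding hx
          proof (rule N)
            fix i assume i: "i \<in> {1..m}" and nz: "orth_proj (E i) v \<noteq> 0"
            have "(\<Sum>k\<in>Basis. (dd (orth_proj (E i) k) u x)\<^sup>2) \<noteq> 0" using Sx[OF i] nz unfolding S_def by simp
            then show "\<exists>\<kappa>\<ge>0. inv_cp \<Phi> x (E i) = ereal \<kappa> \<and> \<kappa> \<le> lam i x"
              unfolding lam_def using E i by (intro fib_ratio_ge[OF oR[OF i] _ Pc PR[OF i] u2(1) us uR[OF i]]) auto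
          qed
        qed
        then show "AE x in \<mu>. ennreal (h x / wt \<Phi> x) \<le> N x"
          unfolding mu by (subst AE_density) (auto elim: eventually_mono)
      qed
      finally show ?thesis .
    qed
    then have "ennreal (\<integral>x. h x \<partial>lborel) + ennreal \<delta> \<le> (\<integral>\<^sup>+x. N x \<partial>\<mu>) + ennreal \<delta>" by (rule add_right_mono)
    moreover have "ennreal (Var \<mu> f) \<le> ennreal (\<integral>x. h x \<partial>lborel) + ennreal \<delta>"
    proof -
      have "ennreal (Var \<mu> f) \<le> ennreal (max 0 (\<integral>x. h x \<partial>lborel) + \<delta>)" using Vh by (intro ennreal_leI) linarith
      also have "\<dots> = ennreal (\<integral>x. h x \<partial>lborel) + ennreal \<delta>" using \<delta> by (simp add: ennreal_plus ennreal_max_0)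
      finally show ?thesis .
    qed
    ultimately show ?thesis by (rule order.trans[rotated])
  qed
  show ?thesis by (rule ennreal_le_epsilon) (rule bound)
qed

section \<open>The variance inequality\<close>

lemma hessian_symmetric: "class_C2 \<Phi> \<Longrightarrow> hessian \<Phi> x v \<bullet> w = v \<bullet> hessian \<Phi> x w"
  using dd_commute[OF class_C2_Ck, of \<Phi> v w x] hessian_inner[of \<Phi> x v w] hessian_inner[of \<Phi> x w v]
  by (simp add: inner_commute)

text \<open>Expand \<open>0 \<le> H (v + w) \<bullet> (v + w)\<close> with w = H^{-1} a.\<close>
lemma complete_square:
  fixes H :: "'a::euclidean_space \<Rightarrow> 'a"
  assumes lin: "linear H" and sym: "\<And>v w. H v \<bullet> w = v \<bullet> H w" and pd: "pos_def H"
  shows "- 2 * (a \<bullet> v) - H v \<bullet> v \<le> inv H a \<bullet> a"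
proof -
  have "inj H"
  proof (rule injI)
    fix x y assume "H x = H y"
    then have "H (x - y) = 0" using linear_diff[OF lin] by simp
    then have "H (x - y) \<bullet> (x - y) = 0" by simp
    then show "x = y" using pd unfolding pos_def_def by (metis eq_iff_diff_eq_0 less_irrefl)
  qed
  then have "surj H" using linear_injective_imp_surjective[OF lin] by blast
  then have w: "H (inv H a) = a" by (rule surj_f_inv_f)
  define w where "w = inv H a"
  have "0 \<le> H (v + w) \<bullet> (v + w)" using pd unfolding pos_def_def by (cases "v + w = 0") (auto simp: less_imp_le)
  also have "\<dots> = H v \<bullet> v + 2 * (a \<bullet> v) + w \<bullet> a"
    using sym[of v w] w unfolding w_def[symmetric] by (simp add: linear_add[OF lin] inner_add_left inner_add_right inner_commute)
  finally show ?thesis unfolding w_def by simp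
qed

text \<open>The case s = 0 relies on the convention 1 / 0 = \<infinity>: the right-hand side is infinite unless p = 0, when it is 0.\<close>
lemma young_ereal:
  assumes "s \<ge> 0" shows "ereal (- 2 * (p \<bullet> q) - s * (norm q)\<^sup>2) \<le> inverse (ereal s) * ereal ((norm p)\<^sup>2)"
proof (cases "s = 0")
  case True
  then show ?thesis by (cases "p = 0") auto
next
  case False
  then have s: "s > 0" using assms by simp
  have "0 \<le> (norm (p + s *\<^sub>R q))\<^sup>2" by simp
  also have "\<dots> = (norm p)\<^sup>2 + 2 * s * (p \<bullet> q) + s\<^sup>2 * (norm q)\<^sup>2"
    unfolding power2_norm_eq_inner by (simp add: inner_add_left inner_add_right inner_commute power2_eq_square algebra_simps)
  finally have "s * (- 2 * (p \<bullet> q) - s * (norm q)\<^sup>2) \<le> (norm p)\<^sup>2" by (simp add: algebra_simps power2_eq_square)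
  then have "- 2 * (p \<bullet> q) - s * (norm q)\<^sup>2 \<le> (norm p)\<^sup>2 / s" using s by (simp add: le_divide_eq mult.commute)
  then show ?thesis using s by (simp add: divide_inverse mult.commute)
qed

text \<open>Both parts instantiate \<open>variance_le_of_pointwise\<close>. In the first, N is the quadratic form of the inverse of H and the pointwise
inequality is \<open>complete_square\<close>. In the second, D^2\<Phi> is replaced by \<rho> Id, all terms are split by the resolution of
the identity, and \<open>young_ereal\<close> is applied in every E_i. In the last inequality the constant is moved out of the
integral after replacing the gradient by its measurable representative \<open>wgrad\<close>.\<close>
theorem theorem3:
  fixes \<mu> :: "(real ^ 'n) measure" and \<Phi> :: "real ^ 'n \<Rightarrow> real"
    and m :: nat and R :: "nat \<Rightarrow> real ^ 'n \<Rightarrow> real ^ 'n" and c :: "nat \<Rightarrow> real"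
    and E :: "nat \<Rightarrow> (real ^ 'n) set"
  assumes prob: "prob_space \<mu>"
    and dens: "\<mu> = density lborel (\<lambda>x. ennreal (exp (- \<Phi> x)))"
    and C2: "class_C2 \<Phi>"
    and R: "\<forall>i\<in>{1..m}. R i \<in> isometries_preserving \<mu>"
    and c: "\<forall>i\<in>{1..m}. c i > 0"
    and E: "\<forall>i\<in>{1..m}. E i = (fixed_space (R i))\<^sup>\<bottom>"
    and decomp: "\<forall>v. (\<Sum>i=1..m. c i *\<^sub>R orth_proj (E i) v) = v"
  shows
    "((\<forall>x. pos_def (H_op \<Phi> m c E x)) \<longrightarrow>
       (\<forall>f :: real ^ 'n \<Rightarrow> real.
          locally_lipschitz_on UNIV f \<and> f \<in> L2 \<mu> \<and> (\<forall>i\<in>{1..m}. f \<circ> R i = f) \<longrightarrow>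
          ennreal (Var \<mu> f) \<le>
            (\<integral>\<^sup>+x. ennreal (inv (H_op \<Phi> m c E x) (gradient f x) \<bullet> gradient f x) \<partial>\<mu>)))
     \<and>
     (\<forall>\<rho> :: real.
       (\<forall>x v. hessian \<Phi> x v \<bullet> v \<ge> \<rho> * (v \<bullet> v)) \<and>
       (\<forall>x. \<forall>i\<in>{1..m}. inv_cp \<Phi> x (E i) + ereal \<rho> \<ge> 0) \<longrightarrow>
       (\<forall>f :: real ^ 'n \<Rightarrow> real.
          locally_lipschitz_on UNIV f \<and> f \<in> L2 \<mu> \<and> (\<forall>i\<in>{1..m}. f \<circ> R i = f) \<longrightarrow>
          ennreal (Var \<mu> f) \<le>
            (\<integral>\<^sup>+x. e2ennreal (\<Sum>i=1..m. ereal (c i) * inverse (inv_cp \<Phi> x (E i) + ereal \<rho>) *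
                ereal ((norm (orth_proj (E i) (gradient f x)))\<^sup>2)) \<partial>\<mu>)
          \<and>
          (\<integral>\<^sup>+x. e2ennreal (\<Sum>i=1..m. ereal (c i) * inverse (inv_cp \<Phi> x (E i) + ereal \<rho>) *
                ereal ((norm (orth_proj (E i) (gradient f x)))\<^sup>2)) \<partial>\<mu>)
            \<le> e2ennreal (SUP i\<in>{1..m}. SUP x. inverse (inv_cp \<Phi> x (E i) + ereal \<rho>)) *
               (\<integral>\<^sup>+x. ennreal ((norm (gradient f x))\<^sup>2) \<partial>\<mu>)))"
proof -
  have sE: "subspace (E i)" if "i \<in> {1..m}" for i using E that subspace_orthogonal_comp by metis
  have dn: "v \<bullet> w = (\<Sum>i=1..m. c i * (orth_proj (E i) v \<bullet> orth_proj (E i) w))"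
    "(norm v)\<^sup>2 = (\<Sum>i=1..m. c i * (norm (orth_proj (E i) v))\<^sup>2)" for v w
    by (rule decomp_norm[OF sE decomp[rule_format]], assumption)+
  note core = variance_le_of_pointwise[OF prob dens C2 R c E decomp]
  have part1: "ennreal (Var \<mu> f) \<le> (\<integral>\<^sup>+x. ennreal (inv (H_op \<Phi> m c E x) (gradient f x) \<bullet> gradient f x) \<partial>\<mu>)"
    if pd: "\<forall>x. pos_def (H_op \<Phi> m c E x)"
      and f: "locally_lipschitz_on UNIV f" "f \<in> L2 \<mu>" "\<forall>i\<in>{1..m}. f \<circ> R i = f" for f
  proof (rule core[OF f])
    fix x v lam
    assume lam: "\<And>i. i \<in> {1..m} \<Longrightarrow> orth_proj (E i) v \<noteq> 0 \<Longrightarrow> \<exists>\<kappa>\<ge>0. inv_cp \<Phi> x (E i) = ereal \<kappa> \<and> \<kappa> \<le> lam i"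
    define H where "H = H_op \<Phi> m c E x"
    define k where "k i = real_of_ereal (inv_cp \<Phi> x (E i))" for i
    have Hv: "H v = hessian \<Phi> x v + (\<Sum>i=1..m. (c i * k i) *\<^sub>R orth_proj (E i) v)" for v
      unfolding H_def H_op_def k_def ..
    have lin: "linear H"
    proof (rule linearI)
      fix v w r
      have "hessian \<Phi> x (v + w) = hessian \<Phi> x v + hessian \<Phi> x w" by (rule linear_add[OF hessian_linear[OF C2]])
      moreover have "(\<Sum>i=1..m. (c i * k i) *\<^sub>R orth_proj (E i) (v + w))
        = (\<Sum>i=1..m. (c i * k i) *\<^sub>R orth_proj (E i) v) + (\<Sum>i=1..m. (c i * k i) *\<^sub>R orth_proj (E i) w)"
        unfolding sum.distrib[symmetric] scaleR_add_right[symmetric]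
        by (intro sum.cong refl arg_cong[where f="(*\<^sub>R) _"] linear_add orth_proj_linear sE)
      ultimately show "H (v + w) = H v + H w" unfolding Hv by (simp only: add_ac)
      have "hessian \<Phi> x (r *\<^sub>R v) = r *\<^sub>R hessian \<Phi> x v" by (rule linear_cmul[OF hessian_linear[OF C2]])
      moreover have "(\<Sum>i=1..m. (c i * k i) *\<^sub>R orth_proj (E i) (r *\<^sub>R v)) = r *\<^sub>R (\<Sum>i=1..m. (c i * k i) *\<^sub>R orth_proj (E i) v)"
        unfolding scaleR_sum_right scaleR_left_commute[of r]
        by (intro sum.cong refl arg_cong[where f="(*\<^sub>R) _"] linear_cmul orth_proj_linear sE)
      ultimately show "H (r *\<^sub>R v) = r *\<^sub>R H v" unfolding Hv by (simp only: scaleR_add_right)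
    qed
    have sym: "H v \<bullet> w = v \<bullet> H w" for v w
    proof -
      have "(\<Sum>i=1..m. ((c i * k i) *\<^sub>R orth_proj (E i) v) \<bullet> w) = (\<Sum>i=1..m. v \<bullet> ((c i * k i) *\<^sub>R orth_proj (E i) w))"
      proof (rule sum.cong[OF refl])
        fix i assume "i \<in> {1..m}"
        then show "((c i * k i) *\<^sub>R orth_proj (E i) v) \<bullet> w = v \<bullet> ((c i * k i) *\<^sub>R orth_proj (E i) w)"
          by (simp add: orth_proj_inner(2)[OF sE])
      qed
      then show ?thesis
        unfolding Hv inner_add_left inner_add_right inner_sum_left inner_sum_right
        by (simp only: hessian_symmetric[OF C2])
    qed
    have Hvv: "H v \<bullet> v = hessian \<Phi> x v \<bullet> v + (\<Sum>i=1..m. c i * k i * (norm (orth_proj (E i) v))\<^sup>2)"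
    proof -
      have "(\<Sum>i=1..m. ((c i * k i) *\<^sub>R orth_proj (E i) v) \<bullet> v) = (\<Sum>i=1..m. c i * k i * (norm (orth_proj (E i) v))\<^sup>2)"
      proof (rule sum.cong[OF refl])
        fix i assume "i \<in> {1..m}"
        then show "((c i * k i) *\<^sub>R orth_proj (E i) v) \<bullet> v = c i * k i * (norm (orth_proj (E i) v))\<^sup>2"
          using orth_proj_inner(1)[OF sE, of i v v] by (simp add: power2_norm_eq_inner)
      qed
      then show ?thesis unfolding Hv inner_add_left inner_sum_left by simp
    qed
    have "(\<Sum>i=1..m. c i * k i * (norm (orth_proj (E i) v))\<^sup>2) \<le> (\<Sum>i=1..m. c i * lam i * (norm (orth_proj (E i) v))\<^sup>2)"
    proof (rule sum_mono)
      fix i assume i: "i \<in> {1..m}"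
      show "c i * k i * (norm (orth_proj (E i) v))\<^sup>2 \<le> c i * lam i * (norm (orth_proj (E i) v))\<^sup>2"
      proof (cases "orth_proj (E i) v = 0")
        case False
        then have "k i \<le> lam i" using lam[OF i] unfolding k_def by (metis real_of_ereal.simps(1))
        then show ?thesis using c i by (intro mult_right_mono mult_left_mono) (auto simp: less_imp_le)
      qed simp
    qed
    then have "- 2 * (gradient f x \<bullet> v) - hessian \<Phi> x v \<bullet> v - (\<Sum>i=1..m. c i * lam i * (norm (orth_proj (E i) v))\<^sup>2)
      \<le> - 2 * (gradient f x \<bullet> v) - H v \<bullet> v" unfolding Hvv by linarith
    also have "\<dots> \<le> inv H (gradient f x) \<bullet> gradient f x"
      using pd unfolding H_def[symmetric] by (intro complete_square lin sym) (auto simp: H_def)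
    finally show "ennreal (- 2 * (gradient f x \<bullet> v) - hessian \<Phi> x v \<bullet> v - (\<Sum>i=1..m. c i * lam i * (norm (orth_proj (E i) v))\<^sup>2))
      \<le> ennreal (inv (H_op \<Phi> m c E x) (gradient f x) \<bullet> gradient f x)"
      unfolding H_def by (rule ennreal_leI)
  qed
  have part2a: "ennreal (Var \<mu> f) \<le> (\<integral>\<^sup>+x. e2ennreal (\<Sum>i=1..m. ereal (c i) * inverse (inv_cp \<Phi> x (E i) + ereal \<rho>) *
                ereal ((norm (orth_proj (E i) (gradient f x)))\<^sup>2)) \<partial>\<mu>)"
    if hess: "\<forall>x v. hessian \<Phi> x v \<bullet> v \<ge> \<rho> * (v \<bullet> v)" and nn: "\<forall>x. \<forall>i\<in>{1..m}. inv_cp \<Phi> x (E i) + ereal \<rho> \<ge> 0"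
      and f: "locally_lipschitz_on UNIV f" "f \<in> L2 \<mu>" "\<forall>i\<in>{1..m}. f \<circ> R i = f" for \<rho> f
  proof (rule core[OF f])
    fix x v lam
    assume lam: "\<And>i. i \<in> {1..m} \<Longrightarrow> orth_proj (E i) v \<noteq> 0 \<Longrightarrow> \<exists>\<kappa>\<ge>0. inv_cp \<Phi> x (E i) = ereal \<kappa> \<and> \<kappa> \<le> lam i"
    let ?a = "gradient f x"
    let ?P = "\<lambda>i. orth_proj (E i)"
    define t where "t i = c i * (- 2 * (?P i ?a \<bullet> ?P i v) - (lam i + \<rho>) * (norm (?P i v))\<^sup>2)" for i
    have "- 2 * (?a \<bullet> v) - hessian \<Phi> x v \<bullet> v - (\<Sum>i=1..m. c i * lam i * (norm (?P i v))\<^sup>2)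
       \<le> - 2 * (?a \<bullet> v) - \<rho> * (norm v)\<^sup>2 - (\<Sum>i=1..m. c i * lam i * (norm (?P i v))\<^sup>2)"
      using hess[rule_format, of v x] by (simp add: power2_norm_eq_inner)
    also have "\<dots> = (\<Sum>i=1..m. t i)"
      unfolding dn(1)[of ?a v] dn(2)[of v] t_def sum_distrib_left sum_subtractf[symmetric]
      by (intro sum.cong refl) (simp add: algebra_simps)
    finally have le: "- 2 * (?a \<bullet> v) - hessian \<Phi> x v \<bullet> v - (\<Sum>i=1..m. c i * lam i * (norm (?P i v))\<^sup>2) \<le> (\<Sum>i=1..m. t i)" .
    have "ereal (\<Sum>i=1..m. t i) = (\<Sum>i=1..m. ereal (t i))" by simp
    also have "\<dots> \<le> (\<Sum>i=1..m. ereal (c i) * inverse (inv_cp \<Phi> x (E i) + ereal \<rho>) * ereal ((norm (?P i ?a))\<^sup>2))"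
    proof (rule sum_mono)
      fix i assume i: "i \<in> {1..m}"
      have ci: "c i > 0" using c i by blast
      have inn: "inverse (inv_cp \<Phi> x (E i) + ereal \<rho>) \<ge> 0" using nn i by (intro inverse_ereal_ge0I) auto
      show "ereal (t i) \<le> ereal (c i) * inverse (inv_cp \<Phi> x (E i) + ereal \<rho>) * ereal ((norm (?P i ?a))\<^sup>2)"
      proof (cases "?P i v = 0")
        case True
        then have "t i = 0" by (simp add: t_def)
        then show ?thesis using ci inn by (simp add: zero_ereal_def[symmetric])
      next
        case False
        obtain \<kappa> where \<kappa>: "\<kappa> \<ge> 0" "inv_cp \<Phi> x (E i) = ereal \<kappa>" "\<kappa> \<le> lam i" using lam[OF i False] by blast
        define s where "s = \<kappa> + \<rho>"
        have s: "inv_cp \<Phi> x (E i) + ereal \<rho> = ereal s" using \<kappa>(2) by (simp add: s_def)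
        have s0: "s \<ge> 0" using nn i s by (metis ereal_less_eq(5))
        have "t i \<le> c i * (- 2 * (?P i ?a \<bullet> ?P i v) - s * (norm (?P i v))\<^sup>2)"
          unfolding t_def s_def using ci \<kappa>(3) by (intro mult_left_mono diff_left_mono mult_right_mono) auto
        then have "ereal (t i) \<le> ereal (c i) * ereal (- 2 * (?P i ?a \<bullet> ?P i v) - s * (norm (?P i v))\<^sup>2)" by simp
        also have "\<dots> \<le> ereal (c i) * (inverse (ereal s) * ereal ((norm (?P i ?a))\<^sup>2))"
          using ci by (intro ereal_mult_left_mono young_ereal s0) simp
        finally show ?thesis unfolding s by (simp add: mult.assoc)
      qed
    qed
    finally have "e2ennreal (ereal (\<Sum>i=1..m. t i)) \<le> e2ennreal (\<Sum>i=1..m. ereal (c i) * inverse (inv_cp \<Phi> x (E i) + ereal \<rho>) * ereal ((norm (?P i ?a))\<^sup>2))"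
      by (rule e2ennreal_mono)
    then show "ennreal (- 2 * (?a \<bullet> v) - hessian \<Phi> x v \<bullet> v - (\<Sum>i=1..m. c i * lam i * (norm (?P i v))\<^sup>2))
      \<le> e2ennreal (\<Sum>i=1..m. ereal (c i) * inverse (inv_cp \<Phi> x (E i) + ereal \<rho>) * ereal ((norm (?P i ?a))\<^sup>2))"
      using ennreal_leI[OF le] by simp
  qed
  have part2b: "(\<integral>\<^sup>+x. e2ennreal (\<Sum>i=1..m. ereal (c i) * inverse (inv_cp \<Phi> x (E i) + ereal \<rho>) *
                ereal ((norm (orth_proj (E i) (gradient f x)))\<^sup>2)) \<partial>\<mu>)
            \<le> e2ennreal (SUP i\<in>{1..m}. SUP x. inverse (inv_cp \<Phi> x (E i) + ereal \<rho>)) *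
               (\<integral>\<^sup>+x. ennreal ((norm (gradient f x))\<^sup>2) \<partial>\<mu>)"
    if nn: "\<forall>x. \<forall>i\<in>{1..m}. inv_cp \<Phi> x (E i) + ereal \<rho> \<ge> 0"
      and f: "locally_lipschitz_on UNIV f" for \<rho> f
  proof -
    define M where "M = (SUP i\<in>{1..m}. SUP x. inverse (inv_cp \<Phi> x (E i) + ereal \<rho>))"
    have inn: "inverse (inv_cp \<Phi> x (E i) + ereal \<rho>) \<ge> 0" if "i \<in> {1..m}" for i x
      using nn that by (intro inverse_ereal_ge0I) auto
    have leM: "inverse (inv_cp \<Phi> x (E i) + ereal \<rho>) \<le> M" if "i \<in> {1..m}" for i x
      unfolding M_def by (intro SUP_upper2[OF that] SUP_upper2[of x] order.refl UNIV_I)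
    have ptw: "e2ennreal (\<Sum>i=1..m. ereal (c i) * inverse (inv_cp \<Phi> x (E i) + ereal \<rho>) * ereal ((norm (orth_proj (E i) a))\<^sup>2))
      \<le> e2ennreal M * ennreal ((norm a)\<^sup>2)" for x a
    \<comment> \<open>for m = 0 the sum is empty and the supremum of the empty set is minus infinity; both sides are 0\<close>
    proof (cases "m = 0")
      case True then show ?thesis by (simp add: e2ennreal_neg)
    next
      case False
      then have one: "1 \<in> {1..m}" by simp
      have M0: "M \<ge> 0" using order.trans[OF inn[OF one] leM[OF one]] .
      have "(\<Sum>i=1..m. ereal (c i) * inverse (inv_cp \<Phi> x (E i) + ereal \<rho>) * ereal ((norm (orth_proj (E i) a))\<^sup>2))
        \<le> (\<Sum>i=1..m. M * ereal (c i * (norm (orth_proj (E i) a))\<^sup>2))"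
      proof (rule sum_mono)
        fix i assume i: "i \<in> {1..m}"
        have "ereal (c i) * inverse (inv_cp \<Phi> x (E i) + ereal \<rho>) * ereal ((norm (orth_proj (E i) a))\<^sup>2)
          = inverse (inv_cp \<Phi> x (E i) + ereal \<rho>) * ereal (c i * (norm (orth_proj (E i) a))\<^sup>2)"
          unfolding times_ereal.simps(1)[symmetric] by (simp only: mult_ac)
        also have "\<dots> \<le> M * ereal (c i * (norm (orth_proj (E i) a))\<^sup>2)"
          using c i by (intro ereal_mult_right_mono leM) (auto simp: less_imp_le)
        finally show "ereal (c i) * inverse (inv_cp \<Phi> x (E i) + ereal \<rho>) * ereal ((norm (orth_proj (E i) a))\<^sup>2)
          \<le> M * ereal (c i * (norm (orth_proj (E i) a))\<^sup>2)" .
      qed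
      also have "\<dots> = M * (\<Sum>i=1..m. ereal (c i * (norm (orth_proj (E i) a))\<^sup>2))"
        using c by (intro sum_ereal_right_distrib[symmetric]) (auto simp: less_imp_le)
      also have "\<dots> = M * ereal ((norm a)\<^sup>2)" unfolding dn(2)[of a] by simp
      finally have "e2ennreal (\<Sum>i=1..m. ereal (c i) * inverse (inv_cp \<Phi> x (E i) + ereal \<rho>) * ereal ((norm (orth_proj (E i) a))\<^sup>2))
        \<le> e2ennreal (M * ereal ((norm a)\<^sup>2))" by (rule e2ennreal_mono)
      also have "\<dots> = e2ennreal M * ennreal ((norm a)\<^sup>2)"
      proof -
        have "M * ereal ((norm a)\<^sup>2) = enn2ereal (e2ennreal M * ennreal ((norm a)\<^sup>2))"
          using M0 by (simp add: times_ennreal.rep_eq enn2ereal_e2ennreal)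
        then show ?thesis by simp
      qed
      finally show ?thesis .
    qed
    have fb: "blip f" by (rule locally_lipschitz_blip[OF f])
    have ae: "AE x in \<mu>. ennreal ((norm (gradient f x))\<^sup>2) = ennreal ((norm (wgrad f x))\<^sup>2)"
    proof -
      have "AE x in lborel. ennreal ((norm (gradient f x))\<^sup>2) = ennreal ((norm (wgrad f x))\<^sup>2)"
        using gradient_AE_wgrad[OF fb] by eventually_elim simp
      moreover have "(\<lambda>x. ennreal (exp (- \<Phi> x))) \<in> borel_measurable lborel"
        using borel_measurable_continuous_onI[OF Ck_cont[OF class_C2_Ck[OF C2]]] by measurable
      ultimately show ?thesis unfolding dens by (subst AE_density) (auto elim: eventually_mono)
    qed
    have wm: "(\<lambda>x. ennreal ((norm (wgrad f x))\<^sup>2)) \<in> borel_measurable \<mu>"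
      unfolding dens using wgrad_measurable[OF fb] by measurable
    have "(\<integral>\<^sup>+x. e2ennreal (\<Sum>i=1..m. ereal (c i) * inverse (inv_cp \<Phi> x (E i) + ereal \<rho>) *
                ereal ((norm (orth_proj (E i) (gradient f x)))\<^sup>2)) \<partial>\<mu>)
      \<le> (\<integral>\<^sup>+x. e2ennreal M * ennreal ((norm (gradient f x))\<^sup>2) \<partial>\<mu>)"
      by (intro nn_integral_mono ptw)
    also have "\<dots> = (\<integral>\<^sup>+x. e2ennreal M * ennreal ((norm (wgrad f x))\<^sup>2) \<partial>\<mu>)"
      using ae by (intro nn_integral_cong_AE) (auto elim: eventually_mono)
    also have "\<dots> = e2ennreal M * (\<integral>\<^sup>+x. ennreal ((norm (wgrad f x))\<^sup>2) \<partial>\<mu>)" by (rule nn_integral_cmult[OF wm])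
    also have "(\<integral>\<^sup>+x. ennreal ((norm (wgrad f x))\<^sup>2) \<partial>\<mu>) = (\<integral>\<^sup>+x. ennreal ((norm (gradient f x))\<^sup>2) \<partial>\<mu>)"
      using ae by (intro nn_integral_cong_AE) (auto elim: eventually_mono)
    finally show ?thesis unfolding M_def .
  qed
  show ?thesis using part1 part2a part2b by blast
qed

end
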